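(* Fix $\alpha,\beta,\gamma>0$ with $\gamma^2-\alpha\beta>0$, and let the six-vertex weights be $(a_1,a_2,a_3,a_4,a_5,a_6)=(1,\ \gamma^2-\alpha\beta,\ \beta,\ \alpha,\ \gamma,\ \gamma)$ (these lie in the free-fermion regime $\triangle=0$). Then for every $k\ge1$, all distinct vertices $v^1,\dots,v^k\in\mathbb{Z}^2$ and all types $t_1,\dots,t_k\in\{1,\dots,6\}$, the limit $$\mathbb{P}\Big(\bigcap_{i=1}^k\{\tau_{v^i}(\sigma)=t_i\}\Big):=\lim_{n\to\infty}\mathbb{P}_n\Big(\bigcap_{i=1}^k\{\tau_{v^i}(\sigma)=t_i\}\Big)$$ exists (so that these limits are the finite-dimensional distributions of a probability measure $\mathbb{P}$ on six-vertex configurations of $\mathbb{Z}^2$) and $$\mathbb{P}\Big(\bigcap_{i=1}^k\{\tau_{v^i}(\sigma)=t_i\}\Big)=\Big(\prod_{i=1}^k a_{t_i}\Big)\det_{i,j=1}^{2k}\big[L(x^i,y^j)\big],$$ where the mid-edges $x^1,\dots,x^{2k},y^1,\dots,y^{2k}$ are defined for each $1\le i\le k$ by $x^{2i-1}=W_{v^i}$, $x^{2i}=S_{v^i}$ and - $t_i=1$: $y^{2i-1}=W_{v^i}$, $y^{2i}=S_{v^i}$; - $t_i=2$: $y^{2i-1}=N_{v^i}$, $y^{2i}=E_{v^i}$; - $t_i=3$: $y^{2i-1}=W_{v^i}$, $y^{2i}=N_{v^i}$; - $t_i=4$: $y^{2i-1}=E_{v^i}$, $y^{2i}=S_{v^i}$;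 - $t_i=5$: $y^{2i-1}=W_{v^i}$, $y^{2i}=E_{v^i}$; - $t_i=6$: $y^{2i-1}=N_{v^i}$, $y^{2i}=S_{v^i}$.
   Context: Six-vertex model. For $n\ge2$ let $\mathbb{T}_n=(\mathbb{Z}/n\mathbb{Z})^2$ with nearest-neighbour edges (mod $n$). A six-vertex configuration $\sigma$ is an orientation of all edges such that every vertex has exactly two incoming and two outgoing edges. At a vertex $v$ the local type $\tau_v(\sigma)\in\{1,\dots,6\}$ is: type 1: both horizontal edges point right (east) and both vertical edges point up (north); type 2: horizontal edges point left, vertical edges point down; type 3: horizontal edges point right, vertical edges point down; type 4: horizontal edges point left, vertical edges point up; type 5: both horizontal edges point into $v$ and both vertical edges point out of $v$; type 6: both horizontal edges point out of $v$ and both vertical edges point into $v$. Given positive weights $a_1,\dots,a_6$ (classically named $a_1,a_2,b_1,b_2,c_1,c_2$), $\mathbb{P}_n(\sigma)=\prod_{v\in\mathbb{T}_n}a_{\tau_v(\sigma)}/Z_n$, with $Z_n$ the normalising sum over all six-vertex configurations. A configuration on $\mathbb{T}_n$ is identified with its $n$-periodic extension to $\mathbb{Z}^2$, so $\mathbb{P}_n$ is a measure on six-vertex configurations of $\mathbb{Z}^2$. The anisotropy is $\triangle=(a_1a_2+a_3a_4-a_5a_6)/(2\sqrt{a_1a_2a_3a_4})$. Mid-edges. $e^1=(1,0)$, $e^2=(0,1)$. $\mathbb{M}=(\mathbb{Z}\times(\mathbb{Z}+\tfrac12))\sqcup((\mathbb{Z}+\tfrac12)\times\mathbb{Z})$;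 points of $(\mathbb{Z}+\frac12)\times\mathbb{Z}$ (midpoints of horizontal edges) are black, colour $c(x)=B$, and points of $\mathbb{Z}\times(\mathbb{Z}+\frac12)$ are white, $c(x)=W$. For $v\in\mathbb{Z}^2$: $W_v=v-\tfrac12e^1$, $S_v=v-\tfrac12e^2$, $E_v=v+\tfrac12e^1$, $N_v=v+\tfrac12e^2$. Kernel. $\Delta(w_1,w_2)=(1+\alpha w_1)(1+\beta w_2)-\gamma^2w_1w_2$; $g(w_1,w_2,B,B)=1+\beta w_2$, $g(w_1,w_2,W,W)=1+\alpha w_1$, $g(w_1,w_2,B,W)=g(w_1,w_2,W,B)=-\gamma w_1^{1/2}w_2^{1/2}$. For $x=(x_1,x_2),y=(y_1,y_2)\in\mathbb{M}$, $$L(x,y)=\oint_{|w_1|=1}\oint_{|w_2|=1}\frac{dw_1}{2\pi i w_1}\frac{dw_2}{2\pi i w_2}\,\frac{w_1^{y_1-x_1}w_2^{y_2-x_2}\,g(w_1,w_2,c(x),c(y))}{\Delta(w_1,w_2)},$$ where the half-integer powers combine so that the integrand involves only integer powers of $w_1,w_2$. *)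

theory Defs
  imports "HOL-Complex_Analysis.Complex_Analysis" "Jordan_Normal_Form.Determinant"
begin

text \<open>Six-vertex configurations. A configuration on the torus T_n, identified with its
 n-periodic extension to Z^2, is a pair (h,u) of n-periodic functions on Z^2:
 h v = True iff the horizontal edge from v to v+e1 points east (right);
 u v = True iff the vertical edge from v to v+e2 points north (up).\<close>

definition vtype :: "(int \<times> int \<Rightarrow> bool) \<Rightarrow> (int \<times> int \<Rightarrow> bool) \<Rightarrow> int \<times> int \<Rightarrow> nat" where
  "vtype h u v = (case v of (i, j) \<Rightarrow>
     let W = h (i - 1, j); E = h (i, j); S = u (i, j - 1); N = u (i, j) in
     if W \<and> E \<and> S \<and> N then 1
     else if \<not> W \<and> \<not> E \<and> \<not> S \<and> \<not> N then 2
     else if W \<and> E \<and> \<not> S \<and> \<not> N then 3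
     else if \<not> W \<and> \<not> E \<and> S \<and> N then 4
     else if W \<and> \<not> E \<and> \<not> S \<and> N then 5
     else if \<not> W \<and> E \<and> S \<and> \<not> N then 6
     else 0)"

definition tor_configs :: "nat \<Rightarrow> ((int \<times> int \<Rightarrow> bool) \<times> (int \<times> int \<Rightarrow> bool)) set" where
  "tor_configs n = {(h, u).
     (\<forall>i j. h (i, j) = h (i mod int n, j mod int n) \<and> u (i, j) = u (i mod int n, j mod int n))
     \<and> (\<forall>v. vtype h u v \<in> {1..6})}"

definition config_weight :: "nat \<Rightarrow> (nat \<Rightarrow> real) \<Rightarrow> ((int \<times> int \<Rightarrow> bool) \<times> (int \<times> int \<Rightarrow> bool)) \<Rightarrow> real" where
  "config_weight n a \<sigma> = (\<Prod>v\<in>{0..<int n} \<times> {0..<int n}. a (vtype (fst \<sigma>) (snd \<sigma>) v))"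

definition partition_fn :: "nat \<Rightarrow> (nat \<Rightarrow> real) \<Rightarrow> real" where
  "partition_fn n a = (\<Sum>\<sigma>\<in>tor_configs n. config_weight n a \<sigma>)"

definition Pn :: "nat \<Rightarrow> (nat \<Rightarrow> real) \<Rightarrow> ((int \<times> int \<Rightarrow> bool) \<times> (int \<times> int \<Rightarrow> bool)) set \<Rightarrow> real" where
  "Pn n a E = (\<Sum>\<sigma>\<in>tor_configs n \<inter> E. config_weight n a \<sigma>) / partition_fn n a"

definition type_event :: "(int \<times> int) list \<Rightarrow> nat list \<Rightarrow> ((int \<times> int \<Rightarrow> bool) \<times> (int \<times> int \<Rightarrow> bool)) set" where
  "type_event vs ts = {(h, u). \<forall>i < length vs. vtype h u (vs ! i) = ts ! i}"

definition ff_weights :: "real \<Rightarrow> real \<Rightarrow> real \<Rightarrow> nat \<Rightarrow> real" where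
  "ff_weights \<alpha> \<beta> \<gamma> t = [1, \<gamma>^2 - \<alpha> * \<beta>, \<beta>, \<alpha>, \<gamma>, \<gamma>] ! (t - 1)"

text \<open>Mid-edges are represented by DOUBLED coordinates: the mid-edge (x1,x2) in M is stored as
 (2 x1, 2 x2) :: int \<times> int. Black points (midpoints of horizontal edges, (Z+1/2) x Z) have odd
 first doubled coordinate; white points (Z x (Z+1/2)) have even first doubled coordinate.\<close>
definition is_black :: "int \<times> int \<Rightarrow> bool" where
  "is_black x = odd (fst x)"

definition mW :: "int \<times> int \<Rightarrow> int \<times> int" where "mW v = (2 * fst v - 1, 2 * snd v)"
definition mS :: "int \<times> int \<Rightarrow> int \<times> int" where "mS v = (2 * fst v, 2 * snd v - 1)"
definition mE :: "int \<times> int \<Rightarrow> int \<times> int" where "mE v = (2 * fst v + 1, 2 * snd v)"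
definition mN :: "int \<times> int \<Rightarrow> int \<times> int" where "mN v = (2 * fst v, 2 * snd v + 1)"

definition Delta :: "real \<Rightarrow> real \<Rightarrow> real \<Rightarrow> complex \<Rightarrow> complex \<Rightarrow> complex" where
  "Delta \<alpha> \<beta> \<gamma> w1 w2 = (1 + of_real \<alpha> * w1) * (1 + of_real \<beta> * w2) - of_real (\<gamma>^2) * w1 * w2"

text \<open>Integrand w1^(y1-x1) w2^(y2-x2) g(w1,w2,c(x),c(y)) / Delta, with the half-integer powers
 w1^(1/2) w2^(1/2) of the mixed-colour g combined into the integer exponents
 (y1-x1+1/2) and (y2-x2+1/2).\<close>
definition kernel_integrand :: "real \<Rightarrow> real \<Rightarrow> real \<Rightarrow> int \<times> int \<Rightarrow> int \<times> int \<Rightarrow> complex \<Rightarrow> complex \<Rightarrow> complex" where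
  "kernel_integrand \<alpha> \<beta> \<gamma> x y w1 w2 =
     (let mixed = (is_black x \<noteq> is_black y);
          e1 = (fst y - fst x + (if mixed then 1 else 0)) div 2;
          e2 = (snd y - snd x + (if mixed then 1 else 0)) div 2;
          g = (if mixed then - of_real \<gamma>
               else if is_black x then 1 + of_real \<beta> * w2
               else 1 + of_real \<alpha> * w1)
      in w1 powi e1 * w2 powi e2 * g / Delta \<alpha> \<beta> \<gamma> w1 w2)"

definition Lker :: "real \<Rightarrow> real \<Rightarrow> real \<Rightarrow> int \<times> int \<Rightarrow> int \<times> int \<Rightarrow> complex" where
  "Lker \<alpha> \<beta> \<gamma> x y =
     contour_integral (circlepath 0 1) (\<lambda>w1.
       contour_integral (circlepath 0 1) (\<lambda>w2.
         kernel_integrand \<alpha> \<beta> \<gamma> x y w1 w2 / (w1 * w2))) / (2 * of_real pi * \<i>)^2"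

text \<open>Mid-edges x^1..x^{2k}, y^1..y^{2k}, here 0-indexed: x_idx vs (2i) = W_{v^i}, etc.\<close>
definition x_idx :: "(int \<times> int) list \<Rightarrow> nat \<Rightarrow> int \<times> int" where
  "x_idx vs m = (let v = vs ! (m div 2) in if even m then mW v else mS v)"

definition y_idx :: "(int \<times> int) list \<Rightarrow> nat list \<Rightarrow> nat \<Rightarrow> int \<times> int" where
  "y_idx vs ts m = (let v = vs ! (m div 2); t = ts ! (m div 2) in
     if even m then
       (if t = 1 then mW v else if t = 2 then mN v else if t = 3 then mW v
        else if t = 4 then mE v else if t = 5 then mW v else mN v)
     else
       (if t = 1 then mS v else if t = 2 then mE v else if t = 3 then mN v
        else if t = 4 then mS v else if t = 5 then mE v else mS v))"

end

theory Submission
  imports Defs "HOL-Library.Z2"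
begin

text \<open>
  Six-vertex configurations on the torus are families of paths, hence permutations of the
  mid-edges, and the free-fermion relation makes every weight a minor of a translation-invariant
  matrix. Its determinant is therefore the partition function with signs that depend only on the
  two winding numbers, and fixing the types at given vertices replaces rows of the matrix by unit
  rows, which yields a finite minor of the inverse, diagonalised by the Fourier transform.
  Combining the four choices of signs removes them, but some of the four determinants may be
  (nearly) singular. This is avoided by a small extra twist of the phase in the vertical
  direction: the vertical winding number concentrates at the scale \<open>n\<close>, so the twist acts as a
  scalar, while a pigeonhole choice of its size keeps all eigenvalues away from zero.
  This argument needs the two factors of \<open>\<Delta> = A(w\<^sub>1) + B(w\<^sub>1) w\<^sub>2\<close> to be
  equal in modulus at transversal points only. The remaining boundary parameters are frozen: there
  all vertices asymptotically have one and the same type, and both sides are compared through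
  strictly frozen parameters nearby.
\<close>

text \<open>No lower bound on the four signed sums is needed. Divided by \<open>partition_fn\<close>
  they have modulus at most 1, so it suffices to show that the signed sum over the event minus
  \<open>R\<close> times the full signed sum is negligible, with the same \<open>R\<close> for all
  four; the combination removing the signs then yields the probability minus \<open>R\<close>. What
  has to be controlled is the inverse matrix. For a fixed first frequency its sum over the second
  one is a monomial of degree \<open>n - 1\<close> in A and B divided by A^n - (-B)^n u^n, so
  trouble is confined to frequencies at which the two moduli agree up to O(1/n), and transversality
  leaves boundedly many of them. An extra phase of size \<eta> loses a factor 1/\<eta> at each,
  which is harmless after averaging if 1/(n \<eta>) tends to 0; it acts as a scalar if \<eta> times
  the mean deviation of the winding number tends to 0. As that deviation is o(n), both can be met.
  The concentration rests on positivity: tilting the weights acts on the scale exp(n^2), whereas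
  comparing products with maxima costs only 2^n.\<close>

section \<open>Determinants expanded along rows\<close>

definition dt :: "nat \<Rightarrow> (nat \<Rightarrow> nat \<Rightarrow> 'a::comm_ring_1) \<Rightarrow> 'a" where
  "dt N M = det (mat N N (\<lambda>(i, j). M i j))"

lemma dt_leibniz:
  "dt N M = (\<Sum>p | p permutes {0..<N}. of_int (sign p) * (\<Prod>i = 0..<N. M i (p i)))"
proof -
  have "(\<Prod>i = 0..<N. mat N N (\<lambda>(i, j). M i j) $$ (i, p i)) = (\<Prod>i = 0..<N. M i (p i))"
    if "p permutes {0..<N}" for p
    using permutes_in_image[OF that] by (intro prod.cong) auto
  then show ?thesis
    unfolding dt_def by (subst det_def'[of _ N]) (auto intro!: sum.cong)
qed

lemma dt_cong:
  assumes "\<And>i j. i < N \<Longrightarrow> j < N \<Longrightarrow> M i j = M' i j"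
  shows "dt N M = dt N M'"
  unfolding dt_def by (rule arg_cong[where f = det]) (use assms in \<open>auto intro!: eq_matI\<close>)

text \<open>Each Leibniz term contains exactly one factor from row \<open>r\<close>. Rows are
  functions and are replaced by function update, which keeps the later expansions free of matrix
  reindexing.\<close>

lemma dt_row_linear:
  assumes r: "r < N" and K: "finite K"
  shows "dt N (M(r := \<lambda>j. \<Sum>k\<in>K. a k * F k j)) = (\<Sum>k\<in>K. a k * dt N (M(r := F k)))"
proof -
  have split: "(\<Prod>i = 0..<N. (M(r := f)) i (p i)) = f (p r) * (\<Prod>i\<in>{0..<N} - {r}. M i (p i))"
    for f p
  proof -
    have "(\<Prod>i = 0..<N. (M(r := f)) i (p i)) = f (p r) * (\<Prod>i\<in>{0..<N} - {r}. (M(r := f)) i (p i))"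
      using r by (subst prod.remove[of _ r]) auto
    also have "(\<Prod>i\<in>{0..<N} - {r}. (M(r := f)) i (p i)) = (\<Prod>i\<in>{0..<N} - {r}. M i (p i))"
      by (intro prod.cong) auto
    finally show ?thesis .
  qed
  show ?thesis
    unfolding dt_leibniz split sum_distrib_left sum_distrib_right
    by (subst sum.swap) (simp add: mult_ac)
qed

lemma dt_same_rows:
  assumes "r < N" "s < N" "r \<noteq> s" "M r = M s"
  shows "dt N M = 0"
  unfolding dt_def
  by (rule det_identical_rows[of _ N r s]) (use assms in auto)

lemma dt_row_add:
  assumes r: "r < N"
  shows "dt N (M(r := \<lambda>j. f j + g j)) = dt N (M(r := f)) + dt N (M(r := g))"
proof -
  have eq: "(\<lambda>j. f j + g j) = (\<lambda>j. \<Sum>k\<in>UNIV. 1 * (if k then f else g) j)"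
    by (simp add: UNIV_bool add.commute)
  show ?thesis
    unfolding eq by (subst dt_row_linear[OF r]) (simp_all add: UNIV_bool add.commute)
qed

text \<open>Polarisation: the determinant with \<open>f + g\<close> in both rows vanishes, and so do
  the two diagonal terms of its expansion.\<close>

lemma dt_swap_rows:
  assumes "r < N" "s < N" "r \<noteq> s"
  shows "dt N (M(r := f, s := g)) = - dt N (M(r := g, s := f))"
proof -
  have upd: "M(r := a, s := b) = M(s := b, r := a)" for a b using assms by auto
  have z: "dt N (M(r := a, s := a)) = 0" for a
    by (rule dt_same_rows[of r _ s]) (use assms in auto)
  have "0 = dt N (M(r := \<lambda>j. f j + g j, s := \<lambda>j. f j + g j))" by (rule z[symmetric])
  also have "\<dots> = dt N (M(r := \<lambda>j. f j + g j, s := f)) + dt N (M(r := \<lambda>j. f j + g j, s := g))"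
    by (rule dt_row_add) fact
  also have "\<dots> = dt N (M(r := f, s := f)) + dt N (M(r := g, s := f))
      + (dt N (M(r := f, s := g)) + dt N (M(r := g, s := g)))"
    unfolding upd by (simp add: dt_row_add assms)
  finally show ?thesis by (simp add: z eq_neg_iff_add_eq_0 add.commute)
qed

definition unit_row :: "nat \<Rightarrow> nat \<Rightarrow> 'a::comm_ring_1" where
  "unit_row k = (\<lambda>j. if j = k then 1 else 0)"

text \<open>The directions W, S, E, N are numbered 0 to 3. The functions below list, for each vertex type,
  the two incoming edges in the order y^{2i-1}, y^{2i}.\<close>

definition dir1 :: "nat \<Rightarrow> nat" where
  "dir1 t = (if t = 2 \<or> t = 6 then 3 else if t = 4 then 2 else 0)"

definition dir2 :: "nat \<Rightarrow> nat" where
  "dir2 t = (if t = 2 \<or> t = 5 then 2 else if t = 3 then 3 else 1)"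

lemma types_eq: "{1..6::nat} = {1, 2, 3, 4, 5, 6}" by auto

text \<open>Laplace expansion along two rows supported in the same four columns. The six pairs of
  columns are the six vertex types: \<open>dir1 t\<close> and \<open>dir2 t\<close> run through all
  two-element sets of directions, and their order fixes the sign of each minor.\<close>

lemma dt_two_rows:
  fixes f g :: "nat \<Rightarrow> 'a::comm_ring_1"
  assumes "r < N" "s < N" "r \<noteq> s"
  shows "dt N (M(r := \<lambda>j. \<Sum>d<4. f d * unit_row (cl d) j, s := \<lambda>j. \<Sum>d<4. g d * unit_row (cl d) j)) =
    (\<Sum>t\<in>{1..6}. (f (dir1 t) * g (dir2 t) - f (dir2 t) * g (dir1 t)) *
       dt N (M(r := unit_row (cl (dir1 t)), s := unit_row (cl (dir2 t)))))"
proof -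
  define X where "X c d = dt N (M(r := unit_row (cl c), s := unit_row (cl d) :: nat \<Rightarrow> 'a))" for c d
  have upd: "M(r := a, s := b) = M(s := b, r := a)" for a b using assms by auto
  have X0: "X c c = 0" for c
    unfolding X_def by (rule dt_same_rows[of r _ s]) (use assms in auto)
  have Xs: "X c d = - X d c" for c d
    unfolding X_def by (rule dt_swap_rows) (use assms in auto)
  have "dt N (M(r := \<lambda>j. \<Sum>d<4. f d * unit_row (cl d) j, s := \<lambda>j. \<Sum>d<4. g d * unit_row (cl d) j))
    = (\<Sum>d<4. g d * (\<Sum>c<4. f c * X c d))"
    unfolding X_def using assms
    apply (subst dt_row_linear) apply simp_all
    apply (intro sum.cong refl arg_cong2[where f = "(*)"])
    unfolding upd
    apply (subst dt_row_linear) apply simp_all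
    done
  \<comment> \<open>Of the sixteen pairs of directions the diagonal ones vanish, and antisymmetry
    joins the remaining twelve into one term per type.\<close>
  also have "\<dots> = (\<Sum>t\<in>{1..6}. (f (dir1 t) * g (dir2 t) - f (dir2 t) * g (dir1 t)) * X (dir1 t) (dir2 t))"
    unfolding types_eq dir1_def dir2_def
    apply (simp add: eval_nat_numeral lessThan_Suc X0)
    apply (simp add: Xs[of "Suc 0" 0] Xs[of "Suc (Suc 0)" 0] Xs[of "Suc (Suc 0)" "Suc 0"] 
       Xs[of "Suc (Suc (Suc 0))" 0] Xs[of "Suc (Suc (Suc 0))" "Suc 0"] Xs[of "Suc (Suc (Suc 0))" "Suc (Suc 0)"])
    apply (simp add: algebra_simps)
    done
  finally show ?thesis unfolding X_def .
qed

text \<open>Rows \<open>2*q\<close> and \<open>2*q+1\<close> belong to vertex \<open>q\<close>, so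
  choosing one term for every pair amounts to choosing a type for every vertex. The index set and
  the coefficients stay abstract because the same expansion serves the full matrix, the matrix with
  prescribed vertices and, with a single choice per pair, a block diagonal matrix.\<close>

lemma dt_expand_pairs:
  fixes R :: "nat \<Rightarrow> nat \<Rightarrow> 'a::comm_ring_1"
  assumes T: "finite TT"
  and step: "\<And>q M. q < K \<Longrightarrow> dt (2 * K) (M(2*q := R (2*q), 2*q+1 := R (2*q+1))) =
      (\<Sum>t\<in>TT. m q t * dt (2 * K) (M(2*q := y1 q t, 2*q+1 := y2 q t)))"
  shows "dt (2 * K) R = (\<Sum>T\<in>PiE {..<K} (\<lambda>_. TT). (\<Prod>q<K. m q (T q)) *
      dt (2 * K) (\<lambda>r. if even r then y1 (r div 2) (T (r div 2)) else y2 (r div 2) (T (r div 2))))"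
proof -
  \<comment> \<open>After \<open>k\<close> steps the first \<open>k\<close> pairs of rows have been
    replaced according to \<open>T\<close>; the other rows are still those of
    \<open>R\<close>.\<close>
  define Y where "Y k T = (\<lambda>r. if r div 2 < k then (if even r then y1 (r div 2) (T (r div 2))
     else y2 (r div 2) (T (r div 2))) else R r)" for k T
  have "dt (2 * K) R = (\<Sum>T\<in>PiE {..<k} (\<lambda>_. TT). (\<Prod>q<k. m q (T q)) * dt (2 * K) (Y k T))" if "k \<le> K" for k
    using that
  proof (induction k)
    case 0
    show ?case by (simp add: Y_def)
  next
    case (Suc k)
    have upd: "Y k T = (Y k T)(2*k := R (2*k), 2*k+1 := R (2*k+1))" for T
      by (auto simp: Y_def fun_eq_iff)
    have upd2: "(Y k T)(2*k := y1 k t, 2*k+1 := y2 k t) = Y (Suc k) (T(k := t))" for T t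
    proof
      fix r
      consider "r div 2 < k" | "r = 2 * k" | "r = 2 * k + 1" | "r div 2 > k" by arith
      then show "((Y k T)(2*k := y1 k t, 2*k+1 := y2 k t)) r = Y (Suc k) (T(k := t)) r"
        by cases (auto simp: Y_def)
    qed
    have pr0: "(\<Prod>q<k. m q ((T(k := t)) q)) = (\<Prod>q<k. m q (T q))" for T t
      by (intro prod.cong) auto
    have pr: "(\<Prod>q<Suc k. m q ((T(k := t)) q)) = (\<Prod>q<k. m q (T q)) * m k t" for T t
      unfolding prod.lessThan_Suc pr0 by simp
    have "dt (2 * K) R = (\<Sum>T\<in>PiE {..<k} (\<lambda>_. TT). (\<Prod>q<k. m q (T q)) * dt (2 * K) (Y k T))"
      using Suc by simp
    also have "\<dots> = (\<Sum>T\<in>PiE {..<k} (\<lambda>_. TT). \<Sum>t\<in>TT. (\<Prod>q<k. m q (T q)) * m k t * dt (2 * K) (Y (Suc k) (T(k := t))))"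
      apply (intro sum.cong refl)
      apply (subst upd)
      apply (subst step)
      using Suc apply simp
      apply (subst upd2)
      apply (simp add: sum_distrib_left mult_ac)
      done
    also have "\<dots> = (\<Sum>(t, T)\<in>TT \<times> PiE {..<k} (\<lambda>_. TT). (\<Prod>q<k. m q (T q)) * m k t * dt (2 * K) (Y (Suc k) (T(k := t))))"
      by (subst sum.swap) (simp only: sum.cartesian_product)
    also have "\<dots> = (\<Sum>T\<in>(\<lambda>(t, T). T(k := t)) ` (TT \<times> PiE {..<k} (\<lambda>_. TT)). (\<Prod>q<Suc k. m q (T q)) * dt (2 * K) (Y (Suc k) T))"
      apply (subst sum.reindex[OF inj_combinator])
       apply simp
      apply (rule sum.cong[OF refl])
      subgoal for z by (cases z) (simp only: o_def prod.case pr)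
      done
    also have "(\<lambda>(t, T). T(k := t)) ` (TT \<times> PiE {..<k} (\<lambda>_. TT)) = PiE {..<Suc k} (\<lambda>_. TT)"
      unfolding lessThan_Suc PiE_insert_eq ..
    finally show ?case .
  qed
  from this[OF le_refl] have "dt (2 * K) R = (\<Sum>T\<in>PiE {..<K} (\<lambda>_. TT). (\<Prod>q<K. m q (T q)) * dt (2 * K) (Y K T))" .
  also have "\<dots> = (\<Sum>T\<in>PiE {..<K} (\<lambda>_. TT). (\<Prod>q<K. m q (T q)) *
      dt (2 * K) (\<lambda>r. if even r then y1 (r div 2) (T (r div 2)) else y2 (r div 2) (T (r div 2))))"
  proof -
    have "dt (2 * K) (Y K T) = dt (2 * K) (\<lambda>r. if even r then y1 (r div 2) (T (r div 2))
        else y2 (r div 2) (T (r div 2)))" for T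
      by (rule dt_cong) (simp add: Y_def less_mult_imp_div_less mult.commute)
    then show ?thesis by (simp only:)
  qed
  finally show ?thesis .
qed

lemma dt_mult: "dt N M * dt N M' = dt N (\<lambda>i j. \<Sum>k<N. M i k * M' k j)"
proof -
  have "mat N N (\<lambda>(i, j). M i j) * mat N N (\<lambda>(i, j). M' i j) = mat N N (\<lambda>(i, j). \<Sum>k<N. M i k * M' k j)"
    by (rule eq_matI) (auto simp: scalar_prod_def atLeast0LessThan)
  then show ?thesis
    unfolding dt_def
    using det_mult[of "mat N N (\<lambda>(i, j). M i j)" N "mat N N (\<lambda>(i, j). M' i j)"] by simp
qed

lemma dt_identity: "dt N unit_row = (1 :: 'a::comm_ring_1)"
proof -
  have "mat N N (\<lambda>(i, j). unit_row i j) = (1\<^sub>m N :: 'a mat)" by (rule eq_matI) (auto simp: unit_row_def)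
  then show ?thesis unfolding dt_def by simp
qed

text \<open>A Leibniz term that moves an index outside the image of \<open>x\<close> meets a zero of
  a unit row, so only permutations of that image survive; transported along \<open>x\<close> they
  keep their sign.\<close>

lemma dt_identity_outside:
  fixes C :: "nat \<Rightarrow> nat \<Rightarrow> 'a::comm_ring_1"
  assumes inj: "inj_on x {0..<m}" and xN: "x ` {0..<m} \<subseteq> {0..<N}"
    and unit: "\<And>r. r < N \<Longrightarrow> r \<notin> x ` {0..<m} \<Longrightarrow> C r = unit_row r"
  shows "dt N C = dt m (\<lambda>i j. C (x i) (x j))"
proof -
  let ?X = "x ` {0..<m}"
  define F where "F p = of_int (sign p) * (\<Prod>i = 0..<N. C i (p i))" for p
  have "dt N C = (\<Sum>p | p permutes {0..<N}. F p)" unfolding dt_leibniz F_def ..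
  also have "\<dots> = (\<Sum>p | p permutes ?X. F p)"
  proof (rule sum.mono_neutral_right)
    show "finite {p. p permutes {0..<N}}" by (simp add: finite_permutations)
    show "{p. p permutes ?X} \<subseteq> {p. p permutes {0..<N}}"
      using permutes_subset[OF _ xN] by auto
    show "\<forall>p\<in>{p. p permutes {0..<N}} - {p. p permutes ?X}. F p = 0"
    proof
      fix p assume p: "p \<in> {p. p permutes {0..<N}} - {p. p permutes ?X}"
      then obtain r where r: "r \<in> {0..<N} - ?X" "p r \<noteq> r" using permutes_superset[of p "{0..<N}" ?X] by auto
      then have "C r (p r) = 0" using unit[of r] by (auto simp: unit_row_def)
      then have "(\<Prod>i = 0..<N. C i (p i)) = 0" using r by (intro prod_zero) auto
      then show "F p = 0" unfolding F_def by simp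
    qed
  qed
  also have "\<dots> = (\<Sum>p | p permutes {0..<m}. of_int (sign p) * (\<Prod>i = 0..<m. C (x i) (x (p i))))"
  proof -
    define h where "h = (\<lambda>\<pi> y. if y \<in> ?X then x (\<pi> (inv_into {0..<m} x y)) else y)"
    have bij: "bij_betw x {0..<m} ?X" using inj by (simp add: bij_betw_def)
    have bh: "bij_betw h {p. p permutes {0..<m}} {p. p permutes ?X}"
      unfolding h_def by (rule bij_betw_permutations[OF bij])
    have "(\<Sum>p | p permutes ?X. F p) = (\<Sum>p | p permutes {0..<m}. F (h p))"
      by (rule sum.reindex_bij_betw[OF bh, symmetric])
    also have "\<dots> = (\<Sum>p | p permutes {0..<m}. of_int (sign p) * (\<Prod>i = 0..<m. C (x i) (x (p i))))"
    proof (rule sum.cong[OF refl])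
      fix p assume "p \<in> {p. p permutes {0..<m}}"
      then have p: "p permutes {0..<m}" by simp
      have "h p = map_permutation {0..<m} x p"
        unfolding h_def map_permutation_def restrict_id_def by (auto simp: fun_eq_iff)
      then have s: "sign (h p) = sign p" using sign_map_permutation[OF inj p] by simp
      have "(\<Prod>i = 0..<N. C i (h p i)) = (\<Prod>i\<in>?X. C i (h p i))"
        by (rule prod.mono_neutral_right) (use xN unit in \<open>auto simp: h_def unit_row_def\<close>)
      also have "\<dots> = (\<Prod>i = 0..<m. C (x i) (h p (x i)))"
        by (subst prod.reindex[OF inj]) simp
      also have "\<dots> = (\<Prod>i = 0..<m. C (x i) (x (p i)))"
        using inj by (intro prod.cong) (auto simp: h_def)
      finally show "F (h p) = of_int (sign p) * (\<Prod>i = 0..<m. C (x i) (x (p i)))"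
        unfolding F_def s by simp
    qed
    finally show ?thesis .
  qed
  also have "\<dots> = dt m (\<lambda>i j. C (x i) (x j))" unfolding dt_leibniz ..
  finally show ?thesis .
qed

text \<open>In the Leibniz formula every permutation other than \<open>p\<close> meets a
  zero.\<close>

lemma dt_unit_rows:
  fixes p :: "nat \<Rightarrow> nat"
  assumes p: "p permutes {0..<N}"
  shows "dt N (\<lambda>r. unit_row (p r)) = (of_int (sign p) :: 'a::comm_ring_1)"
proof -
  have "(\<Prod>i = 0..<N. unit_row (p i) (q i)) = (if q = p then 1 else 0 :: 'a)" if q: "q permutes {0..<N}" for q
  proof (cases "q = p")
    case True then show ?thesis by (auto simp: unit_row_def)
  next
    case False
    then obtain i where i: "q i \<noteq> p i" by auto
    then have "i < N" using permutes_not_in[OF p, of i] permutes_not_in[OF q, of i] by (cases "i < N") auto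
    then show ?thesis using i False by (auto simp: unit_row_def intro!: prod_zero)
  qed
  then have "dt N (\<lambda>r. unit_row (p r)) = (\<Sum>q | q permutes {0..<N}. of_int (sign q) * (if q = p then 1 else 0 :: 'a))"
    unfolding dt_leibniz by (intro sum.cong) auto
  also have "\<dots> = (\<Sum>q\<in>{p}. of_int (sign q))"
    by (rule sum.mono_neutral_cong_right) (use p in \<open>auto simp: finite_permutations\<close>)
  also have "\<dots> = of_int (sign p)" by simp
  finally show ?thesis .
qed

lemma dt_unit_rows_not_inj:
  assumes "r < N" "s < N" "r \<noteq> s" "p r = p s"
  shows "dt N (\<lambda>r. unit_row (p r)) = 0"
  by (rule dt_same_rows[of r _ s]) (use assms in auto)

section \<open>Signs of permutations as inversion parities\<close>

text \<open>The product changes sign under composition with an adjacent transposition. Every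
  transposition is a word of odd length in adjacent ones, and transpositions generate all
  permutations.\<close>

lemma prod_inversion_signs:
  fixes N :: nat
  assumes "p permutes {0..<N}"
  shows "(\<Prod>(a, b) | a < b \<and> b < N. if p b < p a then - 1 else 1) = sign p"
proof -
  define P where "P = {(a, b). a < b \<and> b < N}"
  define S where "S q = (\<Prod>(a, b)\<in>P. if q b < q a then - 1 else 1 :: int)" for q :: "nat \<Rightarrow> nat"
  have fP: "finite P" by (rule finite_subset[of _ "{0..<N} \<times> {0..<N}"]) (auto simp: P_def)
  have step: "S (q \<circ> Transposition.transpose k (Suc k)) = - S q" if q: "q permutes {0..<N}" and k: "Suc k < N" for q k
  proof -
    let ?t = "Transposition.transpose k (Suc k)"
    let ?P = "P - {(k, Suc k)}"
    have kP: "(k, Suc k) \<in> P" using k by (auto simp: P_def)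
    \<comment> \<open>Exchanging \<open>k\<close> and \<open>Suc k\<close> keeps all increasing
      pairs increasing once the pair \<open>(k, Suc k)\<close> itself is removed.\<close>
    have bij: "bij_betw (map_prod ?t ?t) ?P ?P"
      by (rule bij_betwI[where g = "map_prod ?t ?t"])
        (use k in \<open>auto simp: P_def Transposition.transpose_def split: if_splits\<close>)
    have "(\<Prod>(a, b)\<in>?P. if q (?t b) < q (?t a) then - 1 else 1 :: int) = (\<Prod>(a, b)\<in>?P. if q b < q a then - 1 else 1)"
      using prod.reindex_bij_betw[OF bij, of "\<lambda>(a, b). if q b < q a then - 1 else 1 :: int"]
      by (simp add: case_prod_beta)
    moreover have "q k \<noteq> q (Suc k)" using permutes_inj[OF q] by (simp add: inj_eq)
    ultimately show ?thesis
      unfolding S_def by (simp add: prod.remove[OF fP kP])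
  qed
  have app: "S (q \<circ> apply_adj_transps xs) = (- 1) ^ length xs * S q"
    if "q permutes {0..<N}" "\<forall>x\<in>set xs. Suc x < N" for q xs
    using that
  proof (induction xs arbitrary: q)
    case (Cons x xs)
    have "q \<circ> apply_adj_transps (x # xs) = (q \<circ> Transposition.transpose x (Suc x)) \<circ> apply_adj_transps xs"
      by (simp add: o_assoc)
    moreover have perm: "(q \<circ> Transposition.transpose x (Suc x)) permutes {0..<N}"
      by (rule permutes_compose) (use Cons.prems in \<open>auto intro: permutes_swap_id\<close>)
    have "S ((q \<circ> Transposition.transpose x (Suc x)) \<circ> apply_adj_transps xs) =
        (- 1) ^ length xs * S (q \<circ> Transposition.transpose x (Suc x))"
      by (rule Cons.IH[OF perm]) (use Cons.prems in simp)
    moreover have "S (q \<circ> Transposition.transpose x (Suc x)) = - S q"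
      by (rule step) (use Cons.prems in auto)
    ultimately show ?case by (simp only: list.size(4) power_add power_one_right power_Suc0_right mult_minus_left
        mult_minus_right mult_1_right)
  qed simp
  have tr: "S (q \<circ> Transposition.transpose a b) = - S q" if "q permutes {0..<N}" "a < b" "b < N" for q a b
    using app[OF that(1), of "adj_transp_seq a b"] that
    by (simp add: adj_transp_seq_correct set_adj_transp_seq length_adj_transp_seq)
  have "S p = sign p" using finite_atLeastLessThan assms
  proof (induction rule: permutes_rev_induct)
    case id
    show ?case unfolding S_def by (auto simp: P_def intro!: prod.neutral)
  next
    case (swap a b p)
    have "S (p \<circ> Transposition.transpose a b) = - S p" if "a \<noteq> b"
    proof (cases "a < b")
      case True then show ?thesis using swap by (intro tr) auto
    next
      case False
      then show ?thesis using swap that tr[of p b a] by (simp add: transpose_commute)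
    qed
    moreover have "sign (p \<circ> Transposition.transpose a b) = sign p * sign (Transposition.transpose a b)"
      by (intro sign_compose permutation_swap_id permutes_imp_permutation[of "{0..<N}"]) (use swap in auto)
    ultimately show ?case
      using swap.IH by (cases "a = b") (simp_all only: sign_swap_id if_True if_False refl
        not_True_eq_False not_False_eq_True Transposition.transpose_same comp_id mult_1_right mult_minus_right)
  qed
  then show ?thesis unfolding S_def P_def .
qed

lemma prod_signs_bit:
  assumes "finite A"
  shows "(\<Prod>x\<in>A. if P x then - 1 else 1 :: int) = (if (\<Sum>x\<in>A. of_bool (P x) :: bit) = 0 then 1 else - 1)"
  using assms by (induction) auto

text \<open>Counting inversions in the two-element field \<open>bit\<close> makes the fourfold sums
  over the torus below accessible to ring identities, with x + x = 0 and x * x = x.\<close>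

lemma sign_eq_inversion_parity:
  fixes N :: nat
  assumes "p permutes {0..<N}"
  shows "sign p = (if (\<Sum>(a, b) | a < b \<and> b < N. of_bool (p b < p a) :: bit) = 0 then 1 else - 1)"
proof -
  have "finite {(a, b). a < b \<and> b < N}"
    by (rule finite_subset[of _ "{0..<N} \<times> {0..<N}"]) auto
  from prod_signs_bit[OF this, of "\<lambda>(a, b). p b < p a"] show ?thesis
    using prod_inversion_signs[OF assms] by (simp add: case_prod_beta)
qed

lemma bit_add_self [simp]: "x + x = (0::bit)" "x + (x + y) = (y::bit)"
  by (cases x; cases y; simp)+

lemma bit_mult_self: "x * x = (x::bit)"
  by (cases x) auto

lemma sum_lessThan_add:
  fixes f :: "nat \<Rightarrow> 'a::comm_monoid_add"
  shows "(\<Sum>a<m + k. f a) = (\<Sum>a<m. f a) + (\<Sum>c<k. f (m + c))"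
  by (induction k) (simp_all add: add.assoc)

lemma sum_lessThan_mult:
  fixes f :: "nat \<Rightarrow> 'a::comm_monoid_add"
  shows "(\<Sum>a<m * k. f a) = (\<Sum>q<m. \<Sum>c<k. f (q * k + c))"
proof (induction m)
  case (Suc m)
  show ?case
    unfolding mult_Suc add.commute[of k] sum_lessThan_add Suc.IH sum.lessThan_Suc by (rule refl)
qed simp

lemma sum_lessThan_square_pairs:
  fixes g :: "nat \<Rightarrow> 'a::comm_monoid_add"
  shows "(\<Sum>a<2 * (n * n). g a) = (\<Sum>j<n. \<Sum>i<n. g (2 * (j * n + i)) + g (2 * (j * n + i) + 1))"
proof -
  have two: "{..<2::nat} = {0, 1}" by auto
  have "(\<Sum>a<2 * (n * n). g a) = (\<Sum>q<n * n. \<Sum>c<2. g (q * 2 + c))"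
    unfolding mult.commute[of 2] sum_lessThan_mult ..
  also have "\<dots> = (\<Sum>q<n * n. g (2 * q) + g (2 * q + 1))"
    unfolding two by (simp add: mult.commute)
  also have "\<dots> = (\<Sum>j<n. \<Sum>i<n. g (2 * (j * n + i)) + g (2 * (j * n + i) + 1))"
    by (rule sum_lessThan_mult)
  finally show ?thesis .
qed

section \<open>Inversions of the permutation given by the paths\<close>

text \<open>Edges are numbered along the rows of the torus, the western edge of a vertex
  (\<open>c\<close> false) just before its southern edge (\<open>c\<close> true). Rows and columns
  of the matrix are numbered in this way.\<close>

definition pair_pos :: "nat \<Rightarrow> nat \<Rightarrow> nat \<Rightarrow> bool \<Rightarrow> nat" where
  "pair_pos n j i c = 2 * (j * n + i) + of_bool c"

lemma pair_pos_less:
  assumes "i < n" "i' < n"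
  shows "pair_pos n j i c < pair_pos n j' i' c' \<longleftrightarrow> j < j' \<or> j = j' \<and> (i < i' \<or> i = i' \<and> \<not> c \<and> c')"
proof -
  have lt: "a * n + x < b * n + y" if "a < b" "x < n" for a b x y
  proof -
    have "a * n + x < Suc a * n" using that by simp
    also have "\<dots> \<le> b * n" using that by (intro mult_le_mono1) simp
    finally show ?thesis by simp
  qed
  consider "j < j'" | "j = j'" | "j' < j" by arith
  then show ?thesis
  proof cases
    case 1
    then show ?thesis using lt[OF 1 assms(1), of i'] assms by (simp add: pair_pos_def)
  next
    case 2
    then show ?thesis using assms by (auto simp: pair_pos_def)
  next
    case 3
    then show ?thesis using lt[OF 3 assms(2), of i] assms by (simp add: pair_pos_def)
  qed
qed

text \<open>\<open>h i j\<close> and \<open>s i j\<close> say whether the edge to the west and the edge to the south of the vertex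
  \<open>(i, j)\<close> of the torus is occupied, i.e. incoming at its other end vertex. An unoccupied edge is
  its own source; the source of an occupied one is determined by the occupation of the two edges
  entering the previous vertex.\<close>

locale torus_paths =
  fixes n :: nat and h s :: "nat \<Rightarrow> nat \<Rightarrow> bool"
  assumes n2: "n \<ge> 2"
    and conservation: "i < n \<Longrightarrow> j < n \<Longrightarrow> of_bool (h i j) + of_bool (s i j) =
      (of_bool (h (if Suc i = n then 0 else Suc i) j) + of_bool (s i (if Suc j = n then 0 else Suc j)) :: nat)"
begin

text \<open>Two paths that meet in a vertex do not cross: the one from the west leaves to the north,
  the one from the south to the east. Hence an occupied western edge comes from the south of the
  previous vertex exactly when the southern edge there is occupied.\<close>

definition srcW :: "nat \<Rightarrow> nat \<Rightarrow> nat" where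
  "srcW i j = (if h i j
     then let i' = (if i = 0 then n - 1 else i - 1) in pair_pos n j i' (s i' j)
     else pair_pos n j i False)"

definition srcS :: "nat \<Rightarrow> nat \<Rightarrow> nat" where
  "srcS i j = (if s i j
     then let j' = (if j = 0 then n - 1 else j - 1) in pair_pos n j' i (\<not> h i j')
     else pair_pos n j i True)"

lemma conservation_bool:
  assumes "i < n" "j < n"
    and "i' = (if Suc i = n then 0 else Suc i)" "j' = (if Suc j = n then 0 else Suc j)"
  shows "h i j \<and> s i j \<longleftrightarrow> h i' j \<and> s i j'" "h i j \<or> s i j \<longleftrightarrow> h i' j \<or> s i j'"
proof -
  have c: "of_bool (h i j) + of_bool (s i j) = (of_bool (h i' j) + of_bool (s i j') :: nat)"
    using conservation[OF assms(1,2)] unfolding assms(3,4)[symmetric] .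
  show "h i j \<and> s i j \<longleftrightarrow> h i' j \<and> s i j'" "h i j \<or> s i j \<longleftrightarrow> h i' j \<or> s i j'"
    using c by (simp_all add: of_bool_def split: if_splits)
qed

lemma srcW_simps:
  "\<not> h i j \<Longrightarrow> srcW i j = pair_pos n j i False"
  "h (Suc i) j \<Longrightarrow> srcW (Suc i) j = pair_pos n j i (s i j)"
  "n - 1 = m \<Longrightarrow> h 0 j \<Longrightarrow> srcW 0 j = pair_pos n j m (s m j)"
  by (simp_all add: srcW_def Let_def cong: if_cong)

lemma srcS_simps:
  "\<not> s i j \<Longrightarrow> srcS i j = pair_pos n j i True"
  "s i (Suc j) \<Longrightarrow> srcS i (Suc j) = pair_pos n j i (\<not> h i j)"
  "n - 1 = m \<Longrightarrow> s i 0 \<Longrightarrow> srcS i 0 = pair_pos n m i (\<not> h i m)"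
  by (simp_all add: srcS_def Let_def cong: if_cong)

text \<open>Sources of western edges move at most one step back along their row, which preserves the
  order, except for an occupied edge with \<open>i = 0\<close>: its source jumps to the last vertex
  of the row and passes all others. Conservation decides the tie at that vertex.\<close>

lemma inv_WW:
  assumes "i < n" "i' < n" "j < n" "j' < n"
  shows "(pair_pos n j i False < pair_pos n j' i' False \<and> srcW i' j' < srcW i j) \<longleftrightarrow> 
     j = j' \<and> i = 0 \<and> 0 < i' \<and> h 0 j"
proof -
  obtain m where m: "n = Suc m" using n2 by (cases n) auto
  have m1: "n - 1 = m" using m by simp
  have a: "\<not> h m j \<Longrightarrow> h 0 j \<Longrightarrow> s m j"
    using conservation_bool[of "n - 1" j 0] assms m by auto
  have le: "x < n \<longleftrightarrow> x \<le> m" for x using m by auto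
  note ppl = pair_pos_less[where n = n, unfolded le]
  show ?thesis
    using assms[unfolded le] a
    apply (cases i; cases i'; cases "h i j"; cases "h i' j'")
    apply (simp_all add: srcW_simps(1,2) srcW_simps(3)[OF m1] ppl)
    apply (auto simp: le_less)
    done
qed

text \<open>For \<open>j > 0\<close> a source lies in the same row or one row below, so only edges
  of equal or adjacent rows can be inverted. The sources of occupied edges of row 0 jump to the last
  row and pass nearly all later edges.\<close>

lemma inv_SS:
  assumes "i < n" "i' < n" "j < n" "j' < n"
  shows "(pair_pos n j i True < pair_pos n j' i' True \<and> srcS i' j' < srcS i j) \<longleftrightarrow> 
     (if j = j' then i < i' \<and> (if j = 0 then s i 0 \<and> \<not> s i' 0 else \<not> s i j \<and> s i' j)
      else if j < j' then
        (if j = 0 then (if s i 0 then s i' j' \<or> j' < n - 1 \<or> i' < i else j' = 1 \<and> i' \<le> i \<and> s i' j')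
         else j' = Suc j \<and> i' \<le> i \<and> \<not> s i j \<and> s i' j')
      else False)"
proof -
  obtain m where m: "n = Suc m" using n2 by (cases n) auto
  have m1: "n - 1 = m" using m by simp
  have a: "s i (Suc k) \<Longrightarrow> \<not> s i k \<Longrightarrow> h i k" if "Suc k \<le> m" for k
    using conservation_bool[of i k _ "Suc k"] that assms m by auto
  have b: "s i 0 \<Longrightarrow> \<not> s i m \<Longrightarrow> h i m"
    using conservation_bool[of i "n - 1" _ 0] assms m by auto
  have le: "x < n \<longleftrightarrow> x \<le> m" for x using m by auto
  note ppl = pair_pos_less[where n = n, unfolded le]
  have n2': "1 \<le> m" using n2 m by simp
  show ?thesis
    unfolding m1
    using assms[unfolded le] a[of j] b a[of 0] n2'
    apply (cases j; cases j'; cases "s i j"; cases "s i' j'")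
    apply (simp_all add: srcS_simps(1,2) srcS_simps(3)[OF m1] ppl)
    apply (auto simp: le_less)
    done
qed

text \<open>The western edge may precede or follow the southern one in the numbering, hence the
  conditional on the left. An occupied southern edge of row 0, whose source jumps to the last row,
  is again the exceptional case.\<close>

lemma inv_WS:
  assumes "i < n" "i' < n" "j < n" "j' < n"
  shows "(if pair_pos n j' i' False < pair_pos n j i True then srcS i j < srcW i' j' else srcW i' j' < srcS i j) \<longleftrightarrow> 
     (if \<not> s i j then j' = j \<and> (i' = 0 \<and> i < n - 1 \<and> h 0 j \<or> i' = Suc i \<and> h (Suc i) j)
      else if j = 0 then (j' = 0 \<and> i < i' \<or> 0 < j' \<and> j' < n - 1 \<or> j' = n - 1 \<and> i' \<le> i) \<noteq> 
          (j' = n - 1 \<and> i' = 0 \<and> h 0 (n - 1))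
      else (j' = j \<and> i' \<le> i) \<or> (j' = j - 1 \<and> i < i') \<or> (j' = j - 1 \<and> i' = 0 \<and> h 0 (j - 1)))"
proof -
  obtain m where m: "n = Suc m" using n2 by (cases n) auto
  have m1: "n - 1 = m" using m by simp
  have next_eq: "k' = (if Suc k = n then 0 else Suc k)" if "k' = (if k = m then 0 else Suc k)" for k k'
    unfolding that m by simp
  have a: "h 0 k \<Longrightarrow> s m k \<or> h m k" "h 0 k \<Longrightarrow> s m k' \<Longrightarrow> s m k \<and> h m k"
    if "k \<le> m" "k' = (if k = m then 0 else Suc k)" for k k'
    using conservation_bool[of m k 0, OF _ _ _ next_eq[OF that(2)]] that(1) m by auto
  have b: "h (Suc i) k \<Longrightarrow> s i k \<or> h i k" "h (Suc i) k \<Longrightarrow> s i k' \<Longrightarrow> s i k \<and> h i k"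
    if "Suc i \<le> m" "k \<le> m" "k' = (if k = m then 0 else Suc k)" for k k'
    using conservation_bool[of i k "Suc i", OF _ _ _ next_eq[OF that(3)]] that(1,2) m by auto
  have le: "x < n \<longleftrightarrow> x \<le> m" for x using m by auto
  note ppl = pair_pos_less[where n = n, unfolded le]
  have n2': "1 \<le> m" using n2 m by simp
  note asm = assms[unfolded le]
  \<comment> \<open>The three possible sources of a western edge: itself, one step back, or across
    the boundary of the fundamental domain.\<close>
  consider (u) "\<not> h i' j'" "srcW i' j' = pair_pos n j' i' False"
    | (o) k where "i' = Suc k" "h (Suc k) j'" "srcW i' j' = pair_pos n j' k (s k j')" "k \<le> m"
    | (w) "i' = 0" "h 0 j'" "srcW i' j' = pair_pos n j' m (s m j')"
    using srcW_simps(1,2) srcW_simps(3)[OF m1] asm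
    by (cases i'; cases "h i' j'") force+
  note srcW_cases = this
  show ?thesis
  proof (cases "s i j")
    case F: False
    show ?thesis
      unfolding m1
      using asm F n2' a(1)[of j] b(1)[of j]
      apply (cases i'; cases "h i' j'")
      apply (simp_all add: srcW_simps(1,2) srcS_simps(1,2) srcW_simps(3)[OF m1] srcS_simps(3)[OF m1] ppl)
      apply (auto simp: le_less not_less split: if_splits)
      done
  next
    case T: True
    show ?thesis
    proof (cases j)
      case j: 0
      have a0: "h 0 m \<Longrightarrow> s m 0 \<Longrightarrow> s m m \<and> h m m" using a(2)[of m 0] by simp
      have b0: "Suc i \<le> m \<Longrightarrow> h (Suc i) m \<Longrightarrow> s i 0 \<Longrightarrow> s i m \<and> h i m" using b(2)[of m 0] by simp
      show ?thesis
        unfolding m1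
        unfolding j srcS_simps(3)[OF m1 T[unfolded j]]
        using asm(1,2,4) T[unfolded j] n2' a0 b0
        apply -
        apply (rule srcW_cases)
          apply (simp_all only: ppl le0 le_refl)
          apply (auto simp: le_less not_less)
        done
    next
      case j: (Suc k)
      have km: "Suc k \<le> m" using asm(3) j by simp
      have a0: "h 0 k \<Longrightarrow> s m (Suc k) \<Longrightarrow> s m k \<and> h m k" using a(2)[of k "Suc k"] km by simp
      have b0: "Suc i \<le> m \<Longrightarrow> h (Suc i) k \<Longrightarrow> s i (Suc k) \<Longrightarrow> s i k \<and> h i k" using b(2)[of k "Suc k"] km by simp
      show ?thesis
        unfolding m1
        unfolding j srcS_simps(2)[OF T[unfolded j]]
        using asm(1,2,4) km T[unfolded j] n2' a0 b0
        apply -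
        apply (rule srcW_cases)
          apply (simp_all only: ppl le0 le_refl)
          apply (cases "j' < k"; cases "j' = k"; cases "j' = Suc k"; simp; (linarith | (auto simp: not_less le_eq_less_or_eq)[1]))
         apply (cases "j' < k"; cases "j' = k"; cases "j' = Suc k"; simp; (linarith | (auto simp: not_less le_eq_less_or_eq)[1]))
        apply (cases "j' < k"; cases "j' = k"; cases "j' = Suc k"; simp; (linarith | (auto simp: not_less le_eq_less_or_eq)[1]))
        done
    qed
  qed
qed

end

section \<open>The inversion count modulo 2\<close>

context torus_paths
begin

definition H :: "nat \<Rightarrow> nat \<Rightarrow> bit" where "H i j = of_bool (h i j)"
definition S :: "nat \<Rightarrow> nat \<Rightarrow> bit" where "S i j = of_bool (s i j)"
abbreviation N :: bit where "N \<equiv> of_nat n"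

definition nx :: "nat \<Rightarrow> nat" where "nx j = (if Suc j = n then 0 else Suc j)"

text \<open>\<open>Q\<close> and \<open>P\<close> are the winding numbers modulo 2: the occupied
  edges that cross one horizontal, respectively one vertical, cut of the torus.\<close>

definition Q :: bit where "Q = (\<Sum>i<n. S i 0)"
definition P :: bit where "P = (\<Sum>j<n. H 0 j)"

lemma bit_eq_from_sum: "x + y = (z::bit) \<Longrightarrow> x = z + y"
  by (cases x; cases y; cases z) auto

lemma conservation_bit:
  assumes "i < n" "j < n"
  shows "H i j + S i j = H (nx i) j + S i (nx j)"
proof -
  have "of_nat (of_bool (h i j) + of_bool (s i j)) = (of_nat (of_bool (h (nx i) j) + of_bool (s i (nx j))) :: bit)"
    using conservation[OF assms] unfolding nx_def by (rule arg_cong)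
  then show ?thesis by (simp add: H_def S_def)
qed

lemma sum_shift_nx: "(\<Sum>i<n. f (nx i)) = (\<Sum>i<n. f i :: bit)"
proof -
  obtain m where m: "n = Suc m" using n2 by (cases n) auto
  have ins: "{..<n} = insert m {..<m}" using m by auto
  have nx: "nx m = 0" "i < m \<Longrightarrow> nx i = Suc i" for i unfolding nx_def using m by auto
  have "(\<Sum>i<n. f (nx i)) = f (nx m) + (\<Sum>i<m. f (nx i))"
    unfolding ins by simp
  also have "\<dots> = f 0 + (\<Sum>i<m. f (Suc i))"
    unfolding nx(1) by (intro arg_cong2[where f = "(+)"] sum.cong refl) (simp only: nx(2) lessThan_iff)
  also have "\<dots> = (\<Sum>i<n. f i)"
    unfolding m sum.lessThan_Suc_shift by (rule refl)
  finally show ?thesis .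
qed

lemma nx_less: "j < n \<Longrightarrow> nx j < n"
  using n2 by (auto simp: nx_def)

lemma row_sum: "j < n \<Longrightarrow> (\<Sum>i<n. S i j) = Q"
proof (induction j)
  case 0
  then show ?case by (simp add: Q_def)
next
  case (Suc j)
  have nxj: "nx j = Suc j" using Suc.prems by (simp add: nx_def)
  have "(\<Sum>i<n. H i j + S i j) = (\<Sum>i<n. H (nx i) j + S i (nx j))"
    by (intro sum.cong refl conservation_bit) (use Suc.prems in auto)
  then have "(\<Sum>i<n. S i j) = (\<Sum>i<n. S i (nx j))"
    unfolding sum.distrib sum_shift_nx[of "\<lambda>i. H i j"] add_left_cancel .
  then show ?case using Suc by (simp add: nxj)
qed

lemma Q_idem: "Q * Q = Q" and N_idem: "N * N = N"
  by (simp_all add: bit_mult_self)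

lemma sum_delta_left:
  "k < n \<Longrightarrow> (\<Sum>i<n. of_bool (i = k) * f i) = (f k :: bit)"
  "(\<Sum>i<n. of_bool (i = n) * f i) = (0::bit)"
proof -
  have eq: "(\<Sum>i<n. of_bool (i = k) * f i) = (\<Sum>i<n. if i = k then f i else 0)" for k
    by (intro sum.cong) auto
  show "k < n \<Longrightarrow> (\<Sum>i<n. of_bool (i = k) * f i) = f k" "(\<Sum>i<n. of_bool (i = n) * f i) = 0"
    unfolding eq by (simp_all only: sum.delta finite_lessThan lessThan_iff if_True less_irrefl if_False)
qed

lemma N_simps: "(\<Sum>i<n. 1) = N" "(\<Sum>i<n. x) = N * (x::bit)"
  by simp_all

lemma sum_le_gt: "(\<Sum>i<n. of_bool (k < i)) + (\<Sum>i<n. of_bool (i \<le> k)) = N"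
proof -
  have "(\<Sum>i<n. of_bool (k < i) :: bit) + (\<Sum>i<n. of_bool (i \<le> k)) = (\<Sum>i<n. 1)"
    unfolding sum.distrib[symmetric] by (intro sum.cong) (auto simp: not_le)
  then show ?thesis unfolding N_simps(1) .
qed

text \<open>\<open>X j\<close> counts the pairs in row \<open>j\<close> with an unoccupied edge to
  the left of an occupied one, \<open>Y j\<close> those of an unoccupied edge of row
  \<open>j\<close> and an occupied edge of the next row weakly to its left. These quadratic sums
  have to cancel in the total, as they are not functions of the winding numbers.\<close>

definition X :: "nat \<Rightarrow> bit" where
  "X j = (\<Sum>i<n. \<Sum>k<n. of_bool (i < k) * ((1 + S i j) * S k j))"

definition Y :: "nat \<Rightarrow> bit" where
  "Y j = (\<Sum>i<n. \<Sum>k<n. of_bool (k \<le> i) * ((1 + S i j) * S k (nx j)))"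

lemma sum_prod_rows:
  assumes "j < n" "j' < n"
  shows "(\<Sum>i<n. \<Sum>k<n. (1 + S i j) * S k j') = N * Q + Q"
proof -
  have "(\<Sum>i<n. \<Sum>k<n. (1 + S i j) * S k j') = (\<Sum>i<n. 1 + S i j) * (\<Sum>k<n. S k j')"
    by (simp only: sum_product)
  also have "\<dots> = (N + Q) * Q"
    unfolding sum.distrib row_sum[OF assms(1)] row_sum[OF assms(2)] N_simps(1) ..
  finally show ?thesis unfolding distrib_right Q_idem .
qed

text \<open>A row has, modulo 2, N + Q unoccupied and Q occupied edges; removing the pairs with
  \<open>i < k\<close> from their product leaves those with \<open>k \<le> i\<close>.\<close>

lemma X_complement:
  assumes "j < n"
  shows "(\<Sum>i<n. \<Sum>k<n. of_bool (k \<le> i) * ((1 + S i j) * S k j)) = X j + (N * Q + Q)"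
proof -
  have "(\<Sum>i<n. \<Sum>k<n. of_bool (k \<le> i) * ((1 + S i j) * S k j)) + X j = N * Q + Q"
    unfolding X_def sum.distrib[symmetric] sum_prod_rows[OF assms assms, symmetric]
    by (intro sum.cong refl, rename_tac i k, case_tac "k \<le> i") (simp_all add: not_le)
  from bit_eq_from_sum[OF this] show ?thesis unfolding add.commute[of "X j"] .
qed

text \<open>In row 0 an inversion has the occupied edge on the left; exchanging the summation
  variables leads back to \<open>X 0\<close>.\<close>

lemma X_mirror: "(\<Sum>i<n. \<Sum>k<n. of_bool (i < k) * (S i 0 * (1 + S k 0))) = X 0 + (N * Q + Q)"
proof -
  have "(\<Sum>i<n. \<Sum>k<n. of_bool (i < k) * (S i 0 * (1 + S k 0))) =
      (\<Sum>i<n. \<Sum>k<n. of_bool (k < i) * ((1 + S i 0) * S k 0))"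
    by (subst sum.swap) (simp only: mult.commute)
  also have "\<dots> = (\<Sum>i<n. \<Sum>k<n. of_bool (k \<le> i) * ((1 + S i 0) * S k 0))"
    by (intro sum.cong refl) (auto simp: le_less)
  also have "\<dots> = X 0 + (N * Q + Q)" by (rule X_complement) (use n2 in simp)
  finally show ?thesis .
qed

lemma Y_mirror:
  "(\<Sum>i<n. \<Sum>k<n. of_bool (k < i) * (S i 0 * (1 + S k (n - 1)))) = Y (n - 1) + (N * Q + Q)"
proof -
  have nx: "nx (n - 1) = 0" using n2 by (simp add: nx_def)
  have "(\<Sum>i<n. \<Sum>k<n. of_bool (k < i) * (S i 0 * (1 + S k (n - 1)))) =
      (\<Sum>i<n. \<Sum>k<n. of_bool (i < k) * ((1 + S i (n - 1)) * S k 0))"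
    by (subst sum.swap) (simp only: mult.commute)
  moreover have "(\<Sum>i<n. \<Sum>k<n. of_bool (i < k) * ((1 + S i (n - 1)) * S k 0)) + Y (n - 1) = N * Q + Q"
    unfolding Y_def nx sum.distrib[symmetric]
    by (subst sum_prod_rows[of "n - 1" 0, symmetric])
      (use n2 in simp, use n2 in simp, intro sum.cong refl, rename_tac i k, case_tac "k \<le> i", simp_all add: not_le)
  ultimately show ?thesis
    unfolding add.commute[of "Y (n - 1)"] by (simp only: bit_eq_from_sum)
qed

lemma parity_WW:
  "(\<Sum>j<n. \<Sum>i<n. \<Sum>j'<n. \<Sum>i'<n. of_bool (j = j' \<and> i = 0 \<and> 0 < i' \<and> h 0 j)) = (N + 1) * P"
proof -
  have pos: "(\<Sum>i'<n. of_bool (0 < i')) = N + (1::bit)"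
  proof -
    have "(\<Sum>i'<n. of_bool (i' \<le> 0) :: bit) = (\<Sum>i'<n. of_bool (i' = 0) * 1)"
      by (intro sum.cong) auto
    also have "\<dots> = 1" using n2 by (subst sum_delta_left) auto
    finally have "(\<Sum>i'<n. of_bool (i' \<le> 0) :: bit) = 1" .
    then show ?thesis using bit_eq_from_sum[OF sum_le_gt[of 0]] by (simp only:)
  qed
  have "(\<Sum>i<n. \<Sum>j'<n. \<Sum>i'<n. of_bool (j = j' \<and> i = 0 \<and> 0 < i' \<and> h 0 j)) = (N + 1) * H 0 j" if "j < n" for j
  proof -
    have "(\<Sum>i<n. \<Sum>j'<n. \<Sum>i'<n. of_bool (j = j' \<and> i = 0 \<and> 0 < i' \<and> h 0 j)) =
      (\<Sum>i<n. of_bool (i = 0) * (\<Sum>j'<n. of_bool (j' = j) * (\<Sum>i'<n. of_bool (0 < i') * H 0 j)))"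
      unfolding sum_distrib_left by (intro sum.cong refl) (auto simp: H_def)
    also have "\<dots> = (\<Sum>j'<n. of_bool (j' = j) * (\<Sum>i'<n. of_bool (0 < i') * H 0 j))"
      by (rule sum_delta_left(1)) (use n2 in simp)
    also have "\<dots> = (\<Sum>i'<n. of_bool (0 < i') * H 0 j)" by (rule sum_delta_left(1)[OF that])
    also have "\<dots> = (N + 1) * H 0 j" unfolding sum_distrib_right[symmetric] pos ..
    finally show ?thesis .
  qed
  then show ?thesis unfolding P_def sum_distrib_left by (intro sum.cong refl) simp
qed

text \<open>There are \<open>n - 2\<close> of them, which has the parity of
  \<open>n\<close>.\<close>

lemma middle_rows: "(\<Sum>j<n. of_bool (0 < j \<and> j < n - 1)) = N"
proof -
  have "(\<Sum>j<n. of_bool (0 < j \<and> j < n - 1)) = (\<Sum>j<n. 1 + (of_bool (j = 0) * 1 + of_bool (j = n - 1) * (1::bit)))"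
    using n2 by (intro sum.cong refl) (auto simp: not_less)
  also have "\<dots> = (\<Sum>j<n. 1) + ((\<Sum>j<n. of_bool (j = 0) * 1) + (\<Sum>j<n. of_bool (j = n - 1) * 1))"
    unfolding sum.distrib ..
  also have "\<dots> = N + (1 + 1)"
    using n2 sum_delta_left(1)[of 0 "\<lambda>_. 1"] sum_delta_left(1)[of "n - 1" "\<lambda>_. 1"]
    by (simp only: N_simps(1))
  finally show ?thesis by simp
qed

text \<open>Template for the counts below: an edge is inverted with some edges of the rows
  \<open>a\<close>, \<open>b\<close> and \<open>c\<close>, and uniformly with all or none of those
  in the rows strictly between the first and the last. The value \<open>b = n\<close> encodes an
  absent row, and the rows may coincide.\<close>

lemma sum_two_rows:
  assumes "\<And>j' i'. j' < n \<Longrightarrow> i' < n \<Longrightarrow> F j' i' =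
     of_bool (j' = a) * A i' + of_bool (j' = b) * B i' + of_bool (0 < j' \<and> j' < n - 1) * C + of_bool (j' = c) * D i'"
    and "a < n" "c < n"
  shows "(\<Sum>j'<n. \<Sum>i'<n. F j' i') =
     (\<Sum>i'<n. A i') + (if b < n then \<Sum>i'<n. B i' else 0) + N * C + (\<Sum>i'<n. D i' :: bit)"
proof -
  have "(\<Sum>j'<n. \<Sum>i'<n. F j' i') = (\<Sum>j'<n. \<Sum>i'<n. 
     of_bool (j' = a) * A i' + of_bool (j' = b) * B i' + of_bool (0 < j' \<and> j' < n - 1) * C + of_bool (j' = c) * D i')"
    by (intro sum.cong refl) (simp only: assms(1) lessThan_iff)
  also have "\<dots> = (\<Sum>j'<n. of_bool (j' = a) * (\<Sum>i'<n. A i')) + (\<Sum>j'<n. of_bool (j' = b) * (\<Sum>i'<n. B i'))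
       + (\<Sum>j'<n. of_bool (0 < j' \<and> j' < n - 1) * (\<Sum>i'<n. C)) + (\<Sum>j'<n. of_bool (j' = c) * (\<Sum>i'<n. D i'))"
    unfolding sum.distrib sum_distrib_left ..
  also have "(\<Sum>j'<n. of_bool (0 < j' \<and> j' < n - 1) * (\<Sum>i'<n. C)) = (\<Sum>j'<n. of_bool (0 < j' \<and> j' < n - 1)) * (\<Sum>i'<n. C)"
    unfolding sum_distrib_right ..
  also have "(\<Sum>j'<n. of_bool (j' = a) * (\<Sum>i'<n. A i')) = (\<Sum>i'<n. A i')"
    by (rule sum_delta_left(1)) fact
  also have "(\<Sum>j'<n. of_bool (j' = c) * (\<Sum>i'<n. D i')) = (\<Sum>i'<n. D i')"
    by (rule sum_delta_left(1)) fact
  also have "(\<Sum>j'<n. of_bool (j' = b) * (\<Sum>i'<n. B i')) = (if b < n then \<Sum>i'<n. B i' else 0)"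
  proof (cases "b < n")
    case False
    then show ?thesis by (auto intro!: sum.neutral)
  qed (simp only: sum_delta_left if_True)
  finally show ?thesis unfolding middle_rows N_simps(2) mult.assoc[symmetric] N_idem .
qed

lemma parity_SS_row:
  assumes "j < n" "0 < j" "i < n"
  shows "(\<Sum>j'<n. \<Sum>i'<n. of_bool (pair_pos n j i True < pair_pos n j' i' True \<and> srcS i' j' < srcS i j)) =
     (\<Sum>k<n. of_bool (i < k) * ((1 + S i j) * S k j)) +
     (if Suc j < n then \<Sum>k<n. of_bool (k \<le> i) * ((1 + S i j) * S k (nx j)) else 0)"
proof -
  have "(\<Sum>j'<n. \<Sum>i'<n. of_bool (pair_pos n j i True < pair_pos n j' i' True \<and> srcS i' j' < srcS i j)) =
      (\<Sum>k<n. of_bool (i < k) * ((1 + S i j) * S k j)) +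
     (if Suc j < n then \<Sum>k<n. of_bool (k \<le> i) * ((1 + S i j) * S k (Suc j)) else 0) + N * 0 + (\<Sum>k<n. 0)"
  proof (rule sum_two_rows[of _ j _ "Suc j" _ _ j])
    fix j' i' assume "j' < n" "i' < n"
    then show "of_bool (pair_pos n j i True < pair_pos n j' i' True \<and> srcS i' j' < srcS i j) =
     of_bool (j' = j) * (of_bool (i < i') * ((1 + S i j) * S i' j)) +
     of_bool (j' = Suc j) * (of_bool (i' \<le> i) * ((1 + S i j) * S i' (Suc j))) +
     of_bool (0 < j' \<and> j' < n - 1) * 0 + of_bool (j' = j) * 0"
      using assms by (subst inv_SS) (auto simp: S_def)
  qed (use assms in auto)
  moreover have "Suc j < n \<Longrightarrow> nx j = Suc j" by (simp add: nx_def)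
  ultimately show ?thesis by (simp cong: if_cong)
qed

lemma parity_SS_row0:
  assumes "i < n"
  shows "(\<Sum>j'<n. \<Sum>i'<n. of_bool (pair_pos n 0 i True < pair_pos n j' i' True \<and> srcS i' j' < srcS i 0)) =
     (\<Sum>k<n. of_bool (i < k) * (S i 0 * (1 + S k 0))) + (\<Sum>k<n. of_bool (k \<le> i) * ((1 + S i 0) * S k (nx 0)))
      + N * S i 0 + (S i 0 * Q + (\<Sum>k<n. of_bool (k < i) * (S i 0 * (1 + S k (n - 1)))))"
proof -
  have nx0: "nx 0 = 1" using n2 by (simp add: nx_def)
  have "(\<Sum>j'<n. \<Sum>i'<n. of_bool (pair_pos n 0 i True < pair_pos n j' i' True \<and> srcS i' j' < srcS i 0)) =
     (\<Sum>k<n. of_bool (i < k) * (S i 0 * (1 + S k 0))) +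
     (if 1 < n then \<Sum>k<n. of_bool (k \<le> i) * ((1 + S i 0) * S k 1) else 0)
      + N * S i 0 + (\<Sum>k<n. S i 0 * S k (n - 1) + of_bool (k < i) * (S i 0 * (1 + S k (n - 1))))"
  proof (rule sum_two_rows[of _ 0 _ 1 _ _ "n - 1"])
    fix j' i' assume *: "j' < n" "i' < n"
    have n0: "0 < n" using n2 by simp
    show "of_bool (pair_pos n 0 i True < pair_pos n j' i' True \<and> srcS i' j' < srcS i 0) =
     of_bool (j' = 0) * (of_bool (i < i') * (S i 0 * (1 + S i' 0))) +
     of_bool (j' = 1) * (of_bool (i' \<le> i) * ((1 + S i 0) * S i' 1)) +
     of_bool (0 < j' \<and> j' < n - 1) * S i 0 +
     of_bool (j' = n - 1) * (S i 0 * S i' (n - 1) + of_bool (i' < i) * (S i 0 * (1 + S i' (n - 1))))"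
      unfolding inv_SS[OF assms *(2) n0 *(1)]
      using n2 *
      apply (cases "j' = 0"; cases "j' = n - 1"; cases "s i 0"; cases "s i' j'"; simp add: S_def)
      apply (auto simp: S_def)
      done
  qed (use n2 in auto)
  also have "(\<Sum>k<n. S i 0 * S k (n - 1) + of_bool (k < i) * (S i 0 * (1 + S k (n - 1)))) =
    S i 0 * Q + (\<Sum>k<n. of_bool (k < i) * (S i 0 * (1 + S k (n - 1))))"
    unfolding sum.distrib sum_distrib_left[symmetric] by (subst row_sum) (use n2 in auto)
  finally show ?thesis using n2 unfolding nx0 by simp
qed

text \<open>The last row has no later neighbour in the numbering, so its \<open>Y\<close> term is
  missing from its own count; the jump of row 0 to the last row supplies it.\<close>

lemma parity_SS:
  "(\<Sum>j<n. \<Sum>i<n. \<Sum>j'<n. \<Sum>i'<n. of_bool (pair_pos n j i True < pair_pos n j' i' True \<and> srcS i' j' < srcS i j)) =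
     (\<Sum>j<n. X j + Y j) + (N * Q + Q)" (is "(\<Sum>j<n. \<Sum>i<n. ?f i j) = _")
proof -
  \<comment> \<open>The surplus of row 0: \<open>Y (n - 1)\<close> occurs twice here and cancels,
    besides the single copy that completes the last row, and three copies of
    \<open>N * Q + Q\<close> leave one.\<close>
  define d where "d j = (if j = (0::nat) then (N * Q + Q) + Y (n - 1) + (N * Q + Q) + (N * Q + Q) + Y (n - 1) else 0)" for j
  have row: "(\<Sum>i<n. ?f i j) = X j + (if Suc j < n then Y j else 0) + d j + (if j = 0 then Y (n - 1) else 0)" if "j < n" for j
  proof (cases "j = 0")
    case True
    have "(\<Sum>i<n. ?f i 0) = (\<Sum>i<n. \<Sum>k<n. of_bool (i < k) * (S i 0 * (1 + S k 0))) + Y 0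
      + N * Q + (Q * Q + (\<Sum>i<n. \<Sum>k<n. of_bool (k < i) * (S i 0 * (1 + S k (n - 1)))))"
    proof -
      have n0: "0 < n" using n2 by simp
      have "(\<Sum>i<n. ?f i 0) = (\<Sum>i<n. (\<Sum>k<n. of_bool (i < k) * (S i 0 * (1 + S k 0))) + (\<Sum>k<n. of_bool (k \<le> i) * ((1 + S i 0) * S k (nx 0)))
        + N * S i 0 + (S i 0 * Q + (\<Sum>k<n. of_bool (k < i) * (S i 0 * (1 + S k (n - 1))))))"
        by (intro sum.cong refl) (simp only: parity_SS_row0 lessThan_iff)
      then show ?thesis
        unfolding Y_def sum.distrib sum_distrib_left[symmetric] sum_distrib_right[symmetric] row_sum[OF n0] .
    qed
    also have "\<dots> = X 0 + (N * Q + Q) + Y 0 + N * Q + (Q + (Y (n - 1) + (N * Q + Q)))"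
      unfolding X_mirror Y_mirror Q_idem ..
    also have "\<dots> = X 0 + Y 0 + d 0 + Y (n - 1)"
      by (simp only: d_def simp_thms if_True ac_simps bit_add_self)
    finally show ?thesis using n2 True by simp
  next
    case False
    have "(\<Sum>i<n. ?f i j) = X j + (if Suc j < n then Y j else 0)"
    proof -
      have "(\<Sum>i<n. ?f i j) = (\<Sum>i<n. (\<Sum>k<n. of_bool (i < k) * ((1 + S i j) * S k j)) +
         (if Suc j < n then \<Sum>k<n. of_bool (k \<le> i) * ((1 + S i j) * S k (nx j)) else 0))"
        by (intro sum.cong refl) (use that False in \<open>simp only: parity_SS_row lessThan_iff neq0_conv\<close>)
      then show ?thesis
        by (cases "Suc j < n") (simp_all only: if_True if_False X_def Y_def sum.distrib sum.neutral_const)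
    qed
    then show ?thesis using False by (simp only: d_def if_False add_0_right)
  qed
  have "(\<Sum>j<n. \<Sum>i<n. ?f i j) = (\<Sum>j<n. X j + (if Suc j < n then Y j else 0) + d j + (if j = 0 then Y (n - 1) else 0))"
    by (intro sum.cong refl) (simp only: row lessThan_iff)
  also have "\<dots> = (\<Sum>j<n. X j) + (\<Sum>j<n. if Suc j < n then Y j else 0) + (\<Sum>j<n. d j) + (\<Sum>j<n. if j = 0 then Y (n - 1) else 0)"
    unfolding sum.distrib ..
  also have "(\<Sum>j<n. d j) = N * Q + Q"
    unfolding d_def using n2 by (subst sum.delta) (auto simp: ac_simps)
  also have "(\<Sum>j<n. if j = 0 then Y (n - 1) else 0) = (\<Sum>j<n. if j = n - 1 then Y j else 0)"
    using n2 by (simp add: sum.delta)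
  also have "(\<Sum>j<n. X j) + (\<Sum>j<n. if Suc j < n then Y j else 0) + (N * Q + Q) + (\<Sum>j<n. if j = n - 1 then Y j else 0)
      = (\<Sum>j<n. X j + ((if Suc j < n then Y j else 0) + (if j = n - 1 then Y j else 0))) + (N * Q + Q)"
    unfolding sum.distrib by (simp only: ac_simps)
  also have "(\<Sum>j<n. X j + ((if Suc j < n then Y j else 0) + (if j = n - 1 then Y j else 0))) = (\<Sum>j<n. X j + Y j)"
    by (intro sum.cong refl arg_cong2[where f = "(+)"]) auto
  finally show ?thesis .
qed

text \<open>Conservation telescopes along a row and expresses horizontal occupation by vertical
  occupation and one boundary value. This turns the mixed inversions into the same quadratic sums as
  the vertical ones.\<close>

lemma H_partial_sum:
  "j < n \<Longrightarrow> i < n \<Longrightarrow> H (nx i) j = H 0 j + (\<Sum>k<n. of_bool (k \<le> i) * (S k j + S k (nx j)))"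
proof (induction i)
  case 0
  have "(\<Sum>k<n. of_bool (k \<le> 0) * (S k j + S k (nx j))) = (\<Sum>k<n. of_bool (k = 0) * (S k j + S k (nx j)))"
    by (intro sum.cong) auto
  also have "\<dots> = S 0 j + S 0 (nx j)" by (rule sum_delta_left(1)) fact
  finally show ?case using conservation_bit[OF 0(2,1)]
    by (cases "H 0 j"; cases "S 0 j"; cases "S 0 (nx j)"; cases "H (nx 0) j"; simp)
next
  case (Suc i)
  have "(\<Sum>k<n. of_bool (k \<le> Suc i) * (S k j + S k (nx j))) =
      (\<Sum>k<n. of_bool (k \<le> i) * (S k j + S k (nx j)) + of_bool (k = Suc i) * (S k j + S k (nx j)))"
    by (intro sum.cong refl, rename_tac k, case_tac "k = Suc i") (simp_all add: le_Suc_eq)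
  also have "\<dots> = (\<Sum>k<n. of_bool (k \<le> i) * (S k j + S k (nx j))) + (S (Suc i) j + S (Suc i) (nx j))"
    unfolding sum.distrib sum_delta_left(1)[OF Suc.prems(2)] ..
  finally have eq: "H 0 j + (\<Sum>k<n. of_bool (k \<le> Suc i) * (S k j + S k (nx j))) =
      H (nx i) j + (S (Suc i) j + S (Suc i) (nx j))"
    using Suc by (simp only: Suc_lessD add.assoc)
  have nxi: "nx i = Suc i" using Suc.prems by (simp add: nx_def)
  show ?case unfolding eq nxi using conservation_bit[OF Suc.prems(2,1)]
    by (cases "H (Suc i) j"; cases "S (Suc i) j"; cases "S (Suc i) (nx j)"; cases "H (nx (Suc i)) j"; simp)
qed

lemma parity_WS_vertex:
  assumes "i < n" "j < n"
  shows "(\<Sum>j'<n. \<Sum>i'<n. of_bool (if pair_pos n j' i' False < pair_pos n j i True then srcS i j < srcW i' j' else srcW i' j' < srcS i j)) =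
    (1 + S i j) * (H 0 j + H (nx i) j) + S i j * (of_bool (j \<noteq> 0) * N + H 0 (if j = 0 then n - 1 else j - 1))"
    (is "?L = _")
proof -
  have n1: "n - 1 < n" using n2 by simp
  consider (u) "\<not> s i j" | (z) "s i j" "j = 0" | (o) "s i j" "j \<noteq> 0" by blast
  then show ?thesis
  proof cases
    case u
    have "?L = (\<Sum>k<n. of_bool (k = 0) * (of_bool (i < n - 1) * H 0 j)) + (if n < n then \<Sum>k<n. 0 else 0) + N * 0
        + (\<Sum>k<n. of_bool (k = Suc i) * H (Suc i) j)"
    proof (rule sum_two_rows[of _ j _ n _ _ j])
      fix j' i' assume *: "j' < n" "i' < n"
      show "of_bool (if pair_pos n j' i' False < pair_pos n j i True then srcS i j < srcW i' j' else srcW i' j' < srcS i j) =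
        of_bool (j' = j) * (of_bool (i' = 0) * (of_bool (i < n - 1) * H 0 j)) + of_bool (j' = n) * 0 +
        of_bool (0 < j' \<and> j' < n - 1) * 0 + of_bool (j' = j) * (of_bool (i' = Suc i) * H (Suc i) j)"
        unfolding inv_WS[OF assms(1) *(2) assms(2) *(1)] using u * by (auto simp: H_def)
    qed fact+
    also have "(\<Sum>k<n. of_bool (k = 0) * (of_bool (i < n - 1) * H 0 j)) = of_bool (i < n - 1) * H 0 j"
      by (rule sum_delta_left(1)) (use n2 in simp)
    also have "(\<Sum>k<n. of_bool (k = Suc i) * H (Suc i) j) = of_bool (i < n - 1) * H (Suc i) j"
    proof (cases "Suc i < n")
      case True
      show ?thesis using sum_delta_left(1)[OF True, of "\<lambda>_. H (Suc i) j"] True by auto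
    next
      case False
      then show ?thesis by (auto intro!: sum.neutral)
    qed
    finally have "?L = of_bool (i < n - 1) * H 0 j + of_bool (i < n - 1) * H (Suc i) j" by (simp only: less_irrefl if_False mult_zero_right add_0_right)
    also have "\<dots> = H 0 j + H (nx i) j"
    proof (cases "i < n - 1")
      case True
      then have "nx i = Suc i" by (simp add: nx_def)
      then show ?thesis using True by (simp only: of_bool_eq mult_1_left)
    next
      case False
      then have "nx i = 0" unfolding nx_def using assms by auto
      then show ?thesis using False by (simp only: of_bool_eq mult_zero_left bit_add_self)
    qed
    finally show ?thesis using u by (simp add: S_def)
  next
    case z
    have "?L = (\<Sum>k<n. of_bool (i < k)) + (if n < n then \<Sum>k<n. 0 else 0) + N * 1
        + (\<Sum>k<n. of_bool (k \<le> i) + of_bool (k = 0) * H 0 (n - 1))"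
    proof (rule sum_two_rows[of _ 0 _ n _ _ "n - 1"])
      fix j' i' assume *: "j' < n" "i' < n"
      show "of_bool (if pair_pos n j' i' False < pair_pos n j i True then srcS i j < srcW i' j' else srcW i' j' < srcS i j) =
        of_bool (j' = 0) * of_bool (i < i') + of_bool (j' = n) * 0 +
        of_bool (0 < j' \<and> j' < n - 1) * 1 + of_bool (j' = n - 1) * (of_bool (i' \<le> i) + of_bool (i' = 0) * H 0 (n - 1))"
        unfolding inv_WS[OF assms(1) *(2) assms(2) *(1)] using z * n2 
        by (cases "j' = 0"; cases "j' = n - 1"; cases "h 0 (n - 1)"; auto simp: H_def)
    qed (use n2 in auto)
    also have "(\<Sum>k<n. of_bool (k \<le> i) + of_bool (k = 0) * H 0 (n - 1)) = (\<Sum>k<n. of_bool (k \<le> i)) + H 0 (n - 1)"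
      unfolding sum.distrib using sum_delta_left(1)[of 0 "\<lambda>_. H 0 (n - 1)"] n2 by (simp only:)
    finally have "?L = ((\<Sum>k<n. of_bool (i < k)) + (\<Sum>k<n. of_bool (k \<le> i))) + N + H 0 (n - 1)"
      by (simp only: less_irrefl if_False mult_1_right mult_1_left add_0_left add_0_right ac_simps)
    also have "\<dots> = H 0 (n - 1)" unfolding sum_le_gt by simp
    finally show ?thesis using z by (simp add: S_def)
  next
    case o
    have j1: "j - 1 < n" using assms by simp
    have "?L = (\<Sum>k<n. of_bool (k \<le> i)) + (if n < n then \<Sum>k<n. 0 else 0) + N * 0
        + (\<Sum>k<n. of_bool (i < k) + of_bool (k = 0) * H 0 (j - 1))"
    proof (rule sum_two_rows[of _ j _ n _ _ "j - 1"])
      fix j' i' assume *: "j' < n" "i' < n"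
      show "of_bool (if pair_pos n j' i' False < pair_pos n j i True then srcS i j < srcW i' j' else srcW i' j' < srcS i j) =
        of_bool (j' = j) * of_bool (i' \<le> i) + of_bool (j' = n) * 0 +
        of_bool (0 < j' \<and> j' < n - 1) * 0 + of_bool (j' = j - 1) * (of_bool (i < i') + of_bool (i' = 0) * H 0 (j - 1))"
        unfolding inv_WS[OF assms(1) *(2) assms(2) *(1)] using o * n2 
        by (cases "j' = j"; cases "j' = j - 1"; cases "h 0 (j - 1)"; cases "i' = 0"; simp add: H_def)
    qed fact+
    also have "(\<Sum>k<n. of_bool (i < k) + of_bool (k = 0) * H 0 (j - 1)) = (\<Sum>k<n. of_bool (i < k)) + H 0 (j - 1)"
      unfolding sum.distrib using sum_delta_left(1)[of 0 "\<lambda>_. H 0 (j - 1)"] n2 by (simp only:)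
    finally have "?L = ((\<Sum>k<n. of_bool (i < k)) + (\<Sum>k<n. of_bool (k \<le> i))) + H 0 (j - 1)"
      by (simp only: less_irrefl if_False mult_zero_right mult_zero_left add_0_left add_0_right ac_simps)
    then show ?thesis unfolding sum_le_gt using o by (simp add: S_def)
  qed
qed

text \<open>Inserting \<open>H_partial_sum\<close> produces \<open>X\<close> and \<open>Y\<close> in
  every row; the boundary values of the horizontal occupation collect to Q * P, and the remaining
  terms contain N + N * N = 0.\<close>

lemma parity_WS:
  "(\<Sum>j<n. \<Sum>i<n. \<Sum>j'<n. \<Sum>i'<n. of_bool (if pair_pos n j' i' False < pair_pos n j i True
      then srcS i j < srcW i' j' else srcW i' j' < srcS i j)) = (\<Sum>j<n. X j + Y j) + Q * P"
proof -
  define pv where "pv j = (if j = 0 then n - 1 else j - 1)" for j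
  have shift: "(\<Sum>j<n. H 0 (pv j)) = P"
  proof -
    have "(\<Sum>j<n. H 0 (pv j)) = (\<Sum>j<n. H 0 (pv (nx j)))" by (rule sum_shift_nx[symmetric])
    also have "\<dots> = P" unfolding P_def by (intro sum.cong refl) (auto simp: pv_def nx_def)
    finally show ?thesis .
  qed
  have row: "(\<Sum>i<n. \<Sum>j'<n. \<Sum>i'<n. of_bool (if pair_pos n j' i' False < pair_pos n j i True
      then srcS i j < srcW i' j' else srcW i' j' < srcS i j)) =
      X j + Y j + (N * Q + Q) + Q * (of_bool (j \<noteq> 0) * N) + Q * H 0 (pv j)" (is "?L = _") if j: "j < n" for j
  proof -
    have H: "H 0 j + H (nx i) j = (\<Sum>k<n. of_bool (k \<le> i) * (S k j + S k (nx j)))" if "i < n" for i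
      unfolding H_partial_sum[OF j that] by (rule bit_add_self(2))
    have "?L = (\<Sum>i<n. (1 + S i j) * (\<Sum>k<n. of_bool (k \<le> i) * (S k j + S k (nx j))) + S i j * (of_bool (j \<noteq> 0) * N + H 0 (pv j)))"
      by (intro sum.cong refl) (simp only: parity_WS_vertex j H lessThan_iff pv_def)
    also have "\<dots> = (\<Sum>i<n. \<Sum>k<n. of_bool (k \<le> i) * ((1 + S i j) * S k j)) + Y j + (\<Sum>i<n. S i j) * (of_bool (j \<noteq> 0) * N + H 0 (pv j))"
      unfolding Y_def sum_distrib_left sum_distrib_right sum.distrib[symmetric]
      by (intro sum.cong refl arg_cong2[where f = "(+)"]) (simp only: distrib_left ac_simps)
    finally show ?thesis
      unfolding X_complement[OF j] row_sum[OF j] by (simp only: distrib_left ac_simps)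
  qed
  have "(\<Sum>j<n. \<Sum>i<n. \<Sum>j'<n. \<Sum>i'<n. of_bool (if pair_pos n j' i' False < pair_pos n j i True
      then srcS i j < srcW i' j' else srcW i' j' < srcS i j)) =
      (\<Sum>j<n. X j + Y j + (N * Q + Q) + Q * (of_bool (j \<noteq> 0) * N) + Q * H 0 (pv j))"
    by (intro sum.cong refl) (simp only: row lessThan_iff)
  also have "\<dots> = (\<Sum>j<n. X j + Y j) + N * (N * Q + Q) + Q * N * (\<Sum>j<n. of_bool (j \<noteq> 0)) + Q * P"
    unfolding sum.distrib N_simps(2) shift[symmetric] sum_distrib_left by (simp only: ac_simps distrib_left)
  also have "(\<Sum>j<n. of_bool (j \<noteq> 0)) = N + (1::bit)"
  proof -
    have "(\<Sum>j<n. of_bool (j \<noteq> 0)) = (\<Sum>j<n. 1 + of_bool (j = 0) * (1::bit))"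
      by (intro sum.cong) auto
    also have "\<dots> = N + 1" unfolding sum.distrib N_simps(1)
      using sum_delta_left(1)[of 0 "\<lambda>_. 1"] n2 by (simp only:)
    finally show ?thesis .
  qed
  also have "N * (N * Q + Q) = 0" by (cases N) auto
  also have "Q * N * (N + 1) = 0" by (cases N) auto
  finally show ?thesis by (simp only: add_0_right)
qed

text \<open>The sums of \<open>X\<close> and \<open>Y\<close> occur once among the pairs of southern
  edges and once among the mixed pairs, hence cancel. What remains depends only on the parities of
  \<open>n\<close> and of the two winding numbers.\<close>

theorem inversion_parity:
  assumes "\<And>i j. i < n \<Longrightarrow> j < n \<Longrightarrow> src (pair_pos n j i False) = srcW i j"
    and "\<And>i j. i < n \<Longrightarrow> j < n \<Longrightarrow> src (pair_pos n j i True) = srcS i j"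
  shows "(\<Sum>a<2 * (n * n). \<Sum>b<2 * (n * n). of_bool (a < b \<and> src b < src a)) = (N + 1) * P + (N + 1) * Q + Q * P"
proof -
  define f where "f a b = (of_bool (a < b \<and> src b < src a) :: bit)" for a b
  let ?p = "pair_pos n"
  have sq: "(\<Sum>a<2 * (n * n). g a) = (\<Sum>j<n. \<Sum>i<n. g (?p j i False) + g (?p j i True))" for g :: "nat \<Rightarrow> bit"
    unfolding sum_lessThan_square_pairs pair_pos_def by simp
  have "(\<Sum>a<2 * (n * n). \<Sum>b<2 * (n * n). f a b) =
     (\<Sum>j<n. \<Sum>i<n. \<Sum>j'<n. \<Sum>i'<n. f (?p j i False) (?p j' i' False)) +
      (\<Sum>j<n. \<Sum>i<n. \<Sum>j'<n. \<Sum>i'<n. f (?p j i False) (?p j' i' True)) +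
      ((\<Sum>j<n. \<Sum>i<n. \<Sum>j'<n. \<Sum>i'<n. f (?p j i True) (?p j' i' False)) +
      (\<Sum>j<n. \<Sum>i<n. \<Sum>j'<n. \<Sum>i'<n. f (?p j i True) (?p j' i' True)))"
    unfolding sq sum.distrib by (simp only: ac_simps)
  also have "(\<Sum>j<n. \<Sum>i<n. \<Sum>j'<n. \<Sum>i'<n. f (?p j i False) (?p j' i' False)) = (N + 1) * P"
    unfolding parity_WW[symmetric] f_def
    by (intro sum.cong refl arg_cong[where f = of_bool]) (simp only: assms inv_WW lessThan_iff)
  also have "(\<Sum>j<n. \<Sum>i<n. \<Sum>j'<n. \<Sum>i'<n. f (?p j i True) (?p j' i' True)) = (\<Sum>j<n. X j + Y j) + (N * Q + Q)"
    unfolding parity_SS[symmetric] f_def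
    by (intro sum.cong refl arg_cong[where f = of_bool]) (simp only: assms lessThan_iff)
  \<comment> \<open>Either edge of a mixed pair may come first; the two orders are brought to the
    same summation variables before they are added.\<close>
  also have "(\<Sum>j<n. \<Sum>i<n. \<Sum>j'<n. \<Sum>i'<n. f (?p j i False) (?p j' i' True)) =
      (\<Sum>j<n. \<Sum>i<n. \<Sum>j'<n. \<Sum>i'<n. f (?p j' i' False) (?p j i True))"
  proof -
    have "(\<Sum>j<n. \<Sum>i<n. \<Sum>j'<n. \<Sum>i'<n. F j i j' i') = (\<Sum>j<n. \<Sum>i<n. \<Sum>j'<n. \<Sum>i'<n. F j' i' j i :: bit)" for F
    proof -
      have "(\<Sum>j<n. \<Sum>i<n. \<Sum>j'<n. \<Sum>i'<n. F j i j' i') = (\<Sum>j<n. \<Sum>j'<n. \<Sum>i<n. \<Sum>i'<n. F j i j' i')"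
        by (rule sum.cong[OF refl]) (rule sum.swap)
      also have "\<dots> = (\<Sum>j'<n. \<Sum>j<n. \<Sum>i<n. \<Sum>i'<n. F j i j' i')" by (rule sum.swap)
      also have "\<dots> = (\<Sum>j'<n. \<Sum>j<n. \<Sum>i'<n. \<Sum>i<n. F j i j' i')"
        by (rule sum.cong[OF refl], rule sum.cong[OF refl], rule sum.swap)
      also have "\<dots> = (\<Sum>j'<n. \<Sum>i'<n. \<Sum>j<n. \<Sum>i<n. F j i j' i')"
        by (rule sum.cong[OF refl]) (rule sum.swap)
      finally show ?thesis .
    qed
    then show ?thesis .
  qed
  also have "(N + 1) * P + (\<Sum>j<n. \<Sum>i<n. \<Sum>j'<n. \<Sum>i'<n. f (?p j' i' False) (?p j i True)) +
      ((\<Sum>j<n. \<Sum>i<n. \<Sum>j'<n. \<Sum>i'<n. f (?p j i True) (?p j' i' False)) + ((\<Sum>j<n. X j + Y j) + (N * Q + Q)))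
      = (N + 1) * P + (\<Sum>j<n. \<Sum>i<n. \<Sum>j'<n. \<Sum>i'<n. f (?p j' i' False) (?p j i True) + f (?p j i True) (?p j' i' False))
        + ((\<Sum>j<n. X j + Y j) + (N * Q + Q))"
    unfolding sum.distrib by (simp only: ac_simps)
  also have "(\<Sum>j<n. \<Sum>i<n. \<Sum>j'<n. \<Sum>i'<n. f (?p j' i' False) (?p j i True) + f (?p j i True) (?p j' i' False)) =
      (\<Sum>j<n. X j + Y j) + Q * P"
    unfolding parity_WS[symmetric]
  proof (intro sum.cong refl)
    fix j i j' i' assume *: "j \<in> {..<n}" "i \<in> {..<n}" "j' \<in> {..<n}" "i' \<in> {..<n}"
    have "?p j i True < ?p j' i' False \<longleftrightarrow> \<not> ?p j' i' False < ?p j i True"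
      using * by (simp add: pair_pos_less) auto
    then show "f (?p j' i' False) (?p j i True) + f (?p j i True) (?p j' i' False) = 
      of_bool (if ?p j' i' False < ?p j i True then srcS i j < srcW i' j' else srcW i' j' < srcS i j)"
      using * unfolding f_def by (simp add: assms)
  qed
  also have "(N + 1) * P + ((\<Sum>j<n. X j + Y j) + Q * P) + ((\<Sum>j<n. X j + Y j) + (N * Q + Q)) =
      (N + 1) * P + (N + 1) * Q + Q * P + ((\<Sum>j<n. X j + Y j) + (\<Sum>j<n. X j + Y j))"
    by (simp only: distrib_right distrib_left mult_1_left mult_1_right ac_simps)
  also have "\<dots> = (N + 1) * P + (N + 1) * Q + Q * P" by (simp only: bit_add_self add_0_right)
  finally show ?thesis unfolding f_def .
qed

end

section \<open>Configurations as permutations of the edges\<close>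

definition enc :: "nat \<Rightarrow> int \<times> int \<Rightarrow> nat" where
  "enc n v = nat (snd v mod int n) * n + nat (fst v mod int n)"

definition dec :: "nat \<Rightarrow> nat \<Rightarrow> int \<times> int" where
  "dec n q = (int (q mod n), int (q div n))"

lemma enc_less: "n > 0 \<Longrightarrow> enc n v < n * n"
proof -
  assume n: "n > 0"
  have "nat (snd v mod int n) < n" "nat (fst v mod int n) < n"
    using n by (auto simp: nat_less_iff)
  then have "nat (snd v mod int n) * n + nat (fst v mod int n) < Suc (nat (snd v mod int n)) * n"
    "Suc (nat (snd v mod int n)) * n \<le> n * n"
    by (auto intro!: mult_le_mono1 simp del: mult_Suc) simp
  then show ?thesis unfolding enc_def by linarith
qed

lemma enc_dec: "q < n * n \<Longrightarrow> enc n (dec n q) = q"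
proof -
  assume q: "q < n * n"
  then have "n > 0" by (cases n) auto
  moreover have "q div n < n" using q by (simp add: less_mult_imp_div_less)
  ultimately show ?thesis
    unfolding enc_def dec_def by (simp add: zmod_int[symmetric])
qed

lemma dec_enc: "n > 0 \<Longrightarrow> dec n (enc n v) = (fst v mod int n, snd v mod int n)"
proof -
  assume n: "n > 0"
  then have "nat (fst v mod int n) < n" by (auto simp: nat_less_iff)
  then show ?thesis unfolding enc_def dec_def using n by simp
qed

lemma enc_eq_iff:
  "n > 0 \<Longrightarrow> enc n v = enc n w \<longleftrightarrow> fst v mod int n = fst w mod int n \<and> snd v mod int n = snd w mod int n"
proof
  assume n: "n > 0" and eq: "enc n v = enc n w"
  show "fst v mod int n = fst w mod int n \<and> snd v mod int n = snd w mod int n"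
    using dec_enc[OF n, of v] dec_enc[OF n, of w] unfolding eq by simp
qed (simp only: enc_def)

lemma enc_nat: "i < n \<Longrightarrow> j < n \<Longrightarrow> enc n (int i, int j) = j * n + i"
  unfolding enc_def by (simp add: zmod_int[symmetric])

lemma dec_pos: "i < n \<Longrightarrow> dec n (j * n + i) = (int i, int j)"
  unfolding dec_def by simp

text \<open>The eastern edge of a vertex is the western edge of its right neighbour, the northern
  edge the southern edge of its upper neighbour. So every edge has a single column, computed by
  \<open>dcol\<close>; \<open>tcol\<close> is the column assigned to a row when the types are
  given.\<close>

definition dshift :: "nat \<Rightarrow> int \<times> int \<Rightarrow> int \<times> int" where
  "dshift d v = (if d = 2 then (fst v + 1, snd v) else if d = 3 then (fst v, snd v + 1) else v)"

definition dcol :: "nat \<Rightarrow> int \<times> int \<Rightarrow> nat \<Rightarrow> nat" where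
  "dcol n v d = 2 * enc n (dshift d v) + of_bool (d = 1 \<or> d = 3)"

definition tcol :: "nat \<Rightarrow> (nat \<Rightarrow> nat) \<Rightarrow> nat \<Rightarrow> nat" where
  "tcol n T r = dcol n (dec n (r div 2)) (if even r then dir1 (T (r div 2)) else dir2 (T (r div 2)))"

text \<open>The edge in direction \<open>d\<close> points into a vertex of type
  \<open>t\<close>.\<close>

definition has :: "nat \<Rightarrow> nat \<Rightarrow> bool" where
  "has t d \<longleftrightarrow> dir1 t = d \<or> dir2 t = d"

lemma vtype_has:
  assumes "vtype h u (i, j) \<in> {1..6}"
  shows "has (vtype h u (i, j)) 0 = h (i - 1, j)" "has (vtype h u (i, j)) 1 = u (i, j - 1)"
    "has (vtype h u (i, j)) 2 = (\<not> h (i, j))" "has (vtype h u (i, j)) 3 = (\<not> u (i, j))"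
  using assms
  by (cases "h (i - 1, j)"; cases "u (i, j - 1)"; cases "h (i, j)"; cases "u (i, j)";
    simp add: vtype_def Let_def has_def dir1_def dir2_def)+

lemma vtype_of_has:
  assumes "t \<in> {1..6}" "has t 0 = h (i - 1, j)" "has t 1 = u (i, j - 1)"
    "has t 2 = (\<not> h (i, j))" "has t 3 = (\<not> u (i, j))"
  shows "vtype h u (i, j) = t"
  using assms unfolding types_eq
  by (elim insertE) (simp_all add: vtype_def Let_def has_def dir1_def dir2_def)

lemma tor_configs_periodic:
  assumes "(h, u) \<in> tor_configs n"
  shows "h (i mod int n, j mod int n) = h (i, j)" "u (i mod int n, j mod int n) = u (i, j)"
  using assms unfolding tor_configs_def by auto

lemma tor_configs_periodic_cong:
  assumes "(h, u) \<in> tor_configs n" "i mod int n = i' mod int n" "j mod int n = j' mod int n"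
  shows "h (i, j) = h (i', j')" "u (i, j) = u (i', j')"
  using tor_configs_periodic[OF assms(1), of i j] tor_configs_periodic[OF assms(1), of i' j'] assms(2,3) by simp_all

lemma tor_configs_vtype: "(h, u) \<in> tor_configs n \<Longrightarrow> vtype h u v \<in> {1..6}"
  unfolding tor_configs_def by (cases v) auto

text \<open>Occupied edges are those pointing west or south, so the configuration with all vertices
  of type 1 is the empty one.\<close>

definition occW :: "(int \<times> int \<Rightarrow> bool) \<Rightarrow> nat \<Rightarrow> nat \<Rightarrow> bool" where
  "occW h i j = (\<not> h (int i - 1, int j))"

definition occS :: "(int \<times> int \<Rightarrow> bool) \<Rightarrow> nat \<Rightarrow> nat \<Rightarrow> bool" where
  "occS u i j = (\<not> u (int i, int j - 1))"

lemma succ_mod: "i < n \<Longrightarrow> (int (if Suc i = n then 0 else Suc i) - 1) mod int n = int i mod int n"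
proof -
  assume "i < n"
  show ?thesis
  proof (cases "Suc i = n")
    case True
    then have n: "int n = int i + 1" by simp
    have "(0 - 1) mod int n = ((0 - 1) + int n) mod int n" by (rule mod_add_self2[symmetric])
    also have "\<dots> = int i mod int n" unfolding n by simp
    finally show ?thesis using True by simp
  qed simp
qed

lemma occ_succ:
  assumes "(h, u) \<in> tor_configs n" "i < n" "j < n"
  shows "occW h (if Suc i = n then 0 else Suc i) j = (\<not> h (int i, int j))"
    "occS u i (if Suc j = n then 0 else Suc j) = (\<not> u (int i, int j))"
  unfolding occW_def occS_def
  using tor_configs_periodic_cong[OF assms(1) succ_mod[OF assms(2)] refl]
    tor_configs_periodic_cong[OF assms(1) refl succ_mod[OF assms(3)]] by simp_all

lemma tor_configs_paths:
  assumes "(h, u) \<in> tor_configs n" "n \<ge> 2"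
  shows "torus_paths n (occW h) (occS u)"
proof
  fix i j assume ij: "i < n" "j < n"
  have "vtype h u (int i, int j) \<in> {1..6}" by (rule tor_configs_vtype) fact
  then show "of_bool (occW h i j) + of_bool (occS u i j) =
      (of_bool (occW h (if Suc i = n then 0 else Suc i) j) + of_bool (occS u i (if Suc j = n then 0 else Suc j)) :: nat)"
    unfolding occ_succ[OF assms(1) ij] unfolding occW_def occS_def
    by (cases "h (int i - 1, int j)"; cases "u (int i, int j - 1)"; cases "h (int i, int j)"; cases "u (int i, int j)";
      simp add: vtype_def Let_def)
qed fact

context torus_paths
begin

definition src :: "nat \<Rightarrow> nat" where
  "src e = (if even e then srcW (e div 2 mod n) (e div 2 div n) else srcS (e div 2 mod n) (e div 2 div n))"

lemma src_pair_pos: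
  "i < n \<Longrightarrow> src (pair_pos n j i False) = srcW i j" "i < n \<Longrightarrow> src (pair_pos n j i True) = srcS i j"
  unfolding src_def pair_pos_def by simp_all

lemma srcW_nx: "i < n \<Longrightarrow> h (nx i) j \<Longrightarrow> srcW (nx i) j = pair_pos n j i (s i j)"
  by (auto simp: nx_def srcW_simps srcW_simps(3)[of i] split: if_splits)

lemma srcS_nx: "j < n \<Longrightarrow> s i (nx j) \<Longrightarrow> srcS i (nx j) = pair_pos n j i (\<not> h i j)"
  by (auto simp: nx_def srcS_simps srcS_simps(3)[of j] split: if_splits)

lemma sum_nx:
  fixes f :: "nat \<Rightarrow> 'b::comm_monoid_add"
  shows "(\<Sum>i<n. f (nx i)) = (\<Sum>i<n. f i)"
proof -
  obtain m where m: "n = Suc m" using n2 by (cases n) auto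
  have ins: "{..<n} = insert m {..<m}" using m by auto
  have nx: "nx m = 0" "i < m \<Longrightarrow> nx i = Suc i" for i unfolding nx_def using m by auto
  have "(\<Sum>i<n. f (nx i)) = f (nx m) + (\<Sum>i<m. f (nx i))"
    unfolding ins by simp
  also have "\<dots> = f 0 + (\<Sum>i<m. f (Suc i))"
    unfolding nx(1) by (intro arg_cong2[where f = "(+)"] sum.cong refl) (simp only: nx(2) lessThan_iff)
  also have "\<dots> = (\<Sum>i<n. f i)"
    unfolding m sum.lessThan_Suc_shift by (rule refl)
  finally show ?thesis .
qed

lemma column_count: "i < n \<Longrightarrow> (\<Sum>j<n. of_bool (h i j)) = (\<Sum>j<n. of_bool (h 0 j) :: nat)"
proof (induction i)
  case (Suc i)
  have nxi: "nx i = Suc i" using Suc.prems by (simp add: nx_def)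
  have "(\<Sum>j<n. of_bool (h i j) + of_bool (s i j)) = (\<Sum>j<n. of_bool (h (nx i) j) + of_bool (s i (nx j)) :: nat)"
    by (intro sum.cong refl) (use conservation[of i] Suc.prems in \<open>simp add: nx_def\<close>)
  then have "(\<Sum>j<n. of_bool (h i j)) = (\<Sum>j<n. of_bool (h (nx i) j) :: nat)"
    unfolding sum.distrib sum_nx[of "\<lambda>j. of_bool (s i j)"] add_right_cancel .
  then show ?case using Suc unfolding nxi by (simp only: Suc_lessD)
qed simp

lemma row_count: "j < n \<Longrightarrow> (\<Sum>i<n. of_bool (s i j)) = (\<Sum>i<n. of_bool (s i 0) :: nat)"
proof (induction j)
  case (Suc j)
  have nxj: "nx j = Suc j" using Suc.prems by (simp add: nx_def)
  have "(\<Sum>i<n. of_bool (h i j) + of_bool (s i j)) = (\<Sum>i<n. of_bool (h (nx i) j) + of_bool (s i (nx j)) :: nat)"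
    by (intro sum.cong refl) (use conservation[of _ j] Suc.prems in \<open>simp add: nx_def\<close>)
  then have "(\<Sum>i<n. of_bool (s i j)) = (\<Sum>i<n. of_bool (s i (nx j)) :: nat)"
    unfolding sum.distrib sum_nx[of "\<lambda>i. of_bool (h i j)"] add_left_cancel .
  then show ?case using Suc unfolding nxj by (simp only: Suc_lessD)
qed simp

lemma total_counts:
  "(\<Sum>j<n. \<Sum>i<n. of_bool (h (nx i) j)) = n * (\<Sum>j<n. of_bool (h 0 j) :: nat)"
  "(\<Sum>j<n. \<Sum>i<n. of_bool (s i (nx j))) = n * (\<Sum>i<n. of_bool (s i 0) :: nat)"
proof -
  have "(\<Sum>j<n. \<Sum>i<n. of_bool (h (nx i) j)) = (\<Sum>j<n. \<Sum>i<n. of_bool (h i j) :: nat)"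
    unfolding sum_nx[of "\<lambda>i. of_bool (h i _)"] ..
  also have "\<dots> = (\<Sum>i<n. \<Sum>j<n. of_bool (h i j))" by (rule sum.swap)
  also have "\<dots> = (\<Sum>i<n. \<Sum>j<n. of_bool (h 0 j))" by (rule sum.cong[OF refl], rule column_count) simp
  finally show "(\<Sum>j<n. \<Sum>i<n. of_bool (h (nx i) j)) = n * (\<Sum>j<n. of_bool (h 0 j) :: nat)"
    unfolding sum_constant by (simp only: card_lessThan of_nat_id)
  have "(\<Sum>j<n. \<Sum>i<n. of_bool (s i (nx j))) = (\<Sum>j<n. \<Sum>i<n. of_bool (s i j) :: nat)"
    by (rule sum_nx)
  also have "\<dots> = (\<Sum>j<n. \<Sum>i<n. of_bool (s i 0))" by (rule sum.cong[OF refl], rule row_count) simp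
  finally show "(\<Sum>j<n. \<Sum>i<n. of_bool (s i (nx j))) = n * (\<Sum>i<n. of_bool (s i 0) :: nat)"
    unfolding sum_constant by (simp only: card_lessThan of_nat_id)
qed

end

text \<open>The winding numbers of the closed paths formed by the occupied edges.\<close>

definition windH :: "nat \<Rightarrow> (int \<times> int \<Rightarrow> bool) \<times> (int \<times> int \<Rightarrow> bool) \<Rightarrow> nat" where
  "windH n \<sigma> = (\<Sum>j<n. of_bool (occW (fst \<sigma>) 0 j))"

definition windV :: "nat \<Rightarrow> (int \<times> int \<Rightarrow> bool) \<times> (int \<times> int \<Rightarrow> bool) \<Rightarrow> nat" where
  "windV n \<sigma> = (\<Sum>i<n. of_bool (occS (snd \<sigma>) i 0))"

definition wind_sign :: "nat \<Rightarrow> nat \<Rightarrow> nat \<Rightarrow> int" where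
  "wind_sign n p q = (if even ((n + 1) * p + (n + 1) * q + q * p) then 1 else - 1)"

definition types_of :: "nat \<Rightarrow> (int \<times> int \<Rightarrow> bool) \<times> (int \<times> int \<Rightarrow> bool) \<Rightarrow> nat \<Rightarrow> nat" where
  "types_of n \<sigma> = restrict (\<lambda>q. vtype (fst \<sigma>) (snd \<sigma>) (dec n q)) {..<n * n}"

lemma pair_pos_cases:
  assumes "r < 2 * (n * n)"
  obtains i j c where "i < n" "j < n" "r = pair_pos n j i c"
proof
  have "0 < n" using assms by (cases n) auto
  then show "r div 2 mod n < n" by simp
  have "r div 2 < n * n" using assms by linarith
  then show "r div 2 div n < n" by (simp add: less_mult_imp_div_less)
  show "r = pair_pos n (r div 2 div n) (r div 2 mod n) (odd r)"
    unfolding pair_pos_def by simp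
qed

lemma tcol_types_of:
  assumes "i < n" "j < n" "T = types_of n (h, u)" "vtype h u (int i, int j) = t"
  shows "tcol n T (pair_pos n j i c) = dcol n (int i, int j) (if c then dir2 t else dir1 t)"
proof -
  have "j * n + i < n * n" using enc_less[of n "(int i, int j)"] enc_nat[OF assms(1,2)] assms(1) by simp
  then show ?thesis
    using assms unfolding tcol_def types_of_def pair_pos_def by (auto simp: dec_pos)
qed

lemma dcol_pair_pos:
  assumes "i < n" "j < n"
  shows "dcol n (int i, int j) 0 = pair_pos n j i False"
    "dcol n (int i, int j) 1 = pair_pos n j i True"
    "dcol n (int i, int j) 2 = pair_pos n j (if Suc i = n then 0 else Suc i) False"
    "dcol n (int i, int j) 3 = pair_pos n (if Suc j = n then 0 else Suc j) i True"
proof -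
  have e: "enc n (int i + 1, int j) = j * n + (if Suc i = n then 0 else Suc i)"
    "enc n (int i, int j + 1) = (if Suc j = n then 0 else Suc j) * n + i"
  proof -
    have m: "(int k + 1) mod int n = int (if Suc k = n then 0 else Suc k)" if "k < n" for k
    proof (cases "Suc k = n")
      case True
      then have "int k + 1 = int n" by simp
      then show ?thesis unfolding \<open>int k + 1 = int n\<close> if_P[OF True] by simp
    next
      case False
      then have "Suc k < n" using that by simp
      then show ?thesis using False by (simp add: zmod_int[symmetric] of_nat_Suc[symmetric] del: of_nat_Suc) 
    qed
    show "enc n (int i + 1, int j) = j * n + (if Suc i = n then 0 else Suc i)"
      "enc n (int i, int j + 1) = (if Suc j = n then 0 else Suc j) * n + i"
      unfolding enc_def using assms by (simp_all only: fst_conv snd_conv m nat_int) (simp_all add: zmod_int[symmetric])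
  qed
  show "dcol n (int i, int j) 0 = pair_pos n j i False"
    "dcol n (int i, int j) 1 = pair_pos n j i True"
    "dcol n (int i, int j) 2 = pair_pos n j (if Suc i = n then 0 else Suc i) False"
    "dcol n (int i, int j) 3 = pair_pos n (if Suc j = n then 0 else Suc j) i True"
    unfolding dcol_def dshift_def pair_pos_def using e enc_nat[OF assms] by simp_all
qed

lemma dcol_less: "n > 0 \<Longrightarrow> dcol n v d < 2 * (n * n)"
  using enc_less[of n "dshift d v"] unfolding dcol_def by auto

text \<open>A type determines where the paths through the vertex leave, and the source map traces
  them back. This identifies the inverse of the row-to-column map with the function whose inversions
  have been counted.\<close>

lemma src_tcol:
  assumes \<sigma>: "(h, u) \<in> tor_configs n" and n: "n \<ge> 2" and T: "T = types_of n (h, u)" and r: "r < 2 * (n * n)"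
  shows "torus_paths.src n (occW h) (occS u) (tcol n T r) = r"
proof -
  interpret torus_paths n "occW h" "occS u" by (rule tor_configs_paths) fact+
  obtain i j c where ij: "i < n" "j < n" and r: "r = pair_pos n j i c" using pair_pos_cases[OF r] .
  define t where "t = vtype h u (int i, int j)"
  have t: "t \<in> {1..6}" unfolding t_def by (rule tor_configs_vtype) fact
  note tc = tcol_types_of[OF ij T t_def[symmetric]]
  have nxl: "nx i < n" "nx j < n" by (rule nx_less, fact)+
  have hs: "has t 0 = (\<not> occW h i j)" "has t 1 = (\<not> occS u i j)" "has t 2 = occW h (nx i) j" "has t 3 = occS u i (nx j)"
    using vtype_has[of h u "int i" "int j"] t occ_succ[OF \<sigma> ij] unfolding t_def nx_def occW_def occS_def by simp_all
  note dc = dcol_pair_pos[OF ij, folded nx_def]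
  have f: "src (dcol n (int i, int j) 0) = pair_pos n j i False" if "has t 0"
    unfolding dc src_pair_pos[OF ij(1)] using that hs by (simp add: srcW_simps)
  have g: "src (dcol n (int i, int j) 1) = pair_pos n j i True" if "has t 1"
    unfolding dc src_pair_pos[OF ij(1)] using that hs by (simp add: srcS_simps)
  have e: "src (dcol n (int i, int j) 2) = pair_pos n j i (\<not> has t 1)" if "has t 2"
    unfolding dc src_pair_pos[OF nxl(1)] using that hs srcW_nx[OF ij(1)] by simp
  have o: "src (dcol n (int i, int j) 3) = pair_pos n j i (has t 0)" if "has t 3"
    unfolding dc src_pair_pos[OF ij(1)] using that hs srcS_nx[OF ij(2)] by simp
  show ?thesis
    unfolding r tc using t f g e o unfolding types_eq
    by (elim insertE; cases c) (auto simp: has_def dir1_def dir2_def)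
qed

lemma of_nat_eq_0_bit_iff: "of_nat m = (0::bit) \<longleftrightarrow> even m"
  by (induction m) auto

lemma parity_sum_pairs:
  fixes N :: nat
  shows "(\<Sum>(a, b) | a < b \<and> b < N. of_bool (f b < f a) :: bit) = (\<Sum>a<N. \<Sum>b<N. of_bool (a < b \<and> f b < (f a :: nat)))"
proof -
  have "(\<Sum>a<N. \<Sum>b<N. of_bool (a < b \<and> f b < f a)) = (\<Sum>(a, b)\<in>{..<N} \<times> {..<N}. of_bool (a < b \<and> f b < f a) :: bit)"
    by (simp only: sum.cartesian_product)
  also have "\<dots> = (\<Sum>(a, b) | a < b \<and> b < N. of_bool (f b < f a))"
    by (rule sum.mono_neutral_cong_right) auto
  finally show ?thesis ..
qed

text \<open>The columns chosen by a configuration form a permutation whose inverse is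
  \<open>src\<close>, and a permutation has the sign of its inverse.\<close>

lemma dt_types_of:
  assumes \<sigma>: "\<sigma> \<in> tor_configs n" and n: "n \<ge> 2"
  shows "dt (2 * (n * n)) (\<lambda>r. unit_row (tcol n (types_of n \<sigma>) r)) =
     (of_int (wind_sign n (windH n \<sigma>) (windV n \<sigma>)) :: 'a::comm_ring_1)"
proof -
  obtain h u where hu: "\<sigma> = (h, u)" by (cases \<sigma>)
  interpret torus_paths n "occW h" "occS u" by (rule tor_configs_paths) (use \<sigma> hu n in auto)
  define T where "T = types_of n (h, u)"
  define M where "M = 2 * (n * n)"
  have st: "src (tcol n T r) = r" if "r < M" for r
    using src_tcol[OF _ n T_def] \<sigma> hu that M_def by simp
  have tl: "tcol n T r < M" for r
    unfolding tcol_def M_def by (rule dcol_less) (use n in simp)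
  define p where "p = (\<lambda>r. if r < M then tcol n T r else r)"
  have "bij_betw p {0..<M} {0..<M}"
  proof (rule bij_betwI')
    show "p x = p y \<longleftrightarrow> x = y" if "x \<in> {0..<M}" "y \<in> {0..<M}" for x y
      using that st by (auto simp: p_def) metis
    show "p x \<in> {0..<M}" if "x \<in> {0..<M}" for x using that tl by (simp add: p_def)
    have inj: "inj_on p {0..<M}" using st by (auto simp: inj_on_def p_def) metis
    have "p ` {0..<M} = {0..<M}"
      by (rule endo_inj_surj[OF _ _ inj]) (use tl in \<open>auto simp: p_def\<close>)
    then show "\<exists>x\<in>{0..<M}. y = p x" if "y \<in> {0..<M}" for y using that by blast
  qed
  then have p: "p permutes {0..<M}" by (rule bij_imp_permutes) (simp add: p_def)
  have inv: "Hilbert_Choice.inv p y = src y" if "y < M" for y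
  proof -
    have "Hilbert_Choice.inv p y < M" using permutes_in_image[OF permutes_inv[OF p], of y] that by simp
    then have "src (p (Hilbert_Choice.inv p y)) = Hilbert_Choice.inv p y" using st by (simp add: p_def)
    then show ?thesis using permutes_inverses(1)[OF p] by simp
  qed
  have "sign p = sign (Hilbert_Choice.inv p)"
    using sign_inverse[OF permutes_imp_permutation[OF finite_atLeastLessThan p]] by simp
  also have "\<dots> = (if (\<Sum>(a, b) | a < b \<and> b < M. of_bool (Hilbert_Choice.inv p b < Hilbert_Choice.inv p a) :: bit) = 0 then 1 else - 1)"
    by (rule sign_eq_inversion_parity) (rule permutes_inv[OF p])
  also have "(\<Sum>(a, b) | a < b \<and> b < M. of_bool (Hilbert_Choice.inv p b < Hilbert_Choice.inv p a) :: bit) = 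
      (\<Sum>a<M. \<Sum>b<M. of_bool (a < b \<and> src b < src a))"
    unfolding parity_sum_pairs by (intro sum.cong refl) (simp add: inv)
  also have "\<dots> = (of_nat n + 1) * P + (of_nat n + 1) * Q + Q * P"
    unfolding M_def by (rule inversion_parity) (simp_all add: src_pair_pos)
  also have "P = of_nat (windH n \<sigma>)" unfolding P_def windH_def hu H_def of_nat_sum by (simp only: of_nat_of_bool fst_conv)
  also have "Q = of_nat (windV n \<sigma>)" unfolding Q_def windV_def hu S_def of_nat_sum by (simp only: of_nat_of_bool snd_conv)
  also have "(of_nat n + 1) * of_nat (windH n \<sigma>) + (of_nat n + 1) * of_nat (windV n \<sigma>) + of_nat (windV n \<sigma>) * of_nat (windH n \<sigma>)
      = (of_nat ((n + 1) * windH n \<sigma> + (n + 1) * windV n \<sigma> + windV n \<sigma> * windH n \<sigma>) :: bit)"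
    by (simp only: of_nat_add of_nat_mult of_nat_1)
  finally have "sign p = wind_sign n (windH n \<sigma>) (windV n \<sigma>)"
    unfolding wind_sign_def by (simp only: of_nat_eq_0_bit_iff)
  moreover have "dt M (\<lambda>r. unit_row (tcol n T r)) = dt M (\<lambda>r. unit_row (p r) :: nat \<Rightarrow> 'a)"
    by (rule dt_cong) (simp add: p_def)
  ultimately show ?thesis using dt_unit_rows[OF p] unfolding T_def M_def hu by simp
qed

lemma tor_configs_vtype_cong:
  assumes "(h, u) \<in> tor_configs n" "fst v mod int n = fst w mod int n" "snd v mod int n = snd w mod int n"
  shows "vtype h u v = vtype h u w"
proof -
  obtain i j i' j' where vw: "v = (i, j)" "w = (i', j')" by (cases v; cases w)
  note c = tor_configs_periodic_cong[OF assms(1)]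
  have m: "(i - 1) mod int n = (i' - 1) mod int n" "(j - 1) mod int n = (j' - 1) mod int n"
    using assms(2,3) vw by (auto intro: mod_diff_cong)
  have "h (i - 1, j) = h (i' - 1, j')" "h (i, j) = h (i', j')" "u (i, j - 1) = u (i', j' - 1)" "u (i, j) = u (i', j')"
    using assms(2,3) m unfolding vw by (auto intro!: c)
  then show ?thesis unfolding vw vtype_def by simp
qed

lemma vtype_dec_enc:
  "(h, u) \<in> tor_configs n \<Longrightarrow> n > 0 \<Longrightarrow> vtype h u (dec n (enc n v)) = vtype h u v"
proof (rule tor_configs_vtype_cong)
  have mm: "x mod int n mod int n = x mod int n" for x by (rule mod_mod_trivial)
  assume "n > 0"
  then show "fst (dec n (enc n v)) mod int n = fst v mod int n" "snd (dec n (enc n v)) mod int n = snd v mod int n"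
    by (simp_all only: dec_enc fst_conv snd_conv mm)
qed

lemma types_of_PiE: "\<sigma> \<in> tor_configs n \<Longrightarrow> types_of n \<sigma> \<in> PiE {..<n * n} (\<lambda>_. {1..6})"
  unfolding types_of_def using tor_configs_vtype[of "fst \<sigma>" "snd \<sigma>" n] by (auto simp: PiE_iff)

lemma types_of_inj: "n > 0 \<Longrightarrow> inj_on (types_of n) (tor_configs n)"
proof (rule inj_onI)
  fix \<sigma> \<sigma>' assume n: "n > 0" and s: "\<sigma> \<in> tor_configs n" "\<sigma>' \<in> tor_configs n" and eq: "types_of n \<sigma> = types_of n \<sigma>'"
  obtain h u h' u' where hu: "\<sigma> = (h, u)" "\<sigma>' = (h', u')" by (cases \<sigma>; cases \<sigma>')
  have vt: "vtype h u v = vtype h' u' v" for v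
  proof -
    have "types_of n \<sigma> (enc n v) = types_of n \<sigma>' (enc n v)" using eq by simp
    then show ?thesis using enc_less[OF n, of v] s n unfolding hu types_of_def by (simp add: vtype_dec_enc)
  qed
  have "h (i, j) = h' (i, j)" "u (i, j) = u' (i, j)" for i j
    using vtype_has(3,4)[of h u i j] vtype_has(3,4)[of h' u' i j] vt[of "(i, j)"] s hu tor_configs_vtype by metis+
  then show "\<sigma> = \<sigma>'" unfolding hu by auto
qed

lemma succ_mod_neq: "n \<ge> 2 \<Longrightarrow> (x + 1) mod int n \<noteq> x mod int n"
proof
  assume n: "n \<ge> 2" and "(x + 1) mod int n = x mod int n"
  then have "int n dvd (x + 1) - x" by (simp only: mod_eq_dvd_iff)
  then have "int n dvd 1" by simp
  then show False using n zdvd_imp_le[of "int n" 1] by simp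
qed

lemma enc_shift_eq:
  assumes "n > 0"
  shows "enc n (x + 1, y) = enc n (x' + 1, y') \<longleftrightarrow> enc n (x, y) = enc n (x', y')"
    "enc n (x, y + 1) = enc n (x', y' + 1) \<longleftrightarrow> enc n (x, y) = enc n (x', y')"
  unfolding enc_eq_iff[OF assms] fst_conv snd_conv mod_eq_dvd_iff by simp_all

lemma dcol_dec_enc: "n > 0 \<Longrightarrow> dcol n (dec n (enc n v)) d = dcol n v d"
  unfolding dcol_def dshift_def by (auto simp: dec_enc enc_eq_iff mod_simps)

text \<open>If the determinant does not vanish, distinct rows choose distinct columns, so every edge
  is chosen exactly once. Each edge then points into exactly one of its ends, and the types fit
  together to an orientation.\<close>

lemma dt_types_nonzero:
  assumes n: "n \<ge> 2" and T: "T \<in> PiE {..<n * n} (\<lambda>_. {1..6})"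
    and nz: "dt (2 * (n * n)) (\<lambda>r. unit_row (tcol n T r)) \<noteq> (0 :: 'a::comm_ring_1)"
  obtains \<sigma> where "\<sigma> \<in> tor_configs n" "T = types_of n \<sigma>"
proof -
  define M where "M = 2 * (n * n)"
  have n0: "n > 0" using n by simp
  have inj: "r = s" if "r < M" "s < M" "tcol n T r = tcol n T s" for r s
    using dt_unit_rows_not_inj[of r M s "tcol n T"] nz that unfolding M_def by (cases "r = s") auto
  have less: "tcol n T r < M" for r unfolding tcol_def M_def by (rule dcol_less[OF n0])
  have surj: "\<exists>r<M. tcol n T r = c" if "c < M" for c
  proof -
    have "tcol n T ` {..<M} = {..<M}"
      by (rule endo_inj_surj) (use less inj in \<open>auto simp: inj_on_def\<close>)
    then have "c \<in> tcol n T ` {..<M}" using that by simp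
    then show ?thesis by auto
  qed
  define t where "t v = T (enc n v)" for v
  have t6: "t v \<in> {1..6}" for v unfolding t_def using T enc_less[OF n0, of v] by (auto simp: PiE_iff)
  have row: "\<exists>r<M. r div 2 = enc n v \<and> tcol n T r = dcol n v d" if hd: "has (t v) d" for v d
  proof -
    have e: "enc n v < n * n" by (rule enc_less[OF n0])
    consider "dir1 (t v) = d" | "dir2 (t v) = d" using hd unfolding has_def by blast
    then show ?thesis
    proof cases
      case 1
      then show ?thesis using e
        by (intro exI[of _ "2 * enc n v"]) (simp add: M_def tcol_def t_def dcol_dec_enc n0)
    next
      case 2
      then show ?thesis using e
        by (intro exI[of _ "2 * enc n v + 1"]) (simp add: M_def tcol_def t_def dcol_dec_enc n0)
    qed
  qed
  have hit: "\<exists>v d. has (t v) d \<and> d < 4 \<and> dcol n v d = c" if c: "c < M" for c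
  proof -
    obtain r where r: "r < M" "tcol n T r = c" using surj[OF c] by auto
    have "r div 2 < n * n" using r unfolding M_def by linarith
    then have "t (dec n (r div 2)) = T (r div 2)" unfolding t_def by (simp add: enc_dec)
    moreover have "dir1 x < 4" "dir2 x < 4" for x unfolding dir1_def dir2_def by auto
    ultimately show ?thesis using r(2) unfolding tcol_def has_def by (metis (full_types))
  qed
  have ex: "has (t (x, y)) 2 \<longleftrightarrow> \<not> has (t (x + 1, y)) 0" for x y
  proof -
    have c: "dcol n (x, y) 2 = dcol n (x + 1, y) 0" by (simp add: dcol_def dshift_def)
    \<comment> \<open>As \<open>n \<ge> 2\<close>, the two ends of an edge are distinct vertices;
      the two rows found below are therefore different.\<close>
    have neq: "enc n (x, y) \<noteq> enc n (x + 1, y)" using succ_mod_neq[OF n, of x] unfolding enc_eq_iff[OF n0] by auto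
    have "\<not> (has (t (x, y)) 2 \<and> has (t (x + 1, y)) 0)"
    proof
      assume a: "has (t (x, y)) 2 \<and> has (t (x + 1, y)) 0"
      obtain r where r: "r < M" "r div 2 = enc n (x, y)" "tcol n T r = dcol n (x, y) 2" using row a by blast
      obtain s where s: "s < M" "s div 2 = enc n (x + 1, y)" "tcol n T s = dcol n (x + 1, y) 0" using row a by blast
      show False using inj[OF r(1) s(1)] r s c neq by simp
    qed
    moreover have "has (t (x, y)) 2 \<or> has (t (x + 1, y)) 0"
    proof -
      obtain v d where vd: "has (t v) d" "d < 4" "dcol n v d = dcol n (x + 1, y) 0"
        using hit[of "dcol n (x + 1, y) 0"] dcol_less[OF n0] unfolding M_def by blast
      obtain a b where v: "v = (a, b)" by (cases v)
      have "d \<noteq> 1 \<and> d \<noteq> 3"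
      proof -
        have "even (dcol n v d)" unfolding vd(3) by (simp add: dcol_def)
        then show ?thesis by (auto simp: dcol_def)
      qed
      then consider "d = 0" | "d = 2" using vd(2) by linarith
      then show ?thesis
      proof cases
        case 1
        then have "enc n v = enc n (x + 1, y)" using vd(3) by (simp add: dcol_def dshift_def)
        then show ?thesis using vd(1) 1 unfolding t_def by simp
      next
        case 2
        then have "enc n (a + 1, b) = enc n (x + 1, y)" using vd(3) unfolding v by (simp add: dcol_def dshift_def)
        then have "enc n v = enc n (x, y)" unfolding v enc_shift_eq[OF n0] .
        then show ?thesis using vd(1) 2 unfolding t_def by simp
      qed
    qed
    ultimately show ?thesis by blast
  qed
  have ey: "has (t (x, y)) 3 \<longleftrightarrow> \<not> has (t (x, y + 1)) 1" for x y
  proof -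
    have c: "dcol n (x, y) 3 = dcol n (x, y + 1) 1" by (simp add: dcol_def dshift_def)
    have neq: "enc n (x, y) \<noteq> enc n (x, y + 1)" using succ_mod_neq[OF n, of y] unfolding enc_eq_iff[OF n0] by auto
    have "\<not> (has (t (x, y)) 3 \<and> has (t (x, y + 1)) 1)"
    proof
      assume a: "has (t (x, y)) 3 \<and> has (t (x, y + 1)) 1"
      obtain r where r: "r < M" "r div 2 = enc n (x, y)" "tcol n T r = dcol n (x, y) 3" using row a by blast
      obtain s where s: "s < M" "s div 2 = enc n (x, y + 1)" "tcol n T s = dcol n (x, y + 1) 1" using row a by blast
      show False using inj[OF r(1) s(1)] r s c neq by simp
    qed
    moreover have "has (t (x, y)) 3 \<or> has (t (x, y + 1)) 1"
    proof -
      obtain v d where vd: "has (t v) d" "d < 4" "dcol n v d = dcol n (x, y + 1) 1"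
        using hit[of "dcol n (x, y + 1) 1"] dcol_less[OF n0] unfolding M_def by blast
      obtain a b where v: "v = (a, b)" by (cases v)
      have "d \<noteq> 0 \<and> d \<noteq> 2"
      proof -
        have "odd (dcol n v d)" unfolding vd(3) by (simp add: dcol_def)
        then show ?thesis by (cases "d = 0"; cases "d = 2"; simp add: dcol_def)
      qed
      then consider "d = 1" | "d = 3" using vd(2) by linarith
      then show ?thesis
      proof cases
        case 1
        then have "enc n v = enc n (x, y + 1)" using vd(3) by (simp add: dcol_def dshift_def)
        then show ?thesis using vd(1) 1 unfolding t_def by simp
      next
        case 2
        then have "enc n (a, b + 1) = enc n (x, y + 1)" using vd(3) unfolding v by (simp add: dcol_def dshift_def)
        then have "enc n v = enc n (x, y)" unfolding v enc_shift_eq[OF n0] .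
        then show ?thesis using vd(1) 2 unfolding t_def by simp
      qed
    qed
    ultimately show ?thesis by blast
  qed
  \<comment> \<open>The edge to the right of a vertex points east iff it points into its right
    end.\<close>
  define h where "h = (\<lambda>(x, y). has (t (x + 1, y)) 0)"
  define u where "u = (\<lambda>(x, y). has (t (x, y + 1)) 1)"
  have vt: "vtype h u v = t v" for v
  proof -
    obtain x y where v: "v = (x, y)" by (cases v)
    show ?thesis unfolding v
      by (rule vtype_of_has[OF t6]) (simp_all add: h_def u_def ex ey)
  qed
  have "t (x mod int n + 1, y mod int n) = t (x + 1, y)" "t (x mod int n, y mod int n + 1) = t (x, y + 1)" for x y
    unfolding t_def by (auto intro!: arg_cong[where f = T] simp: enc_eq_iff[OF n0] mod_simps)
  then have "(h, u) \<in> tor_configs n"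
    unfolding tor_configs_def using vt t6 by (auto simp: h_def u_def)
  moreover have "T = types_of n (h, u)"
  proof
    fix q
    show "T q = types_of n (h, u) q"
    proof (cases "q < n * n")
      case True
      then show ?thesis by (simp add: types_of_def vt t_def enc_dec)
    next
      case False
      then show ?thesis using T by (auto simp: types_of_def PiE_def extensional_def)
    qed
  qed
  ultimately show ?thesis by (rule that)
qed

lemma finite_tor_configs: "n > 0 \<Longrightarrow> finite (tor_configs n)"
proof -
  assume n: "n > 0"
  have "types_of n ` tor_configs n \<subseteq> PiE {..<n * n} (\<lambda>_. {1..6})" using types_of_PiE by blast
  then have "finite (types_of n ` tor_configs n)" by (rule finite_subset) (simp add: finite_PiE)
  then show ?thesis using types_of_inj[OF n] by (rule finite_imageD)
qed

text \<open>Type assignments that do not match along some edge have determinant zero, so only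
  configurations contribute, each with its winding sign.\<close>

lemma config_sum:
  fixes m :: "nat \<Rightarrow> nat \<Rightarrow> 'a::comm_ring_1"
  assumes n: "n \<ge> 2"
  shows "(\<Sum>T\<in>PiE {..<n * n} (\<lambda>_. {1..6}). (\<Prod>q<n * n. m q (T q)) * dt (2 * (n * n)) (\<lambda>r. unit_row (tcol n T r)))
    = (\<Sum>\<sigma>\<in>tor_configs n. (\<Prod>q<n * n. m q (vtype (fst \<sigma>) (snd \<sigma>) (dec n q))) * of_int (wind_sign n (windH n \<sigma>) (windV n \<sigma>)))"
proof -
  have n0: "n > 0" using n by simp
  have "(\<Sum>T\<in>PiE {..<n * n} (\<lambda>_. {1..6}). (\<Prod>q<n * n. m q (T q)) * dt (2 * (n * n)) (\<lambda>r. unit_row (tcol n T r)))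
    = (\<Sum>T\<in>types_of n ` tor_configs n. (\<Prod>q<n * n. m q (T q)) * dt (2 * (n * n)) (\<lambda>r. unit_row (tcol n T r)))"
  proof (rule sum.mono_neutral_right)
    show "finite (PiE {..<n * n} (\<lambda>_. {1..6::nat}))" by (simp add: finite_PiE)
    show "types_of n ` tor_configs n \<subseteq> PiE {..<n * n} (\<lambda>_. {1..6})" using types_of_PiE by blast
    show "\<forall>T\<in>PiE {..<n * n} (\<lambda>_. {1..6}) - types_of n ` tor_configs n.
       (\<Prod>q<n * n. m q (T q)) * dt (2 * (n * n)) (\<lambda>r. unit_row (tcol n T r)) = 0"
    proof
      fix T assume "T \<in> PiE {..<n * n} (\<lambda>_. {1..6}) - types_of n ` tor_configs n"
      then have T: "T \<in> PiE {..<n * n} (\<lambda>_. {1..6})" "T \<notin> types_of n ` tor_configs n" by blast+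
      have "dt (2 * (n * n)) (\<lambda>r. unit_row (tcol n T r)) = (0 :: 'a)"
        by (rule ccontr) (use dt_types_nonzero[OF n T(1)] T(2) in blast)
      then show "(\<Prod>q<n * n. m q (T q)) * dt (2 * (n * n)) (\<lambda>r. unit_row (tcol n T r)) = 0" by simp
    qed
  qed
  also have "\<dots> = (\<Sum>\<sigma>\<in>tor_configs n. (\<Prod>q<n * n. m q (vtype (fst \<sigma>) (snd \<sigma>) (dec n q))) * of_int (wind_sign n (windH n \<sigma>) (windV n \<sigma>)))"
    unfolding sum.reindex[OF types_of_inj[OF n0]] o_def
  proof (rule sum.cong[OF refl])
    fix \<sigma> assume s: "\<sigma> \<in> tor_configs n"
    have "(\<Prod>q<n * n. m q (types_of n \<sigma> q)) = (\<Prod>q<n * n. m q (vtype (fst \<sigma>) (snd \<sigma>) (dec n q)))"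
      by (rule prod.cong) (simp_all add: types_of_def)
    then show "(\<Prod>q<n * n. m q (types_of n \<sigma> q)) * dt (2 * (n * n)) (\<lambda>r. unit_row (tcol n (types_of n \<sigma>) r)) =
        (\<Prod>q<n * n. m q (vtype (fst \<sigma>) (snd \<sigma>) (dec n q))) * of_int (wind_sign n (windH n \<sigma>) (windV n \<sigma>))"
      unfolding dt_types_of[OF s n] by (rule arg_cong)
  qed
  finally show ?thesis .
qed

section \<open>The weighted matrix and its determinant\<close>

definition xmono :: "complex \<Rightarrow> complex \<Rightarrow> nat \<Rightarrow> complex" where
  "xmono u1 u2 t = (if has t 2 then u1 else 1) * (if has t 3 then u2 else 1)"

text \<open>An unoccupied edge stays in place with entry 1, an occupied western edge continues to
  the east or to the north. The entries of \<open>entW\<close> and \<open>entS\<close> are chosen so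
  that their 2x2 minors are the vertex weights; \<open>u1\<close> and \<open>u2\<close> mark
  occupied horizontal and vertical edges.\<close>

definition entW :: "real \<Rightarrow> real \<Rightarrow> complex \<Rightarrow> complex \<Rightarrow> nat \<Rightarrow> complex" where
  "entW \<alpha> \<gamma> u1 u2 d = (if d = 0 then 1 else if d = 1 then 0 else if d = 2 then of_real \<alpha> * u1 else of_real \<gamma> * u2)"

definition entS :: "real \<Rightarrow> real \<Rightarrow> complex \<Rightarrow> complex \<Rightarrow> nat \<Rightarrow> complex" where
  "entS \<beta> \<gamma> u1 u2 d = (if d = 0 then 0 else if d = 1 then 1 else if d = 2 then of_real \<gamma> * u1 else of_real \<beta> * u2)"

definition kast :: "nat \<Rightarrow> real \<Rightarrow> real \<Rightarrow> real \<Rightarrow> complex \<Rightarrow> complex \<Rightarrow> nat \<Rightarrow> nat \<Rightarrow> complex" where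
  "kast n \<alpha> \<beta> \<gamma> u1 u2 r = (\<lambda>j. \<Sum>d<4. (if even r then entW \<alpha> \<gamma> u1 u2 d else entS \<beta> \<gamma> u1 u2 d)
     * unit_row (dcol n (dec n (r div 2)) d) j)"

definition twisted_sum :: "nat \<Rightarrow> real \<Rightarrow> real \<Rightarrow> real \<Rightarrow> complex \<Rightarrow> complex \<Rightarrow>
    ((int \<times> int \<Rightarrow> bool) \<times> (int \<times> int \<Rightarrow> bool)) set \<Rightarrow> complex" where
  "twisted_sum n \<alpha> \<beta> \<gamma> u1 u2 E = (\<Sum>\<sigma>\<in>tor_configs n \<inter> E. of_int (wind_sign n (windH n \<sigma>) (windV n \<sigma>)) *
     of_real (config_weight n (ff_weights \<alpha> \<beta> \<gamma>) \<sigma>) * u1 ^ (n * windH n \<sigma>) * u2 ^ (n * windV n \<sigma>))"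

text \<open>The free-fermion relation enters here: the minor of type 2 is \<open>u1 * u2\<close>
  times \<gamma>^2 - \<alpha> * \<beta>, and the other five reduce to single entries.\<close>

lemma minor_eq:
  assumes "t \<in> {1..6}"
  shows "entW \<alpha> \<gamma> u1 u2 (dir1 t) * entS \<beta> \<gamma> u1 u2 (dir2 t) - entW \<alpha> \<gamma> u1 u2 (dir2 t) * entS \<beta> \<gamma> u1 u2 (dir1 t) =
    of_real (ff_weights \<alpha> \<beta> \<gamma> t) * xmono u1 u2 t"
  using assms unfolding types_eq
  by (elim insertE) (simp_all add: entW_def entS_def dir1_def dir2_def xmono_def has_def ff_weights_def
      power2_eq_square algebra_simps)

lemma kast_step:
  assumes "q < n * n"
  shows "dt (2 * (n * n)) (M(2 * q := kast n \<alpha> \<beta> \<gamma> u1 u2 (2 * q), 2 * q + 1 := kast n \<alpha> \<beta> \<gamma> u1 u2 (2 * q + 1))) =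
    (\<Sum>t\<in>{1..6}. of_real (ff_weights \<alpha> \<beta> \<gamma> t) * xmono u1 u2 t *
      dt (2 * (n * n)) (M(2 * q := unit_row (dcol n (dec n q) (dir1 t)), 2 * q + 1 := unit_row (dcol n (dec n q) (dir2 t)))))"
proof -
  have k: "kast n \<alpha> \<beta> \<gamma> u1 u2 (2 * q) = (\<lambda>j. \<Sum>d<4. entW \<alpha> \<gamma> u1 u2 d * unit_row (dcol n (dec n q) d) j)"
    "kast n \<alpha> \<beta> \<gamma> u1 u2 (2 * q + 1) = (\<lambda>j. \<Sum>d<4. entS \<beta> \<gamma> u1 u2 d * unit_row (dcol n (dec n q) d) j)"
    unfolding kast_def by simp_all
  show ?thesis
    unfolding k by (subst dt_two_rows) (use assms minor_eq in simp_all)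
qed

text \<open>Every occupied edge is counted at the vertex of which it is the eastern or northern
  edge. All columns carry \<open>windH\<close> and all rows \<open>windV\<close> occupied edges, so
  the exponents are \<open>n\<close> times the winding numbers.\<close>

lemma weight_prod:
  assumes \<sigma>: "\<sigma> \<in> tor_configs n" and n: "n \<ge> 2"
  shows "(\<Prod>q<n * n. of_real (a (vtype (fst \<sigma>) (snd \<sigma>) (dec n q))) * xmono u1 u2 (vtype (fst \<sigma>) (snd \<sigma>) (dec n q))) =
    of_real (config_weight n a \<sigma>) * u1 ^ (n * windH n \<sigma>) * u2 ^ (n * windV n \<sigma>)"
proof -
  obtain h u where hu: "\<sigma> = (h, u)" by (cases \<sigma>)
  have hu': "(h, u) \<in> tor_configs n" using \<sigma> hu by simp
  interpret torus_paths n "occW h" "occS u" by (rule tor_configs_paths) fact+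
  have pw: "(\<Prod>q\<in>A. if P q then z else 1) = z ^ (\<Sum>q\<in>A. of_bool (P q))" if "finite A" for A :: "nat set" and P and z :: complex
    using that by induction auto
  have cnt: "(\<Sum>q<n * n. of_bool (has (vtype h u (dec n q)) 2)) = n * windH n \<sigma>"
    "(\<Sum>q<n * n. of_bool (has (vtype h u (dec n q)) 3)) = n * windV n \<sigma>"
  proof -
    have *: "has (vtype h u (dec n (j * n + i))) 2 = occW h (nx i) j" "has (vtype h u (dec n (j * n + i))) 3 = occS u i (nx j)"
      if "i < n" "j < n" for i j
      using vtype_has(3,4)[of h u "int i" "int j"] tor_configs_vtype[OF hu'] occ_succ[OF hu' that] that
      unfolding nx_def by (simp_all add: dec_pos)
    show "(\<Sum>q<n * n. of_bool (has (vtype h u (dec n q)) 2)) = n * windH n \<sigma>"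
      unfolding windH_def hu fst_conv total_counts(1)[symmetric] sum_lessThan_mult
      by (intro sum.cong refl) (simp add: *)
    show "(\<Sum>q<n * n. of_bool (has (vtype h u (dec n q)) 3)) = n * windV n \<sigma>"
      unfolding windV_def hu snd_conv total_counts(2)[symmetric] sum_lessThan_mult
      by (intro sum.cong refl) (simp add: *)
  qed
  have "config_weight n a \<sigma> = (\<Prod>q<n * n. a (vtype h u (dec n q)))"
    unfolding config_weight_def hu fst_conv snd_conv
  proof (rule prod.reindex_bij_witness[of _ "dec n" "enc n"])
    fix q assume "q \<in> {..<n * n}"
    then have "q < n * n" by simp
    then show "enc n (dec n q) = q" by (rule enc_dec)
    show "dec n q \<in> {0..<int n} \<times> {0..<int n}"
      using \<open>q < n * n\<close> n by (simp add: dec_def less_mult_imp_div_less)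
  next
    fix v assume v: "v \<in> {0..<int n} \<times> {0..<int n}"
    then show "dec n (enc n v) = v" using n by (auto simp: dec_enc)
    then show "a (vtype h u (dec n (enc n v))) = a (vtype h u v)" by simp
    show "enc n v \<in> {..<n * n}" using enc_less[of n v] n by simp
  qed
  then show ?thesis
    unfolding hu fst_conv snd_conv xmono_def prod.distrib
    by (simp add: pw cnt[unfolded hu] mult.assoc of_real_prod)
qed

theorem dt_kast:
  assumes n: "n \<ge> 2"
  shows "dt (2 * (n * n)) (kast n \<alpha> \<beta> \<gamma> u1 u2) = twisted_sum n \<alpha> \<beta> \<gamma> u1 u2 UNIV"
proof -
  have "dt (2 * (n * n)) (kast n \<alpha> \<beta> \<gamma> u1 u2) = (\<Sum>T\<in>PiE {..<n * n} (\<lambda>_. {1..6}).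
      (\<Prod>q<n * n. of_real (ff_weights \<alpha> \<beta> \<gamma> (T q)) * xmono u1 u2 (T q)) *
      dt (2 * (n * n)) (\<lambda>r. if even r then unit_row (dcol n (dec n (r div 2)) (dir1 (T (r div 2))))
         else unit_row (dcol n (dec n (r div 2)) (dir2 (T (r div 2))))))"
    by (rule dt_expand_pairs) (rule finite_atLeastAtMost, rule kast_step)
  also have "\<dots> = (\<Sum>T\<in>PiE {..<n * n} (\<lambda>_. {1..6}).
      (\<Prod>q<n * n. of_real (ff_weights \<alpha> \<beta> \<gamma> (T q)) * xmono u1 u2 (T q)) * dt (2 * (n * n)) (\<lambda>r. unit_row (tcol n T r)))"
    by (intro sum.cong refl arg_cong2[where f = "(*)"] dt_cong) (simp add: tcol_def)
  also have "\<dots> = twisted_sum n \<alpha> \<beta> \<gamma> u1 u2 UNIV"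
    unfolding config_sum[OF n, of "\<lambda>_ t. of_real (ff_weights \<alpha> \<beta> \<gamma> t) * xmono u1 u2 t"] twisted_sum_def Int_UNIV_right
  proof (rule sum.cong[OF refl])
    fix \<sigma> assume s: "\<sigma> \<in> tor_configs n"
    show "(\<Prod>q<n * n. of_real (ff_weights \<alpha> \<beta> \<gamma> (vtype (fst \<sigma>) (snd \<sigma>) (dec n q))) * xmono u1 u2 (vtype (fst \<sigma>) (snd \<sigma>) (dec n q))) *
        of_int (wind_sign n (windH n \<sigma>) (windV n \<sigma>)) =
        of_int (wind_sign n (windH n \<sigma>) (windV n \<sigma>)) * of_real (config_weight n (ff_weights \<alpha> \<beta> \<gamma>) \<sigma>) *
        u1 ^ (n * windH n \<sigma>) * u2 ^ (n * windV n \<sigma>)"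
      unfolding weight_prod[OF s n] by (simp only: mult_ac)
  qed
  finally show ?thesis .
qed

text \<open>Conditioning on the types at the vertices \<open>vs\<close> amounts to replacing the rows of these vertices by unit rows.\<close>

definition kast_event :: "nat \<Rightarrow> real \<Rightarrow> real \<Rightarrow> real \<Rightarrow> complex \<Rightarrow> complex \<Rightarrow> (int \<times> int) list \<Rightarrow> nat list \<Rightarrow> nat \<Rightarrow> nat \<Rightarrow> complex" where
  "kast_event n \<alpha> \<beta> \<gamma> u1 u2 vs ts r = (if \<exists>i<length vs. r div 2 = enc n (vs ! i)
     then let i = (SOME i. i < length vs \<and> r div 2 = enc n (vs ! i))
       in unit_row (dcol n (vs ! i) (if even r then dir1 (ts ! i) else dir2 (ts ! i)))
     else kast n \<alpha> \<beta> \<gamma> u1 u2 r)"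

lemma kast_event_at:
  assumes "inj_on (\<lambda>i. enc n (vs ! i)) {..<length vs}" "i < length vs" "r div 2 = enc n (vs ! i)"
  shows "kast_event n \<alpha> \<beta> \<gamma> u1 u2 vs ts r =
    unit_row (dcol n (vs ! i) (if even r then dir1 (ts ! i) else dir2 (ts ! i)))"
proof -
  have "(SOME i. i < length vs \<and> r div 2 = enc n (vs ! i)) = i"
    by (rule some_equality) (use assms in \<open>auto simp: inj_on_def\<close>)
  then show ?thesis unfolding kast_event_def using assms(2,3) by auto
qed

lemma kast_event_away:
  "\<not> (\<exists>i<length vs. r div 2 = enc n (vs ! i)) \<Longrightarrow> kast_event n \<alpha> \<beta> \<gamma> u1 u2 vs ts r = kast n \<alpha> \<beta> \<gamma> u1 u2 r"
  unfolding kast_event_def by (rule if_not_P)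

theorem dt_kast_event:
  assumes n: "n \<ge> 2" and inj: "inj_on (\<lambda>i. enc n (vs ! i)) {..<length vs}"
    and ts: "length ts = length vs" "set ts \<subseteq> {1..6}"
  shows "(\<Prod>i<length vs. of_real (ff_weights \<alpha> \<beta> \<gamma> (ts ! i)) * xmono u1 u2 (ts ! i)) *
     dt (2 * (n * n)) (kast_event n \<alpha> \<beta> \<gamma> u1 u2 vs ts) = twisted_sum n \<alpha> \<beta> \<gamma> u1 u2 (type_event vs ts)"
proof -
  have n0: "n > 0" using n by simp
  define w where "w t = of_real (ff_weights \<alpha> \<beta> \<gamma> t) * xmono u1 u2 t" for t
  define V where "V = (\<lambda>i. enc n (vs ! i)) ` {..<length vs}"
  define idx where "idx q = (SOME i. i < length vs \<and> q = enc n (vs ! i))" for q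
  have idx: "idx (enc n (vs ! i)) = i" if "i < length vs" for i
    unfolding idx_def by (rule some_equality) (use that inj in \<open>auto simp: inj_on_def\<close>)
  \<comment> \<open>At a prescribed vertex only the prescribed type has a nonzero coefficient; its
    weight is restored by the product in front of the determinant.\<close>
  define m where "m q t = (if q \<in> V then of_bool (t = ts ! idx q) else w t)" for q t
  have t6: "ts ! i \<in> {1..6}" if "i < length vs" for i
  proof -
    have "ts ! i \<in> set ts" using that ts(1) by simp
    then show ?thesis using ts(2) by blast
  qed
  have VN: "V \<subseteq> {..<n * n}" unfolding V_def by (auto intro: enc_less[OF n0])
  have "dt (2 * (n * n)) (kast_event n \<alpha> \<beta> \<gamma> u1 u2 vs ts) = (\<Sum>T\<in>PiE {..<n * n} (\<lambda>_. {1..6}).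
      (\<Prod>q<n * n. m q (T q)) *
      dt (2 * (n * n)) (\<lambda>r. if even r then unit_row (dcol n (dec n (r div 2)) (dir1 (T (r div 2))))
         else unit_row (dcol n (dec n (r div 2)) (dir2 (T (r div 2))))))"
  proof (rule dt_expand_pairs)
    fix q M assume q: "q < n * n"
    show "dt (2 * (n * n)) (M(2 * q := kast_event n \<alpha> \<beta> \<gamma> u1 u2 vs ts (2 * q), 2 * q + 1 := kast_event n \<alpha> \<beta> \<gamma> u1 u2 vs ts (2 * q + 1))) =
       (\<Sum>t\<in>{1..6}. m q t * dt (2 * (n * n)) (M(2 * q := unit_row (dcol n (dec n q) (dir1 t)), 2 * q + 1 := unit_row (dcol n (dec n q) (dir2 t)))))"
    proof (cases "q \<in> V")
      case False
      then have "\<not> (\<exists>i<length vs. (2 * q) div 2 = enc n (vs ! i))" "\<not> (\<exists>i<length vs. (2 * q + 1) div 2 = enc n (vs ! i))"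
        unfolding V_def by auto
      note aw = this[THEN kast_event_away]
      show ?thesis unfolding aw kast_step[OF q] m_def w_def using False by simp
    next
      case True
      then obtain i where i: "i < length vs" "q = enc n (vs ! i)" unfolding V_def by auto
      have "kast_event n \<alpha> \<beta> \<gamma> u1 u2 vs ts (2 * q) = unit_row (dcol n (dec n q) (dir1 (ts ! i)))"
        "kast_event n \<alpha> \<beta> \<gamma> u1 u2 vs ts (2 * q + 1) = unit_row (dcol n (dec n q) (dir2 (ts ! i)))"
        using kast_event_at[OF inj i(1), of "2 * q"] kast_event_at[OF inj i(1), of "2 * q + 1"] i(2)
        by (simp_all add: dcol_dec_enc[OF n0])
      moreover have "m q t = of_bool (t = ts ! i)" for t using True i idx by (simp add: m_def)
      ultimately show ?thesis
        using t6[OF i(1)] by (simp add: of_bool_def if_distrib[of "\<lambda>x. x * _"] sum.delta cong: if_cong)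
    qed
  qed simp
  also have "\<dots> = (\<Sum>T\<in>PiE {..<n * n} (\<lambda>_. {1..6}).
      (\<Prod>q<n * n. m q (T q)) * dt (2 * (n * n)) (\<lambda>r. unit_row (tcol n T r)))"
    by (intro sum.cong refl arg_cong2[where f = "(*)"] dt_cong) (simp add: tcol_def)
  also have "\<dots> = (\<Sum>\<sigma>\<in>tor_configs n. (\<Prod>q<n * n. m q (vtype (fst \<sigma>) (snd \<sigma>) (dec n q))) * of_int (wind_sign n (windH n \<sigma>) (windV n \<sigma>)))"
    by (rule config_sum[OF n])
  finally have "(\<Prod>i<length vs. w (ts ! i)) * dt (2 * (n * n)) (kast_event n \<alpha> \<beta> \<gamma> u1 u2 vs ts) =
    (\<Sum>\<sigma>\<in>tor_configs n. (\<Prod>i<length vs. w (ts ! i)) * ((\<Prod>q<n * n. m q (vtype (fst \<sigma>) (snd \<sigma>) (dec n q))) * of_int (wind_sign n (windH n \<sigma>) (windV n \<sigma>))))"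
    by (simp only: sum_distrib_left)
  also have "\<dots> = (\<Sum>\<sigma>\<in>tor_configs n. if \<sigma> \<in> type_event vs ts then of_int (wind_sign n (windH n \<sigma>) (windV n \<sigma>)) *
     of_real (config_weight n (ff_weights \<alpha> \<beta> \<gamma>) \<sigma>) * u1 ^ (n * windH n \<sigma>) * u2 ^ (n * windV n \<sigma>) else 0)"
  proof (rule sum.cong[OF refl])
    fix \<sigma> assume s: "\<sigma> \<in> tor_configs n"
    obtain h u where hu: "\<sigma> = (h, u)" by (cases \<sigma>)
    define t where "t q = vtype h u (dec n q)" for q
    have tv: "t (enc n (vs ! i)) = vtype h u (vs ! i)" for i
      unfolding t_def by (rule vtype_dec_enc) (use s hu n0 in auto)
    have split: "(\<Prod>q<n * n. m q (t q)) = (\<Prod>i<length vs. of_bool (vtype h u (vs ! i) = ts ! i)) * (\<Prod>q\<in>{..<n * n} - V. w (t q))"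
    proof -
      have "(\<Prod>q<n * n. m q (t q)) = (\<Prod>q\<in>{..<n * n} - V. m q (t q)) * (\<Prod>q\<in>V. m q (t q))"
        by (rule prod.subset_diff) (use VN in auto)
      also have "(\<Prod>q\<in>V. m q (t q)) = (\<Prod>i<length vs. m (enc n (vs ! i)) (t (enc n (vs ! i))))"
        unfolding V_def by (subst prod.reindex[OF inj]) simp
      also have "\<dots> = (\<Prod>i<length vs. of_bool (vtype h u (vs ! i) = ts ! i))"
        by (intro prod.cong refl) (simp add: m_def V_def idx tv)
      also have "(\<Prod>q\<in>{..<n * n} - V. m q (t q)) = (\<Prod>q\<in>{..<n * n} - V. w (t q))"
        by (intro prod.cong refl) (simp add: m_def)
      finally show ?thesis by (simp only: mult.commute)
    qed
    show "(\<Prod>i<length vs. w (ts ! i)) * ((\<Prod>q<n * n. m q (vtype (fst \<sigma>) (snd \<sigma>) (dec n q))) * of_int (wind_sign n (windH n \<sigma>) (windV n \<sigma>))) =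
      (if \<sigma> \<in> type_event vs ts then of_int (wind_sign n (windH n \<sigma>) (windV n \<sigma>)) *
     of_real (config_weight n (ff_weights \<alpha> \<beta> \<gamma>) \<sigma>) * u1 ^ (n * windH n \<sigma>) * u2 ^ (n * windV n \<sigma>) else 0)"
    proof (cases "\<sigma> \<in> type_event vs ts")
      case True
      then have ev: "vtype h u (vs ! i) = ts ! i" if "i < length vs" for i using that unfolding type_event_def hu by auto
      have "(\<Prod>i<length vs. w (ts ! i)) * (\<Prod>q<n * n. m q (t q)) = (\<Prod>i<length vs. w (t (enc n (vs ! i)))) * (\<Prod>q\<in>{..<n * n} - V. w (t q))"
        unfolding split using ev by (simp add: tv)
      also have "(\<Prod>i<length vs. w (t (enc n (vs ! i)))) = (\<Prod>q\<in>V. w (t q))"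
        unfolding V_def by (subst prod.reindex[OF inj]) simp
      also have "\<dots> * (\<Prod>q\<in>{..<n * n} - V. w (t q)) = (\<Prod>q<n * n. w (t q))"
        by (subst prod.subset_diff[OF VN]) (simp_all add: mult.commute)
      also have "\<dots> = of_real (config_weight n (ff_weights \<alpha> \<beta> \<gamma>) \<sigma>) * u1 ^ (n * windH n \<sigma>) * u2 ^ (n * windV n \<sigma>)"
        using weight_prod[OF s n, of "ff_weights \<alpha> \<beta> \<gamma>" u1 u2] unfolding w_def t_def hu by simp
      finally show ?thesis using True unfolding t_def hu by (simp add: mult_ac)
    next
      case False
      then obtain i where "i < length vs" "vtype h u (vs ! i) \<noteq> ts ! i" unfolding type_event_def hu by auto
      then have "(\<Prod>i<length vs. of_bool (vtype h u (vs ! i) = ts ! i)) = (0 :: complex)"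
        by (intro prod_zero) auto
      then show ?thesis using False split unfolding t_def hu by simp
    qed
  qed
  also have "\<dots> = twisted_sum n \<alpha> \<beta> \<gamma> u1 u2 (type_event vs ts)"
    unfolding twisted_sum_def by (rule sum.inter_restrict[symmetric]) (rule finite_tor_configs[OF n0])
  finally show ?thesis unfolding w_def .
qed

section \<open>Fourier diagonalisation and the inverse matrix\<close>

definition rt :: "nat \<Rightarrow> nat \<Rightarrow> complex" where
  "rt n k = cis (2 * pi * real k / real n)"

lemma rt_nonzero [simp]: "rt n k \<noteq> 0" and norm_rt [simp]: "norm (rt n k) = 1"
  unfolding rt_def by simp_all

lemma rt_power: "n > 0 \<Longrightarrow> rt n k ^ n = 1"
  unfolding rt_def by (simp add: Complex.DeMoivre)

lemma rt_powi_n: "n > 0 \<Longrightarrow> rt n k powi (int n * a) = 1"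
  by (simp add: power_int_mult rt_power)

lemma rt_powi_mod:
  assumes "n > 0"
  shows "rt n k powi (a mod int n) = rt n k powi a"
proof -
  have "rt n k powi a = rt n k powi (int n * (a div int n) + a mod int n)" by simp
  also have "\<dots> = rt n k powi (a mod int n)" 
    unfolding power_int_add[OF disjI1[OF rt_nonzero]] rt_powi_n[OF assms] by simp
  finally show ?thesis by simp
qed

lemma rt_eq_power: "rt n k = rt n 1 ^ k"
  unfolding rt_def by (simp add: Complex.DeMoivre mult_ac)

lemma rt_powi_swap: "rt n k powi a = (rt n 1 powi a) ^ k"
  unfolding rt_eq_power[of n k] by (simp add: power_int_power power_int_power' mult.commute)

lemma rt_one_powi_eq_1:
  assumes n: "n > 0"
  shows "rt n 1 powi a = 1 \<longleftrightarrow> int n dvd a"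
proof
  assume a: "rt n 1 powi a = 1"
  define k where "k = nat (a mod int n)"
  have k: "k < n" "int k = a mod int n" unfolding k_def using n by (auto simp: nat_less_iff)
  have "rt n k = rt n 1 powi (int k)" unfolding rt_eq_power[of n k] by simp
  also have "\<dots> = 1" unfolding k(2) rt_powi_mod[OF n] a ..
  finally have "rt n k = rt n 0" by (simp add: rt_def)
  moreover have "inj_on (rt n) {..<n}"
    using Complex.bij_betw_roots_unity[OF n] unfolding rt_def by (auto simp: bij_betw_def)
  ultimately have "k = 0" using k n by (auto simp: inj_on_def)
  then show "int n dvd a" using k(2) by (simp add: mod_eq_0_iff_dvd)
next
  assume "int n dvd a"
  then show "rt n 1 powi a = 1" using rt_powi_n[OF n] by (auto elim!: dvdE)
qed

lemma sum_rt_powi: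
  assumes n: "n > 0"
  shows "(\<Sum>k<n. rt n k powi a) = (if int n dvd a then of_nat n else 0)"
proof (cases "int n dvd a")
  case True
  then have "rt n 1 powi a = 1" using rt_one_powi_eq_1[OF n] by simp
  then have "rt n k powi a = 1" for k unfolding rt_powi_swap[of n k] by simp
  then show ?thesis using True by simp
next
  case False
  then have z: "rt n 1 powi a \<noteq> 1" using rt_one_powi_eq_1[OF n] by simp
  have "(\<Sum>k<n. rt n k powi a) = (\<Sum>k<n. (rt n 1 powi a) ^ k)"
    by (rule sum.cong[OF refl]) (rule rt_powi_swap)
  also have "\<dots> = ((rt n 1 powi a) ^ n - 1) / (rt n 1 powi a - 1)" by (rule geometric_sum[OF z])
  also have "(rt n 1 powi a) ^ n = 1" using rt_powi_n[OF n, of 1 a] by (simp add: power_int_power' mult.commute)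
  finally show ?thesis using False by simp
qed

text \<open>The character of the discrete torus with frequency \<open>(k, l)\<close>.\<close>

definition wave :: "nat \<Rightarrow> nat \<Rightarrow> nat \<Rightarrow> int \<times> int \<Rightarrow> complex" where
  "wave n k l v = rt n k powi fst v * rt n l powi snd v"

lemma wave_dec_enc: "n > 0 \<Longrightarrow> wave n k l (dec n (enc n v)) = wave n k l v"
  unfolding wave_def by (simp add: dec_enc rt_powi_mod)

lemma sum_wave:
  assumes n: "n > 0" and q: "q < n * n" "q' < n * n"
  shows "(\<Sum>k<n. \<Sum>l<n. wave n k l (dec n q) / wave n k l (dec n q')) = (if q = q' then of_nat n ^ 2 else 0)"
proof -
  obtain a b a' b' where ab: "dec n q = (a, b)" "dec n q' = (a', b')" by (cases "dec n q"; cases "dec n q'")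
  have r: "0 \<le> a" "a < int n" "0 \<le> b" "b < int n" "0 \<le> a'" "a' < int n" "0 \<le> b'" "b' < int n"
    using ab q n unfolding dec_def by (auto simp: less_mult_imp_div_less)
  have dv: "int n dvd x - y \<longleftrightarrow> x = y" if "0 \<le> x" "x < int n" "0 \<le> y" "y < int n" for x y
    using that by (simp add: mod_eq_dvd_iff[symmetric])
  have "(\<Sum>k<n. \<Sum>l<n. wave n k l (dec n q) / wave n k l (dec n q')) =
      (\<Sum>k<n. \<Sum>l<n. rt n k powi (a - a') * rt n l powi (b - b'))"
    unfolding ab wave_def by (intro sum.cong refl) (simp add: power_int_diff)
  also have "\<dots> = (\<Sum>k<n. rt n k powi (a - a')) * (\<Sum>l<n. rt n l powi (b - b'))"
    by (simp only: sum_product)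
  also have "\<dots> = (if a = a' \<and> b = b' then of_nat n ^ 2 else 0)"
    unfolding sum_rt_powi[OF n] using r by (simp add: dv power2_eq_square)
  also have "a = a' \<and> b = b' \<longleftrightarrow> q = q'"
  proof
    assume "a = a' \<and> b = b'"
    then have "enc n (dec n q) = enc n (dec n q')" unfolding ab by simp
    then show "q = q'" unfolding enc_dec[OF q(1)] enc_dec[OF q(2)] .
  next
    assume "q = q'"
    then show "a = a' \<and> b = b'" using ab by simp
  qed
  finally show ?thesis .
qed

text \<open>The 2x2 symbol of the matrix, indexed by the kinds of edges, False for western and True
  for southern; a step to the east or north multiplies by \<open>w1\<close> or \<open>w2\<close>.
  Its determinant is \<open>Delta\<close>, and \<open>isymb\<close> is its inverse by Cramer's
  rule.\<close>

definition symb :: "real \<Rightarrow> real \<Rightarrow> real \<Rightarrow> complex \<Rightarrow> complex \<Rightarrow> bool \<Rightarrow> bool \<Rightarrow> complex" where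
  "symb \<alpha> \<beta> \<gamma> w1 w2 c d = (if c then (if d then 1 + of_real \<beta> * w2 else of_real \<gamma> * w1)
     else (if d then of_real \<gamma> * w2 else 1 + of_real \<alpha> * w1))"

definition isymb :: "real \<Rightarrow> real \<Rightarrow> real \<Rightarrow> complex \<Rightarrow> complex \<Rightarrow> bool \<Rightarrow> bool \<Rightarrow> complex" where
  "isymb \<alpha> \<beta> \<gamma> w1 w2 c d = (if c then (if d then 1 + of_real \<alpha> * w1 else - of_real \<gamma> * w1)
     else (if d then - of_real \<gamma> * w2 else 1 + of_real \<beta> * w2)) / Delta \<alpha> \<beta> \<gamma> w1 w2"

lemma symb_isymb:
  assumes "Delta \<alpha> \<beta> \<gamma> w1 w2 \<noteq> 0"
  shows "symb \<alpha> \<beta> \<gamma> w1 w2 c False * isymb \<alpha> \<beta> \<gamma> w1 w2 False d + symb \<alpha> \<beta> \<gamma> w1 w2 c True * isymb \<alpha> \<beta> \<gamma> w1 w2 True d =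
    (if c = d then 1 else 0)"
proof -
  have "symb \<alpha> \<beta> \<gamma> w1 w2 c False * isymb \<alpha> \<beta> \<gamma> w1 w2 False d + symb \<alpha> \<beta> \<gamma> w1 w2 c True * isymb \<alpha> \<beta> \<gamma> w1 w2 True d =
     (if c = d then Delta \<alpha> \<beta> \<gamma> w1 w2 else 0) / Delta \<alpha> \<beta> \<gamma> w1 w2"
    unfolding symb_def isymb_def
    by (cases c; cases d; simp add: add_divide_distrib[symmetric] diff_divide_distrib[symmetric])
      (simp_all add: Delta_def power2_eq_square algebra_simps)
  then show ?thesis using assms by simp
qed

lemma sum_kast_column:
  assumes n: "n > 0" and f: "\<And>v d. f (dcol n v d) = g (dshift d v) (d = 1 \<or> d = 3)"
    and per: "\<And>v c. g (dec n (enc n v)) c = g v c"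
  shows "(\<Sum>j<2 * (n * n). kast n \<alpha> \<beta> \<gamma> u1 u2 r j * f j) =
    (\<Sum>d<4. (if even r then entW \<alpha> \<gamma> u1 u2 d else entS \<beta> \<gamma> u1 u2 d) * g (dshift d (dec n (r div 2))) (d = 1 \<or> d = 3))"
proof -
  have "(\<Sum>j<2 * (n * n). unit_row (dcol n v d) j * f j) = f (dcol n v d)" for v d
    using dcol_less[OF n, of v d] unfolding unit_row_def
    by (simp add: if_distrib[of "\<lambda>x. x * _"] sum.delta' cong: if_cong)
  then have u: "(\<Sum>j<2 * (n * n). unit_row (dcol n v d) j * f j) = g (dshift d v) (d = 1 \<or> d = 3)" for v d
    by (simp add: f)
  show ?thesis
    unfolding kast_def sum_distrib_right
    by (subst sum.swap) (simp only: mult.assoc sum_distrib_left[symmetric] u)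
qed

lemma wave_shift:
  "wave n k l (dshift 2 v) = wave n k l v * rt n k" "wave n k l (dshift 3 v) = wave n k l v * rt n l"
  "wave n k l (dshift 0 v) = wave n k l v" "wave n k l (dshift 1 v) = wave n k l v"
  unfolding wave_def dshift_def by (simp_all add: power_int_add)

lemma sum_lessThan_4: "(\<Sum>d<4::nat. f d) = f 0 + f 1 + f 2 + (f 3 :: 'a::comm_monoid_add)"
  by (simp add: eval_nat_numeral add.assoc)

text \<open>Translation invariance: the matrix acts on waves through its symbol. The twists
  \<open>u1\<close> and \<open>u2\<close> merely rotate the points at which the symbol is
  evaluated.\<close>

lemma kast_wave:
  assumes n: "n > 0" and f: "\<And>v d. f (dcol n v d) = wave n k l (dshift d v) * F (d = 1 \<or> d = 3)"
  shows "(\<Sum>j<2 * (n * n). kast n \<alpha> \<beta> \<gamma> u1 u2 r j * f j) =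
    wave n k l (dec n (r div 2)) * (symb \<alpha> \<beta> \<gamma> (u1 * rt n k) (u2 * rt n l) (odd r) False * F False +
      symb \<alpha> \<beta> \<gamma> (u1 * rt n k) (u2 * rt n l) (odd r) True * F True)"
proof -
  have "(\<Sum>j<2 * (n * n). kast n \<alpha> \<beta> \<gamma> u1 u2 r j * f j) =
    (\<Sum>d<4. (if even r then entW \<alpha> \<gamma> u1 u2 d else entS \<beta> \<gamma> u1 u2 d) * 
      (wave n k l (dshift d (dec n (r div 2))) * F (d = 1 \<or> d = 3)))"
    by (rule sum_kast_column[OF n, where g = "\<lambda>v c. wave n k l v * F c"]) (simp_all add: f wave_dec_enc n)
  also have "\<dots> = wave n k l (dec n (r div 2)) * (symb \<alpha> \<beta> \<gamma> (u1 * rt n k) (u2 * rt n l) (odd r) False * F False +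
      symb \<alpha> \<beta> \<gamma> (u1 * rt n k) (u2 * rt n l) (odd r) True * F True)"
    unfolding sum_lessThan_4 wave_shift
    by (cases "even r") (simp_all add: entW_def entS_def symb_def algebra_simps)
  finally show ?thesis .
qed

definition invk :: "nat \<Rightarrow> real \<Rightarrow> real \<Rightarrow> real \<Rightarrow> complex \<Rightarrow> complex \<Rightarrow> nat \<Rightarrow> nat \<Rightarrow> complex" where
  "invk n \<alpha> \<beta> \<gamma> u1 u2 e r = (\<Sum>k<n. \<Sum>l<n. wave n k l (dec n (e div 2)) / wave n k l (dec n (r div 2)) *
     isymb \<alpha> \<beta> \<gamma> (u1 * rt n k) (u2 * rt n l) (odd e) (odd r)) / of_nat n ^ 2"

lemma dcol_div_odd: "dcol n v d div 2 = enc n (dshift d v)" "odd (dcol n v d) \<longleftrightarrow> d = 1 \<or> d = 3"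
  unfolding dcol_def by auto

lemma kast_invk:
  assumes n: "n > 0" and nz: "\<And>k l. k < n \<Longrightarrow> l < n \<Longrightarrow> Delta \<alpha> \<beta> \<gamma> (u1 * rt n k) (u2 * rt n l) \<noteq> 0"
    and rs: "r < 2 * (n * n)" "s < 2 * (n * n)"
  shows "(\<Sum>j<2 * (n * n). kast n \<alpha> \<beta> \<gamma> u1 u2 r j * invk n \<alpha> \<beta> \<gamma> u1 u2 j s) = unit_row r s"
proof -
  define f where "f k l j = wave n k l (dec n (j div 2)) * isymb \<alpha> \<beta> \<gamma> (u1 * rt n k) (u2 * rt n l) (odd j) (odd s)" for k l j
  have fd: "f k l (dcol n v d) = wave n k l (dshift d v) * isymb \<alpha> \<beta> \<gamma> (u1 * rt n k) (u2 * rt n l) (d = 1 \<or> d = 3) (odd s)" for k l v d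
    unfolding f_def dcol_div_odd wave_dec_enc[OF n] ..
  have "(\<Sum>j<2 * (n * n). kast n \<alpha> \<beta> \<gamma> u1 u2 r j * invk n \<alpha> \<beta> \<gamma> u1 u2 j s) =
     (\<Sum>j<2 * (n * n). \<Sum>k<n. \<Sum>l<n. kast n \<alpha> \<beta> \<gamma> u1 u2 r j * f k l j / (wave n k l (dec n (s div 2)) * of_nat n ^ 2))"
    unfolding invk_def f_def sum_divide_distrib sum_distrib_left
    by (intro sum.cong refl) (simp add: field_simps)
  also have "\<dots> = (\<Sum>k<n. \<Sum>l<n. (\<Sum>j<2 * (n * n). kast n \<alpha> \<beta> \<gamma> u1 u2 r j * f k l j) / (wave n k l (dec n (s div 2)) * of_nat n ^ 2))"
    unfolding sum_divide_distrib
    by (subst sum.swap) (rule sum.cong[OF refl], rule sum.swap)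
  also have "\<dots> = (\<Sum>k<n. \<Sum>l<n. wave n k l (dec n (r div 2)) / wave n k l (dec n (s div 2)) * ((if odd r = odd s then 1 else 0) / of_nat n ^ 2))"
    by (intro sum.cong refl, subst kast_wave[OF n fd], subst symb_isymb) (use nz in auto)
  also have "\<dots> = (if r div 2 = s div 2 then of_nat n ^ 2 else 0) * ((if odd r = odd s then 1 else 0) / of_nat n ^ 2)"
    unfolding sum_distrib_right[symmetric]
    by (subst sum_wave[OF n]) (use rs in auto)
  also have "\<dots> = unit_row r s"
  proof -
    have "r = s \<longleftrightarrow> r div 2 = s div 2 \<and> odd r = odd s"
      by presburger
    then show ?thesis using n by (auto simp: unit_row_def)
  qed
  finally show ?thesis .
qed

lemma dt_kast_invk:
  assumes n: "n > 0" and nz: "\<And>k l. k < n \<Longrightarrow> l < n \<Longrightarrow> Delta \<alpha> \<beta> \<gamma> (u1 * rt n k) (u2 * rt n l) \<noteq> 0"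
  shows "dt (2 * (n * n)) (kast n \<alpha> \<beta> \<gamma> u1 u2) * dt (2 * (n * n)) (invk n \<alpha> \<beta> \<gamma> u1 u2) = 1"
  unfolding dt_mult dt_identity[of "2 * (n * n)", symmetric]
  by (rule dt_cong) (rule kast_invk[OF n nz])

definition fourier :: "nat \<Rightarrow> nat \<Rightarrow> nat \<Rightarrow> complex" where
  "fourier n j e = (if odd j = odd e then wave n (e div 2 mod n) (e div 2 div n) (dec n (j div 2)) else 0)"

definition block_symb :: "nat \<Rightarrow> real \<Rightarrow> real \<Rightarrow> real \<Rightarrow> complex \<Rightarrow> complex \<Rightarrow> nat \<Rightarrow> nat \<Rightarrow> complex" where
  "block_symb n \<alpha> \<beta> \<gamma> u1 u2 r e = (if r div 2 = e div 2
     then symb \<alpha> \<beta> \<gamma> (u1 * rt n (e div 2 mod n)) (u2 * rt n (e div 2 div n)) (odd r) (odd e) else 0)"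

lemma sum_lessThan_double:
  fixes f :: "nat \<Rightarrow> 'a::comm_monoid_add"
  shows "(\<Sum>a<2 * m. f a) = (\<Sum>q<m. f (2 * q) + f (2 * q + 1))"
  by (induction m) (simp_all add: add.assoc)

lemma kast_fourier:
  assumes n: "n > 0" and e: "e < 2 * (n * n)"
  shows "(\<Sum>j<2 * (n * n). kast n \<alpha> \<beta> \<gamma> u1 u2 r j * fourier n j e) =
    (\<Sum>s<2 * (n * n). fourier n r s * block_symb n \<alpha> \<beta> \<gamma> u1 u2 s e)"
proof -
  define k l where "k = e div 2 mod n" and "l = e div 2 div n"
  have "(\<Sum>j<2 * (n * n). kast n \<alpha> \<beta> \<gamma> u1 u2 r j * fourier n j e) =
    wave n k l (dec n (r div 2)) * (symb \<alpha> \<beta> \<gamma> (u1 * rt n k) (u2 * rt n l) (odd r) False * (if odd e = False then 1 else 0) +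
      symb \<alpha> \<beta> \<gamma> (u1 * rt n k) (u2 * rt n l) (odd r) True * (if odd e = True then 1 else 0))"
    by (rule kast_wave[OF n, where F = "\<lambda>c. if odd e = c then 1 else 0"])
      (auto simp: fourier_def dcol_div_odd wave_dec_enc[OF n] k_def l_def)
  also have "\<dots> = wave n k l (dec n (r div 2)) * symb \<alpha> \<beta> \<gamma> (u1 * rt n k) (u2 * rt n l) (odd r) (odd e)"
    by auto
  also have "\<dots> = (\<Sum>q<n * n. if q = e div 2 then wave n k l (dec n (r div 2)) * symb \<alpha> \<beta> \<gamma> (u1 * rt n k) (u2 * rt n l) (odd r) (odd e) else 0)"
    using e by (subst sum.delta) auto
  also have "\<dots> = (\<Sum>s<2 * (n * n). fourier n r s * block_symb n \<alpha> \<beta> \<gamma> u1 u2 s e)"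
    unfolding sum_lessThan_double
    by (intro sum.cong refl) (auto simp: fourier_def block_symb_def k_def l_def)
  finally show ?thesis .
qed

lemma dt_fourier_nonzero:
  assumes n: "n > 0"
  shows "dt (2 * (n * n)) (fourier n) \<noteq> 0"
proof -
  define F where "F e j = (if odd j = odd e then 1 / wave n (e div 2 mod n) (e div 2 div n) (dec n (j div 2)) / of_nat n ^ 2 else 0)" for e j
  have "dt (2 * (n * n)) (fourier n) * dt (2 * (n * n)) F = 1"
    unfolding dt_mult dt_identity[of "2 * (n * n)", symmetric]
  proof (rule dt_cong)
    fix i j assume ij: "i < 2 * (n * n)" "j < 2 * (n * n)"
    have "(\<Sum>e<2 * (n * n). fourier n i e * F e j) = (\<Sum>q<n * n. if odd i = odd j then
       wave n (q mod n) (q div n) (dec n (i div 2)) / wave n (q mod n) (q div n) (dec n (j div 2)) / of_nat n ^ 2 else 0)"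
      unfolding sum_lessThan_double by (intro sum.cong refl) (auto simp: fourier_def F_def)
    also have "\<dots> = (\<Sum>l<n. \<Sum>k<n. if odd i = odd j then
       wave n k l (dec n (i div 2)) / wave n k l (dec n (j div 2)) / of_nat n ^ 2 else 0)"
      unfolding sum_lessThan_mult by (intro sum.cong refl) simp
    also have "\<dots> = (if odd i = odd j then (\<Sum>l<n. \<Sum>k<n. wave n k l (dec n (i div 2)) / wave n k l (dec n (j div 2))) / of_nat n ^ 2 else 0)"
      by (simp add: sum_divide_distrib)
    also have "(\<Sum>l<n. \<Sum>k<n. wave n k l (dec n (i div 2)) / wave n k l (dec n (j div 2))) = (if i div 2 = j div 2 then of_nat n ^ 2 else 0)"
      by (subst sum.swap) (rule sum_wave[OF n], use ij in auto)
    also have "(if odd i = odd j then (if i div 2 = j div 2 then of_nat n ^ 2 else 0) / of_nat n ^ 2 else 0) = (unit_row i j :: complex)"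
    proof -
      have "i = j \<longleftrightarrow> i div 2 = j div 2 \<and> odd i = odd j"
        by presburger
      then show ?thesis using n by (auto simp: unit_row_def)
    qed
    finally show "(\<Sum>e<2 * (n * n). fourier n i e * F e j) = unit_row i j" .
  qed
  then show ?thesis by auto
qed

lemma symb_det:
  "symb \<alpha> \<beta> \<gamma> w1 w2 False False * symb \<alpha> \<beta> \<gamma> w1 w2 True True - symb \<alpha> \<beta> \<gamma> w1 w2 False True * symb \<alpha> \<beta> \<gamma> w1 w2 True False =
    Delta \<alpha> \<beta> \<gamma> w1 w2"
  unfolding symb_def Delta_def by (simp add: power2_eq_square)

text \<open>Every pair of rows is a 2x2 block with determinant \<open>Delta\<close>. The expansion
  over vertices is reused with a single choice per pair.\<close>

lemma dt_block_symb:
  "dt (2 * (n * n)) (block_symb n \<alpha> \<beta> \<gamma> u1 u2) = (\<Prod>q<n * n. Delta \<alpha> \<beta> \<gamma> (u1 * rt n (q mod n)) (u2 * rt n (q div n)))"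
proof -
  define sy where "sy q c d = symb \<alpha> \<beta> \<gamma> (u1 * rt n (q mod n)) (u2 * rt n (q div n)) c d" for q c d
  have "dt (2 * (n * n)) (block_symb n \<alpha> \<beta> \<gamma> u1 u2) = (\<Sum>T\<in>PiE {..<n * n} (\<lambda>_. {()}).
      (\<Prod>q<n * n. Delta \<alpha> \<beta> \<gamma> (u1 * rt n (q mod n)) (u2 * rt n (q div n))) *
      dt (2 * (n * n)) (\<lambda>r. if even r then unit_row (2 * (r div 2)) else unit_row (2 * (r div 2) + 1)))"
  proof (rule dt_expand_pairs)
    fix q and M :: "nat \<Rightarrow> nat \<Rightarrow> complex" assume q: "q < n * n"
    \<comment> \<open>Only the directions 0 and 1 carry entries, so of the six minors just that of
      type 1 survives.\<close>
    define cl where "cl d = (if d = 0 then 2 * q else 2 * q + 1)" for d :: nat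
    define f where "f d = (if d = 0 then sy q False False else if d = 1 then sy q False True else 0)" for d :: nat
    define g where "g d = (if d = 0 then sy q True False else if d = 1 then sy q True True else 0)" for d :: nat
    have rows: "block_symb n \<alpha> \<beta> \<gamma> u1 u2 (2 * q) = (\<lambda>j. \<Sum>d<4. f d * unit_row (cl d) j)"
      "block_symb n \<alpha> \<beta> \<gamma> u1 u2 (2 * q + 1) = (\<lambda>j. \<Sum>d<4. g d * unit_row (cl d) j)"
      unfolding sum_lessThan_4 by (auto simp: fun_eq_iff block_symb_def f_def g_def cl_def unit_row_def sy_def)
    have "dt (2 * (n * n)) (M(2 * q := block_symb n \<alpha> \<beta> \<gamma> u1 u2 (2 * q), 2 * q + 1 := block_symb n \<alpha> \<beta> \<gamma> u1 u2 (2 * q + 1))) =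
      (\<Sum>t\<in>{1..6}. (f (dir1 t) * g (dir2 t) - f (dir2 t) * g (dir1 t)) *
       dt (2 * (n * n)) (M(2 * q := unit_row (cl (dir1 t)), 2 * q + 1 := unit_row (cl (dir2 t)))))"
      unfolding rows by (rule dt_two_rows) (use q in auto)
    also have "\<dots> = (f 0 * g 1 - f 1 * g 0) * dt (2 * (n * n)) (M(2 * q := unit_row (2 * q), 2 * q + 1 := unit_row (2 * q + 1)))"
      unfolding types_eq by (simp add: dir1_def dir2_def f_def g_def cl_def)
    also have "f 0 * g 1 - f 1 * g 0 = Delta \<alpha> \<beta> \<gamma> (u1 * rt n (q mod n)) (u2 * rt n (q div n))"
      unfolding symb_det[symmetric] f_def g_def sy_def by simp
    finally show "dt (2 * (n * n)) (M(2 * q := block_symb n \<alpha> \<beta> \<gamma> u1 u2 (2 * q), 2 * q + 1 := block_symb n \<alpha> \<beta> \<gamma> u1 u2 (2 * q + 1))) =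
       (\<Sum>t\<in>{()}. Delta \<alpha> \<beta> \<gamma> (u1 * rt n (q mod n)) (u2 * rt n (q div n)) * dt (2 * (n * n)) (M(2 * q := unit_row (2 * q), 2 * q + 1 := unit_row (2 * q + 1))))"
      by (simp only: sum.insert finite.emptyI empty_iff not_False_eq_True sum.empty add_0_right)
  qed simp
  also have "dt (2 * (n * n)) (\<lambda>r. if even r then unit_row (2 * (r div 2)) else unit_row (2 * (r div 2) + 1)) = (1 :: complex)"
    unfolding dt_identity[of "2 * (n * n)", symmetric] by (rule dt_cong) auto
  finally show ?thesis by (simp add: card_PiE)
qed

text \<open>The Fourier matrix intertwines the matrix with its block diagonal form; its determinant
  is nonzero and cancels.\<close>

theorem twisted_sum_product:
  assumes n: "n \<ge> 2"
  shows "twisted_sum n \<alpha> \<beta> \<gamma> u1 u2 UNIV = (\<Prod>k<n. \<Prod>l<n. Delta \<alpha> \<beta> \<gamma> (u1 * rt n k) (u2 * rt n l))"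
proof -
  have n0: "n > 0" using n by simp
  have "dt (2 * (n * n)) (kast n \<alpha> \<beta> \<gamma> u1 u2) * dt (2 * (n * n)) (fourier n) =
      dt (2 * (n * n)) (fourier n) * dt (2 * (n * n)) (block_symb n \<alpha> \<beta> \<gamma> u1 u2)"
    unfolding dt_mult by (rule dt_cong) (rule kast_fourier[OF n0])
  then have "dt (2 * (n * n)) (kast n \<alpha> \<beta> \<gamma> u1 u2) = dt (2 * (n * n)) (block_symb n \<alpha> \<beta> \<gamma> u1 u2)"
    using dt_fourier_nonzero[OF n0] by simp
  also have "\<dots> = (\<Prod>l<n. \<Prod>k<n. Delta \<alpha> \<beta> \<gamma> (u1 * rt n k) (u2 * rt n l))"
    unfolding dt_block_symb
  proof -
    have pm: "(\<Prod>a<m * k. f a) = (\<Prod>q<m. \<Prod>c<k. f (q * k + c))" for m k and f :: "nat \<Rightarrow> complex"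
    proof (induction m)
      case (Suc m)
      have pa: "(\<Prod>a<x + y. f a) = (\<Prod>a<x. f a) * (\<Prod>c<y. f (x + c))" for x y
        by (induction y) (simp_all add: mult.assoc)
      show ?case unfolding mult_Suc add.commute[of k] pa Suc.IH prod.lessThan_Suc by (rule refl)
    qed simp
    show "(\<Prod>q<n * n. Delta \<alpha> \<beta> \<gamma> (u1 * rt n (q mod n)) (u2 * rt n (q div n))) = (\<Prod>l<n. \<Prod>k<n. Delta \<alpha> \<beta> \<gamma> (u1 * rt n k) (u2 * rt n l))"
      unfolding pm by (intro prod.cong refl) simp
  qed
  also have "\<dots> = (\<Prod>k<n. \<Prod>l<n. Delta \<alpha> \<beta> \<gamma> (u1 * rt n k) (u2 * rt n l))" by (rule prod.swap)
  finally show ?thesis unfolding dt_kast[OF n] .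
qed

section \<open>Entries of the inverse matrix as lattice sums of the kernel\<close>

definition pt :: "int \<times> int \<Rightarrow> bool \<Rightarrow> int \<times> int" where
  "pt v c = (if c then mS v else mW v)"

text \<open>The inverse symbol is the integrand of the kernel: western mid-edges are black, southern
  ones white, and the half-integer powers of mixed pairs become the factors \<open>w1\<close> or
  \<open>w2\<close> in \<open>isymb\<close>. The kind of the second point comes first.\<close>

lemma kernel_integrand_pt:
  assumes "w1 \<noteq> 0" "w2 \<noteq> 0"
  shows "kernel_integrand \<alpha> \<beta> \<gamma> (pt v c) (pt v' c') w1 w2 =
    w1 powi (fst v' - fst v) * w2 powi (snd v' - snd v) * isymb \<alpha> \<beta> \<gamma> w1 w2 c' c"
proof -
  have b: "is_black (2 * a - 1, d) = True" "is_black (2 * a, d) = False" for a d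
    unfolding is_black_def by simp_all
  have e: "(2 * a - 1 - (2 * b - 1)) div 2 = a - b" "(2 * a - 2 * b) div 2 = a - b"
    "(2 * a - 1 - 2 * b + 1) div 2 = a - b" "(2 * a - (2 * b - 1) + 1) div 2 = a - b + 1" for a b :: int
    by presburger+
  show ?thesis
    unfolding kernel_integrand_def pt_def
    by (cases c; cases c')
      (simp_all only: if_True if_False b Let_def mW_def mS_def fst_conv snd_conv e add_0_right isymb_def
        not_True_eq_False not_False_eq_True refl simp_thms, 
       simp_all add: assms power_int_add)
qed

definition gridker :: "nat \<Rightarrow> real \<Rightarrow> real \<Rightarrow> real \<Rightarrow> complex \<Rightarrow> complex \<Rightarrow> int \<times> int \<Rightarrow> int \<times> int \<Rightarrow> complex" where
  "gridker n \<alpha> \<beta> \<gamma> u1 u2 x y = (\<Sum>k<n. \<Sum>l<n. kernel_integrand \<alpha> \<beta> \<gamma> x y (u1 * rt n k) (u2 * rt n l)) / of_nat n ^ 2"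

text \<open>Waves use powers of the plain roots of unity, the kernel powers of the twisted ones. The
  prefactor compensates; for fixed vertices it tends to 1 when the twists do.\<close>

lemma invk_pt:
  assumes n: "n > 0" and u: "u1 \<noteq> 0" "u2 \<noteq> 0"
    and e: "e div 2 = enc n v'" "odd e = c'" and r: "r div 2 = enc n v" "odd r = c"
  shows "invk n \<alpha> \<beta> \<gamma> u1 u2 e r =
    u1 powi (fst v - fst v') * u2 powi (snd v - snd v') * gridker n \<alpha> \<beta> \<gamma> u1 u2 (pt v c) (pt v' c')"
proof -
  let ?ph = "u1 powi (fst v - fst v') * u2 powi (snd v - snd v')"
  have "wave n k l (dec n (e div 2)) / wave n k l (dec n (r div 2)) * isymb \<alpha> \<beta> \<gamma> (u1 * rt n k) (u2 * rt n l) (odd e) (odd r) =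
     ?ph * kernel_integrand \<alpha> \<beta> \<gamma> (pt v c) (pt v' c') (u1 * rt n k) (u2 * rt n l)" for k l
  proof -
    have "kernel_integrand \<alpha> \<beta> \<gamma> (pt v c) (pt v' c') (u1 * rt n k) (u2 * rt n l) =
       (u1 * rt n k) powi (fst v' - fst v) * (u2 * rt n l) powi (snd v' - snd v) * isymb \<alpha> \<beta> \<gamma> (u1 * rt n k) (u2 * rt n l) c' c"
      by (rule kernel_integrand_pt) (use u in auto)
    moreover have "wave n k l v' / wave n k l v = rt n k powi (fst v' - fst v) * rt n l powi (snd v' - snd v)"
      unfolding wave_def by (simp add: power_int_diff)
    moreover have "?ph * (u1 powi (fst v' - fst v) * u2 powi (snd v' - snd v)) = 1"
    proof -
      have "u1 powi (fst v - fst v') * u1 powi (fst v' - fst v) = 1" "u2 powi (snd v - snd v') * u2 powi (snd v' - snd v) = 1"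
        using u by (simp_all add: power_int_add[symmetric])
      then show ?thesis by (simp add: mult_ac)
    qed
    ultimately show ?thesis
      unfolding e r wave_dec_enc[OF n] power_int_mult_distrib
      by (simp add: mult_ac)
  qed
  then show ?thesis
    unfolding invk_def gridker_def by (simp add: sum_distrib_left)
qed

definition xbase :: "(int \<times> int) list \<Rightarrow> nat \<Rightarrow> int \<times> int" where
  "xbase vs m = vs ! (m div 2)"

definition ydir :: "nat list \<Rightarrow> nat \<Rightarrow> nat" where
  "ydir ts m = (if even m then dir1 (ts ! (m div 2)) else dir2 (ts ! (m div 2)))"

lemma x_idx_pt: "x_idx vs m = pt (xbase vs m) (odd m)"
  unfolding x_idx_def pt_def xbase_def Let_def by simp

lemma y_idx_pt:
  assumes "ts ! (m div 2) \<in> {1..6}"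
  shows "y_idx vs ts m = pt (dshift (ydir ts m) (xbase vs m)) (ydir ts m = 1 \<or> ydir ts m = 3)"
proof -
  obtain a b where v: "vs ! (m div 2) = (a, b)" by (cases "vs ! (m div 2)")
  show ?thesis
    using assms unfolding types_eq
    by (elim insertE) (auto simp: y_idx_def pt_def xbase_def ydir_def Let_def v dir1_def dir2_def dshift_def
      mW_def mS_def mE_def mN_def)
qed

text \<open>Multiplied by the inverse of the full matrix, the matrix with prescribed vertices has
  unit rows at all other vertices and rows of the inverse at the prescribed ones, so the determinant
  of the product is a finite minor of the inverse. Its rows belong to the incoming mid-edges y and
  its columns to the x, the transpose of the final arrangement.\<close>

theorem event_formula:
  assumes n: "n \<ge> 2" and u: "u1 \<noteq> 0" "u2 \<noteq> 0"
    and nz: "\<And>k l. k < n \<Longrightarrow> l < n \<Longrightarrow> Delta \<alpha> \<beta> \<gamma> (u1 * rt n k) (u2 * rt n l) \<noteq> 0"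
    and inj: "inj_on (\<lambda>i. enc n (vs ! i)) {..<length vs}"
    and ts: "length ts = length vs" "set ts \<subseteq> {1..6}"
  shows "twisted_sum n \<alpha> \<beta> \<gamma> u1 u2 (type_event vs ts) =
    (\<Prod>i<length vs. of_real (ff_weights \<alpha> \<beta> \<gamma> (ts ! i)) * xmono u1 u2 (ts ! i)) *
    dt (2 * length vs) (\<lambda>i j. u1 powi (fst (xbase vs j) - fst (dshift (ydir ts i) (xbase vs i))) *
       u2 powi (snd (xbase vs j) - snd (dshift (ydir ts i) (xbase vs i))) *
       gridker n \<alpha> \<beta> \<gamma> u1 u2 (x_idx vs j) (y_idx vs ts i)) *
    twisted_sum n \<alpha> \<beta> \<gamma> u1 u2 UNIV"
proof -
  have n0: "n > 0" using n by simp
  define M where "M = 2 * (n * n)"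
  define K where "K = length vs"
  define xs where "xs m = 2 * enc n (xbase vs m) + of_bool (odd m)" for m
  define A where "A = kast_event n \<alpha> \<beta> \<gamma> u1 u2 vs ts"
  define B where "B = invk n \<alpha> \<beta> \<gamma> u1 u2"
  define C where "C r s = (\<Sum>j<M. A r j * B j s)" for r s
  define Y where "Y m = dcol n (xbase vs m) (ydir ts m)" for m
  have t6: "ts ! i \<in> {1..6}" if "i < K" for i
  proof -
    have "ts ! i \<in> set ts" using that ts(1) by (simp add: K_def)
    then show ?thesis using ts(2) by blast
  qed
  have xs_div: "xs m div 2 = enc n (xbase vs m)" "odd (xs m) = odd m" "even (xs m) = even m" for m
    unfolding xs_def by simp_all
  have xs_inj: "inj_on xs {0..<2 * K}"
  proof (rule inj_onI)
    fix a b assume ab: "a \<in> {0..<2 * K}" "b \<in> {0..<2 * K}" "xs a = xs b"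
    then have "enc n (vs ! (a div 2)) = enc n (vs ! (b div 2))" "odd a = odd b"
      using xs_div[of a] xs_div[of b] by (simp_all add: xbase_def)
    moreover have "a div 2 < K" "b div 2 < K" using ab by auto
    ultimately have "a div 2 = b div 2" using inj unfolding inj_on_def K_def by auto
    then show "a = b" using \<open>odd a = odd b\<close> by presburger
  qed
  have xs_less: "xs m < M" for m
    using enc_less[OF n0, of "xbase vs m"] unfolding xs_def M_def by auto
  have Cx: "C (xs m) s = B (Y m) s" if "m < 2 * K" for m s
  proof -
    have mK: "m div 2 < K" using that by auto
    have "A (xs m) = unit_row (Y m)"
      unfolding A_def Y_def
      by (subst kast_event_at[OF inj, of "m div 2"]) (use mK in \<open>simp_all add: xs_div K_def xbase_def ydir_def del: even_Suc\<close>)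
    then show ?thesis
      unfolding C_def unit_row_def using dcol_less[OF n0, of "xbase vs m" "ydir ts m"]
      by (simp add: Y_def M_def if_distrib[of "\<lambda>x. x * _"] sum.delta' cong: if_cong)
  qed
  have Co: "C r s = unit_row r s" if "r < M" "r \<notin> xs ` {0..<2 * K}" "s < M" for r s
  proof -
    have "\<not> (\<exists>i<length vs. r div 2 = enc n (vs ! i))"
    proof
      assume "\<exists>i<length vs. r div 2 = enc n (vs ! i)"
      then obtain i where i: "i < K" "r div 2 = enc n (vs ! i)" unfolding K_def by auto
      have "r = xs (2 * i + of_bool (odd r))"
        using i(2) unfolding xs_def xbase_def by (cases "odd r") (auto, presburger+)
      moreover have "2 * i + of_bool (odd r) < 2 * K" using i(1) by (cases "odd r") auto
      ultimately show False using that(2) by auto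
    qed
    then have "A r = kast n \<alpha> \<beta> \<gamma> u1 u2 r" unfolding A_def by (rule kast_event_away)
    then show ?thesis
      unfolding C_def B_def M_def using kast_invk[OF n0 nz] that unfolding M_def by simp
  qed
  have "dt M A * dt M B = dt M C" unfolding dt_mult C_def ..
  also have "dt M C = dt M (\<lambda>r. if r \<in> xs ` {0..<2 * K} then C r else unit_row r)"
    by (rule dt_cong) (auto simp: Co)
  also have "\<dots> = dt (2 * K) (\<lambda>i j. (if xs i \<in> xs ` {0..<2 * K} then C (xs i) else unit_row (xs i)) (xs j))"
    by (rule dt_identity_outside[OF xs_inj]) (use xs_less in auto)
  also have "\<dots> = dt (2 * K) (\<lambda>i j. B (Y i) (xs j))"
    by (rule dt_cong) (auto simp: Cx)
  also have "\<dots> = dt (2 * K) (\<lambda>i j. u1 powi (fst (xbase vs j) - fst (dshift (ydir ts i) (xbase vs i))) *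
       u2 powi (snd (xbase vs j) - snd (dshift (ydir ts i) (xbase vs i))) *
       gridker n \<alpha> \<beta> \<gamma> u1 u2 (x_idx vs j) (y_idx vs ts i))"
  proof (rule dt_cong)
    fix i j assume ij: "i < 2 * K" "j < 2 * K"
    then have iK: "i div 2 < K" by auto
    show "B (Y i) (xs j) = u1 powi (fst (xbase vs j) - fst (dshift (ydir ts i) (xbase vs i))) *
       u2 powi (snd (xbase vs j) - snd (dshift (ydir ts i) (xbase vs i))) *
       gridker n \<alpha> \<beta> \<gamma> u1 u2 (x_idx vs j) (y_idx vs ts i)"
      unfolding B_def Y_def x_idx_pt y_idx_pt[OF t6[OF iK]]
      by (intro invk_pt[OF n0 u]) (simp_all only: dcol_div_odd xs_div)
  qed
  finally have AB: "dt M A * dt M B = dt (2 * K) (\<lambda>i j. u1 powi (fst (xbase vs j) - fst (dshift (ydir ts i) (xbase vs i))) *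
       u2 powi (snd (xbase vs j) - snd (dshift (ydir ts i) (xbase vs i))) *
       gridker n \<alpha> \<beta> \<gamma> u1 u2 (x_idx vs j) (y_idx vs ts i))" (is "_ = ?D") .
  have KB: "twisted_sum n \<alpha> \<beta> \<gamma> u1 u2 UNIV * dt M B = 1"
    using dt_kast_invk[OF n0 nz] unfolding M_def B_def dt_kast[OF n] .
  have "dt M A = dt M A * (twisted_sum n \<alpha> \<beta> \<gamma> u1 u2 UNIV * dt M B)" unfolding KB by simp
  also have "\<dots> = ?D * twisted_sum n \<alpha> \<beta> \<gamma> u1 u2 UNIV" unfolding AB[symmetric] by (simp only: mult_ac)
  finally show ?thesis
    using dt_kast_event[OF n inj ts, of \<alpha> \<beta> \<gamma> u1 u2] unfolding A_def M_def K_def by (simp only: mult.assoc)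
qed

subsection \<open>Removing the signs\<close>

text \<open>For \<open>s = 1\<close> an n-th root of -1, so that the twist multiplies a
  configuration by -1 to the power of a winding number.\<close>

definition tw :: "nat \<Rightarrow> nat \<Rightarrow> complex" where
  "tw n s = cis (pi * real s / real n)"

text \<open>The Fourier coefficients of the winding sign, which is a function of two
  parities.\<close>

definition coef :: "nat \<Rightarrow> nat \<Rightarrow> nat \<Rightarrow> complex" where
  "coef n s1 s2 = (\<Sum>p<2. \<Sum>q<2. of_int (wind_sign n p q) * (-1) ^ (s1 * p + s2 * q)) / 4"

lemma tw_nonzero [simp]: "tw n s \<noteq> 0" and norm_tw [simp]: "norm (tw n s) = 1"
  unfolding tw_def by simp_all

lemma tw_power: "n > 0 \<Longrightarrow> tw n s ^ (n * p) = (-1) ^ (s * p)"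
proof -
  assume n: "n > 0"
  have "tw n s ^ (n * p) = (tw n s ^ n) ^ p" by (rule power_mult)
  also have "tw n s ^ n = cis pi ^ s" unfolding tw_def Complex.DeMoivre using n by (simp add: mult.commute)
  also have "\<dots> = (-1) ^ s" by simp
  finally show ?thesis by (simp only: power_mult)
qed

lemma norm_coef: "norm (coef n s1 s2) \<le> 1"
proof -
  have "norm (\<Sum>p<2. \<Sum>q<2. of_int (wind_sign n p q) * (-1) ^ (s1 * p + s2 * q) :: complex) \<le>
      (\<Sum>p<2::nat. \<Sum>q<2::nat. 1)"
    by (intro sum_norm_le) (auto simp: wind_sign_def norm_mult norm_power)
  then show ?thesis unfolding coef_def norm_divide by simp
qed

lemma lessThan_2: "{..<2::nat} = {0, 1}" by auto

text \<open>Fourier inversion on the group of pairs of parities reproduces the sign, and the sign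
  squares to 1.\<close>

lemma coef_expand: "(\<Sum>s1<2. \<Sum>s2<2. coef n s1 s2 * (of_int (wind_sign n p q) * (-1) ^ (s1 * p + s2 * q))) = 1"
  unfolding lessThan_2 coef_def wind_sign_def
  by (cases "even n"; cases "even p"; cases "even q") (simp_all add: lessThan_2)

text \<open>The parameter \<open>t\<close> weights the vertical winding number in addition:
  \<open>t = 1\<close> just removes the signs, positive \<open>t\<close> other than 1 serves for the
  tilted sums of the concentration argument.\<close>

lemma untwist:
  assumes "n > 0"
  shows "(\<Sum>\<sigma>\<in>tor_configs n \<inter> E. of_real (config_weight n (ff_weights \<alpha> \<beta> \<gamma>) \<sigma>) * t ^ (n * windV n \<sigma>)) =
    (\<Sum>s1<2. \<Sum>s2<2. coef n s1 s2 * twisted_sum n \<alpha> \<beta> \<gamma> (tw n s1) (t * tw n s2) E)"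
proof -
  have "(\<Sum>s1<2. \<Sum>s2<2. coef n s1 s2 * twisted_sum n \<alpha> \<beta> \<gamma> (tw n s1) (t * tw n s2) E) =
     (\<Sum>s1<2. \<Sum>s2<2. \<Sum>\<sigma>\<in>tor_configs n \<inter> E. coef n s1 s2 * (of_int (wind_sign n (windH n \<sigma>) (windV n \<sigma>)) * (-1) ^ (s1 * windH n \<sigma> + s2 * windV n \<sigma>)) *
       (of_real (config_weight n (ff_weights \<alpha> \<beta> \<gamma>) \<sigma>) * t ^ (n * windV n \<sigma>)))"
    unfolding twisted_sum_def sum_distrib_left power_mult_distrib tw_power[OF assms] power_add
    by (intro sum.cong refl) (simp only: mult_ac)
  also have "\<dots> = (\<Sum>\<sigma>\<in>tor_configs n \<inter> E. \<Sum>s1<2. \<Sum>s2<2. coef n s1 s2 * (of_int (wind_sign n (windH n \<sigma>) (windV n \<sigma>)) * (-1) ^ (s1 * windH n \<sigma> + s2 * windV n \<sigma>)) *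
       (of_real (config_weight n (ff_weights \<alpha> \<beta> \<gamma>) \<sigma>) * t ^ (n * windV n \<sigma>)))"
    by (rule trans[OF sum.cong[OF refl sum.swap] sum.swap])
  also have "\<dots> = (\<Sum>\<sigma>\<in>tor_configs n \<inter> E. of_real (config_weight n (ff_weights \<alpha> \<beta> \<gamma>) \<sigma>) * t ^ (n * windV n \<sigma>))"
    unfolding sum_distrib_right[symmetric] coef_expand by simp
  finally show ?thesis ..
qed

subsection \<open>The limit from concentration and non-resonant twists\<close>

text \<open>The expectation of the distance between \<open>windV / n\<close> and \<rho> under the
  torus measure.\<close>

definition dev :: "nat \<Rightarrow> real \<Rightarrow> real \<Rightarrow> real \<Rightarrow> real \<Rightarrow> real" where
  "dev n \<alpha> \<beta> \<gamma> \<rho> = (\<Sum>\<sigma>\<in>tor_configs n. config_weight n (ff_weights \<alpha> \<beta> \<gamma>) \<sigma> * \<bar>real (windV n \<sigma>) - \<rho> * real n\<bar>)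
     / (partition_fn n (ff_weights \<alpha> \<beta> \<gamma>) * real n)"

lemma ff_weights_pos:
  assumes "\<alpha> > 0" "\<beta> > 0" "\<gamma> > 0" "\<gamma>^2 - \<alpha> * \<beta> > 0" "t \<in> {1..6}"
  shows "ff_weights \<alpha> \<beta> \<gamma> t > 0"
  using assms unfolding types_eq by (elim insertE) (simp_all add: ff_weights_def)

lemma config_weight_pos:
  assumes "\<alpha> > 0" "\<beta> > 0" "\<gamma> > 0" "\<gamma>^2 - \<alpha> * \<beta> > 0" "\<sigma> \<in> tor_configs n"
  shows "config_weight n (ff_weights \<alpha> \<beta> \<gamma>) \<sigma> > 0"
  unfolding config_weight_def
  by (intro prod_pos ballI ff_weights_pos assms tor_configs_vtype) (use assms in simp)

lemma partition_fn_pos: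
  assumes "\<alpha> > 0" "\<beta> > 0" "\<gamma> > 0" "\<gamma>^2 - \<alpha> * \<beta> > 0" "n > 0"
  shows "partition_fn n (ff_weights \<alpha> \<beta> \<gamma>) > 0"
proof -
  have "(\<lambda>_. True, \<lambda>_. True) \<in> tor_configs n" unfolding tor_configs_def vtype_def by auto
  then show ?thesis
    unfolding partition_fn_def
    by (intro sum_pos finite_tor_configs assms(5) config_weight_pos assms(1-4)) auto
qed

lemma norm_one_minus_cis: "norm (1 - cis x) \<le> \<bar>x\<bar>"
proof -
  have "(norm (1 - cis x))^2 = (1 - cos x)^2 + (sin x)^2" by (simp add: cmod_power2)
  also have "\<dots> = 2 - 2 * cos x" using sin_cos_squared_add[of x] by (simp add: power2_diff)
  also have "cos x = 1 - 2 * (sin (x / 2))^2" using cos_double_sin[of "x / 2"] by simp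
  finally have e: "(norm (1 - cis x))^2 = (2 * \<bar>sin (x / 2)\<bar>)^2" by (simp add: power_mult_distrib)
  have "norm (1 - cis x) = 2 * \<bar>sin (x / 2)\<bar>"
    using power2_eq_imp_eq[OF e] by simp
  also have "\<dots> \<le> \<bar>x\<bar>" using abs_sin_x_le_abs_x[of "x / 2"] by simp
  finally show ?thesis .
qed

lemma norm_twisted_sum_le:
  assumes "\<alpha> > 0" "\<beta> > 0" "\<gamma> > 0" "\<gamma>^2 - \<alpha> * \<beta> > 0" "n > 0" and u: "norm u1 = 1" "norm u2 = 1"
  shows "norm (twisted_sum n \<alpha> \<beta> \<gamma> u1 u2 E) \<le> partition_fn n (ff_weights \<alpha> \<beta> \<gamma>)"
proof -
  have "norm (twisted_sum n \<alpha> \<beta> \<gamma> u1 u2 E) \<le> (\<Sum>\<sigma>\<in>tor_configs n \<inter> E. config_weight n (ff_weights \<alpha> \<beta> \<gamma>) \<sigma>)"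
    unfolding twisted_sum_def
  proof (rule sum_norm_le)
    fix \<sigma> assume "\<sigma> \<in> tor_configs n \<inter> E"
    then have "config_weight n (ff_weights \<alpha> \<beta> \<gamma>) \<sigma> > 0" using config_weight_pos assms by auto
    then show "norm (of_int (wind_sign n (windH n \<sigma>) (windV n \<sigma>)) * complex_of_real (config_weight n (ff_weights \<alpha> \<beta> \<gamma>) \<sigma>) *
       u1 ^ (n * windH n \<sigma>) * u2 ^ (n * windV n \<sigma>)) \<le> config_weight n (ff_weights \<alpha> \<beta> \<gamma>) \<sigma>"
      by (simp add: norm_mult norm_power u wind_sign_def)
  qed
  also have "\<dots> \<le> partition_fn n (ff_weights \<alpha> \<beta> \<gamma>)"
    unfolding partition_fn_def
  proof (rule sum_mono2)
    show "finite (tor_configs n)" by (rule finite_tor_configs) fact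
    fix \<sigma> assume "\<sigma> \<in> tor_configs n - tor_configs n \<inter> E"
    then have "config_weight n (ff_weights \<alpha> \<beta> \<gamma>) \<sigma> > 0" using config_weight_pos[OF assms(1-4)] by blast
    then show "0 \<le> config_weight n (ff_weights \<alpha> \<beta> \<gamma>) \<sigma>" by simp
  qed blast
  finally show ?thesis .
qed

text \<open>The additional phase \<open>\<psi> / n\<close> per occupied vertical edge multiplies a
  configuration by \<open>cis (\<psi> * windV)\<close>. Replacing the winding number by its typical
  value \<rho> * n makes this a common scalar, at the cost of \<psi> times the mean
  deviation.\<close>

lemma twisted_sum_shift:
  assumes pos: "\<alpha> > 0" "\<beta> > 0" "\<gamma> > 0" "\<gamma>^2 - \<alpha> * \<beta> > 0" and n: "n > 0" and \<psi>: "\<psi> \<ge> 0"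
  shows "norm (twisted_sum n \<alpha> \<beta> \<gamma> (tw n s1) (tw n s2) E - cis (- \<psi> * (\<rho> * real n)) *
       twisted_sum n \<alpha> \<beta> \<gamma> (tw n s1) (cis ((pi * real s2 + \<psi>) / real n)) E) \<le>
     \<psi> * (real n * dev n \<alpha> \<beta> \<gamma> \<rho>) * partition_fn n (ff_weights \<alpha> \<beta> \<gamma>)"
proof -
  let ?W = "config_weight n (ff_weights \<alpha> \<beta> \<gamma>)"
  have pw: "cis ((pi * real s2 + \<psi>) / real n) ^ (n * q) = tw n s2 ^ (n * q) * cis (\<psi> * real q)" for q
    unfolding tw_def Complex.DeMoivre cis_mult using n by (intro arg_cong[where f = cis]) (simp add: field_simps)
  have eq: "twisted_sum n \<alpha> \<beta> \<gamma> (tw n s1) (tw n s2) E - cis (- \<psi> * (\<rho> * real n)) *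
       twisted_sum n \<alpha> \<beta> \<gamma> (tw n s1) (cis ((pi * real s2 + \<psi>) / real n)) E =
    (\<Sum>\<sigma>\<in>tor_configs n \<inter> E. of_int (wind_sign n (windH n \<sigma>) (windV n \<sigma>)) * of_real (?W \<sigma>) *
      tw n s1 ^ (n * windH n \<sigma>) * tw n s2 ^ (n * windV n \<sigma>) * (1 - cis (\<psi> * (real (windV n \<sigma>) - \<rho> * real n))))"
    unfolding twisted_sum_def sum_distrib_left sum_subtractf[symmetric] pw
    by (intro sum.cong refl) (simp add: algebra_simps cis_mult)
  have "norm (\<Sum>\<sigma>\<in>tor_configs n \<inter> E. of_int (wind_sign n (windH n \<sigma>) (windV n \<sigma>)) * of_real (?W \<sigma>) *
      tw n s1 ^ (n * windH n \<sigma>) * tw n s2 ^ (n * windV n \<sigma>) * (1 - cis (\<psi> * (real (windV n \<sigma>) - \<rho> * real n)))) \<le>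
    (\<Sum>\<sigma>\<in>tor_configs n \<inter> E. ?W \<sigma> * (\<psi> * \<bar>real (windV n \<sigma>) - \<rho> * real n\<bar>))"
  proof (rule sum_norm_le)
    fix \<sigma> assume "\<sigma> \<in> tor_configs n \<inter> E"
    then have W: "?W \<sigma> > 0" using config_weight_pos pos by auto
    have "norm (1 - cis (\<psi> * (real (windV n \<sigma>) - \<rho> * real n))) \<le> \<psi> * \<bar>real (windV n \<sigma>) - \<rho> * real n\<bar>"
      using norm_one_minus_cis[of "\<psi> * (real (windV n \<sigma>) - \<rho> * real n)"] \<psi> by (simp add: abs_mult)
    then show "norm (of_int (wind_sign n (windH n \<sigma>) (windV n \<sigma>)) * complex_of_real (?W \<sigma>) *
      tw n s1 ^ (n * windH n \<sigma>) * tw n s2 ^ (n * windV n \<sigma>) * (1 - cis (\<psi> * (real (windV n \<sigma>) - \<rho> * real n))))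
      \<le> ?W \<sigma> * (\<psi> * \<bar>real (windV n \<sigma>) - \<rho> * real n\<bar>)"
      using W by (simp add: norm_mult norm_power wind_sign_def)
  qed
  also have "\<dots> \<le> (\<Sum>\<sigma>\<in>tor_configs n. ?W \<sigma> * (\<psi> * \<bar>real (windV n \<sigma>) - \<rho> * real n\<bar>))"
  proof -
    have "0 \<le> ?W \<sigma> * (\<psi> * \<bar>real (windV n \<sigma>) - \<rho> * real n\<bar>)" if s: "\<sigma> \<in> tor_configs n" for \<sigma>
    proof -
      have "?W \<sigma> > 0" by (rule config_weight_pos[OF pos s])
      then show ?thesis using \<psi> by simp
    qed
    then show ?thesis by (intro sum_mono2[OF finite_tor_configs[OF n] Int_lower1]) (simp only: Diff_iff)
  qed
  also have "\<dots> = \<psi> * (\<Sum>\<sigma>\<in>tor_configs n. ?W \<sigma> * \<bar>real (windV n \<sigma>) - \<rho> * real n\<bar>)"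
    unfolding sum_distrib_left by (intro sum.cong refl) simp
  also have "\<dots> = \<psi> * (real n * dev n \<alpha> \<beta> \<gamma> \<rho>) * partition_fn n (ff_weights \<alpha> \<beta> \<gamma>)"
    unfolding dev_def using partition_fn_pos[OF pos n] n by simp
  finally show ?thesis unfolding eq .
qed

text \<open>Once \<open>n\<close> exceeds the differences of the coordinates, distinct vertices stay
  distinct modulo \<open>n\<close>.\<close>

lemma eventually_enc_inj:
  assumes "distinct vs"
  shows "eventually (\<lambda>n. inj_on (\<lambda>i. enc n (vs ! i)) {..<length vs}) sequentially"
proof -
  define B where "B = (\<Sum>v\<in>set vs. \<bar>fst v\<bar> + \<bar>snd v\<bar>)"
  have B: "\<bar>fst v\<bar> \<le> B" "\<bar>snd v\<bar> \<le> B" if "v \<in> set vs" for v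
    using member_le_sum[OF that, of "\<lambda>v. \<bar>fst v\<bar> + \<bar>snd v\<bar>"] by (auto simp: B_def)
  have B0: "B \<ge> 0" unfolding B_def by (intro sum_nonneg) auto
  have zero: "x = y" if "x mod int n = y mod int n" "\<bar>x\<bar> \<le> B" "\<bar>y\<bar> \<le> B" "n \<ge> nat (2 * B + 1)" for x y n
  proof (rule ccontr)
    assume "x \<noteq> y"
    moreover have "int n dvd x - y" using that(1) by (simp add: mod_eq_dvd_iff)
    ultimately have "\<bar>int n\<bar> \<le> \<bar>x - y\<bar>" by (intro dvd_imp_le_int) auto
    then show False using that B0 by linarith
  qed
  have "inj_on (\<lambda>i. enc n (vs ! i)) {..<length vs}" if n: "n \<ge> nat (2 * B + 1)" for n
  proof (rule inj_onI)
    fix i j assume ij: "i \<in> {..<length vs}" "j \<in> {..<length vs}" "enc n (vs ! i) = enc n (vs ! j)"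
    have n0: "n > 0" using n B0 by linarith
    have v: "vs ! i \<in> set vs" "vs ! j \<in> set vs" using ij(1,2) by simp_all
    have m: "fst (vs ! i) mod int n = fst (vs ! j) mod int n" "snd (vs ! i) mod int n = snd (vs ! j) mod int n"
      using ij(3) unfolding enc_eq_iff[OF n0] by blast+
    have "vs ! i = vs ! j"
      by (rule prod_eqI) (rule zero[OF m(1) B(1)[OF v(1)] B(1)[OF v(2)] n], rule zero[OF m(2) B(2)[OF v(1)] B(2)[OF v(2)] n])
    then show "i = j" using assms ij by (simp add: nth_eq_iff_index_eq)
  qed
  then show ?thesis unfolding eventually_sequentially by blast
qed

lemma tendsto_cis_over_n:
  assumes "\<And>n. \<bar>f n\<bar> \<le> C"
  shows "(\<lambda>n. cis (f n / real n)) \<longlonglongrightarrow> 1"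
proof -
  have "(\<lambda>n. f n / real n) \<longlonglongrightarrow> 0"
  proof (rule Lim_null_comparison)
    show "\<forall>\<^sub>F n in sequentially. norm (f n / real n) \<le> C / real n"
      using assms by (auto intro!: always_eventually divide_right_mono)
    show "(\<lambda>n. C / real n) \<longlonglongrightarrow> 0" by (rule lim_const_over_n)
  qed
  then have "(\<lambda>n. cis (f n / real n)) \<longlonglongrightarrow> cis 0"
    unfolding cis_conv_exp by (intro tendsto_intros) auto
  then show ?thesis by simp
qed

lemma tendsto_dt:
  assumes "\<And>i j. i < N \<Longrightarrow> j < N \<Longrightarrow> (\<lambda>n. M n i j) \<longlonglongrightarrow> (L i j :: complex)"
  shows "(\<lambda>n. dt N (M n)) \<longlonglongrightarrow> dt N L"
  unfolding dt_leibniz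
proof (intro tendsto_sum tendsto_mult tendsto_const tendsto_prod)
  fix p i assume "p \<in> {p. p permutes {0..<N}}" "i \<in> {0..<N}"
  then show "(\<lambda>n. M n i (p i)) \<longlonglongrightarrow> L i (p i)"
    using permutes_in_image[of p "{0..<N}" i] by (intro assms) auto
qed

text \<open>The phase is small enough for the concentrated winding number to turn it into a scalar,
  yet makes the twisted matrix invertible, with an inverse that converges entrywise to the
  kernel.\<close>

definition good_twist :: "real \<Rightarrow> real \<Rightarrow> real \<Rightarrow> real \<Rightarrow> nat \<Rightarrow> nat \<Rightarrow> (nat \<Rightarrow> real) \<Rightarrow> bool" where
  "good_twist \<alpha> \<beta> \<gamma> \<rho> s1 s2 \<psi> \<longleftrightarrow> (\<forall>n. 0 \<le> \<psi> n \<and> \<psi> n \<le> 1) \<and>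
     (\<lambda>n. \<psi> n * (real n * dev n \<alpha> \<beta> \<gamma> \<rho>)) \<longlonglongrightarrow> 0 \<and>
     eventually (\<lambda>n. \<forall>k<n. \<forall>l<n. Delta \<alpha> \<beta> \<gamma> (tw n s1 * rt n k) (cis ((pi * real s2 + \<psi> n) / real n) * rt n l) \<noteq> 0) sequentially \<and>
     (\<forall>v c v' c'. (\<lambda>n. gridker n \<alpha> \<beta> \<gamma> (tw n s1) (cis ((pi * real s2 + \<psi> n) / real n)) (pt v c) (pt v' c')) \<longlonglongrightarrow>
        Lker \<alpha> \<beta> \<gamma> (pt v c) (pt v' c'))"

text \<open>\<open>R\<close> is common to the four twists because the twists tend to 1. For each of
  them the signed sum over the event is \<open>R\<close> times the full signed sum up to o(Z);
  summation with \<open>coef\<close> turns the full sums into Z and the event sums into the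
  numerator of the probability. No quotient of untwisted signed sums is formed, since their
  denominators may vanish.\<close>

theorem limit_of_good_twists:
  assumes pos: "\<alpha> > 0" "\<beta> > 0" "\<gamma> > 0" "\<gamma>^2 - \<alpha> * \<beta> > 0"
    and vs: "distinct vs" "length ts = length vs" "set ts \<subseteq> {1..6}"
    and good: "\<And>s1 s2. s1 < 2 \<Longrightarrow> s2 < 2 \<Longrightarrow> \<exists>\<psi>. good_twist \<alpha> \<beta> \<gamma> \<rho> s1 s2 \<psi>"
  shows "(\<lambda>n. complex_of_real (Pn n (ff_weights \<alpha> \<beta> \<gamma>) (type_event vs ts))) \<longlonglongrightarrow>
     complex_of_real (\<Prod>i<length vs. ff_weights \<alpha> \<beta> \<gamma> (ts ! i)) *
     dt (2 * length vs) (\<lambda>i j. Lker \<alpha> \<beta> \<gamma> (x_idx vs j) (y_idx vs ts i))"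
proof -
  define E where "E = type_event vs ts"
  define Z where "Z n = partition_fn n (ff_weights \<alpha> \<beta> \<gamma>)" for n
  define R where "R = complex_of_real (\<Prod>i<length vs. ff_weights \<alpha> \<beta> \<gamma> (ts ! i)) *
     dt (2 * length vs) (\<lambda>i j. Lker \<alpha> \<beta> \<gamma> (x_idx vs j) (y_idx vs ts i))"
  define G where "G s1 s2 A n = twisted_sum n \<alpha> \<beta> \<gamma> (tw n s1) (tw n s2) A / of_real (Z n)" for s1 s2 A n
  have Zp: "Z n > 0" if "n \<ge> 2" for n unfolding Z_def using partition_fn_pos[OF pos] that by simp
  have main: "(\<lambda>n. G s1 s2 E n - R * G s1 s2 UNIV n) \<longlonglongrightarrow> 0" if s: "s1 < 2" "s2 < 2" for s1 s2
  proof -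
    obtain \<psi> where "good_twist \<alpha> \<beta> \<gamma> \<rho> s1 s2 \<psi>" using good[OF s] by blast
    then have \<psi>: "\<And>n. 0 \<le> \<psi> n" "\<And>n. \<psi> n \<le> 1" and small: "(\<lambda>n. \<psi> n * (real n * dev n \<alpha> \<beta> \<gamma> \<rho>)) \<longlonglongrightarrow> 0"
      and nz: "eventually (\<lambda>n. \<forall>k<n. \<forall>l<n. Delta \<alpha> \<beta> \<gamma> (tw n s1 * rt n k) (cis ((pi * real s2 + \<psi> n) / real n) * rt n l) \<noteq> 0) sequentially"
      and L: "\<And>v c v' c'. (\<lambda>n. gridker n \<alpha> \<beta> \<gamma> (tw n s1) (cis ((pi * real s2 + \<psi> n) / real n)) (pt v c) (pt v' c')) \<longlonglongrightarrow>
        Lker \<alpha> \<beta> \<gamma> (pt v c) (pt v' c')"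
      unfolding good_twist_def by blast+
    define u2 where "u2 n = cis ((pi * real s2 + \<psi> n) / real n)" for n
    define c where "c n = cis (- \<psi> n * (\<rho> * real n))" for n
    define e where "e n = \<psi> n * (real n * dev n \<alpha> \<beta> \<gamma> \<rho>)" for n
    define F where "F A n = twisted_sum n \<alpha> \<beta> \<gamma> (tw n s1) (u2 n) A / of_real (Z n)" for A n
    \<comment> \<open>The extra twist costs a scalar \<open>c n\<close> of modulus 1, the same for
      the event and for the full sum, and a small error.\<close>
    have GF: "norm (G s1 s2 A n - c n * F A n) \<le> e n" if n: "n \<ge> 2" for A n
    proof -
      have "G s1 s2 A n - c n * F A n = (twisted_sum n \<alpha> \<beta> \<gamma> (tw n s1) (tw n s2) A - c n * twisted_sum n \<alpha> \<beta> \<gamma> (tw n s1) (u2 n) A) / of_real (Z n)"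
        unfolding G_def F_def by (simp add: diff_divide_distrib)
      also have "norm \<dots> \<le> e n"
        unfolding norm_divide norm_of_real c_def u2_def e_def
        using twisted_sum_shift[OF pos _ \<psi>(1), of n s1 s2 A n \<rho>] Zp[OF n] n unfolding Z_def
        by (simp add: pos_divide_le_eq)
      finally show ?thesis .
    qed
    have F1: "norm (F UNIV n) \<le> 1" if n: "n \<ge> 2" for n
      unfolding F_def norm_divide norm_of_real
      using norm_twisted_sum_le[OF pos, of n "tw n s1" "u2 n" UNIV] Zp[OF n] n by (simp add: u2_def Z_def)
    define Rn where "Rn n = (\<Prod>i<length vs. of_real (ff_weights \<alpha> \<beta> \<gamma> (ts ! i)) * xmono (tw n s1) (u2 n) (ts ! i)) *
      dt (2 * length vs) (\<lambda>i j. tw n s1 powi (fst (xbase vs j) - fst (dshift (ydir ts i) (xbase vs i))) *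
       u2 n powi (snd (xbase vs j) - snd (dshift (ydir ts i) (xbase vs i))) *
       gridker n \<alpha> \<beta> \<gamma> (tw n s1) (u2 n) (x_idx vs j) (y_idx vs ts i))" for n
    \<comment> \<open>This identity is exact for the extra-twisted sums, whose matrix is
      invertible.\<close>
    have FE: "eventually (\<lambda>n. F E n = Rn n * F UNIV n) sequentially"
      using nz eventually_enc_inj[OF vs(1)] eventually_ge_at_top[of 2]
    proof eventually_elim
      case (elim n)
      have "twisted_sum n \<alpha> \<beta> \<gamma> (tw n s1) (u2 n) E = Rn n * twisted_sum n \<alpha> \<beta> \<gamma> (tw n s1) (u2 n) UNIV"
        unfolding E_def Rn_def by (rule event_formula) (use elim vs in \<open>auto simp: u2_def\<close>)
      then show ?case unfolding F_def by simp
    qed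
    have t1: "(\<lambda>n. tw n s1) \<longlonglongrightarrow> 1" unfolding tw_def by (rule tendsto_cis_over_n[of _ "pi * real s1"]) simp
    have t2: "u2 \<longlonglongrightarrow> 1" unfolding u2_def
      by (rule tendsto_cis_over_n[of _ "pi * real s2 + 1"]) (use \<psi> pi_ge_zero in \<open>auto simp: abs_le_iff intro: add_nonneg_nonneg\<close>)
    have Rlim: "Rn \<longlonglongrightarrow> R"
    proof -
      have xm: "(\<lambda>n. xmono (tw n s1) (u2 n) t) \<longlonglongrightarrow> 1" for t
        unfolding xmono_def using tendsto_mult[OF t1 t2] t1 t2 by (cases "has t 2"; cases "has t 3") auto
      have pw: "(\<lambda>n. f n powi a) \<longlonglongrightarrow> 1" if "f \<longlonglongrightarrow> (1::complex)" for f a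
        using tendsto_power_int[OF that, of a] by simp
      have "(\<lambda>n. \<Prod>i<length vs. of_real (ff_weights \<alpha> \<beta> \<gamma> (ts ! i)) * xmono (tw n s1) (u2 n) (ts ! i)) \<longlonglongrightarrow>
         (\<Prod>i<length vs. of_real (ff_weights \<alpha> \<beta> \<gamma> (ts ! i)) * 1)"
        by (intro tendsto_prod tendsto_mult tendsto_const xm)
      moreover have "(\<lambda>n. dt (2 * length vs) (\<lambda>i j. tw n s1 powi (fst (xbase vs j) - fst (dshift (ydir ts i) (xbase vs i))) *
       u2 n powi (snd (xbase vs j) - snd (dshift (ydir ts i) (xbase vs i))) *
       gridker n \<alpha> \<beta> \<gamma> (tw n s1) (u2 n) (x_idx vs j) (y_idx vs ts i))) \<longlonglongrightarrow>
         dt (2 * length vs) (\<lambda>i j. Lker \<alpha> \<beta> \<gamma> (x_idx vs j) (y_idx vs ts i))"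
      proof (rule tendsto_dt)
        fix i j assume ij: "i < 2 * length vs" "j < 2 * length vs"
        then have "ts ! (i div 2) \<in> set ts" using vs(2) by auto
        then have y: "y_idx vs ts i = pt (dshift (ydir ts i) (xbase vs i)) (ydir ts i = 1 \<or> ydir ts i = 3)"
          using vs(3) by (intro y_idx_pt) blast
        have "(\<lambda>n. tw n s1 powi (fst (xbase vs j) - fst (dshift (ydir ts i) (xbase vs i))) *
       u2 n powi (snd (xbase vs j) - snd (dshift (ydir ts i) (xbase vs i))) *
       gridker n \<alpha> \<beta> \<gamma> (tw n s1) (u2 n) (x_idx vs j) (y_idx vs ts i)) \<longlonglongrightarrow> 1 * 1 * Lker \<alpha> \<beta> \<gamma> (x_idx vs j) (y_idx vs ts i)"
          unfolding y x_idx_pt using L unfolding u2_def[symmetric] by (intro tendsto_mult pw t1 t2)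
        then show "(\<lambda>n. tw n s1 powi (fst (xbase vs j) - fst (dshift (ydir ts i) (xbase vs i))) *
       u2 n powi (snd (xbase vs j) - snd (dshift (ydir ts i) (xbase vs i))) *
       gridker n \<alpha> \<beta> \<gamma> (tw n s1) (u2 n) (x_idx vs j) (y_idx vs ts i)) \<longlonglongrightarrow> Lker \<alpha> \<beta> \<gamma> (x_idx vs j) (y_idx vs ts i)"
          by simp
      qed
      ultimately show ?thesis unfolding Rn_def R_def by (auto dest: tendsto_mult)
    qed
    show ?thesis
    proof (rule Lim_null_comparison)
      show "eventually (\<lambda>n. norm (G s1 s2 E n - R * G s1 s2 UNIV n) \<le> e n + norm (Rn n - R) + norm R * e n) sequentially"
        using FE eventually_ge_at_top[of 2]
      proof eventually_elim
        case (elim n)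
        have "G s1 s2 E n - R * G s1 s2 UNIV n = (G s1 s2 E n - c n * F E n) + c n * ((Rn n - R) * F UNIV n) + - R * (G s1 s2 UNIV n - c n * F UNIV n)"
          unfolding elim(1) by (simp add: algebra_simps)
        also have "norm \<dots> \<le> norm (G s1 s2 E n - c n * F E n) + norm (c n * ((Rn n - R) * F UNIV n)) + norm (- R * (G s1 s2 UNIV n - c n * F UNIV n))"
          by (intro norm_triangle_le add_mono norm_triangle_ineq order_refl)
        also have "\<dots> \<le> e n + norm (Rn n - R) + norm R * e n"
        proof (intro add_mono GF elim)
          show "norm (c n * ((Rn n - R) * F UNIV n)) \<le> norm (Rn n - R)"
            using mult_left_mono[OF F1[OF elim(2)], of "norm (Rn n - R)"] by (simp add: norm_mult c_def)
          show "norm (- R * (G s1 s2 UNIV n - c n * F UNIV n)) \<le> norm R * e n"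
            unfolding norm_mult norm_minus_cancel by (intro mult_left_mono GF elim) simp
        qed
        finally show ?case .
      qed
      have "(\<lambda>n. e n + norm (Rn n - R) + norm R * e n) \<longlonglongrightarrow> 0 + norm (R - R) + norm R * 0"
        using small unfolding e_def[symmetric] by (intro tendsto_intros Rlim)
      then show "(\<lambda>n. e n + norm (Rn n - R) + norm R * e n) \<longlonglongrightarrow> 0" by simp
    qed
  qed
  have "(\<lambda>n. complex_of_real (Pn n (ff_weights \<alpha> \<beta> \<gamma>) E) - R) \<longlonglongrightarrow> 0"
  proof (rule Lim_null_comparison)
    have ex: "complex_of_real (\<Sum>\<sigma>\<in>tor_configs n \<inter> A. config_weight n (ff_weights \<alpha> \<beta> \<gamma>) \<sigma>) / of_real (Z n) =
       (\<Sum>s1<2. \<Sum>s2<2. coef n s1 s2 * G s1 s2 A n)" if "n > 0" for n A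
      using untwist[OF that, where t = 1 and E = A] unfolding G_def by (simp add: sum_divide_distrib)
    show "eventually (\<lambda>n. norm (complex_of_real (Pn n (ff_weights \<alpha> \<beta> \<gamma>) E) - R) \<le>
        (\<Sum>s1<2. \<Sum>s2<2. norm (G s1 s2 E n - R * G s1 s2 UNIV n))) sequentially"
      using eventually_ge_at_top[of 2]
    proof eventually_elim
      case (elim n)
      have "complex_of_real (Pn n (ff_weights \<alpha> \<beta> \<gamma>) E) = (\<Sum>s1<2. \<Sum>s2<2. coef n s1 s2 * G s1 s2 E n)"
        using ex[of n E] elim unfolding Pn_def Z_def by simp
      \<comment> \<open>For the full sum the combination is the partition function divided by
        itself.\<close>
      moreover have "(\<Sum>s1<2. \<Sum>s2<2. coef n s1 s2 * G s1 s2 UNIV n) = 1"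
        using ex[of n UNIV, unfolded Int_UNIV_right, folded partition_fn_def, folded Z_def] Zp[OF elim] elim
        by simp
      ultimately have "complex_of_real (Pn n (ff_weights \<alpha> \<beta> \<gamma>) E) - R =
        (\<Sum>s1<2. \<Sum>s2<2. coef n s1 s2 * G s1 s2 E n) - R * (\<Sum>s1<2. \<Sum>s2<2. coef n s1 s2 * G s1 s2 UNIV n)" by simp
      also have "\<dots> = (\<Sum>s1<2. \<Sum>s2<2. coef n s1 s2 * (G s1 s2 E n - R * G s1 s2 UNIV n))"
        unfolding sum_distrib_left sum_subtractf[symmetric] by (intro sum.cong refl) (simp add: algebra_simps)
      also have "norm \<dots> \<le> (\<Sum>s1<2. \<Sum>s2<2. norm (G s1 s2 E n - R * G s1 s2 UNIV n))"
        by (intro sum_norm_le) (simp add: norm_mult mult_left_le_one_le norm_coef)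
      finally show ?case .
    qed
    have "(\<lambda>n. \<Sum>s1<2. \<Sum>s2<2. norm (G s1 s2 E n - R * G s1 s2 UNIV n)) \<longlonglongrightarrow> (\<Sum>s1<2::nat. \<Sum>s2<2::nat. 0)"
      by (intro tendsto_sum tendsto_norm_zero main) auto
    then show "(\<lambda>n. \<Sum>s1<2. \<Sum>s2<2. norm (G s1 s2 E n - R * G s1 s2 UNIV n)) \<longlonglongrightarrow> 0" by simp
  qed
  then show ?thesis unfolding R_def E_def by (simp add: LIM_zero_iff)
qed

subsection \<open>Riemann sums over twisted roots of unity\<close>

lemma cis_2pi_continuous:
  assumes "continuous_on (sphere 0 1) f"
  shows "continuous_on S (\<lambda>t. f (cis (2 * pi * t)))"
proof (rule continuous_on_compose2[OF assms])
  show "continuous_on S (\<lambda>t. cis (2 * pi * t))"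
    unfolding cis_conv_exp by (intro continuous_intros)
qed auto

lemma integral_unit_split:
  fixes g :: "real \<Rightarrow> 'a::banach"
  assumes g: "continuous_on {0..1} g" and n: "n > 0" and "m \<le> n"
  shows "integral {0..real m / real n} g = (\<Sum>k<m. integral {real k / real n..real (Suc k) / real n} g)"
  using assms(3)
proof (induction m)
  case (Suc m)
  have "integral {0..real m / real n} g + integral {real m / real n..real (Suc m) / real n} g = integral {0..real (Suc m) / real n} g"
  proof (rule Henstock_Kurzweil_Integration.integral_combine)
    have "real (Suc m) / real n \<le> 1" using Suc.prems n by (simp add: field_simps)
    then have "{0..real (Suc m) / real n} \<subseteq> {0..1}" by auto
    then show "g integrable_on {0..real (Suc m) / real n}"
      by (intro integrable_continuous_interval continuous_on_subset[OF g])
  qed (use n in \<open>auto simp: divide_right_mono\<close>)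
  then show ?case using Suc by simp
qed simp

text \<open>For every phase between 0 and 2\<pi> there is one sample point in each of the
  \<open>n\<close> equal subintervals, so uniform continuity gives a bound independent of the
  parameter \<open>w\<close> and of the phase, which may then vary with \<open>n\<close>.\<close>

lemma riemann_grid_uniform:
  fixes f :: "'b::metric_space \<Rightarrow> complex \<Rightarrow> 'a::banach"
  assumes K: "compact K" and f: "continuous_on (K \<times> sphere 0 1) (\<lambda>(w, z). f w z)" and e: "e > 0"
  shows "\<exists>N. \<forall>n\<ge>N. \<forall>w\<in>K. \<forall>\<theta>. 0 \<le> \<theta> \<and> \<theta> \<le> 2 * pi \<longrightarrow>
    norm ((\<Sum>k<n. f w (cis (\<theta> / real n) * rt n k)) /\<^sub>R real n - integral {0..1} (\<lambda>t. f w (cis (2 * pi * t)))) \<le> e"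
proof -
  define g where "g w t = f w (cis (2 * pi * t))" for w t
  have contp: "continuous_on (K \<times> {0..1}) (\<lambda>(w, t). g w t)"
  proof -
    have "continuous_on (K \<times> {0..1}) (\<lambda>p. (\<lambda>(w, z). f w z) (fst p, cis (2 * pi * snd p)))"
    proof (rule continuous_on_compose2[OF f])
      show "continuous_on (K \<times> {0..1}) (\<lambda>p. (fst p, cis (2 * pi * snd p)))"
        unfolding cis_conv_exp by (intro continuous_intros)
    qed auto
    then show ?thesis unfolding g_def by (simp add: case_prod_beta)
  qed
  have cont: "continuous_on S (g w)" if "w \<in> K" for S w
  proof -
    have "continuous_on (sphere 0 1) (\<lambda>z. (\<lambda>(w, z). f w z) (w, z))"
      by (rule continuous_on_compose2[OF f]) (use that in \<open>auto intro!: continuous_intros\<close>)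
    then show ?thesis unfolding g_def by (intro cis_2pi_continuous) simp
  qed
  have "uniformly_continuous_on (K \<times> {0..1}) (\<lambda>(w, t). g w t)"
    by (rule compact_uniformly_continuous[OF contp]) (intro compact_Times K compact_Icc)
  then obtain d where d: "d > 0" and
    ud: "\<And>w x y. w \<in> K \<Longrightarrow> x \<in> {0..1} \<Longrightarrow> y \<in> {0..1} \<Longrightarrow> dist x y < d \<Longrightarrow> dist (g w x) (g w y) < e"
  proof -
    assume *: "\<And>d. 0 < d \<Longrightarrow> (\<And>w x y. w \<in> K \<Longrightarrow> x \<in> {0..1} \<Longrightarrow> y \<in> {0..1} \<Longrightarrow> dist x y < d \<Longrightarrow> dist (g w x) (g w y) < e) \<Longrightarrow> thesis"
    assume "uniformly_continuous_on (K \<times> {0..1}) (\<lambda>(w, t). g w t)"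
    from uniformly_continuous_onE[OF this e] obtain d where "d > 0"
      "\<And>p q. p \<in> K \<times> {0..1} \<Longrightarrow> q \<in> K \<times> {0..1} \<Longrightarrow> dist q p < d \<Longrightarrow> dist ((\<lambda>(w, t). g w t) q) ((\<lambda>(w, t). g w t) p) < e"
      by metis
    note d' = this
    show thesis
    proof (rule *[OF d'(1)])
      fix w and x y :: real assume "w \<in> K" "x \<in> {0..1}" "y \<in> {0..1}" "dist x y < d"
      then show "dist (g w x) (g w y) < e" using d'(2)[of "(w, y)" "(w, x)"] by (simp add: dist_Pair_Pair)
    qed
  qed
  obtain N where N: "N > 0" "1 / real N < d" using reals_Archimedean[OF d] by (metis inverse_eq_divide of_nat_0_less_iff zero_less_Suc)
  show ?thesis
  proof (intro exI allI impI ballI)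
    fix n w \<theta> assume n: "n \<ge> N" and w: "w \<in> K" and \<theta>: "0 \<le> \<theta> \<and> \<theta> \<le> 2 * pi"
    note cont = cont[OF w] and ud = ud[OF w]
    have n0: "n > 0" using n N by simp
    have nd: "1 / real n < d"
    proof -
      have "1 / real n \<le> 1 / real N" using n N(1) by (intro divide_left_mono) auto
      then show ?thesis using N(2) by simp
    qed
    \<comment> \<open>\<open>\<theta> / (2 * pi)\<close> is the relative position of the sample
      point in its subinterval.\<close>
    define p where "p k = (real k + \<theta> / (2 * pi)) / real n" for k :: nat
    have fp: "f w (cis (\<theta> / real n) * rt n k) = g w (p k)" for k
      unfolding g_def rt_def cis_mult p_def using n0 by (intro arg_cong[where f = "f w"] arg_cong[where f = cis]) (simp add: field_simps)
    have th: "0 \<le> \<theta> / (2 * pi)" "\<theta> / (2 * pi) \<le> 1" using \<theta> by (simp_all add: field_simps)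
    have piece: "norm (g w (p k) /\<^sub>R real n - integral {real k / real n..real (Suc k) / real n} (g w)) \<le> e / real n" if k: "k < n" for k
    proof -
      have le: "real k / real n \<le> real (Suc k) / real n" by (simp add: divide_right_mono)
      have sub: "{real k / real n..real (Suc k) / real n} \<subseteq> {0..1}" using k n0 by (auto simp: field_simps intro: order_trans)
      have pk: "p k \<in> {real k / real n..real (Suc k) / real n}" unfolding p_def using th n0 by (auto intro!: divide_right_mono)
      have len: "real (Suc k) / real n - real k / real n = 1 / real n" by (simp add: diff_divide_distrib[symmetric])
      have "norm (integral {real k / real n..real (Suc k) / real n} (\<lambda>t. g w t - g w (p k))) \<le> e * (real (Suc k) / real n - real k / real n)"
      proof (rule integral_bound[OF le])
        show "continuous_on {real k / real n..real (Suc k) / real n} (\<lambda>t. g w t - g w (p k))" by (intro continuous_intros cont)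
        fix t assume t: "t \<in> {real k / real n..real (Suc k) / real n}"
        have "dist t (p k) \<le> 1 / real n" using t pk len by (auto simp: dist_real_def abs_le_iff)
        moreover have "t \<in> {0..1}" "p k \<in> {0..1}" using t pk sub by blast+
        ultimately have "dist (g w t) (g w (p k)) < e" using nd by (intro ud) auto
        then show "norm (g w t - g w (p k)) \<le> e" by (simp add: dist_norm)
      qed
      also have "integral {real k / real n..real (Suc k) / real n} (\<lambda>t. g w t - g w (p k)) =
         integral {real k / real n..real (Suc k) / real n} (g w) - g w (p k) /\<^sub>R real n"
        using le len by (subst Henstock_Kurzweil_Integration.integral_diff)
          (auto intro!: integrable_continuous_interval cont simp: content_real divide_inverse)
      finally show ?thesis unfolding len by (simp add: norm_minus_commute)
    qed
    have "integral {0..1} (g w) = (\<Sum>k<n. integral {real k / real n..real (Suc k) / real n} (g w))"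
      using integral_unit_split[OF cont n0 le_refl] n0 by simp
    then have "(\<Sum>k<n. f w (cis (\<theta> / real n) * rt n k)) /\<^sub>R real n - integral {0..1} (\<lambda>t. f w (cis (2 * pi * t))) =
        (\<Sum>k<n. g w (p k) /\<^sub>R real n - integral {real k / real n..real (Suc k) / real n} (g w))"
      unfolding fp g_def[symmetric] sum_subtractf by (simp add: scaleR_sum_right)
    also have "norm \<dots> \<le> (\<Sum>k<n. e / real n)" by (intro sum_norm_le piece) simp
    also have "\<dots> = e" using n0 by simp
    finally show "norm ((\<Sum>k<n. f w (cis (\<theta> / real n) * rt n k)) /\<^sub>R real n - integral {0..1} (\<lambda>t. f w (cis (2 * pi * t)))) \<le> e" .
  qed
qed

corollary riemann_grid:
  fixes f :: "complex \<Rightarrow> 'a::banach"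
  assumes f: "continuous_on (sphere 0 1) f" and e: "e > 0"
  shows "\<exists>N. \<forall>n\<ge>N. \<forall>\<theta>. 0 \<le> \<theta> \<and> \<theta> \<le> 2 * pi \<longrightarrow>
    norm ((\<Sum>k<n. f (cis (\<theta> / real n) * rt n k)) /\<^sub>R real n - integral {0..1} (\<lambda>t. f (cis (2 * pi * t)))) \<le> e"
proof -
  have "continuous_on ({0::real} \<times> sphere 0 1) (\<lambda>p. f (snd p))"
    by (rule continuous_on_compose2[OF f]) (auto intro!: continuous_intros)
  then have "continuous_on ({0::real} \<times> sphere 0 1) (\<lambda>(w, z). f z)" by (simp add: case_prod_beta)
  from riemann_grid_uniform[OF _ this e] show ?thesis by simp
qed

text \<open>All functions are set to 0 on the finite set \<open>F\<close>, where bound and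
  convergence may fail.\<close>

lemma ae_dominated_convergence:
  fixes f :: "nat \<Rightarrow> real \<Rightarrow> 'a::euclidean_space"
  assumes F: "finite F" and f: "\<And>m. f m integrable_on {0..1}" and b: "\<And>m t. t \<in> {0..1} - F \<Longrightarrow> norm (f m t) \<le> C"
    and lim: "\<And>t. t \<in> {0..1} - F \<Longrightarrow> (\<lambda>m. f m t) \<longlonglongrightarrow> g t"
  shows "g integrable_on {0..1}" "(\<lambda>m. integral {0..1} (f m)) \<longlonglongrightarrow> integral {0..1} g"
proof -
  define f' where "f' m t = (if t \<in> F then 0 else f m t)" for m t
  define g' where "g' t = (if t \<in> F then 0 else g t)" for t
  have neg: "negligible F" using F by (rule negligible_finite)
  have f': "f' m integrable_on {0..1}" for m
    by (rule integrable_spike[OF f neg]) (simp add: f'_def)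
  have If: "integral {0..1} (f' m) = integral {0..1} (f m)" for m
    by (rule integral_spike[OF neg]) (simp add: f'_def)
  have b': "norm (f' m t) \<le> \<bar>C\<bar>" if "t \<in> {0..1}" for m t
    using b[of t m] that unfolding f'_def by auto
  have l': "(\<lambda>m. f' m t) \<longlonglongrightarrow> g' t" if "t \<in> {0..1}" for t
    using lim[of t] that unfolding f'_def g'_def by auto
  note dc = dominated_convergence[where h = "\<lambda>_. \<bar>C\<bar>", OF f' integrable_const_ivl b' l']
  have gg: "g t = g' t" if "t \<in> {0..1} - F" for t using that by (auto simp: g'_def)
  show "g integrable_on {0..1}" using dc(1) neg gg by (rule integrable_spike)
  have "integral {0..1} g = integral {0..1} g'"
    by (rule integral_spike[OF neg]) (simp only: gg)
  then show "(\<lambda>m. integral {0..1} (f m)) \<longlonglongrightarrow> integral {0..1} g"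
    using dc(2) unfolding If by simp
qed

subsection \<open>Sums and products over roots of unity\<close>

lemma sum_twisted_powi:
  assumes "n > 0" "u \<noteq> 0"
  shows "(\<Sum>l<n. (u * rt n l) powi m) = (if int n dvd m then of_nat n * u powi m else 0)"
  unfolding power_int_mult_distrib sum_distrib_left[symmetric] sum_rt_powi[OF assms(1)] by simp

text \<open>Dividing \<open>A^n - (- B * w)^n\<close> by \<open>A + B * w\<close> leaves a geometric
  sum, and \<open>w^n\<close> is the same for all \<open>w = u * rt n l\<close>. Summing over the
  roots of unity keeps only the power whose exponent is divisible by \<open>n\<close>;
  \<open>j0\<close> is the residue of \<open>- b\<close> modulo \<open>n\<close>. The exact formula
  avoids estimating single terms, which may be large.\<close>

lemma resolvent_sum:
  assumes n: "n > 0" and u: "u \<noteq> 0" and nz: "\<And>l. l < n \<Longrightarrow> A + B * (u * rt n l) \<noteq> 0"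
    and c: "0 \<le> j0" "j0 < int n" "j0 + b = int n * z"
  shows "(\<Sum>l<n. (u * rt n l) powi b / (A + B * (u * rt n l))) * (A ^ n - (- B) ^ n * u ^ n) =
    of_nat n * u powi (int n * z) * A ^ nat (int n - 1 - j0) * (- B) ^ nat j0"
proof -
  define w where "w l = u * rt n l" for l
  have w0: "w l \<noteq> 0" for l unfolding w_def using u by simp
  have wn: "w l ^ n = u ^ n" for l unfolding w_def power_mult_distrib rt_power[OF n] by simp
  have geo: "A ^ n - (- B) ^ n * u ^ n = (A + B * w l) * (\<Sum>j<n. A ^ (n - Suc j) * (- B * w l) ^ j)" for l
  proof -
    have "A ^ n - (- B * w l) ^ n = (A - (- B * w l)) * (\<Sum>j<n. A ^ (n - Suc j) * (- B * w l) ^ j)"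
    proof -
      have "(- B * w l) ^ n - A ^ n = (- B * w l - A) * (\<Sum>j<n. A ^ (n - Suc j) * (- B * w l) ^ j)"
        by (rule power_diff_sumr2)
      then show ?thesis by (simp add: algebra_simps)
    qed
    moreover have "(- B * w l) ^ n = (- B) ^ n * u ^ n" by (simp only: power_mult_distrib wn)
    ultimately show ?thesis by simp
  qed
  have "(\<Sum>l<n. w l powi b / (A + B * w l)) * (A ^ n - (- B) ^ n * u ^ n) =
     (\<Sum>l<n. w l powi b * (\<Sum>j<n. A ^ (n - Suc j) * (- B * w l) ^ j))"
    unfolding sum_distrib_right
  proof (rule sum.cong[OF refl])
    fix l assume "l \<in> {..<n}"
    then have "A + B * w l \<noteq> 0" using nz unfolding w_def by simp
    then show "w l powi b / (A + B * w l) * (A ^ n - (- B) ^ n * u ^ n) = w l powi b * (\<Sum>j<n. A ^ (n - Suc j) * (- B * w l) ^ j)"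
      unfolding geo[of l] by simp
  qed
  also have "\<dots> = (\<Sum>j<n. A ^ (n - Suc j) * (- B) ^ j * (\<Sum>l<n. w l powi (int j + b)))"
    unfolding sum_distrib_left
    by (subst sum.swap) (intro sum.cong refl, simp only: power_mult_distrib power_int_add[OF disjI1[OF w0]] power_int_of_nat mult_ac)
  also have "\<dots> = (\<Sum>j<n. if j = nat j0 then A ^ (n - Suc j) * (- B) ^ j * (of_nat n * u powi (int n * z)) else 0)"
  proof (rule sum.cong[OF refl])
    fix j assume "j \<in> {..<n}"
    then have j: "j < n" by simp
    have e: "int j + b = int j - j0 + int n * z" using c(3) by simp
    have "int n dvd int j + b \<longleftrightarrow> int n dvd int j - j0"
      unfolding e by (simp add: dvd_add_left_iff)
    also have "\<dots> \<longleftrightarrow> int j = j0"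
      using j c(1,2) by (simp add: mod_eq_dvd_iff[symmetric])
    also have "\<dots> \<longleftrightarrow> j = nat j0" using c(1) by auto
    finally have d: "int n dvd int j + b \<longleftrightarrow> j = nat j0" .
    have "j = nat j0 \<Longrightarrow> int j + b = int n * z" using c by simp
    then show "A ^ (n - Suc j) * (- B) ^ j * (\<Sum>l<n. w l powi (int j + b)) =
      (if j = nat j0 then A ^ (n - Suc j) * (- B) ^ j * (of_nat n * u powi (int n * z)) else 0)"
      unfolding w_def sum_twisted_powi[OF n u] d by auto
  qed
  also have "\<dots> = A ^ (n - Suc (nat j0)) * (- B) ^ nat j0 * (of_nat n * u powi (int n * z))"
    using c(1,2) n by (subst sum.delta) (auto simp: nat_less_iff)
  also have "n - Suc (nat j0) = nat (int n - 1 - j0)" using c(1,2) by linarith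
  finally show ?thesis unfolding w_def by (simp only: mult_ac)
qed

lemma monic_linear_factors:
  fixes S :: "complex set"
  assumes "finite S"
  shows "degree (\<Prod>a\<in>S. [:- a, 1:]) = card S \<and> lead_coeff (\<Prod>a\<in>S. [:- a, 1:]) = 1"
  using assms
proof induction
  case (insert x S)
  have "(\<Prod>a\<in>S. [:- a, 1:]) \<noteq> (0 :: complex poly)" using insert by auto
  then have D: "degree ([:- x, 1:] * (\<Prod>a\<in>S. [:- a, 1:])) = degree [:- x, 1:] + degree (\<Prod>a\<in>S. [:- a, 1:])"
    by (intro degree_mult_eq) auto
  have L: "lead_coeff ([:- x, 1:] * (\<Prod>a\<in>S. [:- a, 1:])) = lead_coeff [:- x, 1:] * lead_coeff (\<Prod>a\<in>S. [:- a, 1:])"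
    by (rule lead_coeff_mult)
  show ?case unfolding prod.insert[OF insert.hyps]
  proof
    show "degree ([:- x, 1:] * (\<Prod>a\<in>S. [:- a, 1:])) = card (insert x S)"
      unfolding D insert.IH[THEN conjunct1] card_insert_disjoint[OF insert.hyps] by simp
    show "lead_coeff ([:- x, 1:] * (\<Prod>a\<in>S. [:- a, 1:])) = 1"
      unfolding L insert.IH[THEN conjunct2] by simp
  qed
qed simp

text \<open>Both sides are monic of degree \<open>n\<close> in \<open>z\<close> with the same
  \<open>n\<close> zeros, so their difference has too many zeros for its degree.\<close>

lemma prod_minus_rt:
  assumes n: "n > 0"
  shows "(\<Prod>l<n. z - rt n l) = z ^ n - 1"
proof -
  have bij: "bij_betw (rt n) {..<n} {z. z ^ n = 1}"
    using Complex.bij_betw_roots_unity[OF n] unfolding rt_def .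
  define S where "S = {z :: complex. z ^ n = 1}"
  have card: "card S = n" using bij_betw_same_card[OF bij] by (simp add: S_def)
  have fin: "finite S" using bij unfolding S_def by (metis bij_betw_finite finite_lessThan)
  define p where "p = (\<Prod>a\<in>S. [:- a, 1:])"
  define q where "q = p - (monom 1 n - 1)"
  have p: "degree p = n" "lead_coeff p = 1" using monic_linear_factors[OF fin] unfolding p_def card by auto
  have "q = 0"
  proof (rule ccontr)
    assume q0: "q \<noteq> 0"
    have "degree q \<le> n" unfolding q_def
      by (intro degree_diff_le) (simp_all add: p degree_monom_le)
    moreover have "coeff q n = 0" unfolding q_def using p n by simp
    ultimately have "degree q < n" using q0 by (metis leading_coeff_0_iff le_neq_implies_less)
    moreover have "S \<subseteq> {z. poly q z = 0}"
    proof
      fix z assume z: "z \<in> S"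
      have "poly p z = 0" unfolding p_def poly_prod using z fin by (intro prod_zero) auto
      then show "z \<in> {z. poly q z = 0}" using z unfolding q_def S_def by (simp add: poly_monom)
    qed
    then have "card S \<le> card {z. poly q z = 0}" by (intro card_mono poly_roots_finite q0)
    moreover have "card {z. poly q z = 0} \<le> degree q" by (rule card_poly_roots_bound[OF q0])
    ultimately show False using card by simp
  qed
  then have "poly p z = z ^ n - 1" unfolding q_def by (simp add: poly_monom)
  moreover have "poly p z = (\<Prod>a\<in>S. z - a)" unfolding p_def poly_prod by simp
  moreover have "(\<Prod>a\<in>S. z - a) = (\<Prod>l<n. z - rt n l)"
    unfolding S_def by (rule prod.reindex_bij_betw[OF bij, symmetric])
  ultimately show ?thesis by simp
qed

lemma prod_affine_rt:
  assumes n: "n > 0"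
  shows "(\<Prod>l<n. A + B * (u * rt n l)) = A ^ n - (- B) ^ n * u ^ n"
proof (cases "B * u = 0")
  case True
  then have "A + B * (u * rt n l) = A" for l by auto
  then have "(\<Prod>l<n. A + B * (u * rt n l)) = A ^ n" by (simp only: prod_constant card_lessThan)
  moreover have "(- B) ^ n * u ^ n = 0" using True n by auto
  ultimately show ?thesis by (simp only: diff_0_right)
next
  case False
  have "A + B * (u * rt n l) = (- (B * u)) * (- A / (B * u) - rt n l)" for l
    using False by (simp add: field_simps)
  then have "(\<Prod>l<n. A + B * (u * rt n l)) = (- (B * u)) ^ n * ((- A / (B * u)) ^ n - 1)"
    unfolding prod_minus_rt[OF n, symmetric] by (simp only: prod.distrib prod_constant card_lessThan)
  also have "\<dots> = (- (B * u) * (- A / (B * u))) ^ n - (- (B * u)) ^ n"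
    by (simp only: right_diff_distrib power_mult_distrib[symmetric] mult_1_right)
  also have "- (B * u) * (- A / (B * u)) = A" using False by (simp add: field_simps)
  also have "(- (B * u)) ^ n = (- B) ^ n * u ^ n" by (simp add: power_mult_distrib[symmetric])
  finally show ?thesis .
qed

text \<open>Reflecting a factor \<open>a + b z\<close> to \<open>cnj b + cnj a z\<close> does not change its modulus on the unit circle.\<close>

lemma exists_prod_ge_prod_max:
  fixes a b :: "nat \<Rightarrow> complex"
  shows "\<exists>z. norm z = 1 \<and> (\<Prod>k<n. max (norm (a k)) (norm (b k))) \<le> norm (\<Prod>k<n. a k + b k * z)"
proof -
  define c where "c k = (if norm (b k) \<le> norm (a k) then a k else cnj (b k))" for k
  define d where "d k = (if norm (b k) \<le> norm (a k) then b k else cnj (a k))" for k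
  define p where "p z = (\<Prod>k<n. c k + d k * z)" for z
  have nrm: "norm (c k + d k * z) = norm (a k + b k * z)" if z: "norm z = 1" for k z
  proof (cases "norm (b k) \<le> norm (a k)")
    case False
    have zz: "z * cnj z = 1" using z by (simp add: complex_norm_square[symmetric])
    have "norm (cnj (b k) + cnj (a k) * z) = norm (cnj (cnj (b k) + cnj (a k) * z))" by (rule complex_mod_cnj[symmetric])
    also have "cnj (cnj (b k) + cnj (a k) * z) = b k + a k * cnj z" by simp
    also have "norm \<dots> = norm ((b k + a k * cnj z) * z)" using z by (simp add: norm_mult)
    also have "(b k + a k * cnj z) * z = a k + b k * z" using zz by (simp add: algebra_simps)
    finally show ?thesis using False by (simp add: c_def d_def)
  qed (simp add: c_def d_def)
  have cont: "continuous_on A p" for A unfolding p_def by (intro continuous_intros)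
  obtain z where z: "norm z = 1" and mx: "\<And>y. norm y = 1 \<Longrightarrow> norm (p y) \<le> norm (p z)"
  proof -
    have "\<exists>z\<in>sphere 0 1. \<forall>y\<in>sphere 0 1. norm (p y) \<le> norm (p z)"
      by (rule continuous_attains_sup) (auto intro!: continuous_intros cont simp: sphere_eq_empty)
    then show ?thesis using that by auto
  qed
  \<comment> \<open>After the reflections \<open>p 0\<close> is the product of the larger
    coefficients, and the maximum modulus principle transfers this value to the circle.\<close>
  have "norm (p 0) \<le> norm (p z)"
  proof (rule maximum_modulus_frontier[of p "cball 0 1"])
    show "p holomorphic_on interior (cball 0 1)" unfolding p_def by (intro holomorphic_intros)
    show "continuous_on (closure (cball 0 1)) p" by (rule cont)
  qed (use mx in auto)
  moreover have "norm (p 0) = (\<Prod>k<n. max (norm (a k)) (norm (b k)))"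
    unfolding p_def prod_norm[symmetric] by (intro prod.cong refl) (auto simp: c_def)
  moreover have "norm (p z) = norm (\<Prod>k<n. a k + b k * z)"
    unfolding p_def prod_norm[symmetric] by (intro prod.cong refl nrm z)
  ultimately show ?thesis using z by auto
qed

section \<open>The moduli of the two coefficients of \<open>Delta\<close>\<close>

definition AA :: "real \<Rightarrow> complex \<Rightarrow> complex" where "AA \<alpha> w = 1 + of_real \<alpha> * w"
definition BB :: "real \<Rightarrow> real \<Rightarrow> real \<Rightarrow> complex \<Rightarrow> complex" where
  "BB \<alpha> \<beta> \<gamma> w = of_real \<beta> - of_real (\<gamma>^2 - \<alpha> * \<beta>) * w"

lemma Delta_AB: "Delta \<alpha> \<beta> \<gamma> w1 w2 = AA \<alpha> w1 + BB \<alpha> \<beta> \<gamma> w1 * w2"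
  unfolding Delta_def AA_def BB_def by (simp add: algebra_simps)

lemma norm_add_real_mult_sq:
  assumes "norm w = 1"
  shows "(norm (of_real a + of_real b * w))^2 = a^2 + b^2 + 2 * a * b * Re w"
proof -
  have "(Re w)^2 + (Im w)^2 = 1" using assms cmod_power2[of w] by simp
  then have "b^2 * (Re w)^2 + b^2 * (Im w)^2 = b^2" by (metis distrib_left mult.right_neutral)
  then show ?thesis unfolding cmod_power2 by (simp add: power2_eq_square algebra_simps)
qed

lemma norm_sub_real_mult_sq:
  assumes "norm w = 1"
  shows "(norm (of_real a - of_real b * w))^2 = a^2 + b^2 - 2 * a * b * Re w"
  using norm_add_real_mult_sq[OF assms, of a "- b"] by simp

lemma norm_AA_BB:
  assumes "norm w = 1"
  shows "(norm (AA \<alpha> w))^2 = 1 + \<alpha>^2 + 2 * \<alpha> * Re w"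
    "(norm (BB \<alpha> \<beta> \<gamma> w))^2 = \<beta>^2 + (\<gamma>^2 - \<alpha> * \<beta>)^2 - 2 * \<beta> * (\<gamma>^2 - \<alpha> * \<beta>) * Re w"
  using norm_add_real_mult_sq[OF assms, of 1 \<alpha>] unfolding AA_def BB_def
  by (simp, intro norm_sub_real_mult_sq assms)

text \<open>Positive where the coefficient of \<open>w2\<close> dominates. On the circle its zeros
  are the critical frequencies, at which \<open>Delta\<close> vanishes for some \<open>w2\<close> of
  modulus 1.\<close>

definition dd :: "real \<Rightarrow> real \<Rightarrow> real \<Rightarrow> complex \<Rightarrow> real" where
  "dd \<alpha> \<beta> \<gamma> w = norm (BB \<alpha> \<beta> \<gamma> w) - norm (AA \<alpha> w)"

lemma continuous_AA_BB [continuous_intros]: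
  "continuous_on S (AA \<alpha>)" "continuous_on S (BB \<alpha> \<beta> \<gamma>)" "continuous_on S (dd \<alpha> \<beta> \<gamma>)"
  unfolding AA_def BB_def dd_def by (auto intro!: continuous_intros)

text \<open>Clamping to the unit interval, for continuous cutoffs: the Riemann sums need continuous
  functions in place of indicators.\<close>

definition c01 :: "real \<Rightarrow> real" where "c01 x = max 0 (min 1 x)"

lemma c01_bounds [simp]: "0 \<le> c01 x" "c01 x \<le> 1" and continuous_c01 [continuous_intros]: "continuous_on S f \<Longrightarrow> continuous_on S (\<lambda>x. c01 (f x))"
  unfolding c01_def by (auto intro!: continuous_intros)

locale ffsix =
  fixes \<alpha> \<beta> \<gamma> :: real
  assumes pos: "\<alpha> > 0" "\<beta> > 0" "\<gamma> > 0" "\<gamma>^2 - \<alpha> * \<beta> > 0"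
begin

abbreviation "\<delta> \<equiv> \<gamma>^2 - \<alpha> * \<beta>"
abbreviation "A \<equiv> AA \<alpha>"
abbreviation "B \<equiv> BB \<alpha> \<beta> \<gamma>"
abbreviation "d \<equiv> dd \<alpha> \<beta> \<gamma>"

text \<open>On the circle \<open>C0\<close> bounds both moduli from above, \<open>m0\<close> bounds
  the larger one from below, and \<open>x0\<close> is the value of \<open>Re w\<close> at which they
  agree, provided it is attained.\<close>

definition "C0 = 1 + \<alpha> + \<beta> + \<delta>"
definition "m0 = \<gamma>^2 / (\<alpha> + \<delta>)"
definition "x0 = (\<beta>^2 + \<delta>^2 - 1 - \<alpha>^2) / (2 * (\<alpha> + \<beta> * \<delta>))"

lemma C0_pos: "C0 > 0" unfolding C0_def using pos by linarith
lemma m0_pos: "m0 > 0" unfolding m0_def using pos by (intro divide_pos_pos add_pos_pos) auto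

lemma AB_upper: "norm w = 1 \<Longrightarrow> norm (A w) \<le> C0" "norm w = 1 \<Longrightarrow> norm (B w) \<le> C0"
proof -
  assume w: "norm w = 1"
  have "norm (A w) \<le> norm (1::complex) + norm (of_real \<alpha> * w)" unfolding AA_def by (rule norm_triangle_ineq)
  also have "\<dots> = 1 + \<alpha>" using w pos by (simp add: norm_mult)
  finally show "norm (A w) \<le> C0" unfolding C0_def using pos by linarith
  have "norm (B w) \<le> norm (complex_of_real \<beta>) + norm (of_real \<delta> * w)" unfolding BB_def by (rule norm_triangle_ineq4)
  also have "\<dots> = \<beta> + \<delta>" unfolding norm_mult norm_of_real using w pos by simp
  finally show "norm (B w) \<le> C0" unfolding C0_def using pos by linarith
qed

text \<open>The combination \<open>\<delta> * A w + \<alpha> * B w\<close> is the constant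
  \<gamma>^2, so the two coefficients cannot be small together.\<close>

lemma AB_lower: "m0 \<le> max (norm (A w)) (norm (B w))"
proof -
  let ?M = "max (norm (A w)) (norm (B w))"
  have "of_real \<delta> * A w + of_real \<alpha> * B w = of_real (\<gamma>^2)"
    unfolding AA_def BB_def by (simp add: algebra_simps)
  then have "\<gamma>^2 = norm (of_real \<delta> * A w + of_real \<alpha> * B w)" by (simp only: norm_of_real) simp
  also have "\<dots> \<le> \<delta> * norm (A w) + \<alpha> * norm (B w)"
    using norm_triangle_ineq[of "of_real \<delta> * A w" "of_real \<alpha> * B w"] pos unfolding norm_mult norm_of_real by simp
  also have "\<dots> \<le> \<delta> * ?M + \<alpha> * ?M" using pos by (intro add_mono mult_left_mono) auto
  also have "\<dots> = (\<alpha> + \<delta>) * ?M" by (simp add: algebra_simps)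
  finally show ?thesis unfolding m0_def using pos by (simp add: pos_divide_le_eq mult.commute)
qed

text \<open>On the circle both squared moduli are affine in \<open>Re w\<close>, with slopes of
  opposite signs. The moduli therefore separate transversally along the circle unless
  \<open>x0\<close> is 1 or -1, where the line \<open>Re w = x0\<close> is tangent to it.\<close>

lemma sq_diff: "norm w = 1 \<Longrightarrow> (norm (A w))^2 - (norm (B w))^2 = 2 * (\<alpha> + \<beta> * \<delta>) * (Re w - x0)"
proof -
  assume w: "norm w = 1"
  have "\<alpha> + \<beta> * \<delta> > 0" using pos by (intro add_pos_pos mult_pos_pos) auto
  then have "2 * (\<alpha> + \<beta> * \<delta>) * x0 = \<beta>^2 + \<delta>^2 - 1 - \<alpha>^2" unfolding x0_def by simp
  then show ?thesis unfolding norm_AA_BB[OF w] by (simp add: algebra_simps)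
qed

lemma d_zero_finite: "finite {t \<in> {0..1}. d (cis (2 * pi * t)) = 0}"
proof (rule finite_subset)
  define a where "a = arccos x0 / (2 * pi)"
  show "{t \<in> {0..1}. d (cis (2 * pi * t)) = 0} \<subseteq> {a, 1 - a}"
  proof
    fix t assume "t \<in> {t \<in> {0..1}. d (cis (2 * pi * t)) = 0}"
    then have t: "0 \<le> t" "t \<le> 1" and "norm (A (cis (2 * pi * t))) = norm (B (cis (2 * pi * t)))"
      unfolding dd_def by auto
    then have "2 * (\<alpha> + \<beta> * \<delta>) * (Re (cis (2 * pi * t)) - x0) = 0"
      using sq_diff[of "cis (2 * pi * t)"] by simp
    moreover have "\<alpha> + \<beta> * \<delta> > 0" using pos by (intro add_pos_pos mult_pos_pos) auto
    ultimately have c: "cos (2 * pi * t) = x0" by simp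
    show "t \<in> {a, 1 - a}"
    proof (cases "t \<le> 1 / 2")
      case True
      then have "arccos (cos (2 * pi * t)) = 2 * pi * t" using t by (intro arccos_cos) auto
      then show ?thesis unfolding c a_def by simp
    next
      case False
      have "cos (2 * pi * (1 - t)) = cos (2 * pi * t)" by (simp add: right_diff_distrib cos_diff)
      moreover have "arccos (cos (2 * pi * (1 - t))) = 2 * pi * (1 - t)" using t False by (intro arccos_cos) auto
      ultimately show ?thesis unfolding c a_def by simp
    qed
  qed
qed simp

text \<open>\<open>\<rho>\<close> is the limiting density of occupied vertical edges.\<close>

definition "\<rho> = integral {0..1} (\<lambda>t. of_bool (0 < d (cis (2 * pi * t))) :: real)"

text \<open>The first two families are continuous bounds from above and below for the indicator of
  \<open>0 < d\<close>, the third concentrates on the zeros of \<open>d\<close>. The critical set is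
  finite, hence invisible to the limits of the integrals.\<close>

lemma bump_limits:
  shows "(\<lambda>m. integral {0..1} (\<lambda>t. c01 (2 + real m * d (cis (2 * pi * t))))) \<longlonglongrightarrow> \<rho>"
    "(\<lambda>m. integral {0..1} (\<lambda>t. c01 (real m * d (cis (2 * pi * t)) - 1))) \<longlonglongrightarrow> \<rho>"
    "(\<lambda>m. integral {0..1} (\<lambda>t. c01 (2 - real m * \<bar>d (cis (2 * pi * t))\<bar>))) \<longlonglongrightarrow> 0"
    "(\<lambda>t. of_bool (0 < d (cis (2 * pi * t))) :: real) integrable_on {0..1}"
proof -
  let ?F = "{t \<in> {0..1}. d (cis (2 * pi * t)) = 0}"
  let ?d = "\<lambda>t. d (cis (2 * pi * t))"
  have cd: "continuous_on {0..1} ?d" by (rule cis_2pi_continuous) (intro continuous_intros)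
  have i1: "(\<lambda>t. c01 (2 + real m * ?d t)) integrable_on {0..1}"
    and i2: "(\<lambda>t. c01 (real m * ?d t - 1)) integrable_on {0..1}"
    and i3: "(\<lambda>t. c01 (2 - real m * \<bar>?d t\<bar>)) integrable_on {0..1}" for m
    by (intro integrable_continuous_interval continuous_intros cd)+
  have nb: "norm (c01 x) \<le> 1" for x using c01_bounds[of x] by (simp del: c01_bounds)
  have big: "eventually (\<lambda>m. real m * \<bar>?d t\<bar> \<ge> 3) sequentially" if "t \<in> {0..1} - ?F" for t
  proof -
    have "\<bar>?d t\<bar> > 0" using that by auto
    then have "eventually (\<lambda>m. real m \<ge> 3 / \<bar>?d t\<bar>) sequentially"
      by (intro eventually_ge_at_top[THEN filterlim_real_sequentially[unfolded filterlim_iff, rule_format]])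
    then show ?thesis by eventually_elim (use \<open>\<bar>?d t\<bar> > 0\<close> in \<open>simp add: pos_divide_le_eq\<close>)
  qed
  have pos_case: "?d t > 0 \<longrightarrow> real m * ?d t \<ge> 3" "?d t < 0 \<longrightarrow> real m * ?d t \<le> -3" if "real m * \<bar>?d t\<bar> \<ge> 3" for m t
    using that by (auto simp: abs_if split: if_splits)
  have l1: "(\<lambda>m. c01 (2 + real m * ?d t)) \<longlonglongrightarrow> of_bool (0 < ?d t)" if "t \<in> {0..1} - ?F" for t
    by (rule tendsto_eventually, use big[OF that] in eventually_elim) (use pos_case[of _ t] that in \<open>force simp: c01_def\<close>)
  have l2: "(\<lambda>m. c01 (real m * ?d t - 1)) \<longlonglongrightarrow> of_bool (0 < ?d t)" if "t \<in> {0..1} - ?F" for t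
    by (rule tendsto_eventually, use big[OF that] in eventually_elim) (use pos_case[of _ t] that in \<open>force simp: c01_def\<close>)
  have l3: "(\<lambda>m. c01 (2 - real m * \<bar>?d t\<bar>)) \<longlonglongrightarrow> 0" if "t \<in> {0..1} - ?F" for t
    by (rule tendsto_eventually, use big[OF that] in eventually_elim) (simp add: c01_def)
  note dc = ae_dominated_convergence[OF d_zero_finite, where C = 1]
  show "(\<lambda>m. integral {0..1} (\<lambda>t. c01 (2 + real m * d (cis (2 * pi * t))))) \<longlonglongrightarrow> \<rho>" "(\<lambda>t. of_bool (0 < d (cis (2 * pi * t))) :: real) integrable_on {0..1}"
    unfolding \<rho>_def by (rule dc(2)[OF i1 nb l1], assumption, rule dc(1)[OF i1 nb l1], assumption)
  show "(\<lambda>m. integral {0..1} (\<lambda>t. c01 (real m * d (cis (2 * pi * t)) - 1))) \<longlonglongrightarrow> \<rho>"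
    unfolding \<rho>_def by (rule dc(2)[OF i2 nb l2])
  have "(\<lambda>m. integral {0..1} (\<lambda>t. c01 (2 - real m * \<bar>?d t\<bar>))) \<longlonglongrightarrow> integral {0..1} (\<lambda>t::real. 0)"
    by (rule dc(2)[where g = "\<lambda>_. 0", OF i3 nb l3])
  then show "(\<lambda>m. integral {0..1} (\<lambda>t. c01 (2 - real m * \<bar>d (cis (2 * pi * t))\<bar>))) \<longlonglongrightarrow> 0" by simp
qed

lemma \<rho>_bounds: "0 \<le> \<rho>" "\<rho> \<le> 1"
proof -
  show "0 \<le> \<rho>" unfolding \<rho>_def by (rule integral_nonneg[OF bump_limits(4)]) simp
  have "(\<lambda>m. integral {0..1} (\<lambda>t. c01 (2 + real m * d (cis (2 * pi * t))))) \<longlonglongrightarrow> \<rho>" by (rule bump_limits(1))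
  moreover have "integral {0..1} (\<lambda>t. c01 (2 + real m * d (cis (2 * pi * t)))) \<le> 1" for m
  proof -
    have "continuous_on {0..1} (\<lambda>t. c01 (2 + real m * d (cis (2 * pi * t))))"
      by (intro continuous_intros cis_2pi_continuous)
    moreover have "norm (c01 x) \<le> 1" for x using c01_bounds[of x] by (simp del: c01_bounds)
    ultimately have "norm (integral {0..1} (\<lambda>t. c01 (2 + real m * d (cis (2 * pi * t))))) \<le> 1 * (1 - 0)"
      by (intro integral_bound) auto
    then show ?thesis by simp
  qed
  ultimately show "\<rho> \<le> 1" by (intro LIMSEQ_le_const2) auto
qed

subsection \<open>Concentration of the winding number\<close>

lemma twisted_product:
  assumes n: "n \<ge> 2"
  shows "twisted_sum n \<alpha> \<beta> \<gamma> u1 u2 UNIV = (\<Prod>k<n. A (u1 * rt n k) ^ n - (- B (u1 * rt n k)) ^ n * u2 ^ n)"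
  unfolding twisted_sum_product[OF n] Delta_AB using n by (intro prod.cong refl prod_affine_rt) simp

text \<open>Every twisted sum is bounded by the partition function, so \<open>u2\<close> may be
  chosen to make the product over the first frequencies large. The maximum over the phase of
  \<open>u2 ^ n\<close> is at least the product of the maxima.\<close>

lemma partition_lower:
  assumes n: "n \<ge> 2" and u: "norm u1 = 1"
  shows "(\<Prod>k<n. max (norm (A (u1 * rt n k))) (norm (B (u1 * rt n k))) ^ n) \<le> partition_fn n (ff_weights \<alpha> \<beta> \<gamma>)"
proof -
  have n0: "n > 0" using n by simp
  define a where "a k = A (u1 * rt n k) ^ n" for k
  define b where "b k = - ((- B (u1 * rt n k)) ^ n)" for k
  obtain z where z: "norm z = 1" "(\<Prod>k<n. max (norm (a k)) (norm (b k))) \<le> norm (\<Prod>k<n. a k + b k * z)"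
    using exists_prod_ge_prod_max by blast
  \<comment> \<open>An n-th root of the optimal phase \<open>z\<close>.\<close>
  define u2 where "u2 = cis (Arg z / real n)"
  have "z \<noteq> 0" using z by auto
  then have u2: "u2 ^ n = z" "norm u2 = 1"
    unfolding u2_def Complex.DeMoivre using n0 z by (simp_all add: cis_Arg_unique[symmetric] cis_Arg sgn_div_norm)
  have "max (norm (A (u1 * rt n k))) (norm (B (u1 * rt n k))) ^ n = max (norm (a k)) (norm (b k))" for k
    unfolding a_def b_def norm_minus_cancel norm_power
    by (auto simp: max_def power_mono_iff n0)
  then have "(\<Prod>k<n. max (norm (A (u1 * rt n k))) (norm (B (u1 * rt n k))) ^ n) \<le> norm (\<Prod>k<n. a k + b k * z)" using z by simp
  also have "(\<Prod>k<n. a k + b k * z) = twisted_sum n \<alpha> \<beta> \<gamma> u1 u2 UNIV"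
    unfolding twisted_product[OF n] a_def b_def u2 by simp
  also have "norm \<dots> \<le> partition_fn n (ff_weights \<alpha> \<beta> \<gamma>)"
    by (rule norm_twisted_sum_le[OF pos n0 u u2(2)])
  finally show ?thesis .
qed

text \<open>The weight \<open>t\<close> per occupied vertical edge replaces \<open>B\<close> by
  \<open>t * B\<close> in the product. The triangle inequality costs a factor 2 for each of the
  \<open>n\<close> first frequencies, while the tilt acts with an exponent of order n^2; \<phi>
  records how far it changes the maximum at each frequency. The factor 4 counts the four
  twists.\<close>

lemma tilted_upper:
  assumes n: "n \<ge> 2" and t: "t > 0"
    and \<phi>: "\<And>w. norm w = 1 \<Longrightarrow> max (norm (A w)) (t * norm (B w)) \<le> max (norm (A w)) (norm (B w)) * t powr \<phi> w"
    and S: "\<And>s. s < 2 \<Longrightarrow> t powr (real n * (\<Sum>k<n. \<phi> (tw n s * rt n k))) \<le> K"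
  shows "(\<Sum>\<sigma>\<in>tor_configs n. config_weight n (ff_weights \<alpha> \<beta> \<gamma>) \<sigma> * t ^ (n * windV n \<sigma>)) \<le>
    4 * 2 ^ n * K * partition_fn n (ff_weights \<alpha> \<beta> \<gamma>)"
proof -
  let ?Z = "partition_fn n (ff_weights \<alpha> \<beta> \<gamma>)"
  have n0: "n > 0" using n by simp
  have Z: "?Z > 0" by (rule partition_fn_pos[OF pos n0])
  have bound: "norm (twisted_sum n \<alpha> \<beta> \<gamma> (tw n s1) (of_real t * tw n s2) UNIV) \<le> 2 ^ n * K * ?Z" if s: "s1 < 2" for s1 s2
  proof -
    let ?w = "\<lambda>k. tw n s1 * rt n k"
    have w: "norm (?w k) = 1" for k by (simp add: norm_mult)
    have "norm (A (?w k) ^ n - (- B (?w k)) ^ n * (of_real t * tw n s2) ^ n) \<le>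
       2 * (max (norm (A (?w k))) (norm (B (?w k))) ^ n * t powr (real n * \<phi> (?w k)))" for k
    proof -
      let ?m = "max (norm (A (?w k))) (t * norm (B (?w k)))"
      have "norm (A (?w k) ^ n - (- B (?w k)) ^ n * (of_real t * tw n s2) ^ n) \<le> norm (A (?w k)) ^ n + (t * norm (B (?w k))) ^ n"
        using norm_triangle_ineq4[of "A (?w k) ^ n" "(- B (?w k)) ^ n * (of_real t * tw n s2) ^ n"] t
        by (simp add: norm_mult norm_power power_mult_distrib mult_ac)
      also have "\<dots> \<le> ?m ^ n + ?m ^ n" using t by (intro add_mono power_mono) auto
      also have "\<dots> = 2 * ?m ^ n" by simp
      also have "?m ^ n \<le> (max (norm (A (?w k))) (norm (B (?w k))) * t powr \<phi> (?w k)) ^ n"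
        by (intro power_mono \<phi> w) (auto simp: le_max_iff_disj)
      also have "\<dots> = max (norm (A (?w k))) (norm (B (?w k))) ^ n * t powr (real n * \<phi> (?w k))"
        using t by (simp add: power_mult_distrib powr_realpow[symmetric] powr_powr mult.commute)
      finally show ?thesis by simp
    qed
    then have "norm (twisted_sum n \<alpha> \<beta> \<gamma> (tw n s1) (of_real t * tw n s2) UNIV) \<le>
       (\<Prod>k<n. 2 * (max (norm (A (?w k))) (norm (B (?w k))) ^ n * t powr (real n * \<phi> (?w k))))"
      unfolding twisted_product[OF n] prod_norm[symmetric] by (intro prod_mono) auto
    also have "\<dots> = 2 ^ n * ((\<Prod>k<n. max (norm (A (?w k))) (norm (B (?w k))) ^ n) * t powr (real n * (\<Sum>k<n. \<phi> (?w k))))"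
      unfolding prod.distrib sum_distrib_left using t by (simp add: powr_sum)
    also have "\<dots> \<le> 2 ^ n * (?Z * K)"
      by (intro mult_left_mono mult_mono partition_lower[OF n] S s) (use Z in \<open>auto intro: less_imp_le\<close>)
    finally show ?thesis by (simp add: mult_ac)
  qed
  have "complex_of_real (\<Sum>\<sigma>\<in>tor_configs n. config_weight n (ff_weights \<alpha> \<beta> \<gamma>) \<sigma> * t ^ (n * windV n \<sigma>)) =
     (\<Sum>s1<2. \<Sum>s2<2. coef n s1 s2 * twisted_sum n \<alpha> \<beta> \<gamma> (tw n s1) (of_real t * tw n s2) UNIV)"
    using untwist[OF n0, where t = "of_real t" and E = UNIV] by simp
  then have "norm (complex_of_real (\<Sum>\<sigma>\<in>tor_configs n. config_weight n (ff_weights \<alpha> \<beta> \<gamma>) \<sigma> * t ^ (n * windV n \<sigma>))) \<le> 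
     (\<Sum>s1<2::nat. \<Sum>s2<2::nat. 2 ^ n * K * ?Z)"
    by (simp only:) (intro sum_norm_le order_trans[OF _ bound], auto simp: norm_mult intro!: mult_left_le_one_le norm_coef)
  then show ?thesis by (simp only: norm_of_real) simp
qed

lemma grid_average_bounds:
  assumes "continuous_on (sphere 0 1) (f :: complex \<Rightarrow> real)" "e > 0"
  shows "eventually (\<lambda>n. \<forall>s<2. \<bar>(\<Sum>k<n. f (tw n s * rt n k)) - real n * integral {0..1} (\<lambda>t. f (cis (2 * pi * t)))\<bar> \<le> e * real n) sequentially"
proof -
  obtain N where N: "\<And>n \<theta>. n \<ge> N \<Longrightarrow> 0 \<le> \<theta> \<and> \<theta> \<le> 2 * pi \<Longrightarrow>
    norm ((\<Sum>k<n. f (cis (\<theta> / real n) * rt n k)) /\<^sub>R real n - integral {0..1} (\<lambda>t. f (cis (2 * pi * t)))) \<le> e"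
    using riemann_grid[OF assms] by blast
  show ?thesis
    using eventually_ge_at_top[of N] eventually_gt_at_top[of 0]
  proof eventually_elim
    case (elim n)
    show ?case
    proof (intro allI impI)
      fix s :: nat assume "s < 2"
      then have "0 \<le> pi * real s \<and> pi * real s \<le> 2 * pi" by simp
      from N[OF elim(1) this] have "\<bar>(\<Sum>k<n. f (tw n s * rt n k)) / real n - integral {0..1} (\<lambda>t. f (cis (2 * pi * t)))\<bar> \<le> e"
        unfolding tw_def by (simp add: divide_inverse mult.commute)
      moreover have "(\<Sum>k<n. f (tw n s * rt n k)) - real n * integral {0..1} (\<lambda>t. f (cis (2 * pi * t))) =
         real n * ((\<Sum>k<n. f (tw n s * rt n k)) / real n - integral {0..1} (\<lambda>t. f (cis (2 * pi * t))))"
        using elim by (simp add: field_simps)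
      ultimately show "\<bar>(\<Sum>k<n. f (tw n s * rt n k)) - real n * integral {0..1} (\<lambda>t. f (cis (2 * pi * t)))\<bar> \<le> e * real n"
        using mult_left_mono[of "\<bar>(\<Sum>k<n. f (tw n s * rt n k)) / real n - integral {0..1} (\<lambda>t. f (cis (2 * pi * t)))\<bar>" e "real n"]
        by (simp only: abs_mult abs_of_nat of_nat_0_le_iff mult.commute[of e])
    qed
  qed
qed

lemma windV_le: "windV n \<sigma> \<le> n"
proof -
  have "windV n \<sigma> \<le> (\<Sum>i<n. 1)" unfolding windV_def by (intro sum_mono) auto
  then show ?thesis by simp
qed

lemma two_power_mult_square_tendsto_0:
  assumes q: "0 \<le> q" "q < (1::real)"
  shows "(\<lambda>n. 2 ^ n * q ^ (n * n)) \<longlonglongrightarrow> 0"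
proof (rule tendsto_sandwich[OF _ _ tendsto_const])
  show "eventually (\<lambda>n. 0 \<le> 2 ^ n * q ^ (n * n)) sequentially" using q by simp
  have "(\<lambda>n. q ^ n) \<longlonglongrightarrow> 0" by (rule LIMSEQ_realpow_zero[OF q])
  then have "eventually (\<lambda>n. q ^ n < 1 / 4) sequentially" by (rule order_tendstoD) simp
  then show "eventually (\<lambda>n. 2 ^ n * q ^ (n * n) \<le> (1 / 2) ^ n) sequentially"
  proof eventually_elim
    case (elim n)
    have "2 ^ n * q ^ (n * n) = (2 * q ^ n) ^ n" by (simp only: power_mult_distrib power_mult)
    also have "\<dots> \<le> (1 / 2) ^ n" using elim q by (intro power_mono) auto
    finally show ?case .
  qed
  show "(\<lambda>n. (1 / 2 :: real) ^ n) \<longlonglongrightarrow> 0" by (rule LIMSEQ_realpow_zero) auto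
qed

text \<open>A tilt by 1 / (m * C0) moves \<open>norm (B w)\<close> by at most 1 / m. Where the
  moduli differ by more, their order persists and the tilt acts on the maximum either not at all or
  with exponent 1; near the critical frequencies the cruder of the two exponents is used.\<close>

lemma tilt_bounds:
  assumes m: "real m * C0 \<ge> 2" and w: "norm w = 1"
  shows "max (norm (A w)) ((1 + 1 / (real m * C0)) * norm (B w)) \<le>
      max (norm (A w)) (norm (B w)) * (1 + 1 / (real m * C0)) powr c01 (2 + real m * d w)"
    "max (norm (A w)) ((1 - 1 / (real m * C0)) * norm (B w)) \<le>
      max (norm (A w)) (norm (B w)) * (1 - 1 / (real m * C0)) powr c01 (real m * d w - 1)"
proof -
  let ?\<tau> = "1 / (real m * C0)"
  let ?M = "max (norm (A w)) (norm (B w))"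
  have m0: "real m > 0" using m by (cases "m = 0") auto
  have \<tau>: "0 < ?\<tau>" "?\<tau> \<le> 1 / 2" using m m0 C0_pos by (simp_all add: field_simps)
  have "?\<tau> * norm (B w) \<le> ?\<tau> * C0" using AB_upper(2)[OF w] \<tau> by (intro mult_left_mono) auto
  also have "\<dots> = 1 / real m" using C0_pos by simp
  finally have tb: "?\<tau> * norm (B w) \<le> 1 / real m" .
  have M0: "?M \<ge> 0" by (simp add: le_max_iff_disj)
  show "max (norm (A w)) ((1 + ?\<tau>) * norm (B w)) \<le> ?M * (1 + ?\<tau>) powr c01 (2 + real m * d w)"
  proof (cases "real m * d w \<ge> - 1")
    case True
    then have "c01 (2 + real m * d w) = 1" unfolding c01_def by simp
    then have eq: "?M * (1 + ?\<tau>) powr c01 (2 + real m * d w) = ?M * (1 + ?\<tau>)" using \<tau> by simp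
    have "norm (A w) \<le> ?M * (1 + ?\<tau>)"
      using \<tau> M0 mult_mono[of "norm (A w)" ?M 1 "1 + ?\<tau>"] by simp
    moreover have "(1 + ?\<tau>) * norm (B w) \<le> ?M * (1 + ?\<tau>)"
      unfolding mult.commute[of ?M] using \<tau> by (intro mult_left_mono) auto
    ultimately show ?thesis unfolding eq by (rule max.boundedI)
  next
    case False
    then have "d w < - (1 / real m)" using m0 by (simp add: field_simps)
    then have "norm (B w) + 1 / real m < norm (A w)" unfolding dd_def by simp
    then have "(1 + ?\<tau>) * norm (B w) \<le> norm (A w)" using tb unfolding distrib_right mult_1 by linarith
    moreover have "1 \<le> (1 + ?\<tau>) powr c01 (2 + real m * d w)" using \<tau> by (intro ge_one_powr_ge_zero) auto
    then have "norm (A w) \<le> ?M * (1 + ?\<tau>) powr c01 (2 + real m * d w)"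
      using mult_mono[of "norm (A w)" ?M 1 "(1 + ?\<tau>) powr c01 (2 + real m * d w)"] M0 by simp
    ultimately show ?thesis by simp
  qed
  show "max (norm (A w)) ((1 - ?\<tau>) * norm (B w)) \<le> ?M * (1 - ?\<tau>) powr c01 (real m * d w - 1)"
  proof (cases "real m * d w \<le> 1")
    case True
    then have "c01 (real m * d w - 1) = 0" unfolding c01_def by simp
    then have eq: "?M * (1 - ?\<tau>) powr c01 (real m * d w - 1) = ?M" using \<tau> by simp
    have "(1 - ?\<tau>) * norm (B w) \<le> norm (B w)" using \<tau> by (simp add: left_diff_distrib)
    then show ?thesis unfolding eq by simp
  next
    case False
    then have "d w > 1 / real m" using m0 by (simp add: field_simps)
    then have "norm (A w) \<le> norm (B w) - 1 / real m" unfolding dd_def by simp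
    then have le: "norm (A w) \<le> (1 - ?\<tau>) * norm (B w)" using tb unfolding left_diff_distrib mult_1 by linarith
    have "(1 - ?\<tau>) powr 1 \<le> (1 - ?\<tau>) powr c01 (real m * d w - 1)"
      using \<tau> by (intro powr_mono') auto
    then have "(1 - ?\<tau>) * norm (B w) \<le> ?M * (1 - ?\<tau>) powr c01 (real m * d w - 1)"
      using \<tau> M0 mult_mono[of "norm (B w)" ?M "1 - ?\<tau>" "(1 - ?\<tau>) powr c01 (real m * d w - 1)"]
      by (simp add: mult.commute)
    then show ?thesis using le by simp
  qed
qed

text \<open>Exponential Chebyshev bounds on both sides, with \<open>tp > 1\<close> against large and
  \<open>tm < 1\<close> against small winding numbers. The margin \<open>e\<close> in exponents of
  order n^2 beats the prefactors 2^n. No rate is extracted.\<close>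

theorem dev_tendsto_0: "(\<lambda>n. dev n \<alpha> \<beta> \<gamma> \<rho>) \<longlonglongrightarrow> 0"
proof (rule tendstoI)
  fix e' :: real assume "e' > 0"
  define e where "e = e' / 4"
  have e: "e > 0" "e' = 4 * e" using \<open>e' > 0\<close> by (simp_all add: e_def)
  let ?I1 = "\<lambda>m. integral {0..1} (\<lambda>t. c01 (2 + real m * d (cis (2 * pi * t))))"
  let ?I2 = "\<lambda>m. integral {0..1} (\<lambda>t. c01 (real m * d (cis (2 * pi * t)) - 1))"
  have "eventually (\<lambda>m. real m \<ge> 2 / C0) sequentially"
    by (rule eventually_ge_at_top[THEN filterlim_real_sequentially[unfolded filterlim_iff, rule_format]])
  then have "eventually (\<lambda>m. dist (?I1 m) \<rho> < e \<and> dist (?I2 m) \<rho> < e \<and> real m \<ge> 2 / C0) sequentially"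
    using tendstoD[OF bump_limits(1) e(1)] tendstoD[OF bump_limits(2) e(1)] by eventually_elim auto
  then obtain m where m: "dist (?I1 m) \<rho> < e" "dist (?I2 m) \<rho> < e" "real m \<ge> 2 / C0"
    unfolding eventually_sequentially by blast
  have mC: "real m * C0 \<ge> 2" using m(3) C0_pos by (simp add: pos_divide_le_eq)
  define tp where "tp = 1 + 1 / (real m * C0)"
  define tm where "tm = 1 - 1 / (real m * C0)"
  have t: "tp > 1" "0 < tm" "tm < 1" unfolding tp_def tm_def using mC by (simp_all add: field_simps)
  have cont: "continuous_on (sphere 0 1) (\<lambda>w. c01 (2 + real m * d w))" "continuous_on (sphere 0 1) (\<lambda>w. c01 (real m * d w - 1))"
    by (intro continuous_intros)+
  define Z where "Z n = partition_fn n (ff_weights \<alpha> \<beta> \<gamma>)" for n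
  let ?W = "\<lambda>n. config_weight n (ff_weights \<alpha> \<beta> \<gamma>)"
  define K1 where "K1 n = tp powr (real n * (real n * (\<rho> + 2 * e)))" for n
  define K2 where "K2 n = tm powr (real n * (real n * (\<rho> - 2 * e)))" for n
  define q1 where "q1 = tp powr (- e)"
  define q2 where "q2 = tm powr e"
  have q: "0 \<le> q1" "q1 < 1" "0 \<le> q2" "q2 < 1"
    unfolding q1_def q2_def using t e powr_less_mono[of "- e" 0 tp] powr_less_mono'[of tm 0 e] by auto
  define E where "E n = 3 * e + 4 * (2 ^ n * q1 ^ (n * n)) + 4 * (2 ^ n * q2 ^ (n * n))" for n :: nat
  have le: "eventually (\<lambda>n. dev n \<alpha> \<beta> \<gamma> \<rho> \<le> E n) sequentially"
    using grid_average_bounds[OF cont(1) e(1)] grid_average_bounds[OF cont(2) e(1)] eventually_ge_at_top[of 2]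
  proof eventually_elim
    case (elim n)
    have n0: "n > 0" using elim by simp
    have Z: "Z n > 0" unfolding Z_def by (rule partition_fn_pos[OF pos n0])
    have s1: "(\<Sum>\<sigma>\<in>tor_configs n. ?W n \<sigma> * tp ^ (n * windV n \<sigma>)) \<le> 4 * 2 ^ n * K1 n * Z n"
      unfolding Z_def
    proof (rule tilted_upper[OF elim(3) _ tilt_bounds(1)[OF mC, folded tp_def]])
      fix s :: nat assume "s < 2"
      then have "(\<Sum>k<n. c01 (2 + real m * d (tw n s * rt n k))) \<le> real n * ?I1 m + e * real n"
        using elim(1) by (auto simp: abs_le_iff)
      also have "\<dots> = real n * (?I1 m + e)" by (simp add: algebra_simps)
      also have "\<dots> \<le> real n * (\<rho> + 2 * e)" using m(1) by (intro mult_left_mono) (auto simp: dist_real_def abs_le_iff)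
      finally show "tp powr (real n * (\<Sum>k<n. c01 (2 + real m * d (tw n s * rt n k)))) \<le> K1 n"
        unfolding K1_def using t by (intro powr_mono mult_left_mono) auto
    qed (use t in auto)
    have s2: "(\<Sum>\<sigma>\<in>tor_configs n. ?W n \<sigma> * tm ^ (n * windV n \<sigma>)) \<le> 4 * 2 ^ n * K2 n * Z n"
      unfolding Z_def
    proof (rule tilted_upper[OF elim(3) _ tilt_bounds(2)[OF mC, folded tm_def]])
      fix s :: nat assume "s < 2"
      then have "(\<Sum>k<n. c01 (real m * d (tw n s * rt n k) - 1)) \<ge> real n * ?I2 m - e * real n"
        using elim(2) by (auto simp: abs_le_iff)
      moreover have "real n * ?I2 m - e * real n = real n * (?I2 m - e)" by (simp add: algebra_simps)
      moreover have "real n * (?I2 m - e) \<ge> real n * (\<rho> - 2 * e)" using m(2) by (intro mult_left_mono) (auto simp: dist_real_def abs_le_iff)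
      ultimately have "real n * (\<rho> - 2 * e) \<le> (\<Sum>k<n. c01 (real m * d (tw n s * rt n k) - 1))" by linarith
      then show "tm powr (real n * (\<Sum>k<n. c01 (real m * d (tw n s * rt n k) - 1))) \<le> K2 n"
        unfolding K2_def using t by (intro powr_mono' mult_left_mono) auto
    qed (use t in auto)
    \<comment> \<open>Normalisations: \<open>tp ^ (n * V) * L1\<close> is at least 1 once
      \<open>V / n\<close> reaches \<rho> + 3e, and \<open>tm ^ (n * V) * L2\<close> is at least 1
      below \<rho> - 3e.\<close>
    define L1 where "L1 = tp powr (- (real n * (real n * (\<rho> + 3 * e))))"
    define L2 where "L2 = tm powr (- (real n * (real n * (\<rho> - 3 * e))))"
    have KL: "K1 n * L1 = q1 ^ (n * n)" "K2 n * L2 = q2 ^ (n * n)"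
      unfolding K1_def L1_def K2_def L2_def q1_def q2_def powr_add[symmetric]
      using t by (simp_all add: powr_realpow[symmetric] powr_powr algebra_simps)
    have L0: "L1 \<ge> 0" "L2 \<ge> 0" unfolding L1_def L2_def by simp_all
    \<comment> \<open>The two powers dominate the indicators of large deviations; the deviation
      itself is at most 1 because \<open>V / n\<close> and \<rho> both lie in the unit
      interval.\<close>
    have ptw: "\<bar>real V / real n - \<rho>\<bar> \<le> 3 * e + tp ^ (n * V) * L1 + tm ^ (n * V) * L2" if V: "V \<le> n" for V
    proof -
      define x where "x = real V / real n"
      have x: "0 \<le> x" "x \<le> 1" "real V = real n * x" unfolding x_def using V n0 by auto
      have x1: "\<bar>x - \<rho>\<bar> \<le> 1" using x \<rho>_bounds by (auto simp: abs_le_iff)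
      have e1: "tp ^ (n * V) * L1 = tp powr (real n * (real n * (x - (\<rho> + 3 * e))))"
        unfolding L1_def using t x(3) by (simp add: powr_realpow[symmetric] powr_add[symmetric] algebra_simps)
      have e2: "tm ^ (n * V) * L2 = tm powr (real n * (real n * (x - (\<rho> - 3 * e))))"
        unfolding L2_def using t x(3) by (simp add: powr_realpow[symmetric] powr_add[symmetric] algebra_simps)
      have p: "tp ^ (n * V) * L1 \<ge> 0" "tm ^ (n * V) * L2 \<ge> 0" unfolding e1 e2 by simp_all
      consider (a) "x \<ge> \<rho> + 3 * e" | (b) "x \<le> \<rho> - 3 * e" | (c) "\<bar>x - \<rho>\<bar> \<le> 3 * e" by linarith
      then show ?thesis unfolding x_def[symmetric]
      proof cases
        case a
        then have "tp ^ (n * V) * L1 \<ge> 1" unfolding e1 using t by (intro ge_one_powr_ge_zero) auto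
        then show "\<bar>x - \<rho>\<bar> \<le> 3 * e + tp ^ (n * V) * L1 + tm ^ (n * V) * L2" using p x1 e by linarith
      next
        case b
        have "tm powr 0 \<le> tm powr (real n * (real n * (x - (\<rho> - 3 * e))))"
          using t b by (intro powr_mono') (auto simp: mult_nonneg_nonpos)
        then have "tm ^ (n * V) * L2 \<ge> 1" unfolding e2 using t by simp
        then show "\<bar>x - \<rho>\<bar> \<le> 3 * e + tp ^ (n * V) * L1 + tm ^ (n * V) * L2" using p x1 e by linarith
      next
        case c
        then show "\<bar>x - \<rho>\<bar> \<le> 3 * e + tp ^ (n * V) * L1 + tm ^ (n * V) * L2" using p by linarith
      qed
    qed
    have "(\<Sum>\<sigma>\<in>tor_configs n. ?W n \<sigma> * \<bar>real (windV n \<sigma>) - \<rho> * real n\<bar>) / (Z n * real n) =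
        (\<Sum>\<sigma>\<in>tor_configs n. ?W n \<sigma> * \<bar>real (windV n \<sigma>) / real n - \<rho>\<bar>) / Z n"
    proof -
      have "?W n \<sigma> * \<bar>real (windV n \<sigma>) - \<rho> * real n\<bar> = (?W n \<sigma> * \<bar>real (windV n \<sigma>) / real n - \<rho>\<bar>) * real n" for \<sigma>
      proof -
        have "real (windV n \<sigma>) - \<rho> * real n = (real (windV n \<sigma>) / real n - \<rho>) * real n" using n0 by (simp add: field_simps)
        then show ?thesis by (simp add: abs_mult)
      qed
      then have "(\<Sum>\<sigma>\<in>tor_configs n. ?W n \<sigma> * \<bar>real (windV n \<sigma>) - \<rho> * real n\<bar>) =
          (\<Sum>\<sigma>\<in>tor_configs n. ?W n \<sigma> * \<bar>real (windV n \<sigma>) / real n - \<rho>\<bar>) * real n"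
        unfolding sum_distrib_right by (rule sum.cong[OF refl])
      then show ?thesis using n0 by simp
    qed
    also have "\<dots> \<le> (\<Sum>\<sigma>\<in>tor_configs n. ?W n \<sigma> * (3 * e + tp ^ (n * windV n \<sigma>) * L1 + tm ^ (n * windV n \<sigma>) * L2)) / Z n"
    proof (intro divide_right_mono sum_mono mult_left_mono ptw windV_le)
      fix \<sigma> assume "\<sigma> \<in> tor_configs n"
      then show "0 \<le> ?W n \<sigma>" by (rule less_imp_le[OF config_weight_pos[OF pos]])
    qed (use Z in simp)
    also have "\<dots> = (3 * e * Z n + (\<Sum>\<sigma>\<in>tor_configs n. ?W n \<sigma> * tp ^ (n * windV n \<sigma>)) * L1 +
        (\<Sum>\<sigma>\<in>tor_configs n. ?W n \<sigma> * tm ^ (n * windV n \<sigma>)) * L2) / Z n"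
      unfolding Z_def partition_fn_def sum_distrib_left sum_distrib_right sum.distrib[symmetric]
      by (intro arg_cong2[where f = "(/)"] refl sum.cong) (simp add: algebra_simps)
    also have "\<dots> \<le> (3 * e * Z n + (4 * 2 ^ n * K1 n * Z n) * L1 + (4 * 2 ^ n * K2 n * Z n) * L2) / Z n"
      using Z e by (intro divide_right_mono add_mono mult_right_mono s1 s2 L0) auto
    also have "\<dots> = 3 * e + 4 * (2 ^ n * (K1 n * L1)) + 4 * (2 ^ n * (K2 n * L2))"
      using Z by (simp add: field_simps)
    also have "\<dots> = E n" unfolding KL E_def ..
    finally show "dev n \<alpha> \<beta> \<gamma> \<rho> \<le> E n" unfolding dev_def Z_def .
  qed
  have lt: "eventually (\<lambda>n. E n < e') sequentially"
  proof -
    have "E \<longlonglongrightarrow> 3 * e + 4 * 0 + 4 * 0" unfolding E_def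
      by (intro tendsto_intros two_power_mult_square_tendsto_0 q)
    then show ?thesis by (rule order_tendstoD) (use e in simp)
  qed
  have nonneg: "dev n \<alpha> \<beta> \<gamma> \<rho> \<ge> 0" if "n > 0" for n
    unfolding dev_def using partition_fn_pos[OF pos that]
    by (intro divide_nonneg_nonneg sum_nonneg mult_nonneg_nonneg) (auto intro: less_imp_le config_weight_pos[OF pos])
  show "eventually (\<lambda>n. dist (dev n \<alpha> \<beta> \<gamma> \<rho>) 0 < e') sequentially"
    using le lt eventually_gt_at_top[of 0]
  proof eventually_elim
    case (elim n)
    then show ?case using nonneg[of n] by (simp add: dist_real_def)
  qed
qed

end

section \<open>Sums over the second frequency and the inner integral\<close>

text \<open>The derivative of \<open>sin y - y / 2\<close> is nonnegative up to \<pi> / 3, which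
  exceeds 1.\<close>

lemma norm_one_minus_cis_ge:
  assumes "\<bar>x\<bar> \<le> 1"
  shows "\<bar>x\<bar> / 2 \<le> norm (1 - cis x)"
proof -
  have pos_case: "y / 2 \<le> sin y" if "0 \<le> y" "y \<le> 1" for y :: real
  proof -
    have "(\<lambda>y. sin y - y / 2) 0 \<le> (\<lambda>y. sin y - y / 2) y"
    proof (rule DERIV_nonneg_imp_nondecreasing[OF that(1)])
      fix z assume z: "0 \<le> z" "z \<le> y"
      have "cos (pi / 3) \<le> cos z" using z that pi_gt3 by (intro cos_monotone_0_pi_le) auto
      then have "cos z - 1 / 2 \<ge> 0" by (simp add: cos_60)
      moreover have "((\<lambda>y. sin y - y / 2) has_real_derivative (cos z - 1 / 2)) (at z)"
        by (auto intro!: derivative_eq_intros)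
      ultimately show "\<exists>D. ((\<lambda>y. sin y - y / 2) has_real_derivative D) (at z) \<and> 0 \<le> D" by blast
    qed
    then show ?thesis by simp
  qed
  have "\<bar>x\<bar> / 2 \<le> sin \<bar>x\<bar>" using assms by (intro pos_case) auto
  also have "\<dots> \<le> \<bar>sin x\<bar>" by (cases "x \<ge> 0") auto
  also have "\<dots> = \<bar>Im (1 - cis x)\<bar>" by simp
  also have "\<dots> \<le> norm (1 - cis x)" by (rule abs_Im_le_cmod)
  finally show ?thesis .
qed

context ffsix
begin

definition "C1 = 1 + \<alpha> + \<beta> + \<gamma>"

definition Mx :: "complex \<Rightarrow> real" where "Mx w = max (norm (A w)) (norm (B w))"
definition Mn :: "complex \<Rightarrow> real" where "Mn w = min (norm (A w)) (norm (B w))"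
text \<open>For \<open>z = u ^ n\<close> this is the product of \<open>Delta\<close> over all second
  frequencies twisted by \<open>u\<close>, and the denominator produced by
  \<open>resolvent_sum\<close>.\<close>

definition DD :: "nat \<Rightarrow> complex \<Rightarrow> complex \<Rightarrow> complex" where "DD n z w = A w ^ n - (- B w) ^ n * z"

abbreviation ker :: "int \<times> int \<Rightarrow> bool \<Rightarrow> int \<times> int \<Rightarrow> bool \<Rightarrow> complex \<Rightarrow> complex \<Rightarrow> complex" where
  "ker v c v' c' \<equiv> kernel_integrand \<alpha> \<beta> \<gamma> (pt v c) (pt v' c')"

definition inner :: "int \<times> int \<Rightarrow> bool \<Rightarrow> int \<times> int \<Rightarrow> bool \<Rightarrow> complex \<Rightarrow> complex" where
  "inner v c v' c' w = integral {0..1} (\<lambda>t. ker v c v' c' w (cis (2 * pi * t)))"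

lemma Mx_pos: "Mx w \<ge> m0" "Mx w > 0" and Mn_nonneg: "0 \<le> Mn w" and Mn_le_Mx: "Mn w \<le> Mx w"
  and Mx_upper: "norm w = 1 \<Longrightarrow> Mx w \<le> C0" and Mx_Mn: "Mx w - Mn w = \<bar>d w\<bar>"
  using AB_lower[of w] m0_pos AB_upper[of w] unfolding Mx_def Mn_def dd_def by auto

lemma AB_le_Mx: "norm (A w) \<le> Mx w" "norm (B w) \<le> Mx w"
  unfolding Mx_def by auto

lemma DD_lower:
  assumes "norm z = 1"
  shows "Mx w ^ n - Mn w ^ n \<le> norm (DD n z w)"
proof -
  have "norm (A w ^ n) - norm ((- B w) ^ n * z) \<le> norm (DD n z w)" unfolding DD_def by (rule norm_triangle_ineq2)
  moreover have "norm ((- B w) ^ n * z) - norm (A w ^ n) \<le> norm (DD n z w)"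
    unfolding DD_def by (subst norm_minus_commute) (rule norm_triangle_ineq2)
  ultimately show ?thesis using assms unfolding Mx_def Mn_def
    by (auto simp: norm_mult norm_power max_def min_def)
qed

text \<open>By \<open>resolvent_sum\<close> the sum is \<open>n\<close> times a single monomial of
  degree \<open>n - 1\<close> in \<open>A\<close> and \<open>B\<close>, divided by
  \<open>DD\<close>. The missing power of \<open>Mx\<close> is paid for with
  \<open>m0\<close>.\<close>

lemma inner_sum_bound:
  assumes n: "n > 0" and u: "norm u = 1" and D: "DD n (u ^ n) w \<noteq> 0"
  shows "norm (\<Sum>l<n. (u * rt n l) powi b / Delta \<alpha> \<beta> \<gamma> w (u * rt n l)) \<le> real n * Mx w ^ n / (m0 * norm (DD n (u ^ n) w))"
proof -
  define S where "S = (\<Sum>l<n. (u * rt n l) powi b / (A w + B w * (u * rt n l)))"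
  define j0 where "j0 = (- b) mod int n"
  have j0: "0 \<le> j0" "j0 < int n" unfolding j0_def using n by auto
  have "int n dvd j0 + b" unfolding j0_def by (metis add.commute dvd_eq_mod_eq_0 mod_add_right_eq mod_0 right_minus_eq diff_minus_eq_add minus_minus add.right_inverse)
  then obtain z where z: "j0 + b = int n * z" by (rule dvdE)
  have "(\<Prod>l<n. A w + B w * (u * rt n l)) \<noteq> 0" unfolding prod_affine_rt[OF n] using D unfolding DD_def .
  then have nz: "A w + B w * (u * rt n l) \<noteq> 0" if "l < n" for l using that by auto
  have u0: "u \<noteq> 0" using u by auto
  have "S * DD n (u ^ n) w = of_nat n * u powi (int n * z) * A w ^ nat (int n - 1 - j0) * (- B w) ^ nat j0"
    unfolding S_def DD_def by (rule resolvent_sum[OF n u0 nz j0 z])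
  then have "norm S * norm (DD n (u ^ n) w) = norm (of_nat n * u powi (int n * z) * A w ^ nat (int n - 1 - j0) * (- B w) ^ nat j0)"
    by (simp only: norm_mult[symmetric])
  also have "\<dots> = real n * (norm (A w) ^ nat (int n - 1 - j0) * norm (B w) ^ nat j0)"
    using u by (simp add: norm_mult norm_power norm_power_int)
  also have "\<dots> \<le> real n * (Mx w ^ nat (int n - 1 - j0) * Mx w ^ nat j0)"
    using Mx_pos(2)[of w] by (intro mult_left_mono mult_mono power_mono AB_le_Mx) auto
  also have "Mx w ^ nat (int n - 1 - j0) * Mx w ^ nat j0 = Mx w ^ (n - 1)"
    using j0 by (subst power_add[symmetric]) (rule arg_cong[where f = "\<lambda>i. Mx w ^ i"], linarith)
  finally have 1: "norm S * norm (DD n (u ^ n) w) \<le> real n * Mx w ^ (n - 1)" .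
  have "norm S * norm (DD n (u ^ n) w) * m0 \<le> real n * Mx w ^ (n - 1) * Mx w"
    by (rule mult_mono[OF 1]) (use Mx_pos[of w] m0_pos in auto)
  also have "\<dots> = real n * Mx w ^ n" using n by (simp add: power_eq_if mult_ac)
  finally have "norm S \<le> real n * Mx w ^ n / (m0 * norm (DD n (u ^ n) w))"
    using D m0_pos by (simp add: pos_le_divide_eq mult_ac)
  then show ?thesis unfolding S_def Delta_AB .
qed

text \<open>As a function of \<open>w2\<close> the numerator of the kernel is a combination of two
  consecutive powers with coefficients of modulus at most \<open>C1\<close>.\<close>

lemma inner_kernel_bound:
  assumes n: "n > 0" and u: "norm u = 1" and w: "norm w = 1" and D: "DD n (u ^ n) w \<noteq> 0"
  shows "norm (\<Sum>l<n. ker v c v' c' w (u * rt n l)) \<le> 2 * C1 * (real n * Mx w ^ n / (m0 * norm (DD n (u ^ n) w)))"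
proof -
  let ?a = "fst v' - fst v" and ?b = "snd v' - snd v"
  let ?X = "real n * Mx w ^ n / (m0 * norm (DD n (u ^ n) w))"
  let ?T = "\<lambda>b. \<Sum>l<n. (u * rt n l) powi b / Delta \<alpha> \<beta> \<gamma> w (u * rt n l)"
  define g0 where "g0 = w powi ?a * (if c' then (if c then 1 + of_real \<alpha> * w else - of_real \<gamma> * w) else if c then 0 else 1)"
  define g1 where "g1 = w powi ?a * (if c' then 0 else if c then - of_real \<gamma> else of_real \<beta>)"
  have u0: "u \<noteq> 0" and w0: "w \<noteq> 0" using u w by auto
  have X0: "?X \<ge> 0" using m0_pos Mx_pos(2)[of w] by simp
  have "ker v c v' c' w (u * rt n l) = g0 * ((u * rt n l) powi ?b / Delta \<alpha> \<beta> \<gamma> w (u * rt n l)) +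
      g1 * ((u * rt n l) powi (?b + 1) / Delta \<alpha> \<beta> \<gamma> w (u * rt n l))" for l
  proof -
    have z: "u * rt n l \<noteq> 0" using u0 by simp
    have "(u * rt n l) powi (?b + 1) = (u * rt n l) powi ?b * (u * rt n l)"
      using power_int_add[OF disjI1[OF z], of ?b 1] by simp
    then show ?thesis unfolding kernel_integrand_pt[OF w0 z] isymb_def g0_def g1_def
      by (simp add: algebra_simps add_divide_distrib[symmetric] diff_divide_distrib[symmetric])
  qed
  then have "(\<Sum>l<n. ker v c v' c' w (u * rt n l)) = g0 * ?T ?b + g1 * ?T (?b + 1)"
    by (simp only: sum.distrib sum_distrib_left)
  then have "norm (\<Sum>l<n. ker v c v' c' w (u * rt n l)) \<le> norm g0 * norm (?T ?b) + norm g1 * norm (?T (?b + 1))"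
    using norm_triangle_ineq[of "g0 * ?T ?b" "g1 * ?T (?b + 1)"] by (simp only: norm_mult)
  also have "\<dots> \<le> C1 * ?X + C1 * ?X"
  proof (intro add_mono mult_mono inner_sum_bound[OF n u D])
    have "norm (1 + of_real \<alpha> * w) \<le> 1 + \<alpha>"
      using norm_triangle_ineq[of 1 "of_real \<alpha> * w"] w pos by (simp add: norm_mult)
    then show "norm g0 \<le> C1" unfolding g0_def C1_def using w pos by (auto simp: norm_mult norm_power_int)
    show "norm g1 \<le> C1" unfolding g1_def C1_def using w pos by (auto simp: norm_mult norm_power_int)
    show "0 \<le> C1" "0 \<le> C1" unfolding C1_def using pos by auto
  qed auto
  finally show ?thesis by (simp only: mult_2 distrib_right mult.assoc)
qed

lemma Delta_nonzero:
  assumes "norm z = 1" "d w \<noteq> 0"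
  shows "Delta \<alpha> \<beta> \<gamma> w z \<noteq> 0"
proof
  assume "Delta \<alpha> \<beta> \<gamma> w z = 0"
  then have "A w = - (B w * z)" unfolding Delta_AB by (simp add: eq_neg_iff_add_eq_0)
  then have "norm (A w) = norm (B w * z)" by simp
  then show False using assms unfolding dd_def norm_mult by simp
qed

lemma ker_continuous:
  assumes "K \<subseteq> {w. norm w = 1 \<and> d w \<noteq> 0}"
  shows "continuous_on (K \<times> sphere 0 1) (\<lambda>(w, z). ker v c v' c' w z)"
proof -
  have nz: "fst p \<noteq> 0" "snd p \<noteq> 0" "Delta \<alpha> \<beta> \<gamma> (fst p) (snd p) \<noteq> 0" if "p \<in> K \<times> sphere 0 1" for p
    using that assms Delta_nonzero[of "snd p" "fst p"] by (auto simp: mem_Times_iff)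
  have D: "continuous_on (K \<times> sphere 0 1) (\<lambda>p. Delta \<alpha> \<beta> \<gamma> (fst p) (snd p))"
    unfolding Delta_def by (intro continuous_intros)
  have "continuous_on (K \<times> sphere 0 1) (\<lambda>p. fst p powi (fst v' - fst v) * snd p powi (snd v' - snd v) * isymb \<alpha> \<beta> \<gamma> (fst p) (snd p) c' c)"
    unfolding isymb_def using nz by (cases c; cases c') (auto intro!: continuous_intros D)
  then show ?thesis
    by (rule continuous_on_cong[THEN iffD1, rotated 2]) (use nz in \<open>auto simp: kernel_integrand_pt\<close>)
qed

text \<open>The two terms of \<open>DD\<close> are comparable and may cancel. The threshold 1/2
  ensures that at any other frequency \<open>DD\<close> has modulus at least
  \<open>Mx w ^ n / 2\<close>, whatever the phase.\<close>

definition resonant :: "nat \<Rightarrow> complex \<Rightarrow> bool" where "resonant n w \<longleftrightarrow> Mn w ^ n > Mx w ^ n / 2"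

lemma DD_nonresonant:
  assumes "norm z = 1" "\<not> resonant n w"
  shows "Mx w ^ n / 2 \<le> norm (DD n z w)"
  using DD_lower[OF assms(1), of w n] assms(2) unfolding resonant_def by linarith

text \<open>By Bernoulli's inequality, n-th powers within a factor 2 force the moduli to agree up to
  O(1/n).\<close>

lemma resonant_imp_d_small:
  assumes n: "n > 0" and w: "norm w = 1" and r: "resonant n w"
  shows "real n * \<bar>d w\<bar> \<le> C0"
proof -
  have p: "Mn w > 0" using Mn_nonneg[of w] r zero_less_power[OF Mx_pos(2), of w n] Mx_pos(2)[of w] n unfolding resonant_def by (cases "Mn w = 0") (auto simp: power_0_left)
  have "1 + real n * (Mx w / Mn w - 1) \<le> (1 + (Mx w / Mn w - 1)) ^ n"
    by (rule Bernoulli_inequality) (use p Mx_pos(2)[of w] in simp)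
  also have "\<dots> = Mx w ^ n / Mn w ^ n" by (simp add: power_divide)
  also have "\<dots> < 2" using r p unfolding resonant_def by (simp add: pos_divide_less_eq)
  finally have "real n * (Mx w / Mn w - 1) < 1" by simp
  then have "real n * (Mx w - Mn w) < Mn w" using p by (simp add: field_simps)
  then show ?thesis using Mx_Mn[of w] Mn_le_Mx[of w] Mx_upper[OF w] by simp
qed

text \<open>Near the critical frequencies the kernel is unbounded, but its integral over the second
  variable is not: it is a limit of lattice sums to which the exact formula applies, and a fixed
  \<open>w\<close> with \<open>d w \<noteq> 0\<close> is not resonant for large \<open>n\<close>.
  This uniform bound drives the dominated convergence in the first variable.\<close>

lemma inner_bound:
  assumes w: "norm w = 1" "d w \<noteq> 0"
  shows "norm (inner v c v' c' w) \<le> 4 * C1 / m0"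
proof -
  define T where "T n = (\<Sum>l<n. ker v c v' c' w (cis (0 / real n) * rt n l)) /\<^sub>R real n" for n
  have "T \<longlonglongrightarrow> inner v c v' c' w"
  proof (rule LIMSEQ_I)
    fix e :: real assume "e > 0"
    then have e2: "e / 2 > 0" by simp
    have "continuous_on ({w} \<times> sphere 0 1) (\<lambda>(w, z). ker v c v' c' w z)" using w by (intro ker_continuous) auto
    from riemann_grid_uniform[OF _ this e2] obtain N where
      N: "\<And>n. n \<ge> N \<Longrightarrow> norm (T n - inner v c v' c' w) \<le> e / 2"
      unfolding T_def inner_def by fastforce
    show "\<exists>N. \<forall>n\<ge>N. norm (T n - inner v c v' c' w) < e"
      using N \<open>e > 0\<close> by (intro exI[of _ N]) fastforce
  qed
  then have lim: "(\<lambda>n. norm (T n)) \<longlonglongrightarrow> norm (inner v c v' c' w)" by (rule tendsto_norm)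
  have "eventually (\<lambda>n. real n > C0 / \<bar>d w\<bar>) sequentially"
    by (rule eventually_gt_at_top[THEN filterlim_real_sequentially[unfolded filterlim_iff, rule_format]])
  then have "eventually (\<lambda>n. norm (T n) \<le> 4 * C1 / m0) sequentially"
    using eventually_gt_at_top[of 0]
  proof eventually_elim
    case (elim n)
    have "\<not> real n * \<bar>d w\<bar> \<le> C0" using elim(1) w by (simp add: divide_less_eq)
    then have nr: "\<not> resonant n w" using resonant_imp_d_small[OF elim(2) w(1)] by blast
    have D: "Mx w ^ n / 2 \<le> norm (DD n (1 ^ n) w)" by (rule DD_nonresonant[OF _ nr]) simp
    have Mp: "Mx w ^ n > 0" using Mx_pos(2) by simp
    have D0: "DD n (1 ^ n) w \<noteq> 0" using D Mp by auto
    have "norm (\<Sum>l<n. ker v c v' c' w (1 * rt n l)) \<le> 2 * C1 * (real n * Mx w ^ n / (m0 * norm (DD n (1 ^ n) w)))"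
      by (rule inner_kernel_bound[OF elim(2) _ w(1) D0]) simp
    also have "\<dots> \<le> 2 * C1 * (real n * Mx w ^ n / (m0 * (Mx w ^ n / 2)))"
      using D Mp m0_pos pos unfolding C1_def by (intro mult_left_mono divide_left_mono mult_pos_pos) auto
    also have "\<dots> = real n * (4 * C1 / m0)" using Mx_pos(2)[of w] m0_pos by (simp add: field_simps)
    finally show ?case unfolding T_def using elim(2) by (simp add: field_simps)
  qed
  then show ?thesis by (intro tendsto_upperbound[OF lim]) auto
qed

lemma Lker_inner: "Lker \<alpha> \<beta> \<gamma> (pt v c) (pt v' c') = integral {0..1} (\<lambda>t. inner v c v' c' (cis (2 * pi * t)))"
proof -
  have circ: "contour_integral (circlepath 0 1) f = 2 * of_real pi * \<i> * integral {0..1} (\<lambda>t. f (cis (2 * pi * t)) * cis (2 * pi * t))" for f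
  proof -
    have "contour_integral (circlepath 0 1) f = integral {0..1} (\<lambda>t. (2 * of_real pi * \<i>) * (f (cis (2 * pi * t)) * cis (2 * pi * t)))"
      unfolding contour_integral_integral vector_derivative_circlepath
      by (intro integral_cong) (simp add: circlepath cis_conv_exp mult_ac)
    then show ?thesis by (simp only: integral_mult_right)
  qed
  have aux: "k / (w * z) * z = inverse w * k" "b * (inverse z * k) * z = b * k" if "z \<noteq> 0" for b k w z :: complex
    using that by (cases "w = 0"; simp add: field_simps)+
  have in1: "contour_integral (circlepath 0 1) (\<lambda>w2. ker v c v' c' w1 w2 / (w1 * w2)) = 2 * of_real pi * \<i> * (inverse w1 * inner v c v' c' w1)" for w1
  proof -
    have "integral {0..1} (\<lambda>t. ker v c v' c' w1 (cis (2 * pi * t)) / (w1 * cis (2 * pi * t)) * cis (2 * pi * t)) =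
       integral {0..1} (\<lambda>t. inverse w1 * ker v c v' c' w1 (cis (2 * pi * t)))"
      by (intro integral_cong aux cis_neq_zero)
    then show ?thesis unfolding circ inner_def by (simp only: integral_mult_right)
  qed
  have "integral {0..1} (\<lambda>t. 2 * of_real pi * \<i> * (inverse (cis (2 * pi * t)) * inner v c v' c' (cis (2 * pi * t))) * cis (2 * pi * t)) =
     integral {0..1} (\<lambda>t. 2 * of_real pi * \<i> * inner v c v' c' (cis (2 * pi * t)))"
    by (intro integral_cong aux cis_neq_zero)
  then have "contour_integral (circlepath 0 1) (\<lambda>w1. 2 * of_real pi * \<i> * (inverse w1 * inner v c v' c' w1)) =
     (2 * of_real pi * \<i>) ^ 2 * integral {0..1} (\<lambda>t. inner v c v' c' (cis (2 * pi * t)))"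
    unfolding circ by (simp only: integral_mult_right power2_eq_square mult_ac)
  then show ?thesis unfolding Lker_def in1 by simp
qed

end

section \<open>Counting resonant frequencies and choosing the twist\<close>

lemma card_le_of_diff_le:
  assumes "finite S" "\<And>k k'. k \<in> S \<Longrightarrow> k' \<in> S \<Longrightarrow> k < k' \<Longrightarrow> k' - k \<le> (D::nat)"
  shows "card S \<le> D + 1"
proof (cases "S = {}")
  case False
  have "S \<subseteq> {Min S..Min S + D}"
  proof
    fix k assume k: "k \<in> S"
    have "Min S \<le> k" "Min S \<in> S" using k assms(1) False by auto
    then show "k \<in> {Min S..Min S + D}" using assms(2)[of "Min S" k] k by (cases "k = Min S") auto
  qed
  then have "card S \<le> card {Min S..Min S + D}" by (intro card_mono) auto
  then show ?thesis by simp
qed simp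

text \<open>Mean value theorem: between two angles whose cosines are at most \<open>y\<close> in
  modulus, the sine stays above \<open>sqrt (1 - y^2)\<close>.\<close>

lemma cos_diff_lower:
  assumes ab: "0 \<le> a" "a < b" "b \<le> pi" and y: "\<bar>cos a\<bar> \<le> y" "\<bar>cos b\<bar> \<le> y"
  shows "sqrt (1 - y^2) * (b - a) \<le> cos a - cos b"
proof -
  obtain z where z: "z > a" "z < b" "cos b - cos a = (b - a) * (- sin z)"
    using MVT2[of a b cos "\<lambda>x. - sin x"] ab(2) by (auto intro!: derivative_eq_intros)
  have "cos z \<le> cos a" "cos b \<le> cos z" using z ab by (auto intro!: cos_monotone_0_pi_le)
  then have "\<bar>cos z\<bar> \<le> y" using y by (auto simp: abs_le_iff)
  then have "(cos z)^2 \<le> y^2" using abs_le_square_iff[of "cos z" y] by auto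
  then have "1 - y^2 \<le> (sin z)^2" using sin_cos_squared_add[of z] by linarith
  moreover have "0 \<le> sin z" using z ab by (intro sin_ge_zero) auto
  ultimately have "sqrt (1 - y^2) \<le> sin z" by (rule real_le_lsqrt[rotated -1]) 
  then have "sqrt (1 - y^2) * (b - a) \<le> sin z * (b - a)" using ab by (intro mult_right_mono) auto
  then show ?thesis using z(3) by (simp add: algebra_simps)
qed

text \<open>The angles are spaced by 2\<pi> / n, and on each half of the circle the cosine is
  monotone with slope bounded away from 0 as long as its value is bounded away from 1 and -1. A
  window of width O(1/n) around a level then contains O(1) angles of each half.\<close>

lemma card_near_level:
  assumes y: "\<bar>y\<bar> < 1" and n: "n > 0" and "s < 2"
    and S: "S \<subseteq> {..<n}" "\<And>k. k \<in> S \<Longrightarrow> \<bar>cos (pi * real s / real n + 2 * pi * real k / real n)\<bar> \<le> y"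
      "\<And>k. k \<in> S \<Longrightarrow> \<bar>cos (pi * real s / real n + 2 * pi * real k / real n) - x\<bar> \<le> P / real n"
  shows "card S \<le> 2 * (nat \<lfloor>P / (pi * sqrt (1 - y^2))\<rfloor> + 1)"
proof -
  define \<theta> where "\<theta> k = pi * real s / real n + 2 * pi * real k / real n" for k
  define \<sigma> where "\<sigma> = sqrt (1 - y^2)"
  have "y^2 < 1" using y by (simp add: abs_square_less_1)
  then have \<sigma>: "\<sigma> > 0" unfolding \<sigma>_def by simp
  note S = S[folded \<theta>_def]
  have fin: "finite S" using S(1) finite_subset by blast
  have diff: "\<theta> k' - \<theta> k = 2 * pi * (real k' - real k) / real n" for k k'
    unfolding \<theta>_def by (simp add: diff_divide_distrib right_diff_distrib)
  have \<theta>0: "\<theta> k \<ge> 0" for k unfolding \<theta>_def by simp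
  have \<theta>2: "\<theta> k \<le> 2 * pi" if "k < n" for k
  proof -
    have "real s + 2 * real k \<le> 2 * real n" using that \<open>s < 2\<close> by linarith
    then have "pi * (real s + 2 * real k) / real n \<le> pi * (2 * real n) / real n"
      by (intro divide_right_mono mult_left_mono) auto
    then show ?thesis unfolding \<theta>_def using n by (simp add: add_divide_distrib algebra_simps)
  qed
  have mono_\<theta>: "\<theta> k < \<theta> k'" if "k < k'" for k k'
  proof -
    have "\<theta> k' - \<theta> k > 0" unfolding diff using that n by simp
    then show ?thesis by simp
  qed
  have key: "k' - k \<le> nat \<lfloor>P / (pi * \<sigma>)\<rfloor>" if "k < k'" "\<sigma> * (\<theta> k' - \<theta> k) \<le> 2 * P / real n" for k k'
  proof -
    have "2 * ((\<sigma> * pi) * (real k' - real k)) / real n \<le> 2 * P / real n" using that(2) unfolding diff by (simp add: mult_ac)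
    then have "(\<sigma> * pi) * (real k' - real k) \<le> P" using n by (simp only: divide_le_cancel) auto
    then have "real k' - real k \<le> P / (pi * \<sigma>)" using \<sigma> by (simp add: pos_le_divide_eq mult_ac)
    then have "real (k' - k) \<le> P / (pi * \<sigma>)" using that(1) by simp
    then show ?thesis by (metis le_nat_floor)
  qed
  have "card {k \<in> S. \<theta> k \<le> pi} \<le> nat \<lfloor>P / (pi * \<sigma>)\<rfloor> + 1"
  proof (rule card_le_of_diff_le)
    fix k k' assume k: "k \<in> {k \<in> S. \<theta> k \<le> pi}" "k' \<in> {k \<in> S. \<theta> k \<le> pi}" "k < k'"
    have "\<theta> k < \<theta> k'" by (rule mono_\<theta>[OF k(3)])
    then have "\<sigma> * (\<theta> k' - \<theta> k) \<le> cos (\<theta> k) - cos (\<theta> k')"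
      unfolding \<sigma>_def using k \<theta>0 S(2) by (intro cos_diff_lower) auto
    also have "\<dots> \<le> 2 * P / real n" using S(3)[of k] S(3)[of k'] k by (auto simp: abs_le_iff)
    finally show "k' - k \<le> nat \<lfloor>P / (pi * \<sigma>)\<rfloor>" by (rule key[OF k(3)])
  qed (use fin in simp)
  moreover have "card {k \<in> S. \<not> \<theta> k \<le> pi} \<le> nat \<lfloor>P / (pi * \<sigma>)\<rfloor> + 1"
  proof (rule card_le_of_diff_le)
    fix k k' assume k: "k \<in> {k \<in> S. \<not> \<theta> k \<le> pi}" "k' \<in> {k \<in> S. \<not> \<theta> k \<le> pi}" "k < k'"
    have c: "cos (2 * pi - \<theta> j) = cos (\<theta> j)" for j by (simp add: cos_diff)
    have "k' < n" using k S(1) by auto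
    have "\<theta> k < \<theta> k'" by (rule mono_\<theta>[OF k(3)])
    then have "\<sigma> * ((2 * pi - \<theta> k) - (2 * pi - \<theta> k')) \<le> cos (2 * pi - \<theta> k') - cos (2 * pi - \<theta> k)"
      unfolding \<sigma>_def using k \<theta>2[OF \<open>k' < n\<close>] S(2) by (intro cos_diff_lower) (auto simp: c)
    also have "\<dots> \<le> 2 * P / real n" using S(3)[of k] S(3)[of k'] k by (auto simp: c abs_le_iff)
    finally show "k' - k \<le> nat \<lfloor>P / (pi * \<sigma>)\<rfloor>" by (intro key[OF k(3)]) simp
  qed (use fin in simp)
  moreover have "card S = card {k \<in> S. \<theta> k \<le> pi} + card {k \<in> S. \<not> \<theta> k \<le> pi}"
    using fin by (subst card_Un_disjoint[symmetric]) (auto intro: arg_cong[where f = card])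
  ultimately have "card S \<le> (nat \<lfloor>P / (pi * \<sigma>)\<rfloor> + 1) + (nat \<lfloor>P / (pi * \<sigma>)\<rfloor> + 1)" by (simp only: add_mono)
  then show ?thesis unfolding \<sigma>_def mult_2 .
qed

context ffsix
begin

text \<open>The difference of the squared moduli factors through \<open>d\<close>, which is O(1/n)
  at resonance, and is proportional to \<open>Re w - x0\<close>.\<close>

lemma resonant_level:
  assumes n: "n > 0" and w: "norm w = 1" and r: "resonant n w"
  shows "\<bar>Re w - x0\<bar> \<le> C0^2 / (\<alpha> + \<beta> * \<delta>) / real n"
proof -
  have p: "\<alpha> + \<beta> * \<delta> > 0" using pos by (intro add_pos_pos mult_pos_pos) auto
  have "2 * (\<alpha> + \<beta> * \<delta>) * \<bar>Re w - x0\<bar> = \<bar>(norm (A w))^2 - (norm (B w))^2\<bar>"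
    unfolding sq_diff[OF w] using p by (simp add: abs_mult)
  also have "(norm (A w))^2 - (norm (B w))^2 = - (d w * (norm (A w) + norm (B w)))"
    unfolding dd_def by (simp add: power2_eq_square algebra_simps)
  also have "\<bar>\<dots>\<bar> = \<bar>d w\<bar> * (norm (A w) + norm (B w))" by (simp add: abs_mult)
  also have "\<dots> \<le> \<bar>d w\<bar> * (C0 + C0)" by (intro mult_left_mono add_mono AB_upper w) simp
  finally have "2 * ((\<alpha> + \<beta> * \<delta>) * \<bar>Re w - x0\<bar>) \<le> \<bar>d w\<bar> * C0 + \<bar>d w\<bar> * C0" by (simp only: mult.assoc[of 2] distrib_left[of "\<bar>d w\<bar>"])
  then have "(\<alpha> + \<beta> * \<delta>) * \<bar>Re w - x0\<bar> \<le> \<bar>d w\<bar> * C0" by linarith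
  then have "real n * ((\<alpha> + \<beta> * \<delta>) * \<bar>Re w - x0\<bar>) \<le> (real n * \<bar>d w\<bar>) * C0"
    using mult_left_mono[of _ _ "real n"] by (simp add: mult.assoc)
  also have "\<dots> \<le> C0 * C0" using resonant_imp_d_small[OF n w r] C0_pos by (intro mult_right_mono) auto
  finally have f: "real n * ((\<alpha> + \<beta> * \<delta>) * \<bar>Re w - x0\<bar>) \<le> C0^2" by (simp only: power2_eq_square)
  have "X \<le> c / q / r" if "r * (q * X) \<le> c" "q > 0" "r > 0" for X c q r :: real
    using that by (simp add: field_simps)
  from this[OF f p] show ?thesis using n by simp
qed

text \<open>For \<open>x0\<close> beyond 1 in modulus no frequency comes close to the level when
  \<open>n\<close> is large; inside, the level is crossed with nonzero slope. In the excluded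
  tangential cases a window of width of order 1/n around the level contains of the order of sqrt n
  frequencies.\<close>

lemma resonant_count:
  assumes "x0 \<noteq> 1" "x0 \<noteq> -1"
  shows "\<exists>Mb. eventually (\<lambda>n. \<forall>s<2. card {k \<in> {..<n}. resonant n (tw n s * rt n k)} \<le> Mb) sequentially"
proof -
  define P where "P = C0^2 / (\<alpha> + \<beta> * \<delta>)"
  have w: "norm (tw n s * rt n k) = 1" for n s k by (simp add: norm_mult)
  have Re: "Re (tw n s * rt n k) = cos (pi * real s / real n + 2 * pi * real k / real n)" for n s k
    unfolding tw_def rt_def cis_mult by simp
  have large: "eventually (\<lambda>n. real n > P / e) sequentially" for e
    by (rule eventually_gt_at_top[THEN filterlim_real_sequentially[unfolded filterlim_iff, rule_format]])
  consider "\<bar>x0\<bar> > 1" | "\<bar>x0\<bar> < 1" using assms by linarith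
  then show ?thesis
  proof cases
    case 1
    define e where "e = \<bar>x0\<bar> - 1"
    have e: "e > 0" using 1 by (simp add: e_def)
    have "eventually (\<lambda>n. \<forall>s<2. card {k \<in> {..<n}. resonant n (tw n s * rt n k)} \<le> 0) sequentially"
      using large[of e] eventually_gt_at_top[of 0]
    proof eventually_elim
      case (elim n)
      have "\<not> resonant n (tw n s * rt n k)" for s k
      proof
        assume r: "resonant n (tw n s * rt n k)"
        have "\<bar>Re (tw n s * rt n k)\<bar> \<le> 1" using abs_Re_le_cmod[of "tw n s * rt n k"] w by simp
        then have "e \<le> \<bar>Re (tw n s * rt n k) - x0\<bar>" unfolding e_def by linarith
        also have "\<dots> \<le> P / real n" unfolding P_def by (rule resonant_level[OF elim(2) w r])
        finally have "real n \<le> P / e" using e elim(2) by (simp add: field_simps)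
        then show False using elim(1) by simp
      qed
      then show ?case by simp
    qed
    then show ?thesis by blast
  next
    case 2
    define e where "e = (1 - \<bar>x0\<bar>) / 2"
    define y where "y = \<bar>x0\<bar> + e"
    have e: "e > 0" using 2 by (simp add: e_def)
    have y: "\<bar>y\<bar> < 1" 
    proof -
      have "0 \<le> y" "y < 1" using 2 unfolding y_def e_def by (simp_all add: field_simps)
      then show ?thesis by simp
    qed
    have "eventually (\<lambda>n. \<forall>s<2. card {k \<in> {..<n}. resonant n (tw n s * rt n k)} \<le> 2 * (nat \<lfloor>P / (pi * sqrt (1 - y^2))\<rfloor> + 1)) sequentially"
      using large[of e] eventually_gt_at_top[of 0]
    proof eventually_elim
      case (elim n)
      have Pe: "P / real n \<le> e" using elim e by (simp add: field_simps)
      show ?case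
      proof (intro allI impI)
        fix s :: nat assume s: "s < 2"
        have lev: "\<bar>cos (pi * real s / real n + 2 * pi * real k / real n) - x0\<bar> \<le> P / real n" if "k \<in> {k \<in> {..<n}. resonant n (tw n s * rt n k)}" for k
          unfolding Re[symmetric] P_def by (rule resonant_level[OF elim(2) w]) (use that in auto)
        show "card {k \<in> {..<n}. resonant n (tw n s * rt n k)} \<le> 2 * (nat \<lfloor>P / (pi * sqrt (1 - y^2))\<rfloor> + 1)"
        proof (rule card_near_level[OF y elim(2) s])
          fix k assume k: "k \<in> {k \<in> {..<n}. resonant n (tw n s * rt n k)}"
          show "\<bar>cos (pi * real s / real n + 2 * pi * real k / real n)\<bar> \<le> y" using lev[OF k] Pe unfolding y_def by linarith
          show "\<bar>cos (pi * real s / real n + 2 * pi * real k / real n) - x0\<bar> \<le> P / real n" by (rule lev[OF k])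
        qed auto
      qed
    qed
    then show ?thesis by blast
  qed
qed

text \<open>Pigeonhole: \<open>Mb + 1\<close> equally spaced candidates face at most
  \<open>Mb\<close> resonant frequencies. If all failed, two would fail at the same frequency; but
  there the two values of \<open>DD\<close> differ by
  \<open>norm (B w) ^ n * norm (1 - cis x)\<close> with \<open>x\<close> at least
  \<open>\<eta> / M\<close>, and resonance keeps \<open>norm (B w) ^ n\<close> above
  \<open>Mx w ^ n / 2\<close>.\<close>

lemma choose_twist:
  assumes n: "n > 0" and \<eta>: "0 < \<eta>" "\<eta> \<le> 1" and \<epsilon>: "norm \<epsilon> = 1"
    and c: "card {k \<in> {..<n}. resonant n (wk k)} \<le> Mb"
  shows "\<exists>\<psi>. 0 \<le> \<psi> \<and> \<psi> \<le> \<eta> \<and> (\<forall>k<n. resonant n (wk k) \<longrightarrow>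
     Mx (wk k) ^ n * (\<eta> / (8 * (real Mb + 1))) \<le> norm (DD n (\<epsilon> * cis \<psi>) (wk k)))"
proof (rule ccontr)
  assume contra: "\<not> ?thesis"
  define M where "M = real Mb + 1"
  define \<psi> where "\<psi> l = real l * \<eta> / M" for l
  have M: "M > 0" unfolding M_def by simp
  define S where "S = {k \<in> {..<n}. resonant n (wk k)}"
  have "\<exists>k\<in>S. norm (DD n (\<epsilon> * cis (\<psi> l)) (wk k)) < Mx (wk k) ^ n * (\<eta> / (8 * M))" if "l \<le> Mb" for l
  proof -
    have "0 \<le> \<psi> l" unfolding \<psi>_def M_def using \<eta> by simp
    moreover have "real l * \<eta> \<le> M * \<eta>" using \<eta> that unfolding M_def by (intro mult_right_mono) auto
    then have "\<psi> l \<le> \<eta>" unfolding \<psi>_def using M by (simp add: pos_divide_le_eq mult.commute)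
    ultimately have "\<not> (\<forall>k<n. resonant n (wk k) \<longrightarrow> Mx (wk k) ^ n * (\<eta> / (8 * (real Mb + 1))) \<le> norm (DD n (\<epsilon> * cis (\<psi> l)) (wk k)))"
      using contra by blast
    then show ?thesis unfolding S_def M_def by (auto simp: not_le)
  qed
  then obtain f where f: "\<And>l. l \<le> Mb \<Longrightarrow> f l \<in> S"
    "\<And>l. l \<le> Mb \<Longrightarrow> norm (DD n (\<epsilon> * cis (\<psi> l)) (wk (f l))) < Mx (wk (f l)) ^ n * (\<eta> / (8 * M))" by metis
  have "\<not> inj_on f {..Mb}"
  proof
    assume "inj_on f {..Mb}"
    then have "card {..Mb} \<le> card S" by (rule card_inj_on_le) (use f in \<open>auto simp: S_def\<close>)
    then show False using c unfolding S_def by simp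
  qed
  then obtain l l' where l: "l \<le> Mb" "l' \<le> Mb" "l < l'" "f l = f l'"
    unfolding inj_on_def by (metis atMost_iff linorder_neqE_nat)
  define w where "w = wk (f l)"
  define x where "x = \<psi> l' - \<psi> l"
  have "resonant n w" using f(1)[OF l(1)] unfolding S_def w_def by simp
  then have Bn: "norm (B w) ^ n > Mx w ^ n / 2"
  proof -
    have "Mn w ^ n \<le> norm (B w) ^ n" by (rule power_mono) (auto simp: Mn_def)
    then show ?thesis using \<open>resonant n w\<close> unfolding resonant_def by linarith
  qed
  have x: "\<eta> / M \<le> x" "\<bar>x\<bar> \<le> 1"
  proof -
    have e: "x = (real l' - real l) * (\<eta> / M)" unfolding x_def \<psi>_def by (simp add: left_diff_distrib diff_divide_distrib)
    have "1 * (\<eta> / M) \<le> (real l' - real l) * (\<eta> / M)" using l(3) \<eta> M by (intro mult_right_mono) auto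
    then show "\<eta> / M \<le> x" unfolding e by simp
    then have "x \<ge> 0" using \<eta> M by (auto intro: order_trans[rotated])
    moreover have "(real l' - real l) * (\<eta> / M) \<le> M * (\<eta> / M)" using l \<eta> M unfolding M_def by (intro mult_right_mono) auto
    then have "x \<le> \<eta>" unfolding e using M by simp
    then have "x \<le> 1" using \<eta> by simp
    ultimately show "\<bar>x\<bar> \<le> 1" by simp
  qed
  have "DD n (\<epsilon> * cis (\<psi> l')) w - DD n (\<epsilon> * cis (\<psi> l)) w = (- B w) ^ n * (\<epsilon> * cis (\<psi> l)) * (1 - cis x)"
    unfolding DD_def x_def by (simp add: algebra_simps cis_mult)
  then have "norm (B w) ^ n * norm (1 - cis x) = norm (DD n (\<epsilon> * cis (\<psi> l')) w - DD n (\<epsilon> * cis (\<psi> l)) w)"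
    using \<epsilon> by (simp add: norm_mult norm_power)
  also have "\<dots> \<le> norm (DD n (\<epsilon> * cis (\<psi> l')) w) + norm (DD n (\<epsilon> * cis (\<psi> l)) w)" by (rule norm_triangle_ineq4)
  \<comment> \<open>The constant 8 collects three factors 2: two failing values, the power of
    \<open>B\<close> against that of \<open>Mx\<close>, and the chord against the angle.\<close>
  also have "\<dots> < Mx w ^ n * (\<eta> / (8 * M)) + Mx w ^ n * (\<eta> / (8 * M))"
    using f(2)[OF l(1)] f(2)[OF l(2)] l(4) unfolding w_def by (intro add_strict_mono) auto
  also have "\<dots> = Mx w ^ n / 2 * (\<eta> / M / 2)" by simp
  also have "\<dots> \<le> norm (B w) ^ n * norm (1 - cis x)"
  proof (intro mult_mono)
    have "\<eta> / M / 2 \<le> \<bar>x\<bar> / 2" using x(1) by simp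
    also have "\<dots> \<le> norm (1 - cis x)" by (rule norm_one_minus_cis_ge[OF x(2)])
    finally show "\<eta> / M / 2 \<le> norm (1 - cis x)" .
  qed (use Bn \<eta> M in auto)
  finally show False by simp
qed

section \<open>Convergence of the inverse matrix to the kernel\<close>

text \<open>A cutoff around the critical frequencies, equal to 1 where m |d| is at most 1 and to 0
  where it is at least 2. Continuity of \<open>inner\<close> is available only off the critical
  set.\<close>

definition bumpJ :: "nat \<Rightarrow> complex \<Rightarrow> real" where "bumpJ m w = c01 (2 - real m * \<bar>d w\<bar>)"

lemma bumpJ_bounds: "0 \<le> bumpJ m w" "bumpJ m w \<le> 1" and bumpJ_eq_1: "real m * \<bar>d w\<bar> \<le> 1 \<Longrightarrow> bumpJ m w = 1"
  and bumpJ_continuous: "continuous_on S (bumpJ m)"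
  unfolding bumpJ_def by (auto intro!: continuous_intros simp: c01_def)

lemma compact_off_critical: "compact {w \<in> sphere 0 1. 1 \<le> real m * \<bar>d w\<bar>}"
proof -
  have "{w \<in> sphere 0 1. 1 \<le> real m * \<bar>d w\<bar>} = sphere 0 1 \<inter> (\<lambda>w. real m * \<bar>d w\<bar>) -` {1..}" by auto
  moreover have "closed (sphere 0 1 \<inter> (\<lambda>w. real m * \<bar>d w\<bar>) -` {1..})"
    by (intro continuous_closed_preimage) (auto intro!: continuous_intros)
  moreover have "bounded {w \<in> sphere 0 1. 1 \<le> real m * \<bar>d w\<bar>}"
    by (rule bounded_subset[of "sphere 0 1"]) auto
  ultimately show ?thesis by (simp only: compact_eq_bounded_closed)
qed

lemma inner_continuous:
  assumes "K \<subseteq> {w. norm w = 1 \<and> d w \<noteq> 0}"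
  shows "continuous_on K (inner v c v' c')"
proof -
  have "continuous_on (K \<times> cbox 0 1) (\<lambda>p. (\<lambda>(w, z). ker v c v' c' w z) (fst p, cis (2 * pi * snd p)))"
  proof (rule continuous_on_compose2[OF ker_continuous[OF assms]])
    show "continuous_on (K \<times> cbox 0 1) (\<lambda>p. (fst p, cis (2 * pi * snd p)))"
      unfolding cis_conv_exp by (intro continuous_intros)
  qed auto
  then have "continuous_on (K \<times> cbox 0 (1::real)) (\<lambda>(w, t). ker v c v' c' w (cis (2 * pi * t)))"
    by (simp add: case_prod_beta)
  then show ?thesis unfolding inner_def box_real(2)[symmetric] by (rule integral_continuous_on_param)
qed

text \<open>Glued from the closed set where \<open>d\<close> stays away from 0 and the closed set
  where the cutoff makes the product vanish.\<close>

lemma cut_inner_continuous: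
  "continuous_on (sphere 0 1) (\<lambda>w. of_real (1 - bumpJ m w) * inner v c v' c' w)"
proof -
  let ?K = "{w \<in> sphere 0 1. 1 \<le> real m * \<bar>d w\<bar>}" and ?L = "{w \<in> sphere (0::complex) 1. real m * \<bar>d w\<bar> \<le> 1}"
  have "continuous_on (?K \<union> ?L) (\<lambda>w. of_real (1 - bumpJ m w) * inner v c v' c' w)"
  proof (rule continuous_on_closed_Un)
    show "closed ?K" using compact_off_critical by (rule compact_imp_closed)
    have "?L = sphere 0 1 \<inter> (\<lambda>w. real m * \<bar>d w\<bar>) -` {..1}" by auto
    then show "closed ?L"
      by (simp only:) (intro continuous_closed_preimage, auto intro!: continuous_intros)
    have "continuous_on ?K (inner v c v' c')" by (rule inner_continuous) auto
    then show "continuous_on ?K (\<lambda>w. of_real (1 - bumpJ m w) * inner v c v' c' w)"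
      by (intro continuous_intros bumpJ_continuous)
    show "continuous_on ?L (\<lambda>w. of_real (1 - bumpJ m w) * inner v c v' c' w)"
      by (rule continuous_on_cong[THEN iffD1, OF refl _ continuous_on_const[of _ 0]]) (simp add: bumpJ_eq_1)
  qed
  moreover have "?K \<union> ?L = sphere 0 1" by auto
  ultimately show ?thesis by simp
qed

lemma cut_inner_limit:
  "(\<lambda>m. integral {0..1} (\<lambda>t. of_real (1 - bumpJ m (cis (2 * pi * t))) * inner v c v' c' (cis (2 * pi * t))))
     \<longlonglongrightarrow> Lker \<alpha> \<beta> \<gamma> (pt v c) (pt v' c')"
  unfolding Lker_inner
proof (rule ae_dominated_convergence(2)[OF d_zero_finite, where C = "4 * C1 / m0"])
  show "(\<lambda>t. of_real (1 - bumpJ m (cis (2 * pi * t))) * inner v c v' c' (cis (2 * pi * t))) integrable_on {0..1}" for m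
    by (intro integrable_continuous_interval cis_2pi_continuous[of "\<lambda>w. of_real (1 - bumpJ m w) * inner v c v' c' w"] cut_inner_continuous)
next
  fix m and t :: real assume "t \<in> {0..1} - {t \<in> {0..1}. d (cis (2 * pi * t)) = 0}"
  then have t: "d (cis (2 * pi * t)) \<noteq> 0" by auto
  have "norm (of_real (1 - bumpJ m (cis (2 * pi * t))) * inner v c v' c' (cis (2 * pi * t))) =
     \<bar>1 - bumpJ m (cis (2 * pi * t))\<bar> * norm (inner v c v' c' (cis (2 * pi * t)))" by (simp only: norm_mult norm_of_real)
  also have "\<dots> \<le> 1 * (4 * C1 / m0)"
    using bumpJ_bounds[of m "cis (2 * pi * t)"] by (intro mult_mono inner_bound t) auto
  finally show "norm (of_real (1 - bumpJ m (cis (2 * pi * t))) * inner v c v' c' (cis (2 * pi * t))) \<le> 4 * C1 / m0" by simp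
next
  fix t :: real assume "t \<in> {0..1} - {t \<in> {0..1}. d (cis (2 * pi * t)) = 0}"
  then have t: "\<bar>d (cis (2 * pi * t))\<bar> > 0" by auto
  have "eventually (\<lambda>m. real m \<ge> 2 / \<bar>d (cis (2 * pi * t))\<bar>) sequentially"
    by (rule eventually_ge_at_top[THEN filterlim_real_sequentially[unfolded filterlim_iff, rule_format]])
  then have "eventually (\<lambda>m. of_real (1 - bumpJ m (cis (2 * pi * t))) * inner v c v' c' (cis (2 * pi * t)) = inner v c v' c' (cis (2 * pi * t))) sequentially"
  proof eventually_elim
    case (elim m)
    then have "real m * \<bar>d (cis (2 * pi * t))\<bar> \<ge> 2" using t by (simp add: pos_divide_le_eq)
    then have "bumpJ m (cis (2 * pi * t)) = 0" unfolding bumpJ_def c01_def by simp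
    then show ?case by simp
  qed
  then show "(\<lambda>m. of_real (1 - bumpJ m (cis (2 * pi * t))) * inner v c v' c' (cis (2 * pi * t))) \<longlonglongrightarrow> inner v c v' c' (cis (2 * pi * t))"
    by (rule tendsto_eventually)
qed

text \<open>Away from the critical frequencies the inner and outer Riemann sums converge uniformly.
  Near them a non-resonant frequency contributes O(1) to the outer average, and the proportion of
  such frequencies is small; each of the at most \<open>Mb\<close> resonant ones contributes O(1 /
  \<eta>), hence O(1 / (n \<eta>)) after averaging.\<close>

lemma gridker_limit:
  fixes \<psi> \<eta> :: "nat \<Rightarrow> real"
  assumes count: "eventually (\<lambda>n. \<forall>s<2. card {k \<in> {..<n}. resonant n (tw n s * rt n k)} \<le> Mb) sequentially"
    and s: "s1 < 2" "s2 < 2" and \<psi>: "\<And>n. 0 \<le> \<psi> n" "\<And>n. \<psi> n \<le> 1"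
    and \<eta>: "\<And>n. n > 0 \<Longrightarrow> 0 < \<eta> n" "(\<lambda>n. 1 / (\<eta> n * real n)) \<longlonglongrightarrow> 0"
    and gap: "eventually (\<lambda>n. \<forall>k<n. resonant n (tw n s1 * rt n k) \<longrightarrow>
      Mx (tw n s1 * rt n k) ^ n * (\<eta> n / (8 * (real Mb + 1))) \<le>
      norm (DD n (cis (pi * real s2) * cis (\<psi> n)) (tw n s1 * rt n k))) sequentially"
  shows "(\<lambda>n. gridker n \<alpha> \<beta> \<gamma> (tw n s1) (cis ((pi * real s2 + \<psi> n) / real n)) (pt v c) (pt v' c')) \<longlonglongrightarrow>
        Lker \<alpha> \<beta> \<gamma> (pt v c) (pt v' c')" (is "?G \<longlonglongrightarrow> ?L")
    and "eventually (\<lambda>n. \<forall>k<n. \<forall>l<n. Delta \<alpha> \<beta> \<gamma> (tw n s1 * rt n k) (cis ((pi * real s2 + \<psi> n) / real n) * rt n l) \<noteq> 0) sequentially"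
proof -
  define u where "u n = cis ((pi * real s2 + \<psi> n) / real n)" for n
  define w where "w n k = tw n s1 * rt n k" for n k
  \<comment> \<open>The lower bound for \<open>DD\<close> relative to \<open>Mx ^ n\<close> that the
    twist guarantees at resonance; elsewhere 1/2 is available.\<close>
  define \<kappa> where "\<kappa> n = \<eta> n / (8 * (real Mb + 1))" for n
  define T where "T n k = (\<Sum>l<n. ker v c v' c' (w n k) (u n * rt n l))" for n k
  \<comment> \<open>\<open>Q\<close> bounds the average over the second frequency off resonance; at
    resonance \<open>R n\<close>, of order 1 / \<eta>, is added.\<close>
  define Q where "Q = 4 * C1 / m0"
  define R where "R n = 2 * C1 / (m0 * \<kappa> n)" for n
  have C1: "C1 > 0" unfolding C1_def using pos by linarith
  have Q: "Q > 0" unfolding Q_def using C1 m0_pos by simp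
  have w1: "norm (w n k) = 1" for n k unfolding w_def by (simp add: norm_mult)
  have u1: "norm (u n) = 1" for n unfolding u_def by simp
  have un: "u n ^ n = cis (pi * real s2) * cis (\<psi> n)" if "n > 0" for n
    unfolding u_def Complex.DeMoivre cis_mult using that by simp
  have uz: "norm (cis (pi * real s2) * cis (\<psi> n)) = 1" for n by (simp add: norm_mult)
  have \<kappa>: "\<kappa> n > 0" if "n > 0" for n unfolding \<kappa>_def using \<eta>(1)[OF that] by simp
  have Mp: "Mx z ^ n > 0" for z n using Mx_pos(2)[of z] by simp
  have low: "eventually (\<lambda>n. \<forall>k<n. (if resonant n (w n k) then Mx (w n k) ^ n * \<kappa> n else Mx (w n k) ^ n / 2) \<le> norm (DD n (u n ^ n) (w n k))) sequentially"
    using gap eventually_gt_at_top[of 0]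
  proof eventually_elim
    case (elim n)
    then show ?case
      unfolding un[OF elim(2)] \<kappa>_def using DD_nonresonant[OF uz, of n] by (auto simp: w_def)
  qed
  have nz: "eventually (\<lambda>n. \<forall>k<n. DD n (u n ^ n) (w n k) \<noteq> 0) sequentially"
    using low eventually_gt_at_top[of 0]
  proof eventually_elim
    case (elim n)
    show ?case
    proof (intro allI impI)
      fix k assume "k < n"
      then have "(if resonant n (w n k) then Mx (w n k) ^ n * \<kappa> n else Mx (w n k) ^ n / 2) \<le> norm (DD n (u n ^ n) (w n k))" using elim by blast
      moreover have "0 < (if resonant n (w n k) then Mx (w n k) ^ n * \<kappa> n else Mx (w n k) ^ n / 2)"
        using Mp[of "w n k" n] \<kappa>[OF elim(2)] by simp
      ultimately show "DD n (u n ^ n) (w n k) \<noteq> 0" by auto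
    qed
  qed
  show "eventually (\<lambda>n. \<forall>k<n. \<forall>l<n. Delta \<alpha> \<beta> \<gamma> (tw n s1 * rt n k) (cis ((pi * real s2 + \<psi> n) / real n) * rt n l) \<noteq> 0) sequentially"
    using nz eventually_gt_at_top[of 0]
  proof eventually_elim
    case (elim n)
    show ?case
    proof (intro allI impI)
      fix k l assume "k < n" "l < n"
      have "(\<Prod>l<n. A (w n k) + B (w n k) * (u n * rt n l)) \<noteq> 0"
        unfolding prod_affine_rt[OF elim(2)] using elim(1) \<open>k < n\<close> unfolding DD_def by blast
      then show "Delta \<alpha> \<beta> \<gamma> (tw n s1 * rt n k) (cis ((pi * real s2 + \<psi> n) / real n) * rt n l) \<noteq> 0"
        unfolding Delta_AB w_def[symmetric] u_def[symmetric] using \<open>l < n\<close> by simp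
    qed
  qed
  have T: "eventually (\<lambda>n. \<forall>k<n. norm (T n k) \<le> real n * (Q + of_bool (resonant n (w n k)) * R n)) sequentially"
    using low nz eventually_gt_at_top[of 0]
  proof eventually_elim
    case (elim n)
    show ?case
    proof (intro allI impI)
      fix k assume k: "k < n"
      let ?lo = "if resonant n (w n k) then Mx (w n k) ^ n * \<kappa> n else Mx (w n k) ^ n / 2"
      have lo: "?lo > 0" using Mp[of "w n k" n] \<kappa>[OF elim(3)] by simp
      have "norm (T n k) \<le> 2 * C1 * (real n * Mx (w n k) ^ n / (m0 * norm (DD n (u n ^ n) (w n k))))"
        unfolding T_def by (rule inner_kernel_bound[OF elim(3) u1 w1]) (use elim k in blast)
      also have "\<dots> \<le> 2 * C1 * (real n * Mx (w n k) ^ n / (m0 * ?lo))"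
      proof -
        have le: "?lo \<le> norm (DD n (u n ^ n) (w n k))" using elim(1) k by blast
        have aux: "X * (a / (m * y)) \<le> X * (a / (m * x))" if "0 < x" "x \<le> y" "0 < m" "0 \<le> a" "0 \<le> X" for X a m x y :: real
          using that by (intro mult_left_mono frac_le) auto
        show ?thesis by (rule aux[OF lo le m0_pos]) (use C1 Mx_pos(2)[of "w n k"] in auto)
      qed
      also have "\<dots> \<le> real n * (Q + of_bool (resonant n (w n k)) * R n)"
      proof (cases "resonant n (w n k)")
        case True
        have "2 * C1 * (real n * Mx (w n k) ^ n / (m0 * (Mx (w n k) ^ n * \<kappa> n))) = real n * R n"
          unfolding R_def using Mx_pos(2)[of "w n k"] by simp
        then show ?thesis using True Q by (simp add: distrib_left)
      next
        case False
        have "2 * C1 * (real n * Mx (w n k) ^ n / (m0 * (Mx (w n k) ^ n / 2))) = real n * Q"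
          unfolding Q_def using Mx_pos(2)[of "w n k"] by simp
        then show ?thesis using False by simp
      qed
      finally show "norm (T n k) \<le> real n * (Q + of_bool (resonant n (w n k)) * R n)" .
    qed
  qed
  have Rlim: "(\<lambda>n. real Mb * R n / real n) \<longlonglongrightarrow> 0"
  proof -
    have eq: "real Mb * R n / real n = (real Mb * (2 * C1) * (8 * (real Mb + 1)) / m0) * (1 / (\<eta> n * real n))" for n
      unfolding R_def \<kappa>_def by simp
    show ?thesis unfolding eq by (rule tendsto_mult_right_zero[OF \<eta>(2)])
  qed
  have G: "?G n = (\<Sum>k<n. T n k / of_nat n) / of_nat n" for n
    unfolding gridker_def T_def w_def u_def power2_eq_square by (simp add: sum_divide_distrib[symmetric] divide_divide_eq_left)
  have quad: "norm (a + b + c + d) \<le> norm a + norm b + norm c + norm d" for a b c d :: complex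
    using norm_triangle_ineq[of "a + b + c" d] norm_triangle_ineq[of "a + b" c] norm_triangle_ineq[of a b] by linarith
  have gen: "(a + b + c) / q - L = a / q + (b / q - I) + (I - L) + c / q" for a b c q L I :: complex
    by (simp add: add_divide_distrib)
  have lin: "x < 4 * e + 2 * Q * e" if "x \<le> a + b + c + d" "a \<le> e" "b \<le> e" "c < e" "d \<le> 2 * Q * e + r" "r < e" for x a b c d e r :: real
    using that by linarith
  show "?G \<longlonglongrightarrow> ?L"
  proof (rule tendstoI)
    fix e' :: real assume e': "e' > 0"
    \<comment> \<open>Chosen so that the accumulated error \<open>4 * e + 2 * Q * e\<close> equals
      \<open>e' / 2\<close>.\<close>
    define e where "e = e' / (2 * (4 + 2 * Q))"
    have e: "e > 0" unfolding e_def using e' Q by simp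
    have e2: "4 * e + 2 * Q * e < e'"
    proof -
      have "4 * e + 2 * Q * e = e * (4 + 2 * Q)" by (simp add: algebra_simps)
      also have "\<dots> = e' / 2"
      proof -
        have z: "x / (2 * X) * X = x / 2" if "X \<noteq> 0" for x X :: real using that by simp
        show ?thesis unfolding e_def by (rule z) (use Q in simp)
      qed
      finally show ?thesis using e' by simp
    qed
    let ?h = "\<lambda>m w. of_real (1 - bumpJ m w) * inner v c v' c' w"
    let ?IJ = "\<lambda>m. integral {0..1} (\<lambda>t. bumpJ m (cis (2 * pi * t)))"
    let ?Ih = "\<lambda>m. integral {0..1} (\<lambda>t. ?h m (cis (2 * pi * t)))"
    have "eventually (\<lambda>m. dist (?IJ m) 0 < e \<and> dist (?Ih m) ?L < e) sequentially"
      using tendstoD[OF bump_limits(3)[folded bumpJ_def] e] tendstoD[OF cut_inner_limit e] by (rule eventually_conj)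
    then obtain m where "dist (?IJ m) 0 < e \<and> dist (?Ih m) ?L < e" unfolding eventually_sequentially by blast
    then have m: "?IJ m < e" "norm (?Ih m - ?L) < e" by (auto simp: dist_norm abs_less_iff)
    let ?K = "{w \<in> sphere 0 1. 1 \<le> real m * \<bar>d w\<bar>}"
    have "continuous_on (?K \<times> sphere 0 1) (\<lambda>(w, z). ker v c v' c' w z)" by (rule ker_continuous) auto
    from riemann_grid_uniform[OF compact_off_critical this e] obtain N1 where
      N1: "\<forall>n\<ge>N1. \<forall>w\<in>?K. \<forall>\<theta>. 0 \<le> \<theta> \<and> \<theta> \<le> 2 * pi \<longrightarrow>
        norm ((\<Sum>l<n. ker v c v' c' w (cis (\<theta> / real n) * rt n l)) /\<^sub>R real n - inner v c v' c' w) \<le> e"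
      unfolding inner_def by (rule exE)
    from riemann_grid[OF cut_inner_continuous[of m v c v' c'] e] obtain N2 where
      N2: "\<forall>n\<ge>N2. \<forall>\<theta>. 0 \<le> \<theta> \<and> \<theta> \<le> 2 * pi \<longrightarrow>
        norm ((\<Sum>k<n. ?h m (cis (\<theta> / real n) * rt n k)) /\<^sub>R real n - ?Ih m) \<le> e"
      by (rule exE)
    have R': "eventually (\<lambda>n. real Mb * R n / real n < e) sequentially"
      using Rlim e by (rule order_tendstoD)
    have "continuous_on (sphere 0 1) (bumpJ m)" by (rule bumpJ_continuous)
    note grid = grid_average_bounds[OF this e]
    have "eventually (\<lambda>n. n \<ge> N1 \<and> n \<ge> N2 \<and> n > 0) sequentially"
      using eventually_ge_at_top[of N1] eventually_ge_at_top[of N2] eventually_gt_at_top[of 0] by eventually_elim auto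
    then show "eventually (\<lambda>n. dist (?G n) ?L < e') sequentially"
      using grid T count R'
    proof eventually_elim
      case (elim n)
      have n: "n \<ge> N1" "n \<ge> N2" "n > 0" using elim(1) by auto
      let ?J = "\<lambda>k. bumpJ m (w n k)"
      have th1: "0 \<le> pi * real s2 + \<psi> n \<and> pi * real s2 + \<psi> n \<le> 2 * pi"
      proof -
        have "pi * real s2 \<le> pi * 1" using s by (intro mult_left_mono) auto
        then have "pi * real s2 + \<psi> n \<le> 2 * pi" using \<psi>(2)[of n] pi_gt3 by linarith
        then show ?thesis using \<psi>(1)[of n] by simp
      qed
      have th2: "0 \<le> pi * real s1 \<and> pi * real s1 \<le> 2 * pi" using s by auto
      have a: "norm (\<Sum>k<n. of_real (1 - ?J k) * (T n k / of_nat n - inner v c v' c' (w n k))) \<le> (\<Sum>k<n. e)"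
      proof (rule sum_norm_le)
        fix k assume "k \<in> {..<n}"
        show "norm (of_real (1 - ?J k) * (T n k / of_nat n - inner v c v' c' (w n k))) \<le> e"
        proof (cases "1 \<le> real m * \<bar>d (w n k)\<bar>")
          case True
          then have "w n k \<in> ?K" using w1 by simp
          from N1[rule_format, OF n(1) this th1] have "norm (T n k / of_nat n - inner v c v' c' (w n k)) \<le> e"
            unfolding T_def u_def by (simp add: scaleR_conv_of_real divide_inverse mult.commute)
          then have "\<bar>1 - ?J k\<bar> * norm (T n k / of_nat n - inner v c v' c' (w n k)) \<le> 1 * e"
            using bumpJ_bounds[of m "w n k"] by (intro mult_mono) auto
          then show ?thesis by (simp only: norm_mult norm_of_real mult_1)
        next
          case False
          then have "?J k = 1" by (intro bumpJ_eq_1) simp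
          then show ?thesis using e by simp
        qed
      qed
      have b: "norm ((\<Sum>k<n. ?h m (w n k)) / of_nat n - ?Ih m) \<le> e"
        using N2[rule_format, OF n(2) th2] unfolding w_def tw_def by (simp add: scaleR_conv_of_real divide_inverse mult.commute)
      have c: "norm (\<Sum>k<n. of_real (?J k) * (T n k / of_nat n)) \<le> Q * (2 * e * real n) + real Mb * R n"
      proof -
        have R0: "R n \<ge> 0" unfolding R_def using C1 m0_pos \<kappa>[OF n(3)] by simp
        have "norm (\<Sum>k<n. of_real (?J k) * (T n k / of_nat n)) \<le> (\<Sum>k<n. ?J k * Q + of_bool (resonant n (w n k)) * R n)"
        proof (rule sum_norm_le)
          fix k assume "k \<in> {..<n}"
          then have "norm (T n k) / real n \<le> Q + of_bool (resonant n (w n k)) * R n"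
            using elim(3) n(3) by (simp add: pos_divide_le_eq mult.commute)
          then have "?J k * (norm (T n k) / real n) \<le> ?J k * (Q + of_bool (resonant n (w n k)) * R n)"
            using bumpJ_bounds by (intro mult_left_mono) auto
          also have "\<dots> \<le> ?J k * Q + of_bool (resonant n (w n k)) * R n"
            using bumpJ_bounds[of m "w n k"] R0 by (auto simp: distrib_left mult_left_le_one_le)
          finally show "norm (of_real (?J k) * (T n k / of_nat n)) \<le> ?J k * Q + of_bool (resonant n (w n k)) * R n"
            using bumpJ_bounds[of m "w n k"] by (simp add: norm_mult norm_divide)
        qed
        also have "\<dots> = Q * (\<Sum>k<n. ?J k) + real (card {k \<in> {..<n}. resonant n (w n k)}) * R n"
        proof -
          have "(\<Sum>k<n. of_bool (resonant n (w n k)) :: real) = real (card ({..<n} \<inter> {k. resonant n (w n k)}))" by (rule sum_of_bool_eq; rule finite_lessThan)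
          also have "{..<n} \<inter> {k. resonant n (w n k)} = {k \<in> {..<n}. resonant n (w n k)}" by blast
          finally have cardeq: "(\<Sum>k<n. of_bool (resonant n (w n k)) :: real) = real (card {k \<in> {..<n}. resonant n (w n k)})" .
          show ?thesis unfolding sum.distrib sum_distrib_right[symmetric] cardeq by (simp only: mult.commute[of Q])
        qed
        also have "\<dots> \<le> Q * (2 * e * real n) + real Mb * R n"
        proof (intro add_mono mult_left_mono mult_right_mono R0)
          have "(\<Sum>k<n. ?J k) \<le> real n * ?IJ m + e * real n" using elim(2) s(1) unfolding w_def by (auto simp: abs_le_iff)
          also have "\<dots> \<le> real n * e + e * real n" using m(1) e by (intro add_mono mult_left_mono) auto
          finally show "(\<Sum>k<n. ?J k) \<le> 2 * e * real n" by simp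
          show "real (card {k \<in> {..<n}. resonant n (w n k)}) \<le> real Mb" using elim(4) s(1) unfolding w_def by simp
        qed (use Q in simp)
        finally show ?thesis .
      qed
      \<comment> \<open>The three parts: the error of the inner Riemann sums off the critical set,
        the outer Riemann sum of the cut integral, and the neighbourhood of the critical
        set.\<close>
      have split: "(\<Sum>k<n. T n k / of_nat n) = (\<Sum>k<n. of_real (1 - ?J k) * (T n k / of_nat n - inner v c v' c' (w n k))) +
          (\<Sum>k<n. ?h m (w n k)) + (\<Sum>k<n. of_real (?J k) * (T n k / of_nat n))"
        unfolding sum.distrib[symmetric] by (intro sum.cong refl) (simp add: algebra_simps)
      have "?G n - ?L = (\<Sum>k<n. of_real (1 - ?J k) * (T n k / of_nat n - inner v c v' c' (w n k))) / of_nat n +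
          ((\<Sum>k<n. ?h m (w n k)) / of_nat n - ?Ih m) + (?Ih m - ?L) + (\<Sum>k<n. of_real (?J k) * (T n k / of_nat n)) / of_nat n"
        (is "_ = ?a + ?b + ?c + ?d")
        unfolding G split by (rule gen)
      then have le: "norm (?G n - ?L) \<le> norm ?a + norm ?b + norm ?c + norm ?d"
        by (simp only: quad)
      have na: "norm ?a \<le> e" using a n(3) by (simp add: norm_divide pos_divide_le_eq mult.commute)
      have "norm ?d \<le> (Q * (2 * e * real n) + real Mb * R n) / real n"
        unfolding norm_divide norm_of_nat by (intro divide_right_mono c) simp
      also have "\<dots> = 2 * Q * e + real Mb * R n / real n" using n(3) by (simp add: add_divide_distrib)
      finally have nd: "norm ?d \<le> 2 * Q * e + real Mb * R n / real n" .
      have "norm (?G n - ?L) < 4 * e + 2 * Q * e" by (rule lin[OF le na b m(2) nd elim(5)])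
      then show "dist (?G n) ?L < e'" using e2 by (simp add: dist_norm)
    qed
  qed
qed

text \<open>With h^2 = dev + 1/n and \<eta> = 1 / (n h), the distortion \<eta> n dev is at most
  \<open>h\<close> and the loss 1 / (n \<eta>) at resonance equals \<open>h\<close>. Both tend to 0,
  without any rate for the concentration.\<close>

theorem good_twist_exists:
  assumes x0: "x0 \<noteq> 1" "x0 \<noteq> -1" and s: "s1 < 2" "s2 < 2"
  shows "\<exists>\<psi>. good_twist \<alpha> \<beta> \<gamma> \<rho> s1 s2 \<psi>"
proof -
  obtain Mb where count: "eventually (\<lambda>n. \<forall>s<2. card {k \<in> {..<n}. resonant n (tw n s * rt n k)} \<le> Mb) sequentially"
    using resonant_count[OF x0] by blast
  \<comment> \<open>The summand 1 / n keeps \<open>h\<close> positive and makes \<open>n * h\<close>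
    at least 1, hence \<eta> at most 1.\<close>
  define h where "h n = sqrt (dev n \<alpha> \<beta> \<gamma> \<rho> + 1 / real n)" for n
  define \<eta> where "\<eta> n = 1 / (real n * h n)" for n
  have dev0: "dev n \<alpha> \<beta> \<gamma> \<rho> \<ge> 0" if "n > 0" for n
    unfolding dev_def using partition_fn_pos[OF pos that]
    by (intro divide_nonneg_nonneg sum_nonneg mult_nonneg_nonneg) (auto intro: less_imp_le config_weight_pos[OF pos])
  have h2: "(h n)^2 = dev n \<alpha> \<beta> \<gamma> \<rho> + 1 / real n" if "n > 0" for n
    unfolding h_def using dev0[OF that] that by simp
  have h0: "h n > 0" if "n > 0" for n
    unfolding h_def using dev0[OF that] that by (intro real_sqrt_gt_zero add_nonneg_pos) auto
  have hlim: "h \<longlonglongrightarrow> 0"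
  proof -
    have "(\<lambda>n. sqrt (dev n \<alpha> \<beta> \<gamma> \<rho> + 1 / real n)) \<longlonglongrightarrow> sqrt (0 + 0)"
      by (intro tendsto_intros dev_tendsto_0 lim_1_over_n)
    then show ?thesis unfolding h_def by simp
  qed
  have \<eta>0: "\<eta> n > 0" if "n > 0" for n unfolding \<eta>_def using h0[OF that] that by simp
  have \<eta>1: "\<eta> n \<le> 1" if "n > 0" for n
  proof -
    have "(1::real)^2 \<le> real n * real n * dev n \<alpha> \<beta> \<gamma> \<rho> + real n" using dev0[OF that] that by (intro add_increasing mult_nonneg_nonneg) auto
    also have "\<dots> = (real n * h n)^2" unfolding power_mult_distrib h2[OF that] using that by (simp add: power2_eq_square algebra_simps)
    finally have "1 \<le> real n * h n" by (rule power2_le_imp_le) (use h0[OF that] in simp)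
    then show ?thesis unfolding \<eta>_def by simp
  qed
  define gapc where "gapc n \<psi> \<longleftrightarrow> (\<forall>k<n. resonant n (tw n s1 * rt n k) \<longrightarrow>
      Mx (tw n s1 * rt n k) ^ n * (\<eta> n / (8 * (real Mb + 1))) \<le>
      norm (DD n (cis (pi * real s2) * cis \<psi>) (tw n s1 * rt n k)))" for n and \<psi> :: real
  \<comment> \<open>The gap is demanded only if the resonances number at most \<open>Mb\<close>, so
    that some \<psi> exists for every \<open>n\<close>; the exceptional \<open>n\<close> receive
    0.\<close>
  define ok where "ok n \<psi> \<longleftrightarrow> 0 \<le> \<psi> \<and> \<psi> \<le> 1 \<and> (n > 0 \<longrightarrow> \<psi> \<le> \<eta> n) \<and>
      (n > 0 \<and> card {k \<in> {..<n}. resonant n (tw n s1 * rt n k)} \<le> Mb \<longrightarrow> gapc n \<psi>)" for n and \<psi> :: real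
  have "\<exists>\<psi>. ok n \<psi>" for n
  proof (cases "n > 0 \<and> card {k \<in> {..<n}. resonant n (tw n s1 * rt n k)} \<le> Mb")
    case True
    then have n: "n > 0" by simp
    obtain \<psi> where "0 \<le> \<psi>" "\<psi> \<le> \<eta> n" "gapc n \<psi>"
      using choose_twist[OF n \<eta>0[OF n] \<eta>1[OF n], of "cis (pi * real s2)" "\<lambda>k. tw n s1 * rt n k" Mb] True unfolding gapc_def by auto
    then have "ok n \<psi>" unfolding ok_def using \<eta>1[OF n] by simp
    then show ?thesis by blast
  next
    case False
    then have "ok n 0" unfolding ok_def using \<eta>0[of n] less_imp_le by auto
    then show ?thesis by blast
  qed
  then have "\<exists>\<psi>. \<forall>n. ok n (\<psi> n)" by (intro choice allI)
  then obtain \<psi> where ok: "\<And>n. ok n (\<psi> n)" by blast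
  then have \<psi>: "0 \<le> \<psi> n" "\<psi> n \<le> 1" "n > 0 \<Longrightarrow> \<psi> n \<le> \<eta> n"
    "n > 0 \<Longrightarrow> card {k \<in> {..<n}. resonant n (tw n s1 * rt n k)} \<le> Mb \<Longrightarrow> gapc n (\<psi> n)" for n
    unfolding ok_def by blast+
  have gap: "eventually (\<lambda>n. gapc n (\<psi> n)) sequentially"
    using count eventually_gt_at_top[of 0] by eventually_elim (use \<psi>(4) s in auto)
  have "(\<lambda>n. 1 / (\<eta> n * real n)) \<longlonglongrightarrow> 0"
  proof (rule Lim_transform_eventually[OF hlim])
    show "eventually (\<lambda>n. h n = 1 / (\<eta> n * real n)) sequentially"
      using eventually_gt_at_top[of 0] by eventually_elim (simp add: \<eta>_def)
  qed
  note lim = gridker_limit[OF count s \<psi>(1,2) \<eta>0 this gap[unfolded gapc_def]]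
  have "(\<lambda>n. \<psi> n * (real n * dev n \<alpha> \<beta> \<gamma> \<rho>)) \<longlonglongrightarrow> 0"
  proof (rule tendsto_sandwich[OF _ _ tendsto_const hlim])
    show "eventually (\<lambda>n. 0 \<le> \<psi> n * (real n * dev n \<alpha> \<beta> \<gamma> \<rho>)) sequentially"
      using eventually_gt_at_top[of 0] by eventually_elim (use \<psi>(1) dev0 in simp)
    show "eventually (\<lambda>n. \<psi> n * (real n * dev n \<alpha> \<beta> \<gamma> \<rho>) \<le> h n) sequentially"
      using eventually_gt_at_top[of 0]
    proof eventually_elim
      case (elim n)
      have "\<psi> n * (real n * dev n \<alpha> \<beta> \<gamma> \<rho>) \<le> \<eta> n * (real n * dev n \<alpha> \<beta> \<gamma> \<rho>)"
        using \<psi>(3)[OF elim] dev0[OF elim] by (intro mult_right_mono) auto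
      also have "\<dots> = dev n \<alpha> \<beta> \<gamma> \<rho> / h n" unfolding \<eta>_def using elim by simp
      also have "\<dots> \<le> (h n)^2 / h n" using h2[OF elim] h0[OF elim] by (intro divide_right_mono) auto
      also have "\<dots> = h n" using h0[OF elim] by (simp add: power2_eq_square)
      finally show ?case .
    qed
  qed
  then show ?thesis unfolding good_twist_def using \<psi>(1,2) lim by blast
qed

end

section \<open>Symmetries, edge densities and frozen parameters\<close>

type_synonym cfg = "(int \<times> int \<Rightarrow> bool) \<times> (int \<times> int \<Rightarrow> bool)"

definition shift :: "int \<Rightarrow> int \<Rightarrow> cfg \<Rightarrow> cfg" where
  "shift a b \<sigma> = ((\<lambda>(i, j). fst \<sigma> (i + a, j + b)), (\<lambda>(i, j). snd \<sigma> (i + a, j + b)))"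

text \<open>Reflection in the diagonal exchanges the types 3 and 4 as well as 5 and 6, so \<alpha>
  and \<beta> change places while \<gamma> and \<gamma>^2 - \<alpha> * \<beta> are kept.\<close>

definition reflect :: "cfg \<Rightarrow> cfg" where
  "reflect \<sigma> = ((\<lambda>(i, j). snd \<sigma> (j, i)), (\<lambda>(i, j). fst \<sigma> (j, i)))"

definition reflect_type :: "nat \<Rightarrow> nat" where
  "reflect_type t = (if t = 3 then 4 else if t = 4 then 3 else if t = 5 then 6 else if t = 6 then 5 else t)"

lemma shift_inverse: "shift (- a) (- b) (shift a b \<sigma>) = \<sigma>" "shift a b (shift (- a) (- b) \<sigma>) = \<sigma>"
  and reflect_reflect: "reflect (reflect \<sigma>) = \<sigma>"
  unfolding shift_def reflect_def by (simp_all add: prod_eq_iff)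

lemma vtype_shift: "vtype (fst (shift a b \<sigma>)) (snd (shift a b \<sigma>)) (i, j) = vtype (fst \<sigma>) (snd \<sigma>) (i + a, j + b)"
proof -
  have "i - 1 + a = i + a - 1" "j - 1 + b = j + b - 1" by simp_all
  then show ?thesis unfolding vtype_def shift_def by (simp only: prod.case fst_conv snd_conv)
qed

lemma vtype_reflect: "vtype (fst (reflect \<sigma>)) (snd (reflect \<sigma>)) (i, j) = reflect_type (vtype (fst \<sigma>) (snd \<sigma>) (j, i))"
  unfolding vtype_def reflect_def reflect_type_def Let_def by auto

lemma shift_tor_configs: "\<sigma> \<in> tor_configs n \<Longrightarrow> shift a b \<sigma> \<in> tor_configs n"
proof -
  assume s: "\<sigma> \<in> tor_configs n"
  obtain h u where hu: "\<sigma> = (h, u)" by (cases \<sigma>)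
  have m: "(x + y) mod int n = (x mod int n + y) mod int n" for x y by (simp add: mod_add_left_eq)
  have per: "fst (shift a b \<sigma>) (i, j) = fst (shift a b \<sigma>) (i mod int n, j mod int n)"
    "snd (shift a b \<sigma>) (i, j) = snd (shift a b \<sigma>) (i mod int n, j mod int n)" for i j
    using tor_configs_periodic_cong[OF s[unfolded hu], OF m m, of i a j b] unfolding shift_def hu by simp_all
  have "vtype (fst (shift a b \<sigma>)) (snd (shift a b \<sigma>)) v \<in> {1..6}" for v
    using tor_configs_vtype[of "fst \<sigma>" "snd \<sigma>" n] s by (cases v) (simp only: vtype_shift prod.collapse)
  then show ?thesis unfolding tor_configs_def using per by (simp add: case_prod_beta)
qed

lemma reflect_tor_configs: "\<sigma> \<in> tor_configs n \<Longrightarrow> reflect \<sigma> \<in> tor_configs n"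
proof -
  assume s: "\<sigma> \<in> tor_configs n"
  obtain h u where hu: "\<sigma> = (h, u)" by (cases \<sigma>)
  have per: "fst (reflect \<sigma>) (i, j) = fst (reflect \<sigma>) (i mod int n, j mod int n)"
    "snd (reflect \<sigma>) (i, j) = snd (reflect \<sigma>) (i mod int n, j mod int n)" for i j
    using tor_configs_periodic[OF s[unfolded hu], of j i] unfolding reflect_def hu by simp_all
  have "reflect_type t \<in> {1..6}" if "t \<in> {1..6}" for t using that unfolding reflect_type_def by auto
  then have "vtype (fst (reflect \<sigma>)) (snd (reflect \<sigma>)) v \<in> {1..6}" for v
    using tor_configs_vtype[of "fst \<sigma>" "snd \<sigma>" n] s by (cases v) (simp only: vtype_reflect prod.collapse)
  then show ?thesis unfolding tor_configs_def using per by (simp add: case_prod_beta)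
qed

lemma config_weight_shift:
  assumes n: "n > 0" and s: "\<sigma> \<in> tor_configs n"
  shows "config_weight n w (shift a b \<sigma>) = config_weight n w \<sigma>"
proof -
  let ?X = "{0..<int n} \<times> {0..<int n}"
  let ?f = "\<lambda>p. ((fst p + a) mod int n, (snd p + b) mod int n)"
  let ?g = "\<lambda>v. w (vtype (fst \<sigma>) (snd \<sigma>) v)"
  have "bij_betw ?f ?X ?X"
    by (rule bij_betw_byWitness[where f' = "\<lambda>p. ((fst p - a) mod int n, (snd p - b) mod int n)"])
      (use n in \<open>auto simp: mod_simps\<close>)
  then have "(\<Prod>v\<in>?X. ?g (?f v)) = (\<Prod>v\<in>?X. ?g v)" by (rule prod.reindex_bij_betw)
  moreover have "?g (?f v) = w (vtype (fst (shift a b \<sigma>)) (snd (shift a b \<sigma>)) v)" for v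
  proof -
    obtain i j where v: "v = (i, j)" by (cases v)
    have "vtype (fst \<sigma>) (snd \<sigma>) (?f v) = vtype (fst \<sigma>) (snd \<sigma>) (i + a, j + b)"
      by (rule tor_configs_vtype_cong[of _ _ n]) (use s v in simp_all)
    then show ?thesis unfolding v vtype_shift by simp
  qed
  ultimately show ?thesis unfolding config_weight_def by simp
qed

lemma config_weight_reflect:
  assumes s: "\<sigma> \<in> tor_configs n"
  shows "config_weight n (ff_weights \<beta> \<alpha> \<gamma>) (reflect \<sigma>) = config_weight n (ff_weights \<alpha> \<beta> \<gamma>) \<sigma>"
proof -
  let ?X = "{0..<int n} \<times> {0..<int n}"
  let ?g = "\<lambda>v. ff_weights \<alpha> \<beta> \<gamma> (vtype (fst \<sigma>) (snd \<sigma>) v)"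
  have ff: "ff_weights \<beta> \<alpha> \<gamma> (reflect_type t) = ff_weights \<alpha> \<beta> \<gamma> t" if "t \<in> {1..6}" for t
    using that unfolding types_eq reflect_type_def by (elim insertE) (simp_all add: ff_weights_def mult.commute)
  have "bij_betw prod.swap ?X ?X" by (rule bij_betw_byWitness[where f' = prod.swap]) auto
  then have "(\<Prod>v\<in>?X. ?g (prod.swap v)) = (\<Prod>v\<in>?X. ?g v)" by (rule prod.reindex_bij_betw)
  moreover have "?g (prod.swap v) = ff_weights \<beta> \<alpha> \<gamma> (vtype (fst (reflect \<sigma>)) (snd (reflect \<sigma>)) v)" for v
  proof (cases v)
    case (Pair i j)
    have "vtype (fst \<sigma>) (snd \<sigma>) (j, i) \<in> {1..6}" by (rule tor_configs_vtype[of _ _ n]) (use s in simp)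
    then show ?thesis unfolding Pair swap_simp vtype_reflect by (simp only: ff)
  qed
  ultimately show ?thesis unfolding config_weight_def by simp
qed

lemma Pn_shift:
  assumes n: "n > 0"
  shows "Pn n w {\<sigma>. \<not> snd \<sigma> (i + a, j + b)} = Pn n w {\<sigma>. \<not> snd \<sigma> (i, j)}"
proof -
  have "(\<Sum>\<sigma>\<in>tor_configs n \<inter> {\<sigma>. \<not> snd \<sigma> (i + a, j + b)}. config_weight n w \<sigma>) =
     (\<Sum>\<sigma>\<in>tor_configs n \<inter> {\<sigma>. \<not> snd \<sigma> (i, j)}. config_weight n w \<sigma>)"
    by (rule sum.reindex_bij_witness[where i = "shift (- a) (- b)" and j = "shift a b"])
      (auto simp: shift_inverse shift_tor_configs config_weight_shift[OF n], auto simp: shift_def)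
  then show ?thesis unfolding Pn_def by simp
qed

lemma Pn_reflect: "Pn n (ff_weights \<alpha> \<beta> \<gamma>) {\<sigma>. \<not> fst \<sigma> (i, j)} = Pn n (ff_weights \<beta> \<alpha> \<gamma>) {\<sigma>. \<not> snd \<sigma> (j, i)}"
proof -
  have "(\<Sum>\<sigma>\<in>tor_configs n \<inter> {\<sigma>. \<not> fst \<sigma> (i, j)}. config_weight n (ff_weights \<alpha> \<beta> \<gamma>) \<sigma>) =
     (\<Sum>\<sigma>\<in>tor_configs n \<inter> {\<sigma>. \<not> snd \<sigma> (j, i)}. config_weight n (ff_weights \<beta> \<alpha> \<gamma>) \<sigma>)"
    by (rule sum.reindex_bij_witness[where i = reflect and j = reflect])
      (auto simp: reflect_reflect reflect_tor_configs config_weight_reflect, auto simp: reflect_def)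
  moreover have "partition_fn n (ff_weights \<alpha> \<beta> \<gamma>) = partition_fn n (ff_weights \<beta> \<alpha> \<gamma>)"
    unfolding partition_fn_def
    by (rule sum.reindex_bij_witness[where i = reflect and j = reflect])
      (simp_all add: reflect_reflect reflect_tor_configs config_weight_reflect)
  ultimately show ?thesis unfolding Pn_def by simp
qed

text \<open>Adding or subtracting 1 completes squares: the numerators become (b + c)^2 - (1 - a)^2
  and (c - b)^2 - (1 + a)^2, over the positive denominator 2 (a + b c).\<close>

lemma level_iff:
  fixes a b c :: real
  assumes "a > 0" "b > 0" "c > 0"
  shows "(b^2 + c^2 - 1 - a^2) / (2 * (a + b * c)) \<le> -1 \<longleftrightarrow> b + c \<le> \<bar>1 - a\<bar>"
    "(b^2 + c^2 - 1 - a^2) / (2 * (a + b * c)) < -1 \<longleftrightarrow> b + c < \<bar>1 - a\<bar>"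
    "1 \<le> (b^2 + c^2 - 1 - a^2) / (2 * (a + b * c)) \<longleftrightarrow> 1 + a \<le> \<bar>c - b\<bar>"
    "1 < (b^2 + c^2 - 1 - a^2) / (2 * (a + b * c)) \<longleftrightarrow> 1 + a < \<bar>c - b\<bar>"
proof -
  have p: "2 * (a + b * c) > 0" using assms by (simp add: add_pos_pos)
  have e: "\<bar>b + c\<bar> = b + c" "\<bar>1 + a\<bar> = 1 + a" using assms by auto
  have sq: "\<bar>x\<bar> < \<bar>y\<bar> \<longleftrightarrow> x^2 < y^2" "\<bar>x\<bar> \<le> \<bar>y\<bar> \<longleftrightarrow> x^2 \<le> y^2" for x y :: real
    using abs_le_square_iff[of x y] abs_le_square_iff[of y x] by auto
  show "(b^2 + c^2 - 1 - a^2) / (2 * (a + b * c)) \<le> -1 \<longleftrightarrow> b + c \<le> \<bar>1 - a\<bar>"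
    unfolding pos_divide_le_eq[OF p] using sq(2)[of "b + c" "1 - a", unfolded e] by (auto simp: power2_eq_square algebra_simps)
  show "(b^2 + c^2 - 1 - a^2) / (2 * (a + b * c)) < -1 \<longleftrightarrow> b + c < \<bar>1 - a\<bar>"
    unfolding pos_divide_less_eq[OF p] using sq(1)[of "b + c" "1 - a", unfolded e] by (auto simp: power2_eq_square algebra_simps)
  show "1 \<le> (b^2 + c^2 - 1 - a^2) / (2 * (a + b * c)) \<longleftrightarrow> 1 + a \<le> \<bar>c - b\<bar>"
    unfolding pos_le_divide_eq[OF p] using sq(2)[of "1 + a" "c - b", unfolded e] by (auto simp: power2_eq_square algebra_simps)
  show "1 < (b^2 + c^2 - 1 - a^2) / (2 * (a + b * c)) \<longleftrightarrow> 1 + a < \<bar>c - b\<bar>"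
    unfolding pos_less_divide_eq[OF p] using sq(1)[of "1 + a" "c - b", unfolded e] by (auto simp: power2_eq_square algebra_simps)
qed

text \<open>One of the weights 1, \<open>c\<close>, \<open>b\<close>, \<open>a\<close> of the types
  1, 2, 3, 4 is at least the sum of the other three; \<open>c\<close> stands for \<gamma>^2 -
  \<alpha> * \<beta>.\<close>

definition frozen :: "real \<Rightarrow> real \<Rightarrow> real \<Rightarrow> nat \<Rightarrow> bool" where
  "frozen a b c t \<longleftrightarrow> t = 1 \<and> a + b + c \<le> 1 \<or> t = 2 \<and> 1 + a + b \<le> c \<or> t = 3 \<and> 1 + a + c \<le> b \<or> t = 4 \<and> 1 + b + c \<le> a"

definition strictly_frozen :: "real \<Rightarrow> real \<Rightarrow> real \<Rightarrow> nat \<Rightarrow> bool" where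
  "strictly_frozen a b c t \<longleftrightarrow> t = 1 \<and> a + b + c < 1 \<or> t = 2 \<and> 1 + a + b < c \<or> t = 3 \<and> 1 + a + c < b \<or> t = 4 \<and> 1 + b + c < a"

lemma strictly_frozen_imp_frozen: "strictly_frozen a b c t \<Longrightarrow> frozen a b c t"
  unfolding strictly_frozen_def frozen_def by auto

lemma frozen_reflect: "frozen a b c t \<Longrightarrow> frozen b a c (reflect_type t)"
  unfolding frozen_def reflect_type_def by auto

text \<open>It is enough to move \<open>c\<close>: upwards if it is the dominating weight, downwards
  otherwise. The offset 2 keeps the perturbed value positive.\<close>

lemma frozen_perturb:
  assumes "frozen a b c t" "c > 0"
  shows "\<exists>s\<in>{1, -1}. \<forall>m. strictly_frozen a b (c * (1 - s / (real m + 2))) t"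
proof -
  have lt: "c * (1 - 1 / (real m + 2)) < c" "c < c * (1 - -1 / (real m + 2))" for m
    using assms(2) by (simp_all add: field_simps)
  have "\<forall>m. strictly_frozen a b (c * (1 - (if t = 2 then -1 else 1) / (real m + 2))) t"
  proof
    fix m show "strictly_frozen a b (c * (1 - (if t = 2 then -1 else 1) / (real m + 2))) t"
      using assms(1) lt[of m] unfolding frozen_def strictly_frozen_def by auto
  qed
  then show ?thesis by (cases "t = 2") auto
qed

context ffsix
begin

lemma ffsix_reflect: "ffsix \<beta> \<alpha> \<gamma>"
  using pos by unfold_locales (simp_all add: mult.commute)

text \<open>Here \<open>x0\<close> lies at or beyond 1 or -1, so one modulus dominates on the whole
  circle except at finitely many points. The density is 1 for the types 2 and 3, whose vertical
  edges point south.\<close>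

lemma frozen_\<rho>:
  assumes "frozen \<alpha> \<beta> \<delta> t"
  shows "\<rho> = of_bool (t = 2 \<or> t = 3)"
proof -
  note lev = level_iff[OF pos(1) pos(2) pos(4), folded x0_def]
  have p: "2 * (\<alpha> + \<beta> * \<delta>) > 0" using pos by (simp add: add_pos_pos)
  have c: "(0 < d (cis (2 * pi * t'))) = (t = 2 \<or> t = 3)" if "d (cis (2 * pi * t')) \<noteq> 0" for t'
  proof -
    let ?w = "cis (2 * pi * t')"
    have re1: "Re ?w \<le> 1" and re2: "-1 \<le> Re ?w" by simp_all
    have sq: "(norm (A ?w))^2 - (norm (B ?w))^2 = 2 * (\<alpha> + \<beta> * \<delta>) * (Re ?w - x0)" by (rule sq_diff) simp
    show ?thesis
    proof (cases "t = 2 \<or> t = 3")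
      case True
      then have "1 \<le> x0" unfolding lev(3) using assms unfolding frozen_def by auto
      then have "2 * (\<alpha> + \<beta> * \<delta>) * (Re ?w - x0) \<le> 0" using p re1 by (intro mult_nonneg_nonpos) linarith+
      then have "(norm (A ?w))^2 \<le> (norm (B ?w))^2" using sq by linarith
      then have "norm (A ?w) \<le> norm (B ?w)" by (rule power2_le_imp_le) simp
      then show ?thesis using True that unfolding dd_def by auto
    next
      case False
      then have "x0 \<le> -1" unfolding lev(1) using assms unfolding frozen_def by auto
      then have "Re ?w - x0 \<ge> 0" using re2 by linarith
      then have "2 * (\<alpha> + \<beta> * \<delta>) * (Re ?w - x0) \<ge> 0" by (rule mult_nonneg_nonneg[OF less_imp_le[OF p]])
      then have "(norm (B ?w))^2 \<le> (norm (A ?w))^2" using sq by linarith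
      then have "norm (B ?w) \<le> norm (A ?w)" by (rule power2_le_imp_le) simp
      then show ?thesis using False that unfolding dd_def by auto
    qed
  qed
  have "\<rho> = integral {0..1} (\<lambda>x::real. of_bool (t = 2 \<or> t = 3))"
    unfolding \<rho>_def by (rule integral_spike[OF negligible_finite[OF d_zero_finite]]) (use c in auto)
  then show ?thesis by simp
qed

lemma strictly_frozen_d:
  assumes "strictly_frozen \<alpha> \<beta> \<delta> t"
  shows "x0 \<noteq> 1" "x0 \<noteq> -1" "norm w = 1 \<Longrightarrow> d w \<noteq> 0"
proof -
  note lev = level_iff[OF pos(1) pos(2) pos(4), folded x0_def]
  have "1 < x0 \<or> x0 < -1" unfolding lev(2,4) using assms unfolding strictly_frozen_def by auto
  then show x: "x0 \<noteq> 1" "x0 \<noteq> -1" by auto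
  have p: "2 * (\<alpha> + \<beta> * \<delta>) > 0" using pos by (simp add: add_pos_pos)
  show "d w \<noteq> 0" if w: "norm w = 1"
  proof
    assume "d w = 0"
    then have "2 * (\<alpha> + \<beta> * \<delta>) * (Re w - x0) = 0" using sq_diff[OF w] unfolding dd_def by simp
    then have "Re w = x0" using p by auto
    then show False using abs_Re_le_cmod[of w] w \<open>1 < x0 \<or> x0 < -1\<close> by auto
  qed
qed

lemma critical_imp_frozen:
  assumes "x0 = 1 \<or> x0 = -1"
  shows "\<exists>t. frozen \<alpha> \<beta> \<delta> t"
proof -
  note lev = level_iff[OF pos(1) pos(2) pos(4), folded x0_def]
  have "1 + \<alpha> \<le> \<bar>\<delta> - \<beta>\<bar> \<or> \<beta> + \<delta> \<le> \<bar>1 - \<alpha>\<bar>" using assms unfolding lev(1,3)[symmetric] by auto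
  then have "1 + \<alpha> \<le> \<delta> - \<beta> \<or> 1 + \<alpha> \<le> \<beta> - \<delta> \<or> \<beta> + \<delta> \<le> 1 - \<alpha> \<or> \<beta> + \<delta> \<le> \<alpha> - 1"
    by (auto simp only: abs_if split: if_splits)
  then show ?thesis unfolding frozen_def by (smt (verit))
qed

lemma Pn_Compl: "n > 0 \<Longrightarrow> Pn n (ff_weights \<alpha> \<beta> \<gamma>) (- E) = 1 - Pn n (ff_weights \<alpha> \<beta> \<gamma>) E"
proof -
  assume n: "n > 0"
  have "(\<Sum>\<sigma>\<in>tor_configs n \<inter> E. config_weight n (ff_weights \<alpha> \<beta> \<gamma>) \<sigma>) + (\<Sum>\<sigma>\<in>tor_configs n \<inter> - E. config_weight n (ff_weights \<alpha> \<beta> \<gamma>) \<sigma>) =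
     partition_fn n (ff_weights \<alpha> \<beta> \<gamma>)"
    unfolding partition_fn_def
    by (subst sum.union_disjoint[symmetric]) (auto simp: finite_tor_configs[OF n] Int_Un_distrib[symmetric])
  then have "Pn n (ff_weights \<alpha> \<beta> \<gamma>) E + Pn n (ff_weights \<alpha> \<beta> \<gamma>) (- E) = 1"
    unfolding Pn_def add_divide_distrib[symmetric] using partition_fn_pos[OF pos n] by simp
  then show ?thesis by simp
qed

lemma Pn_nonneg: "n > 0 \<Longrightarrow> 0 \<le> Pn n (ff_weights \<alpha> \<beta> \<gamma>) E"
  unfolding Pn_def using partition_fn_pos[OF pos] config_weight_pos[OF pos]
  by (intro divide_nonneg_nonneg sum_nonneg) (auto intro: less_imp_le)

lemma Pn_subadditive:
  assumes n: "n > 0" and X: "finite X" and sub: "tor_configs n \<inter> E \<subseteq> (\<Union>x\<in>X. F x)"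
  shows "Pn n (ff_weights \<alpha> \<beta> \<gamma>) E \<le> (\<Sum>x\<in>X. Pn n (ff_weights \<alpha> \<beta> \<gamma>) (F x))"
proof -
  let ?W = "config_weight n (ff_weights \<alpha> \<beta> \<gamma>)"
  have W: "?W \<sigma> \<ge> 0" if "\<sigma> \<in> tor_configs n" for \<sigma> using config_weight_pos[OF pos that] by simp
  note fin = finite_tor_configs[OF n]
  have "(\<Sum>\<sigma>\<in>tor_configs n \<inter> E. ?W \<sigma>) = (\<Sum>\<sigma>\<in>tor_configs n. if \<sigma> \<in> E then ?W \<sigma> else 0)"
    by (rule sum.inter_restrict[OF fin])
  also have "\<dots> \<le> (\<Sum>\<sigma>\<in>tor_configs n. \<Sum>x\<in>X. if \<sigma> \<in> F x then ?W \<sigma> else 0)"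
  proof (rule sum_mono)
    fix \<sigma> assume s: "\<sigma> \<in> tor_configs n"
    have nn: "0 \<le> (\<Sum>x\<in>X. if \<sigma> \<in> F x then ?W \<sigma> else 0)" by (intro sum_nonneg) (simp add: W[OF s])
    show "(if \<sigma> \<in> E then ?W \<sigma> else 0) \<le> (\<Sum>x\<in>X. if \<sigma> \<in> F x then ?W \<sigma> else 0)"
    proof (cases "\<sigma> \<in> E")
      case True
      then obtain x where x: "x \<in> X" "\<sigma> \<in> F x" using sub s by blast
      then have "(if \<sigma> \<in> F x then ?W \<sigma> else 0) \<le> (\<Sum>x\<in>X. if \<sigma> \<in> F x then ?W \<sigma> else 0)"
        by (intro member_le_sum[of x X "\<lambda>x. if \<sigma> \<in> F x then ?W \<sigma> else 0"] X) (simp_all add: W[OF s])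
      then show ?thesis using x True by simp
    qed (use nn in simp)
  qed
  also have "\<dots> = (\<Sum>x\<in>X. \<Sum>\<sigma>\<in>tor_configs n \<inter> F x. ?W \<sigma>)"
    unfolding sum.inter_restrict[OF fin] by (rule sum.swap)
  finally show ?thesis unfolding Pn_def sum_divide_distrib[symmetric]
    using partition_fn_pos[OF pos n] by (intro divide_right_mono) auto
qed

text \<open>By translation invariance the mean of \<open>windV / n\<close> is the probability that a
  given vertical edge points south, and the concentration of \<open>windV / n\<close> forces this
  probability to \<rho>.\<close>

lemma vertical_density: "(\<lambda>n. Pn n (ff_weights \<alpha> \<beta> \<gamma>) {\<sigma>. \<not> snd \<sigma> v}) \<longlonglongrightarrow> \<rho>"
proof -
  obtain i0 j0 where v: "v = (i0, j0)" by (cases v)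
  let ?w = "ff_weights \<alpha> \<beta> \<gamma>"
  have "(\<lambda>n. Pn n ?w {\<sigma>. \<not> snd \<sigma> v} - \<rho>) \<longlonglongrightarrow> 0"
  proof (rule Lim_null_comparison[OF _ dev_tendsto_0])
    show "eventually (\<lambda>n. norm (Pn n ?w {\<sigma>. \<not> snd \<sigma> v} - \<rho>) \<le> dev n \<alpha> \<beta> \<gamma> \<rho>) sequentially"
      using eventually_gt_at_top[of 0]
    proof eventually_elim
      case (elim n)
      let ?W = "config_weight n ?w"
      define Z where "Z = partition_fn n ?w"
      have Z: "Z > 0" unfolding Z_def by (rule partition_fn_pos[OF pos elim])
      note fin = finite_tor_configs[OF elim]
      \<comment> \<open>The row of edges below the vertices with second coordinate 0 is the cut used
        by \<open>windV\<close>; a translation moves each of its edges to \<open>v\<close>.\<close>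
      have edge: "(\<Sum>\<sigma>\<in>tor_configs n. ?W \<sigma> * of_bool (\<not> snd \<sigma> (int i, - 1))) = Z * Pn n ?w {\<sigma>. \<not> snd \<sigma> v}" for i
      proof -
        have "(\<Sum>\<sigma>\<in>tor_configs n. ?W \<sigma> * of_bool (\<not> snd \<sigma> (int i, - 1))) =
            (\<Sum>\<sigma>\<in>tor_configs n \<inter> {\<sigma>. \<not> snd \<sigma> (int i, - 1)}. ?W \<sigma>)"
          unfolding sum.inter_restrict[OF fin] by (intro sum.cong) auto
        also have "\<dots> = Z * Pn n ?w {\<sigma>. \<not> snd \<sigma> (int i, - 1)}" unfolding Pn_def Z_def[symmetric] using Z by simp
        also have "Pn n ?w {\<sigma>. \<not> snd \<sigma> (int i, - 1)} = Pn n ?w {\<sigma>. \<not> snd \<sigma> v}"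
          using Pn_shift[OF elim, of ?w i0 "int i - i0" j0 "- 1 - j0"] unfolding v by simp
        finally show ?thesis .
      qed
      have "(\<Sum>\<sigma>\<in>tor_configs n. ?W \<sigma> * real (windV n \<sigma>)) =
          (\<Sum>i<n. \<Sum>\<sigma>\<in>tor_configs n. ?W \<sigma> * of_bool (\<not> snd \<sigma> (int i, - 1)))"
        unfolding windV_def occS_def of_nat_sum sum_distrib_left by (subst sum.swap) simp
      also have "\<dots> = real n * (Z * Pn n ?w {\<sigma>. \<not> snd \<sigma> v})" unfolding edge by simp
      finally have V: "(\<Sum>\<sigma>\<in>tor_configs n. ?W \<sigma> * real (windV n \<sigma>)) = real n * (Z * Pn n ?w {\<sigma>. \<not> snd \<sigma> v})" .
      have "(\<Sum>\<sigma>\<in>tor_configs n. ?W \<sigma> * (real (windV n \<sigma>) - \<rho> * real n)) = (Pn n ?w {\<sigma>. \<not> snd \<sigma> v} - \<rho>) * (Z * real n)"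
        unfolding right_diff_distrib sum_subtractf V sum_distrib_right[symmetric] Z_def partition_fn_def by (simp add: algebra_simps)
      then have "\<bar>Pn n ?w {\<sigma>. \<not> snd \<sigma> v} - \<rho>\<bar> * (Z * real n) = \<bar>\<Sum>\<sigma>\<in>tor_configs n. ?W \<sigma> * (real (windV n \<sigma>) - \<rho> * real n)\<bar>"
        using Z by (simp add: abs_mult)
      also have "\<dots> \<le> (\<Sum>\<sigma>\<in>tor_configs n. ?W \<sigma> * \<bar>real (windV n \<sigma>) - \<rho> * real n\<bar>)"
      proof (rule order_trans[OF sum_abs sum_mono])
        fix \<sigma> assume "\<sigma> \<in> tor_configs n"
        then have "?W \<sigma> > 0" by (rule config_weight_pos[OF pos])
        then show "\<bar>?W \<sigma> * (real (windV n \<sigma>) - \<rho> * real n)\<bar> \<le> ?W \<sigma> * \<bar>real (windV n \<sigma>) - \<rho> * real n\<bar>" by (simp add: abs_mult)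
      qed
      finally show ?case unfolding dev_def Z_def[symmetric] using Z elim by (simp add: pos_le_divide_eq)
    qed
  qed
  then show ?thesis by (simp add: LIM_zero_iff)
qed

text \<open>Reflection turns horizontal edges into vertical ones of the model with \<alpha> and
  \<beta> exchanged, so the concentration argument is not repeated.\<close>

lemma horizontal_density: "(\<lambda>n. Pn n (ff_weights \<alpha> \<beta> \<gamma>) {\<sigma>. \<not> fst \<sigma> v}) \<longlonglongrightarrow> ffsix.\<rho> \<beta> \<alpha> \<gamma>"
  using ffsix.vertical_density[OF ffsix_reflect] by (cases v) (simp only: Pn_reflect)

text \<open>Both densities are 0 or 1, so each edge takes the direction prescribed by type
  \<open>t\<close> with probability tending to 1.\<close>

lemma frozen_edges:
  assumes "frozen \<alpha> \<beta> \<delta> t"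
  shows "(\<lambda>n. Pn n (ff_weights \<alpha> \<beta> \<gamma>) {\<sigma>. snd \<sigma> v \<noteq> (t = 1 \<or> t = 4)}) \<longlonglongrightarrow> 0"
    "(\<lambda>n. Pn n (ff_weights \<alpha> \<beta> \<gamma>) {\<sigma>. fst \<sigma> v \<noteq> (t = 1 \<or> t = 3)}) \<longlonglongrightarrow> 0"
proof -
  let ?w = "ff_weights \<alpha> \<beta> \<gamma>"
  have compl: "(\<lambda>n. Pn n ?w (- E)) \<longlonglongrightarrow> 0" if "(\<lambda>n. Pn n ?w E) \<longlonglongrightarrow> 1" for E
  proof (rule Lim_transform_eventually)
    show "(\<lambda>n. 1 - Pn n ?w E) \<longlonglongrightarrow> 0" using tendsto_diff[OF tendsto_const that, of 1] by simp
    show "eventually (\<lambda>n. 1 - Pn n ?w E = Pn n ?w (- E)) sequentially"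
      using eventually_gt_at_top[of 0] by eventually_elim (simp add: Pn_Compl)
  qed
  have t: "t = 1 \<or> t = 2 \<or> t = 3 \<or> t = 4" using assms unfolding frozen_def by auto
  have "frozen \<beta> \<alpha> (\<gamma>^2 - \<beta> * \<alpha>) (reflect_type t)" using frozen_reflect[OF assms] by (simp add: mult.commute)
  then have \<rho>': "ffsix.\<rho> \<beta> \<alpha> \<gamma> = of_bool (reflect_type t = 2 \<or> reflect_type t = 3)" by (rule ffsix.frozen_\<rho>[OF ffsix_reflect])
  note V = vertical_density[of v, unfolded frozen_\<rho>[OF assms]] and H = horizontal_density[of v, unfolded \<rho>']
  have s: "- {\<sigma>. \<not> snd \<sigma> v} = {\<sigma>. snd \<sigma> v}" "- {\<sigma>. \<not> fst \<sigma> v} = {\<sigma>. fst \<sigma> v}" for v :: "int \<times> int" by auto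
  show "(\<lambda>n. Pn n ?w {\<sigma>. snd \<sigma> v \<noteq> (t = 1 \<or> t = 4)}) \<longlonglongrightarrow> 0"
    using t V compl[of "{\<sigma>. \<not> snd \<sigma> v}", unfolded s] by (elim disjE) simp_all
  show "(\<lambda>n. Pn n ?w {\<sigma>. fst \<sigma> v \<noteq> (t = 1 \<or> t = 3)}) \<longlonglongrightarrow> 0"
    using t H compl[of "{\<sigma>. \<not> fst \<sigma> v}", unfolded s] by (elim disjE) (simp_all add: reflect_type_def)
qed

text \<open>The type is fixed by the directions of the four edges, and each of these is wrong with
  vanishing probability.\<close>

lemma frozen_vertex:
  assumes fr: "frozen \<alpha> \<beta> \<delta> t"
  shows "(\<lambda>n. Pn n (ff_weights \<alpha> \<beta> \<gamma>) {\<sigma>. vtype (fst \<sigma>) (snd \<sigma>) v \<noteq> t}) \<longlonglongrightarrow> 0"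
proof -
  obtain i j where v: "v = (i, j)" by (cases v)
  let ?P = "\<lambda>n. Pn n (ff_weights \<alpha> \<beta> \<gamma>)"
  let ?V = "\<lambda>v. {\<sigma>. snd \<sigma> v \<noteq> (t = 1 \<or> t = 4)}" and ?H = "\<lambda>v. {\<sigma>. fst \<sigma> v \<noteq> (t = 1 \<or> t = 3)}"
  define F :: "nat \<Rightarrow> cfg set" where "F k = (if k = 0 then ?V (i, j) else if k = 1 then ?V (i, j - 1) else if k = 2 then ?H (i, j) else ?H (i - 1, j))" for k
  have t: "t = 1 \<or> t = 2 \<or> t = 3 \<or> t = 4" using fr unfolding frozen_def by auto
  have sub: "{\<sigma>. vtype (fst \<sigma>) (snd \<sigma>) v \<noteq> t} \<subseteq> F 0 \<union> F 1 \<union> F 2 \<union> F 3"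
    using t unfolding F_def v by (elim disjE) (auto simp: vtype_def Let_def)
  have F: "(\<lambda>n. ?P n (F k)) \<longlonglongrightarrow> 0" for k unfolding F_def using frozen_edges[OF fr] by simp
  show ?thesis
  proof (rule tendsto_sandwich[OF _ _ tendsto_const])
    show "eventually (\<lambda>n. 0 \<le> ?P n {\<sigma>. vtype (fst \<sigma>) (snd \<sigma>) v \<noteq> t}) sequentially"
      using eventually_gt_at_top[of 0] by eventually_elim (rule Pn_nonneg)
    show "eventually (\<lambda>n. ?P n {\<sigma>. vtype (fst \<sigma>) (snd \<sigma>) v \<noteq> t} \<le> (\<Sum>k\<in>{0,1,2,3}. ?P n (F k))) sequentially"
      using eventually_gt_at_top[of 0] by eventually_elim (rule Pn_subadditive, use sub in auto)
    have "(\<lambda>n. \<Sum>k\<in>{0,1,2,3}. ?P n (F k)) \<longlonglongrightarrow> (\<Sum>k\<in>{0,1,2,3::nat}. 0)" by (intro tendsto_sum F)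
    then show "(\<lambda>n. \<Sum>k\<in>{0,1,2,3}. ?P n (F k)) \<longlonglongrightarrow> 0" by simp
  qed
qed

lemma frozen_limit:
  assumes fr: "frozen \<alpha> \<beta> \<delta> t"
  shows "(\<lambda>n. Pn n (ff_weights \<alpha> \<beta> \<gamma>) (type_event vs ts)) \<longlonglongrightarrow> of_bool (\<forall>i<length vs. ts ! i = t)"
proof -
  let ?P = "\<lambda>n. Pn n (ff_weights \<alpha> \<beta> \<gamma>)"
  let ?N = "\<lambda>v. {\<sigma>. vtype (fst \<sigma>) (snd \<sigma>) v \<noteq> t}"
  show ?thesis
  proof (cases "\<forall>i<length vs. ts ! i = t")
    case True
    have sub: "- type_event vs ts \<subseteq> (\<Union>i<length vs. ?N (vs ! i))"
      using True unfolding type_event_def by auto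
    have c0: "(\<lambda>n. ?P n (- type_event vs ts)) \<longlonglongrightarrow> 0"
    proof (rule tendsto_sandwich[OF _ _ tendsto_const])
      show "eventually (\<lambda>n. 0 \<le> ?P n (- type_event vs ts)) sequentially"
        using eventually_gt_at_top[of 0] by eventually_elim (rule Pn_nonneg)
      show "eventually (\<lambda>n. ?P n (- type_event vs ts) \<le> (\<Sum>i<length vs. ?P n (?N (vs ! i)))) sequentially"
        using eventually_gt_at_top[of 0] by eventually_elim (rule Pn_subadditive, use sub in auto)
      have "(\<lambda>n. \<Sum>i<length vs. ?P n (?N (vs ! i))) \<longlonglongrightarrow> (\<Sum>i<length vs. 0)" by (intro tendsto_sum frozen_vertex fr)
      then show "(\<lambda>n. \<Sum>i<length vs. ?P n (?N (vs ! i))) \<longlonglongrightarrow> 0" by simp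
    qed
    have "(\<lambda>n. ?P n (type_event vs ts)) \<longlonglongrightarrow> 1"
    proof (rule Lim_transform_eventually)
      show "(\<lambda>n. 1 - ?P n (- type_event vs ts)) \<longlonglongrightarrow> 1" using tendsto_diff[OF tendsto_const c0, of 1] by simp
      show "eventually (\<lambda>n. 1 - ?P n (- type_event vs ts) = ?P n (type_event vs ts)) sequentially"
        using eventually_gt_at_top[of 0] by eventually_elim (simp add: Pn_Compl)
    qed
    then show ?thesis using True by simp
  next
    case False
    then obtain i where i: "i < length vs" "ts ! i \<noteq> t" by blast
    have sub: "type_event vs ts \<subseteq> ?N (vs ! i)" using i unfolding type_event_def by auto
    have "(\<lambda>n. ?P n (type_event vs ts)) \<longlonglongrightarrow> 0"
    proof (rule tendsto_sandwich[OF _ _ tendsto_const frozen_vertex[OF fr, of "vs ! i"]])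
      show "eventually (\<lambda>n. 0 \<le> ?P n (type_event vs ts)) sequentially"
        using eventually_gt_at_top[of 0] by eventually_elim (rule Pn_nonneg)
      show "eventually (\<lambda>n. ?P n (type_event vs ts) \<le> ?P n (?N (vs ! i))) sequentially"
        using eventually_gt_at_top[of 0]
      proof eventually_elim
        case (elim n)
        show ?case using Pn_subadditive[OF elim, of "{()}" "type_event vs ts" "\<lambda>_. ?N (vs ! i)"] sub by auto
      qed
    qed
    moreover have "(of_bool (\<forall>i<length vs. ts ! i = t) :: real) = 0" unfolding of_bool_eq_0_iff using False .
    ultimately show ?thesis by (simp only:)
  qed
qed

lemma ker_integrable:
  assumes w: "norm w = 1" "d w \<noteq> 0"
  shows "(\<lambda>t. ker v c v' c' w (cis (2 * pi * t))) integrable_on {0..1}"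
proof -
  have "continuous_on ({w} \<times> sphere 0 1) (\<lambda>(w, z). ker v c v' c' w z)" using w by (intro ker_continuous) auto
  then have "continuous_on (sphere 0 1) (\<lambda>z. (\<lambda>(w, z). ker v c v' c' w z) (w, z))"
    by (rule continuous_on_compose2) (auto intro!: continuous_intros)
  then have "continuous_on (sphere 0 1) (ker v c v' c' w)" by simp
  then show ?thesis by (intro integrable_continuous_interval cis_2pi_continuous)
qed

text \<open>On the torus \<open>Delta\<close> has modulus at least the difference of the moduli of
  its two terms. The bound is uniform in the second variable and dominates the inner integrals when
  \<gamma> varies.\<close>

lemma ker_bound:
  assumes w: "norm w = 1" "d w \<noteq> 0" and z: "norm z = 1"
  shows "norm (ker v c v' c' w z) \<le> C1 / \<bar>d w\<bar>"
proof -
  have w0: "w \<noteq> 0" and z0: "z \<noteq> 0" using w z by auto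
  have "\<bar>norm (A w) - norm (- (B w * z))\<bar> \<le> norm (A w - - (B w * z))" by (rule norm_triangle_ineq3)
  then have D: "\<bar>d w\<bar> \<le> norm (Delta \<alpha> \<beta> \<gamma> w z)" unfolding Delta_AB dd_def using z by (simp add: norm_mult abs_minus_commute)
  have "norm (1 + of_real \<alpha> * w) \<le> 1 + \<alpha>" "norm (1 + of_real \<beta> * z) \<le> 1 + \<beta>"
    using norm_triangle_ineq[of 1 "of_real \<alpha> * w"] norm_triangle_ineq[of 1 "of_real \<beta> * z"] w z pos by (simp_all add: norm_mult)
  then have N: "norm (if c' then (if c then 1 + of_real \<alpha> * w else - of_real \<gamma> * w)
     else (if c then - of_real \<gamma> * z else 1 + of_real \<beta> * z)) \<le> C1"
    unfolding C1_def using w z pos by (auto simp: norm_mult)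
  have "norm (ker v c v' c' w z) = norm (if c' then (if c then 1 + of_real \<alpha> * w else - of_real \<gamma> * w)
     else (if c then - of_real \<gamma> * z else 1 + of_real \<beta> * z)) / norm (Delta \<alpha> \<beta> \<gamma> w z)"
    unfolding kernel_integrand_pt[OF w0 z0] isymb_def norm_mult norm_power_int norm_divide w z by simp
  also have "\<dots> \<le> C1 / \<bar>d w\<bar>" using w D N by (intro frac_le) (auto intro: order_trans[OF norm_ge_zero])
  finally show ?thesis .
qed

end

section \<open>Continuity of the kernel and the critical parameters\<close>

text \<open>Dominated convergence twice. For fixed \<open>w\<close> off the critical set of the
  limit, \<open>C1 / \<bar>d w\<bar>\<close> bounds the kernel; in the first variable the inner
  integrals obey the bound 4 * C1 / m0, which stays bounded along the sequence even if critical
  frequencies appear in the limit.\<close>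

lemma Lker_continuous:
  assumes ff: "ffsix \<alpha> \<beta> \<gamma>" "\<And>m. ffsix \<alpha> \<beta> (g m)" and g: "g \<longlonglongrightarrow> \<gamma>"
    and nz: "\<And>m w. norm w = 1 \<Longrightarrow> dd \<alpha> \<beta> (g m) w \<noteq> 0"
  shows "(\<lambda>m. Lker \<alpha> \<beta> (g m) (pt v c) (pt v' c')) \<longlonglongrightarrow> Lker \<alpha> \<beta> \<gamma> (pt v c) (pt v' c')"
proof -
  interpret ffsix \<alpha> \<beta> \<gamma> by (rule ff)
  have C1: "(\<lambda>m. ffsix.C1 \<alpha> \<beta> (g m)) \<longlonglongrightarrow> C1" 
    unfolding C1_def ffsix.C1_def[OF ff(2)] by (intro tendsto_intros g)
  have m0: "(\<lambda>m. ffsix.m0 \<alpha> \<beta> (g m)) \<longlonglongrightarrow> m0" 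
    unfolding m0_def ffsix.m0_def[OF ff(2)] using pos by (intro tendsto_intros g) auto
  have bdd: "\<exists>K. \<forall>m. norm (X m) \<le> K" if "X \<longlonglongrightarrow> (l :: real)" for X l
    using convergent_imp_Bseq[OF convergentI[OF that]] unfolding Bseq_def by blast
  have lim1: "(\<lambda>m. 4 * ffsix.C1 \<alpha> \<beta> (g m) / ffsix.m0 \<alpha> \<beta> (g m)) \<longlonglongrightarrow> 4 * C1 / m0"
    using m0_pos by (intro tendsto_intros C1 m0) auto
  obtain K where K: "\<forall>m. norm (4 * ffsix.C1 \<alpha> \<beta> (g m) / ffsix.m0 \<alpha> \<beta> (g m)) \<le> K"
    using bdd[OF lim1] by (rule exE)
  have inner_lim: "(\<lambda>m. ffsix.inner \<alpha> \<beta> (g m) v c v' c' w) \<longlonglongrightarrow> inner v c v' c' w" if w: "norm w = 1" "dd \<alpha> \<beta> \<gamma> w \<noteq> 0" for w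
  proof -
    have dl: "(\<lambda>m. dd \<alpha> \<beta> (g m) w) \<longlonglongrightarrow> dd \<alpha> \<beta> \<gamma> w" unfolding dd_def BB_def by (intro tendsto_intros g)
    have lim2: "(\<lambda>m. ffsix.C1 \<alpha> \<beta> (g m) / \<bar>dd \<alpha> \<beta> (g m) w\<bar>) \<longlonglongrightarrow> C1 / \<bar>dd \<alpha> \<beta> \<gamma> w\<bar>"
      using w by (intro tendsto_intros C1 dl) auto
    obtain K' where K': "\<forall>m. norm (ffsix.C1 \<alpha> \<beta> (g m) / \<bar>dd \<alpha> \<beta> (g m) w\<bar>) \<le> K'"
      using bdd[OF lim2] by (rule exE)
    show ?thesis unfolding inner_def ffsix.inner_def[OF ff(2)]
    proof (rule ae_dominated_convergence(2)[OF finite.emptyI, where C = K'])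
      show "(\<lambda>t. kernel_integrand \<alpha> \<beta> (g m) (pt v c) (pt v' c') w (cis (2 * pi * t))) integrable_on {0..1}" for m
        by (rule ffsix.ker_integrable[OF ff(2) w(1) nz[OF w(1)]])
    next
      fix m and t :: real
      have "norm (kernel_integrand \<alpha> \<beta> (g m) (pt v c) (pt v' c') w (cis (2 * pi * t))) \<le> ffsix.C1 \<alpha> \<beta> (g m) / \<bar>dd \<alpha> \<beta> (g m) w\<bar>"
        by (rule ffsix.ker_bound[OF ff(2) w(1) nz[OF w(1)]]) simp
      then show "norm (kernel_integrand \<alpha> \<beta> (g m) (pt v c) (pt v' c') w (cis (2 * pi * t))) \<le> K'"
        by (rule order_trans[OF _ order_trans[OF abs_ge_self spec[OF K', of m, unfolded real_norm_def]]])
    next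
      fix t :: real
      have w0: "w \<noteq> 0" using w by auto
      have "Delta \<alpha> \<beta> \<gamma> w (cis (2 * pi * t)) \<noteq> 0" by (rule Delta_nonzero) (use w in auto)
      moreover have "(\<lambda>m. Delta \<alpha> \<beta> (g m) w (cis (2 * pi * t))) \<longlonglongrightarrow> Delta \<alpha> \<beta> \<gamma> w (cis (2 * pi * t))"
        unfolding Delta_def by (intro tendsto_intros g)
      ultimately show "(\<lambda>m. kernel_integrand \<alpha> \<beta> (g m) (pt v c) (pt v' c') w (cis (2 * pi * t))) \<longlonglongrightarrow>
          kernel_integrand \<alpha> \<beta> \<gamma> (pt v c) (pt v' c') w (cis (2 * pi * t))"
        unfolding kernel_integrand_pt[OF w0 cis_neq_zero] isymb_def
        by (cases c; cases c') (auto intro!: tendsto_intros g)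
    qed
  qed
  show ?thesis unfolding Lker_inner ffsix.Lker_inner[OF ff(2)]
  proof (rule ae_dominated_convergence(2)[OF d_zero_finite, where C = K])
    show "(\<lambda>t. ffsix.inner \<alpha> \<beta> (g m) v c v' c' (cis (2 * pi * t))) integrable_on {0..1}" for m
      using nz by (intro integrable_continuous_interval cis_2pi_continuous ffsix.inner_continuous[OF ff(2)]) auto
  next
    fix m and t :: real
    have "norm (ffsix.inner \<alpha> \<beta> (g m) v c v' c' (cis (2 * pi * t))) \<le> 4 * ffsix.C1 \<alpha> \<beta> (g m) / ffsix.m0 \<alpha> \<beta> (g m)"
      by (rule ffsix.inner_bound[OF ff(2)]) (use nz in auto)
    then show "norm (ffsix.inner \<alpha> \<beta> (g m) v c v' c' (cis (2 * pi * t))) \<le> K" by (rule order_trans[OF _ order_trans[OF abs_ge_self spec[OF K, of m, unfolded real_norm_def]]])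
  next
    fix t :: real assume "t \<in> {0..1} - {t \<in> {0..1}. dd \<alpha> \<beta> \<gamma> (cis (2 * pi * t)) = 0}"
    then show "(\<lambda>m. ffsix.inner \<alpha> \<beta> (g m) v c v' c' (cis (2 * pi * t))) \<longlonglongrightarrow> inner v c v' c' (cis (2 * pi * t))"
      by (intro inner_lim) auto
  qed
qed

lemma det_mat_eq_dt_flip: "det (mat N N (\<lambda>(i, j). M i j)) = dt N (\<lambda>i j. M j i)"
proof -
  have "transpose_mat (mat N N (\<lambda>(i, j). M i j)) = mat N N (\<lambda>(i, j). M j i)" by (rule eq_matI) auto
  then show ?thesis unfolding dt_def using det_transpose[of "mat N N (\<lambda>(i, j). M i j)" N] by simp
qed

theorem theorem1p1:
  fixes \<alpha> \<beta> \<gamma> :: real and vs :: "(int \<times> int) list" and ts :: "nat list"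
  assumes "\<alpha> > 0" and "\<beta> > 0" and "\<gamma> > 0" and "\<gamma>^2 - \<alpha> * \<beta> > 0"
    and "length vs \<ge> 1" and "length ts = length vs" and "distinct vs"
    and "set ts \<subseteq> {1..6}"
  shows "(\<lambda>n. complex_of_real (Pn n (ff_weights \<alpha> \<beta> \<gamma>) (type_event vs ts)))
           \<longlonglongrightarrow>
         complex_of_real (\<Prod>i<length vs. ff_weights \<alpha> \<beta> \<gamma> (ts ! i)) *
         det (mat (2 * length vs) (2 * length vs)
               (\<lambda>(i, j). Lker \<alpha> \<beta> \<gamma> (x_idx vs i) (y_idx vs ts j)))"
proof -
  define R where "R g = complex_of_real (\<Prod>i<length vs. ff_weights \<alpha> \<beta> g (ts ! i)) *
     dt (2 * length vs) (\<lambda>i j. Lker \<alpha> \<beta> g (x_idx vs j) (y_idx vs ts i))" for g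
  interpret ffsix \<alpha> \<beta> \<gamma> by unfold_locales (use assms in auto)
  let ?P = "\<lambda>g n. complex_of_real (Pn n (ff_weights \<alpha> \<beta> g) (type_event vs ts))"
  have generic: "?P g \<longlonglongrightarrow> R g" if g: "ffsix \<alpha> \<beta> g" "ffsix.x0 \<alpha> \<beta> g \<noteq> 1" "ffsix.x0 \<alpha> \<beta> g \<noteq> -1" for g
    unfolding R_def
    by (rule limit_of_good_twists[OF ffsix.pos[OF g(1)] assms(7,6,8)]) (rule ffsix.good_twist_exists[OF g])
  have t6: "ts ! i \<in> {1..6}" if "i < length vs" for i
    using that assms(6,8) nth_mem[of i ts] by (simp add: subset_iff)
  have "?P \<gamma> \<longlonglongrightarrow> R \<gamma>"
  proof (cases "x0 = 1 \<or> x0 = -1")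
    case False
    then show ?thesis using generic[OF ffsix_axioms] by simp
  next
    case True
    then obtain t where t: "frozen \<alpha> \<beta> \<delta> t" using critical_imp_frozen by blast
    obtain s :: real where s: "s \<in> {1, -1}" "\<And>m. strictly_frozen \<alpha> \<beta> (\<delta> * (1 - s / (real m + 2))) t"
      using frozen_perturb[OF t pos(4)] by blast
    \<comment> \<open>Only \<gamma> is perturbed: \<open>g m\<close> is the value for which
      \<open>(g m)^2 - \<alpha> * \<beta>\<close> equals \<open>D m\<close>.\<close>
    define D where "D m = \<delta> * (1 - s / (real m + 2))" for m
    define g where "g m = sqrt (D m + \<alpha> * \<beta>)" for m
    define b where "b = complex_of_real (of_bool (\<forall>i<length vs. ts ! i = t))"
    have D0: "D m > 0" for m
    proof -
      have "s / (real m + 2) < 1" using s(1) by (auto simp: divide_less_eq)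
      then show ?thesis unfolding D_def using pos(4) by simp
    qed
    have ab: "\<alpha> * \<beta> > 0" using pos by simp
    have g2: "(g m)^2 - \<alpha> * \<beta> = D m" and g0: "g m > 0" for m
      unfolding g_def using D0[of m] ab by simp_all
    have fg: "ffsix \<alpha> \<beta> (g m)" for m by unfold_locales (use pos D0 g0 g2 in simp_all)
    have sfg: "strictly_frozen \<alpha> \<beta> ((g m)^2 - \<alpha> * \<beta>) t" for m unfolding g2 D_def by (rule s(2))
    have glim: "g \<longlonglongrightarrow> \<gamma>"
    proof -
      have "(\<lambda>m. s / (real m + 2)) \<longlonglongrightarrow> 0"
        using LIMSEQ_ignore_initial_segment[OF lim_const_over_n[of s], of 2] by (simp add: add.commute)
      then have "(\<lambda>m. sqrt (\<delta> * (1 - s / (real m + 2)) + \<alpha> * \<beta>)) \<longlonglongrightarrow> sqrt (\<delta> * (1 - 0) + \<alpha> * \<beta>)"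
        by (intro tendsto_intros)
      then show ?thesis unfolding g_def D_def using pos(3) by simp
    qed
    have Rg: "R (g m) = b" for m
    proof (rule LIMSEQ_unique)
      show "?P (g m) \<longlonglongrightarrow> R (g m)"
        using ffsix.strictly_frozen_d[OF fg sfg] by (intro generic fg)
      show "?P (g m) \<longlonglongrightarrow> b"
        unfolding b_def by (intro tendsto_of_real ffsix.frozen_limit[OF fg strictly_frozen_imp_frozen[OF sfg]])
    qed
    \<comment> \<open>Only the explicit right-hand side is continued to the critical parameters; the
      torus probabilities there converge by \<open>frozen_limit\<close>, so no limits in
      \<open>n\<close> and \<open>m\<close> are exchanged.\<close>
    have "(\<lambda>m. R (g m)) \<longlonglongrightarrow> R \<gamma>"
      unfolding R_def
    proof (intro tendsto_mult tendsto_of_real tendsto_prod tendsto_dt)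
      fix i assume "i \<in> {..<length vs}"
      then have "ts ! i \<in> {1..6}" using t6 by simp
      then show "(\<lambda>m. ff_weights \<alpha> \<beta> (g m) (ts ! i)) \<longlonglongrightarrow> ff_weights \<alpha> \<beta> \<gamma> (ts ! i)"
        unfolding types_eq by (elim insertE) (auto simp: ff_weights_def intro!: tendsto_intros glim)
    next
      fix i j assume "i < 2 * length vs" "j < 2 * length vs"
      then have "ts ! (i div 2) \<in> {1..6}" by (intro t6) auto
      then show "(\<lambda>m. Lker \<alpha> \<beta> (g m) (x_idx vs j) (y_idx vs ts i)) \<longlonglongrightarrow> Lker \<alpha> \<beta> \<gamma> (x_idx vs j) (y_idx vs ts i)"
        unfolding x_idx_pt y_idx_pt[OF \<open>ts ! (i div 2) \<in> {1..6}\<close>]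
        by (intro Lker_continuous ffsix_axioms fg glim ffsix.strictly_frozen_d(3)[OF fg sfg])
    qed
    then have "R \<gamma> = b" unfolding Rg by (rule LIMSEQ_unique[OF _ tendsto_const])
    then show ?thesis unfolding b_def by (simp only:) (intro tendsto_of_real frozen_limit[OF t])
  qed
  then show ?thesis unfolding R_def det_mat_eq_dt_flip .
qed

end
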